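(* Let $\Omega\subset\mathbb{R}^N$ be a smooth bounded domain with $0\in\Omega$, let $p\in(1,N)$, $q\in(p-1,p)$, $\vartheta>0$, and let $A,B$ satisfy the structural assumptions listed in the context. Let $f\in W^{1,\infty}(\bar\Omega)$ be nonnegative and let $u\in C^1(\bar\Omega\setminus\{0\})$ be a weak solution of $$-\operatorname{div}(A(|\nabla u|)\nabla u)+B(|\nabla u|)=\vartheta\frac{u^q}{|x|^p}+f(x)\ \text{ in }\Omega,\quad u>0\ \text{ in }\Omega,\quad u=0\ \text{ on }\partial\Omega.$$ If $1<p<3$, then $u_i\in W^{1,2}_{loc}(\Omega\setminus\{0\})$ for every $i=1,\dots,N$; if $p\ge3$, then $u_i\in W^{1,s}_{loc}(\Omega\setminus\{0\})$ for every $i=1,\dots,N$ and every $1\le s<\frac{p-1}{p-2}$. Moreover, the generalized derivatives of $u_i$ coincide with the classical ones (both denoted $u_{ij}$) almost everywhere in $\Omega$.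
   Context: Notation: $\mathbb{R}^+=(0,+\infty)$, $\overline{\mathbb{R}}^+=[0,+\infty)$; $u_i=\partial u/\partial x_i$; $Z_u=\{x\in\Omega\setminus\{0\}:\nabla u(x)=0\}$. Such a $u$ is of class $C^2$ in $\Omega\setminus(Z_u\cup\{0\})$ by standard elliptic regularity; the classical second derivatives $u_{ij}$ are defined there, and are set equal to $0$ on $Z_u$. Weak solution means: $u\in W_0^{1,p}(\Omega)$, $u>0$, and $\int_\Omega A(|\nabla u|)(\nabla u,\nabla\varphi)\,dx+\int_\Omega B(|\nabla u|)\varphi\,dx=\vartheta\int_\Omega\frac{u^q}{|x|^p}\varphi\,dx+\int_\Omega f\varphi\,dx$ for all $\varphi\in W_0^{1,p}(\Omega)\cap L^\infty(\Omega)$. Assumptions on $A$: $A:\mathbb{R}^+\to\mathbb{R}^+$ is of class $C^1(\mathbb{R}^+)$ (with the convention that $A(|\eta|)\eta=0$ when $\eta=0$), and there are constants $K\ge 1$, $c_1,c_2>0$ such that: (i) $t\mapsto tA(t)$ is increasing; (ii) $|A(|\eta|)\eta|\le c_1|\eta|^{p-1}$ for all $\eta\in\mathbb{R}^N$ with $|\eta|\ge K$; (iii) $[A(|\eta|)\eta-A(|\eta'|)\eta']\cdot[\eta-\eta']\ge c_2(|\eta|+|\eta'|)^{p-2}|\eta-\eta'|^2$ for all $\eta,\eta'\in\mathbb{R}^N$ (not both zero); (iv) $-1<m_A:=\inf_{t>0}\frac{tA'(t)}{A(t)}\le M_A:=\sup_{t>0}\frac{tA'(t)}{A(t)}<+\infty$.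 Assumptions on $B$: $B:\overline{\mathbb{R}}^+\to\overline{\mathbb{R}}^+$ is of class $C^1(\overline{\mathbb{R}}^+)$, $B(0)=0$, $B(t)\ge\sigma t^p$ for all $t\geq 0$ for some $\sigma>0$, and $B'(t)\le\hat C\,tA(t)$ for all $t>0$ for some $\hat C>0$. *)

theory Defs
  imports "HOL-Analysis.Analysis"
begin

subsection \<open>Classical derivatives and smooth domains\<close>

definition pderiv_at :: "'n::finite \<Rightarrow> (real^'n \<Rightarrow> real) \<Rightarrow> real^'n \<Rightarrow> real" where
  "pderiv_at i g x = deriv (\<lambda>t. g (x + t *\<^sub>R axis i 1)) 0"

definition grad :: "(real^'n \<Rightarrow> real) \<Rightarrow> real^'n \<Rightarrow> real^'n" where
  "grad g x = (\<chi> i. pderiv_at i g x)"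

primrec Ck_on :: "nat \<Rightarrow> (real^'n) set \<Rightarrow> (real^'n \<Rightarrow> real) \<Rightarrow> bool" where
  "Ck_on 0 U g \<longleftrightarrow> continuous_on U g"
| "Ck_on (Suc k) U g \<longleftrightarrow>
     (\<forall>x\<in>U. g differentiable (at x)) \<and> (\<forall>i. Ck_on k U (pderiv_at i g))"

text \<open>\<^term>\<open>C1_upto U K u\<close> is meant for \<^term>\<open>U\<close> open and \<^term>\<open>U \<subseteq> K \<and> K \<subseteq> closure U\<close>:
  \<^term>\<open>u\<close> is continuously differentiable in \<^term>\<open>U\<close>, and \<^term>\<open>u\<close> and its gradient extend
  continuously to \<^term>\<open>K\<close> (\<^term>\<open>u\<close> by its own values).\<close>

definition C1_upto :: "(real^'n) set \<Rightarrow> (real^'n) set \<Rightarrow> (real^'n \<Rightarrow> real) \<Rightarrow> bool" where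
  "C1_upto U K u \<longleftrightarrow> Ck_on 1 U u \<and> continuous_on K u \<and>
     (\<exists>G. continuous_on K G \<and> (\<forall>x\<in>U. G x = grad u x))"

text \<open>A smooth bounded domain: near each boundary point, after relabelling and reorienting the
  coordinate axes (the choice of \<open>k\<close> and \<open>\<epsilon>\<close>), the domain is the region above the graph of a smooth
  function \<open>\<gamma>\<close> of the remaining coordinates.\<close>

definition smooth_bounded_domain :: "(real^'n) set \<Rightarrow> bool" where
  "smooth_bounded_domain \<Omega> \<longleftrightarrow>
     open \<Omega> \<and> connected \<Omega> \<and> \<Omega> \<noteq> {} \<and> bounded \<Omega> \<and>
     (\<forall>z\<in>frontier \<Omega>. \<exists>r>0. \<exists>k. \<exists>\<epsilon>\<in>{-1, 1::real}. \<exists>\<gamma>.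
        (\<forall>m. Ck_on m UNIV \<gamma>) \<and>
        (\<forall>x y. (\<forall>j. j \<noteq> k \<longrightarrow> x $ j = y $ j) \<longrightarrow> \<gamma> x = \<gamma> y) \<and>
        \<Omega> \<inter> ball z r = {x \<in> ball z r. \<epsilon> * x $ k > \<gamma> x})"

subsection \<open>Lebesgue and Sobolev spaces\<close>

text \<open>Elements are represented by functions on the whole space; only the values on the given
  set matter, and only up to null sets.\<close>

definition Lp_on :: "real \<Rightarrow> (real^'n) set \<Rightarrow> (real^'n \<Rightarrow> real) set" where
  "Lp_on p U = {g. set_borel_measurable lebesgue U g \<and>
                   (\<lambda>x. \<bar>g x\<bar> powr p) absolutely_integrable_on U}"

definition Linf_on :: "(real^'n) set \<Rightarrow> (real^'n \<Rightarrow> real) set" where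
  "Linf_on U = {g. set_borel_measurable lebesgue U g \<and>
                   (\<exists>C. AE x in lebesgue. x \<in> U \<longrightarrow> \<bar>g x\<bar> \<le> C)}"

definition Lp_loc :: "real \<Rightarrow> (real^'n) set \<Rightarrow> (real^'n \<Rightarrow> real) set" where
  "Lp_loc p U = {g. \<forall>K. compact K \<and> K \<subseteq> U \<longrightarrow> g \<in> Lp_on p K}"

definition test_fun :: "(real^'n) set \<Rightarrow> (real^'n \<Rightarrow> real) set" where
  "test_fun U = {\<phi>. (\<forall>m. Ck_on m UNIV \<phi>) \<and>
                    compact (closure {x. \<phi> x \<noteq> 0}) \<and> closure {x. \<phi> x \<noteq> 0} \<subseteq> U}"

definition weak_pderiv :: "(real^'n) set \<Rightarrow> 'n \<Rightarrow> (real^'n \<Rightarrow> real) \<Rightarrow> (real^'n \<Rightarrow> real) \<Rightarrow> bool" where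
  "weak_pderiv U i g h \<longleftrightarrow> g \<in> Lp_loc 1 U \<and> h \<in> Lp_loc 1 U \<and>
     (\<forall>\<phi>\<in>test_fun U. (LINT x:U|lebesgue. g x * pderiv_at i \<phi> x) =
                      - (LINT x:U|lebesgue. h x * \<phi> x))"

definition weak_grad :: "(real^'n) set \<Rightarrow> (real^'n \<Rightarrow> real) \<Rightarrow> real^'n \<Rightarrow> real^'n" where
  "weak_grad U g = (SOME G. \<forall>i. weak_pderiv U i g (\<lambda>x. G x $ i))"

definition W1p :: "real \<Rightarrow> (real^'n) set \<Rightarrow> (real^'n \<Rightarrow> real) set" where
  "W1p p U = {g \<in> Lp_on p U. \<forall>i. \<exists>h\<in>Lp_on p U. weak_pderiv U i g h}"

definition W1inf :: "(real^'n) set \<Rightarrow> (real^'n \<Rightarrow> real) set" where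
  "W1inf U = {g \<in> Linf_on U. \<forall>i. \<exists>h\<in>Linf_on U. weak_pderiv U i g h}"

definition W1p_loc :: "real \<Rightarrow> (real^'n) set \<Rightarrow> (real^'n \<Rightarrow> real) set" where
  "W1p_loc p U = {g \<in> Lp_loc p U. \<forall>i. \<exists>h\<in>Lp_loc p U. weak_pderiv U i g h}"

text \<open>The closure of the test functions in \<^term>\<open>W1p p U\<close>.\<close>

definition W1p_0 :: "real \<Rightarrow> (real^'n) set \<Rightarrow> (real^'n \<Rightarrow> real) set" where
  "W1p_0 p U = {g \<in> W1p p U. \<exists>\<phi>. (\<forall>n::nat. \<phi> n \<in> test_fun U) \<and>
      (\<lambda>n. LINT x:U|lebesgue. \<bar>\<phi> n x - g x\<bar> powr p) \<longlonglongrightarrow> 0 \<and>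
      (\<forall>i. (\<lambda>n. LINT x:U|lebesgue. \<bar>pderiv_at i (\<phi> n) x - weak_grad U g x $ i\<bar> powr p)
             \<longlonglongrightarrow> 0)}"

subsection \<open>Structural assumptions\<close>

definition m_low :: "(real \<Rightarrow> real) \<Rightarrow> ereal" where
  "m_low A = (INF t\<in>{0<..}. ereal (t * deriv A t / A t))"

definition M_upp :: "(real \<Rightarrow> real) \<Rightarrow> ereal" where
  "M_upp A = (SUP t\<in>{0<..}. ereal (t * deriv A t / A t))"

text \<open>The first argument carries the type of the space in which the vectors range. The convention
  that \<open>A(|\<eta>|)\<eta>\<close> vanishes at \<open>\<eta> = 0\<close> holds by itself, whatever the value \<^term>\<open>A 0\<close>.\<close>

definition structural_A :: "'n::finite itself \<Rightarrow> real \<Rightarrow> (real \<Rightarrow> real) \<Rightarrow> bool" where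
  "structural_A N p A \<longleftrightarrow>
     (\<forall>t>0. A t > 0) \<and>
     (\<forall>t>0. A differentiable (at t)) \<and> continuous_on {0<..} (deriv A) \<and>
     mono_on {0<..} (\<lambda>t. t * A t) \<and>
     (\<exists>K\<ge>1. \<exists>c\<^sub>1>0. \<forall>\<eta>::real^'n. norm \<eta> \<ge> K \<longrightarrow>
        norm (A (norm \<eta>) *\<^sub>R \<eta>) \<le> c\<^sub>1 * norm \<eta> powr (p - 1)) \<and>
     (\<exists>c\<^sub>2>0. \<forall>\<eta> \<eta>'::real^'n. \<eta> \<noteq> 0 \<or> \<eta>' \<noteq> 0 \<longrightarrow>
        (A (norm \<eta>) *\<^sub>R \<eta> - A (norm \<eta>') *\<^sub>R \<eta>') \<bullet> (\<eta> - \<eta>')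
          \<ge> c\<^sub>2 * (norm \<eta> + norm \<eta>') powr (p - 2) * (norm (\<eta> - \<eta>'))\<^sup>2) \<and>
     - 1 < m_low A \<and> m_low A \<le> M_upp A \<and> M_upp A < \<infinity>"

definition structural_B :: "real \<Rightarrow> (real \<Rightarrow> real) \<Rightarrow> (real \<Rightarrow> real) \<Rightarrow> bool" where
  "structural_B p A B \<longleftrightarrow>
     (\<forall>t\<ge>0. B t \<ge> 0) \<and> B 0 = 0 \<and>
     (\<exists>\<sigma>>0. \<forall>t\<ge>0. B t \<ge> \<sigma> * t powr p) \<and>
     (\<exists>B'. (\<forall>t\<ge>0. (B has_real_derivative B' t) (at t within {0..})) \<and>
           continuous_on {0..} B' \<and>
           (\<exists>C>0. \<forall>t>0. B' t \<le> C * (t * A t)))"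

subsection \<open>The equation\<close>

text \<open>Positivity is not imposed at the origin, where a solution need not have a meaningful value.
  Since \<open>LINT\<close> is 0 for non-integrable functions, integrability is stated explicitly.\<close>

definition weak_solution ::
  "(real^'n) set \<Rightarrow> real \<Rightarrow> real \<Rightarrow> real \<Rightarrow> (real \<Rightarrow> real) \<Rightarrow> (real \<Rightarrow> real) \<Rightarrow>
   (real^'n \<Rightarrow> real) \<Rightarrow> (real^'n \<Rightarrow> real) \<Rightarrow> bool" where
  "weak_solution \<Omega> p q \<theta> A B f u \<longleftrightarrow>
     u \<in> W1p_0 p \<Omega> \<and> (\<forall>x\<in>\<Omega> - {0}. u x > 0) \<and>
     (\<forall>\<phi>\<in>W1p_0 p \<Omega> \<inter> Linf_on \<Omega>.
        let Du = weak_grad \<Omega> u;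
            a = (\<lambda>x. A (norm (Du x)) * (Du x \<bullet> weak_grad \<Omega> \<phi> x));
            b = (\<lambda>x. B (norm (Du x)) * \<phi> x);
            h = (\<lambda>x. u x powr q / norm x powr p * \<phi> x);
            k = (\<lambda>x. f x * \<phi> x)
        in a absolutely_integrable_on \<Omega> \<and> b absolutely_integrable_on \<Omega> \<and>
           h absolutely_integrable_on \<Omega> \<and> k absolutely_integrable_on \<Omega> \<and>
           (LINT x:\<Omega>|lebesgue. a x) + (LINT x:\<Omega>|lebesgue. b x) =
           \<theta> * (LINT x:\<Omega>|lebesgue. h x) + (LINT x:\<Omega>|lebesgue. k x))"

definition crit_set :: "(real^'n) set \<Rightarrow> (real^'n \<Rightarrow> real) \<Rightarrow> (real^'n) set" where
  "crit_set \<Omega> u = {x \<in> \<Omega> - {0}. grad u x = 0}"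

text \<open>\<^term>\<open>d\<close> is the classical derivative \<open>u\<^sub>i\<^sub>j(x)\<close>, which by convention is 0 on the critical set.
  As a relation it also asserts that the derivative exists.\<close>

definition has_classical_pderiv2 ::
  "(real^'n) set \<Rightarrow> (real^'n \<Rightarrow> real) \<Rightarrow> 'n \<Rightarrow> 'n \<Rightarrow> real^'n \<Rightarrow> real \<Rightarrow> bool" where
  "has_classical_pderiv2 \<Omega> u i j x d \<longleftrightarrow>
     (if x \<in> crit_set \<Omega> u then d = 0
      else ((\<lambda>t. pderiv_at i u (x + t *\<^sub>R axis j 1)) has_real_derivative d) (at 0))"

end

theory Submission imports Defs
begin

text \<open>
 Off the critical set the equation is uniformly elliptic, so bounds for difference quotients give second
 derivatives in \<open>L\<^sup>2\<close> there. The linearised equation is tested with \<open>\<psi>\<^sup>2 |\<nabla>u|\<^sup>-\<^sup>b u\<^sub>i\<close>, where \<open>b < 1\<close>, the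
 weight being cut off near the critical set. As \<open>B'\<close> is bounded on one side only, its term is integrated
 by parts, and then \<open>B(t) \<le> C t\<^sup>2 A(t)\<close> suffices. The outcome is that \<open>|\<nabla>u|\<^sup>-\<^sup>b A(|\<nabla>u|) |D\<^sup>2u|\<^sup>2\<close> is locally
 integrable. For \<open>p < 3\<close> and \<open>b = max 0 (p - 2)\<close> the weight is bounded below. For \<open>p \<ge> 3\<close> the equation itself,
 whose right hand side is positive, is tested with \<open>\<psi>\<^sup>2 |\<nabla>u|\<^sup>-\<^sup>b / A(|\<nabla>u|)\<close>; so \<open>|\<nabla>u|\<^sup>-\<^sup>b / A(|\<nabla>u|)\<close> is locally
 integrable, and with \<open>b = (p - 2)(s - 1)\<close> Young's inequality gives \<open>D\<^sup>2u\<close> in \<open>L\<^sup>s\<close>. The test functions are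
 only of class \<open>W\<^sup>1\<^sup>,\<^sup>1\<close>; the equation extends to them because the flux is continuous. That \<open>D\<^sup>2u\<close>, extended by
 zero, is the weak derivative across the critical set follows by truncating \<open>u\<^sub>i\<close> near its zeros. Finally,
 a weakly differentiable continuous function is absolutely continuous on almost every line.\<close>

section \<open>Smooth functions and mollification\<close>

lemma GDERIV_iff_grad:
 fixes g :: "real^'n => real"
 shows "GDERIV g x :> w \<longleftrightarrow> g differentiable (at x) \<and> grad g x = w"
proof -
 have grad_eq: "grad g x = w" if "GDERIV g x :> w" for w
 proof -
  have "((%t. g (x + t *\<^sub>R axis i 1)) has_real_derivative w $ i) (at 0)" for i
  proof -
   have g: "(g has_derivative (%h. inner h w)) (at (x + 0 *\<^sub>R axis i 1))"
    using that by (simp add: gderiv_def)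
   have "((%t. x + t *\<^sub>R axis i (1::real)) has_derivative (%t. t *\<^sub>R axis i 1)) (at 0)"
    by (auto intro!: derivative_eq_intros)
   from has_derivative_compose[OF this g]
   show ?thesis by (simp add: has_field_derivative_def inner_axis' mult_commute_abs)
  qed
  then show ?thesis by (simp add: grad_def pderiv_at_def vec_eq_iff DERIV_imp_deriv)
 qed
 moreover have "GDERIV g x :> grad g x" if diff: "g differentiable (at x)"
 proof -
  obtain g' where g': "(g has_derivative g') (at x)" using diff
   by (auto simp: differentiable_def)
  then have "linear g'" by (simp add: has_derivative_linear)
  then have "g' v = inner v (\<chi> i. g' (axis i 1))" for v
   by (subst basis_expansion[of v, symmetric])
    (simp add: linear_sum linear_cmul inner_vec_def scalar_mult_eq_scaleR o_def)
  then have "GDERIV g x :> (\<chi> i. g' (axis i 1))"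
   unfolding gderiv_def by (intro has_derivative_subst[OF g'] ext)
  with grad_eq show ?thesis by metis
 qed
 ultimately show ?thesis by (metis differentiableI gderiv_def)
qed

lemma grad_nth [simp]: "grad g x $ i = pderiv_at i g x" by (simp add: grad_def)

lemma GDERIV_imp_pderiv_at: "GDERIV g x :> w ==> pderiv_at i g x = w $ i"
 by (metis GDERIV_iff_grad grad_nth)

lemma GDERIV_grad: "g differentiable (at x) ==> GDERIV g x :> grad g x"
 for g :: "real^'n => real" by (simp add: GDERIV_iff_grad)

lemma differentiable_imp_continuous_on:
 assumes "!!x. x \<in> U ==> g differentiable (at x)"
 shows "continuous_on U g"
 using assms by (auto intro!: continuous_at_imp_continuous_on
   differentiable_imp_continuous_within)

lemma GDERIV_line:
 fixes g :: "real^'n => real"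
 assumes "GDERIV g (x + s *\<^sub>R v) :> w"
 shows "((%t. g (x + t *\<^sub>R v)) has_real_derivative inner v w) (at s)"
proof -
 have g: "(g has_derivative (%h. inner h w)) (at (x + s *\<^sub>R v))"
  using assms by (simp add: gderiv_def)
 have "((%t. x + t *\<^sub>R v) has_derivative (%t. t *\<^sub>R v)) (at s)"
  by (auto intro!: derivative_eq_intros)
 from has_derivative_compose[OF this g] show ?thesis
  by (simp add: has_field_derivative_def mult_commute_abs)
qed

lemma mvt_direction:
 fixes u :: "real^'n => real"
 assumes "h > 0" "!!t. t \<in> {0..h} ==> u differentiable (at (x + t *\<^sub>R e))"
 obtains z where "0 < z" "z < h" "u (x + h *\<^sub>R e) - u x = h * (e \<bullet> grad u (x + z *\<^sub>R e))"
proof -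
 have "((%t. u (x + t *\<^sub>R e)) has_real_derivative e \<bullet> grad u (x + t *\<^sub>R e)) (at t)"
  if "0 <= t" "t <= h" for t
  using GDERIV_line[OF GDERIV_grad[OF assms(2)]] that by auto
 from MVT2[OF assms(1) this] show ?thesis using that by auto
qed

lemma GDERIV_translate:
 fixes g :: "real^'n => real"
 assumes "GDERIV g (x + c) :> w"
 shows "GDERIV (%x. g (x + c)) x :> w"
proof -
 have "((%x. x + c) has_derivative (%h. h)) (at x)" by (auto intro!: derivative_eq_intros)
 from has_derivative_compose[OF this assms[unfolded gderiv_def]] show ?thesis
  by (simp add: gderiv_def)
qed

lemma GDERIV_minus_arg:
 fixes g :: "real^'n => real"
 assumes "GDERIV g (c - x) :> w"
 shows "GDERIV (%x. g (c - x)) x :> - w"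
proof -
 have "((%x. c - x) has_derivative (%h. - h)) (at x)" by (auto intro!: derivative_eq_intros)
 from has_derivative_compose[OF this assms[unfolded gderiv_def]] show ?thesis
  by (simp add: gderiv_def)
qed

lemma GDERIV_outside_support:
 fixes g :: "real^'n => real"
 assumes "closed S" "!!x. x \<notin> S ==> g x = 0" "x \<notin> S"
 shows "GDERIV g x :> 0"
proof -
 have "open (- S)" "x \<in> - S" using assms by auto
 moreover have "((%x. 0::real) has_derivative (%h. inner h 0)) (at x)" by simp
 ultimately have "(g has_derivative (%h. inner h 0)) (at x)"
  using has_derivative_transform_within_open[of "%x. 0::real" "%h. inner h 0" x UNIV "- S" g]
    assms(2) by auto
 then show ?thesis by (simp add: gderiv_def)
qed

lemma Ck_on_Suc_D: "Ck_on (Suc m) U g ==> Ck_on m U g"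
proof (induction m arbitrary: g)
 case 0
 then show ?case by (auto intro!: continuous_at_imp_continuous_on
   differentiable_imp_continuous_within)
next
 case (Suc m)
 then show ?case by (metis Ck_on.simps(2))
qed

lemma Ck_on_const: "Ck_on m UNIV (%x::real^'n. c)"
proof (induction m arbitrary: c)
 case (Suc m)
 have "pderiv_at i (%x::real^'n. c) = (%x. 0)" for i
  using GDERIV_imp_pderiv_at[OF GDERIV_const] by fastforce
 then show ?case using Suc by simp
qed (simp)

lemma Ck_on_add:
 fixes f g :: "real^'n => real"
 assumes "Ck_on m UNIV f" "Ck_on m UNIV g"
 shows "Ck_on m UNIV (%x. f x + g x)"
 using assms
proof (induction m arbitrary: f g)
 case 0
 then show ?case by (simp add: continuous_on_add)
next
 case (Suc m)
 have "pderiv_at i (%x. f x + g x) = (%x. pderiv_at i f x + pderiv_at i g x)" for i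
  using Suc.prems GDERIV_imp_pderiv_at[OF GDERIV_add[OF GDERIV_grad[of f] GDERIV_grad[of g]]]
   by (intro ext) simp
 then show ?case using Suc by auto
qed

lemma Ck_on_mult:
 fixes f g :: "real^'n => real"
 assumes "Ck_on m UNIV f" "Ck_on m UNIV g"
 shows "Ck_on m UNIV (%x. f x * g x)"
 using assms
proof (induction m arbitrary: f g)
 case 0
 then show ?case by (simp add: continuous_on_mult)
next
 case (Suc m)
 have "pderiv_at i (%x. f x * g x) = (%x. f x * pderiv_at i g x + g x * pderiv_at i f x)" for i
  using Suc.prems GDERIV_imp_pderiv_at[OF GDERIV_mult[OF GDERIV_grad[of f] GDERIV_grad[of g]]]
   by (intro ext) simp
 moreover have "Ck_on m UNIV f" "Ck_on m UNIV g" using Suc.prems Ck_on_Suc_D by blast+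
 ultimately show ?case using Suc by (auto intro!: Ck_on_add)
qed

lemma Ck_on_compose_real:
 fixes g :: "real^'n => real" and \<sigma> :: "nat => real => real"
 assumes \<sigma>: "!!k t. (\<sigma> k has_real_derivative \<sigma> (Suc k) t) (at t)" and g: "!!m. Ck_on m UNIV g"
 shows "Ck_on m UNIV (%x. \<sigma> k (g x))"
proof (induction m arbitrary: k)
 case 0
 have "continuous_on UNIV (\<sigma> k)"
  using \<sigma> by (meson DERIV_isCont continuous_at_imp_continuous_on)
 then show ?case using g[of 0] by (auto intro: continuous_on_compose2)
next
 case (Suc m)
 have diff: "g differentiable at x" for x using g[of 1] by simp
 have G: "GDERIV (%x. \<sigma> k (g x)) x :> \<sigma> (Suc k) (g x) *\<^sub>R grad g x" for x
  by (rule GDERIV_DERIV_compose[OF GDERIV_grad[OF diff] \<sigma>])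
 then have "pderiv_at i (%x. \<sigma> k (g x)) = (%x. \<sigma> (Suc k) (g x) * pderiv_at i g x)" for i
  using GDERIV_imp_pderiv_at[OF G] by (intro ext) simp
 moreover have "Ck_on m UNIV (pderiv_at i g)" for i using g[of "Suc m"] by simp
 ultimately show ?case using G Suc by (auto intro!: Ck_on_mult simp: GDERIV_iff_grad)
qed

lemma Ck_on_nth: "Ck_on m UNIV (%x::real^'n. x $ i)"
proof (cases m)
 case 0 then show ?thesis by (simp add: continuous_on_component)
next
 case (Suc n)
 have G: "GDERIV (%x::real^'n. x $ i) x :> axis i 1" for x
  unfolding gderiv_def by (simp add: inner_axis bounded_linear_imp_has_derivative
    bounded_linear_vec_nth)
 then have "pderiv_at j (%x::real^'n. x $ i) = (%x. axis i 1 $ j)" for j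
  by (intro ext) (rule GDERIV_imp_pderiv_at)
 then show ?thesis using G by (auto simp: Suc GDERIV_iff_grad intro: Ck_on_const)
qed

lemma Ck_on_diff_norm_sq: "Ck_on m UNIV (%x::real^'n. c - (norm x)^2)"
proof (cases m)
 case 0 then show ?thesis by (auto intro!: continuous_intros)
next
 case (Suc n)
 have G: "GDERIV (%x::real^'n. c - (norm x)^2) x :> - 2 *\<^sub>R x" for x
  unfolding gderiv_def power2_norm_eq_inner
  by (auto intro!: derivative_eq_intros simp: inner_commute)
 then have "pderiv_at j (%x::real^'n. c - (norm x)^2) = (%x. (-2) * x $ j)" for j
  using GDERIV_imp_pderiv_at[OF G] by (intro ext) simp
 then show ?thesis using G Ck_on_mult[OF Ck_on_const[of n "-2"] Ck_on_nth]
  by (auto simp: Suc GDERIV_iff_grad)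
qed

primrec bump_poly :: "nat => real poly" where
 "bump_poly 0 = 1"
| "bump_poly (Suc k) = [:0, 0, 1:] * (bump_poly k - pderiv (bump_poly k))"

definition bump_fun :: "nat => real => real" where
 "bump_fun k t = (if t > 0 then poly (bump_poly k) (1/t) * exp (- (1/t)) else 0)"

lemma tendsto_poly_exp_0: "((%x. poly p x * exp (- x)) \<longlongrightarrow> (0::real)) at_top"
proof -
 have "((%x. \<Sum>i\<le>degree p. coeff p i * (x ^ i / exp x)) \<longlongrightarrow> (\<Sum>i\<le>degree p. coeff p i * 0)) at_top"
  by (intro tendsto_intros tendsto_power_div_exp_0)
 then show ?thesis by (simp add: poly_altdef exp_minus sum_distrib_right divide_inverse
   mult.assoc)
qed

lemma DERIV_bump_fun: "(bump_fun k has_real_derivative bump_fun (Suc k) t) (at t)"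
proof (cases t "0::real" rule: linorder_cases)
 case greater
 let ?p = "bump_poly k"
 have "((%t. poly ?p (1/t) * exp (- (1/t))) has_real_derivative
  (poly (pderiv ?p) (1/t) * (- (1/t^2)) * exp (- (1/t))
   + poly ?p (1/t) * (exp (-(1/t)) * (1/t^2)))) (at t)"
  using greater
  by (auto intro!: derivative_eq_intros DERIV_chain2[OF poly_DERIV] simp: power2_eq_square)
 then have "((%t. poly ?p (1/t) * exp (- (1/t))) has_real_derivative bump_fun (Suc k) t) (at t)"
  by (rule DERIV_cong)
   (use greater in \<open>simp add: bump_fun_def power2_eq_square algebra_simps\<close>)
 then show ?thesis
  by (rule has_field_derivative_transform_within_open[of _ _ _ "{0<..}"])
   (use greater in \<open>auto simp: bump_fun_def\<close>)
next
 case less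
 have "((%s. 0) has_real_derivative bump_fun (Suc k) t) (at t)"
  using less by (simp add: bump_fun_def)
 then show ?thesis
  by (rule has_field_derivative_transform_within_open[of _ _ _ "{..<0}"])
   (use less in \<open>auto simp: bump_fun_def\<close>)
next
 case equal
 have "((%x. poly ([:0,1:] * bump_poly k) x * exp (- x)) \<longlongrightarrow> (0::real)) at_top"
  by (rule tendsto_poly_exp_0)
 then have "((%t. poly ([:0,1:] * bump_poly k) (1/t) * exp (- (1/t))) \<longlongrightarrow> (0::real)) (at_right 0)"
  by (rule filterlim_compose)
   (rule filterlim_inverse_at_top_right[unfolded inverse_eq_divide])
 then have "((%t. bump_fun k t / t) \<longlongrightarrow> (0::real)) (at_right 0)"
  by (rule Lim_transform_eventually) (auto simp: eventually_at_filter bump_fun_def)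
 moreover have "((%t. bump_fun k t / t) \<longlongrightarrow> (0::real)) (at_left 0)"
  by (rule tendsto_eventually) (auto simp: eventually_at_filter bump_fun_def)
 ultimately have "((%t. bump_fun k t / t) \<longlongrightarrow> (0::real)) (at 0)"
  by (simp add: filterlim_split_at)
 then show ?thesis using equal by (simp add: DERIV_def bump_fun_def)
qed

definition thicken :: "real => (real^'n) set => (real^'n) set" where
 "thicken d K = (\<Union>x\<in>K. \<Union>y\<in>cball 0 d. {x + y})"

lemma compact_thicken: "compact K ==> compact (thicken d K)"
 unfolding thicken_def by (rule compact_sums'[OF _ compact_cball])

lemma thickenI: "x \<in> K ==> norm (y - x) <= d ==> y \<in> thicken d K"
 unfolding thicken_def by (rule UN_I[of x], assumption, rule UN_I[of "y - x"]) auto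

lemma thickenE: "y \<in> thicken d K ==> (!!x. x \<in> K ==> norm (y - x) <= d ==> P) ==> P"
 unfolding thicken_def by auto

lemma thicken_mono: "d <= e ==> thicken d K \<subseteq> thicken e K" by (auto elim!: thickenE intro: thickenI)

lemma thicken_superset: "0 <= d ==> K \<subseteq> thicken d K" by (auto intro!: thickenI)

lemma thicken_thicken: "thicken d (thicken e K) \<subseteq> thicken (d + e) K"
proof
 fix y assume "y \<in> thicken d (thicken e K)"
 then obtain x z where "x \<in> K" "norm (z - x) <= e" "norm (y - z) <= d" by (auto elim!: thickenE)
 then show "y \<in> thicken (d + e) K"
  using norm_triangle_ineq[of "y - z" "z - x"] by (intro thickenI[of x]) auto
qed

lemma thicken_subset_open:
 assumes "compact K" "open U" "K \<subseteq> U"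
 obtains d where "d > 0" "thicken d K \<subseteq> U"
proof -
 obtain e where "e > 0" "(\<Union>x\<in>K. cball x e) \<subseteq> U"
  using compact_subset_open_imp_cball_epsilon_subset[OF assms] by blast
 then show ?thesis by (intro that[of e]) (auto elim!: thickenE simp: dist_norm norm_minus_commute
   subset_eq)
qed

lemma uniformly_continuous_compact_support:
 fixes f :: "real^'n => 'b::real_normed_vector"
 assumes "compact S" "continuous_on UNIV f" "!!x. x \<notin> S ==> f x = 0"
 shows "uniformly_continuous_on UNIV f"
 unfolding uniformly_continuous_on_def
proof (intro allI impI)
 fix e :: real assume "e > 0"
 have "uniformly_continuous_on (thicken 1 S) f"
  by (intro compact_uniformly_continuous compact_thicken assms(1)
    continuous_on_subset[OF assms(2)]) simp
 with \<open>e > 0\<close> obtain d where d: "d > 0"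
  "!!x y. x \<in> thicken 1 S ==> y \<in> thicken 1 S ==> dist y x < d ==> dist (f y) (f x) < e"
  unfolding uniformly_continuous_on_def by metis
 have "dist (f y) (f x) < e" if "dist y x < min d 1" for x y
 proof (cases "x \<in> S \<or> y \<in> S")
  case True
  then have "x \<in> thicken 1 S" "y \<in> thicken 1 S"
   using that thickenI[of x S x 1] thickenI[of x S y 1] thickenI[of y S y 1] thickenI[of y S x
     1]
   by (auto simp: dist_norm norm_minus_commute)
  then show ?thesis using d that by simp
 qed (use assms(3) \<open>e > 0\<close> in simp)
 then show "\<exists>d>0. \<forall>x\<in>UNIV. \<forall>x'\<in>UNIV. dist x' x < d --> dist (f x') (f x) < e"
  using d(1) by (intro exI[of _ "min d 1"]) auto
qed

lemma bounded_compact_support: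
 fixes f :: "'a::euclidean_space => 'b::real_normed_vector"
 assumes "compact S" "continuous_on UNIV f" "!!x. x \<notin> S ==> f x = 0"
 obtains C where "C > 0" "!!x. norm (f x) <= C"
proof -
 have "bounded (f ` S)" by (intro compact_imp_bounded compact_continuous_image
   continuous_on_subset[OF assms(2)] assms(1)) auto
 then obtain C where "C > 0" "\<forall>x\<in>S. norm (f x) <= C" by (auto simp: bounded_pos)
 then show ?thesis by (intro that[of C]) (metis assms(3) norm_zero less_imp_le)+
qed

lemma integrable_indicator_compact:
 "compact K ==> integrable lborel (indicator K :: 'a::euclidean_space => real)"
 using emeasure_compact_finite[of K] by (simp add: integrable_indicator_iff borel_compact)

lemma integrable_bounded_compact:
 fixes f :: "'a::euclidean_space => 'b::{banach, second_countable_topology}"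
 assumes "compact S" "f \<in> borel_measurable borel" "AE x\<in>S in lborel. norm (f x) <= C"
  "!!x. x \<notin> S ==> f x = 0"
 shows "integrable lborel f"
proof (rule Bochner_Integration.integrable_bound)
 show "integrable lborel (%x. C * indicator S x)"
  by (intro integrable_mult_right integrable_indicator_compact assms(1))
 show "AE x in lborel. norm (f x) <= norm (C * indicator S x)"
  using assms(3)
 proof eventually_elim
  case (elim x)
  then show ?case using assms(4)[of x] by (cases "x \<in> S") auto
 qed
qed (use assms(2) in simp)

lemma integrable_compact_support:
 fixes f :: "'a::euclidean_space => 'b::{banach, second_countable_topology}"
 assumes "compact S" "continuous_on UNIV f" "!!x. x \<notin> S ==> f x = 0"
 shows "integrable lborel f"
proof -
 obtain C where "!!x. norm (f x) <= C" by (rule bounded_compact_support[OF assms]) auto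
 then show ?thesis
  by (intro integrable_bounded_compact[of S _ C] borel_measurable_continuous_onI assms) auto
qed

lemma set_integrable_continuous:
 fixes g :: "'a::euclidean_space => real"
 assumes "compact K" "continuous_on K g"
 shows "set_integrable lborel K g"
 unfolding set_integrable_def using borel_integrable_compact[OF assms]
 by (simp add: indicator_def if_distrib[of "%c. c *\<^sub>R _"] cong: if_cong)

lemma integrable_mult_compact_support:
 fixes g k :: "'a::euclidean_space => real"
 assumes g: "set_integrable lborel S g" and S: "compact S"
  and k: "k \<in> borel_measurable borel" "!!x. \<bar>k x\<bar> <= C" "!!x. x \<notin> S ==> k x = 0"
 shows "integrable lborel (%x. g x * k x)"
proof (rule Bochner_Integration.integrable_bound)
 have int: "integrable lborel (%x. indicator S x *\<^sub>R g x)" using g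
  by (simp add: set_integrable_def)
 then show "integrable lborel (%x. C * (indicator S x *\<^sub>R g x))" by simp
 have eq: "(%x. g x * k x) = (%x. (indicator S x *\<^sub>R g x) * k x)"
  using k(3) by (intro ext) (auto simp: indicator_def)
 note [measurable] = k(1) borel_measurable_integrable[OF int]
 show "(%x. g x * k x) \<in> borel_measurable lborel" unfolding eq by measurable
 show "AE x in lborel. norm (g x * k x) <= norm (C * (indicator S x *\<^sub>R g x))"
 proof (rule AE_I2)
  fix x
  have "\<bar>g x\<bar> * \<bar>k x\<bar> <= \<bar>g x\<bar> * \<bar>C\<bar>"
   using k(2)[of x] by (intro mult_left_mono) auto
  then show "norm (g x * k x) <= norm (C * (indicator S x *\<^sub>R g x))"
   using k(3)[of x] by (auto simp: abs_mult indicator_def mult.commute)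
 qed
qed

lemma vec_lambda_eq_sum_axis: "(\<chi> i. f i) = (\<Sum>i\<in>UNIV. f i *\<^sub>R axis i (1::real))"
 by (simp add: vec_eq_iff axis_def if_distrib cong: if_cong)

lemma borel_measurable_vec_nth:
 fixes F :: "'a => real^'n"
 assumes "F \<in> borel_measurable M"
 shows "(%x. F x $ i) \<in> borel_measurable M"
proof -
 have "(%x. F x $ i) = (%x. F x \<bullet> axis i 1)" by (simp add: inner_axis)
 then show ?thesis using assms by simp
qed

subsection \<open>Compactly supported continuously differentiable functions\<close>

definition C1c :: "(real^'n) set => (real^'n => real) => bool" where
 "C1c S phi \<longleftrightarrow> compact S \<and> (\<forall>x. phi differentiable (at x)) \<and> continuous_on UNIV (grad phi) \<and>
   (\<forall>x. x \<notin> S --> phi x = 0)"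

lemma C1c_compact: "C1c S phi ==> compact S"
 and C1c_zero: "C1c S phi ==> x \<notin> S ==> phi x = 0"
 and C1c_differentiable: "C1c S phi ==> phi differentiable (at x)"
 and C1c_GDERIV: "C1c S phi ==> GDERIV phi x :> grad phi x"
 by (auto simp: C1c_def GDERIV_iff_grad)

lemma C1c_grad_0: "C1c S phi ==> x \<notin> S ==> grad phi x = 0"
 using GDERIV_outside_support[of S phi x]
  by (auto simp: C1c_def compact_imp_closed GDERIV_iff_grad)

lemma C1c_pderiv_0: "C1c S phi ==> x \<notin> S ==> pderiv_at i phi x = 0"
 by (metis C1c_grad_0 grad_nth zero_index)

lemma C1c_continuous: "C1c S phi ==> continuous_on A phi"
 by (auto simp: C1c_def intro!: continuous_at_imp_continuous_on
   differentiable_imp_continuous_within)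

lemma C1c_continuous_grad: "C1c S phi ==> continuous_on A (grad phi)"
 by (auto simp: C1c_def intro: continuous_on_subset)

lemma continuous_on_grad_iff:
 "continuous_on S (grad g) \<longleftrightarrow> (\<forall>i. continuous_on S (pderiv_at i g))"
proof
 assume "continuous_on S (grad g)"
 then show "\<forall>i. continuous_on S (pderiv_at i g)"
  by (auto dest: continuous_on_component[of S "grad g"])
next
 assume "\<forall>i. continuous_on S (pderiv_at i g)"
 then show "continuous_on S (grad g)"
  unfolding grad_def by (intro continuous_on_vec_lambda) auto
qed

lemma C1c_continuous_pderiv: "C1c S phi ==> continuous_on A (pderiv_at i phi)"
 using C1c_continuous_grad continuous_on_grad_iff by blast

lemma C1c_measurable: "C1c S phi ==> phi \<in> borel_measurable borel"
 and C1c_measurable_grad: "C1c S phi ==> grad phi \<in> borel_measurable borel"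
 and C1c_measurable_pderiv: "C1c S phi ==> pderiv_at i phi \<in> borel_measurable borel"
 by (intro borel_measurable_continuous_onI C1c_continuous C1c_continuous_grad
   C1c_continuous_pderiv; assumption)+

lemma C1c_integrable:
 assumes "C1c S phi"
 shows "integrable lborel phi" "integrable lborel (pderiv_at i phi)" "integrable lborel (grad phi)"
 by (rule integrable_compact_support[OF C1c_compact[OF assms]];
   auto intro: C1c_continuous C1c_continuous_pderiv C1c_continuous_grad C1c_zero C1c_pderiv_0
    C1c_grad_0 assms)+

lemma C1c_bounded:
 assumes "C1c S phi"
 obtains C where "C > 0" "!!x. \<bar>phi x\<bar> <= C" "!!x. norm (grad phi x) <= C" "!!i x. \<bar>pderiv_at i phi x\<bar> <= C"
proof -
 obtain C where C: "C > 0" "!!x. norm (phi x) <= C"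
  using bounded_compact_support[OF C1c_compact[OF assms] C1c_continuous[OF assms]
    C1c_zero[OF assms]] by blast
 obtain C' where C': "C' > 0" "!!x. norm (grad phi x) <= C'"
  using bounded_compact_support[OF C1c_compact[OF assms] C1c_continuous_grad[OF assms]
    C1c_grad_0[OF assms]] by blast
 have "\<bar>pderiv_at i phi x\<bar> <= C'" for i x
  using component_le_norm_cart[of "grad phi x" i] C'(2)[of x] by simp
 then show ?thesis
  using C C' by (intro that[of "max C C'"]) (auto intro: le_max_iff_disj[THEN iffD2])
qed

lemma C1c_integrable_mult:
 assumes "C1c S phi" "set_integrable lborel S g"
 shows "integrable lborel (%x. g x * phi x)" "integrable lborel (%x. g x * pderiv_at i phi x)"
proof -
 obtain C where "!!x. \<bar>phi x\<bar> <= C" "!!i x. \<bar>pderiv_at i phi x\<bar> <= C"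
  using C1c_bounded[OF assms(1)] by metis
 with assms show "integrable lborel (%x. g x * phi x)" "integrable lborel (%x. g x * pderiv_at i phi x)"
  by (auto intro!: integrable_mult_compact_support[where S = S]
    intro: C1c_compact C1c_measurable C1c_measurable_pderiv C1c_zero C1c_pderiv_0)
qed

lemma smooth_imp_C1c:
 assumes "!!m. Ck_on m UNIV phi" "compact S" "!!x. x \<notin> S ==> phi x = 0"
 shows "C1c S phi"
 using assms(1)[of 1] assms(2,3) by (auto simp: C1c_def continuous_on_grad_iff)

lemma test_funI:
 assumes "!!m. Ck_on m UNIV phi" "compact S" "!!x. x \<notin> S ==> phi x = 0" "S \<subseteq> U"
 shows "phi \<in> test_fun U"
proof -
 have "closure {x. phi x \<noteq> 0} \<subseteq> S"
  using assms by (intro closure_minimal) (auto simp: compact_imp_closed)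
 moreover have "compact (closure {x. phi x \<noteq> 0})"
  using calculation assms(2) by (meson closed_closure compact_Int_closed
    compact_eq_bounded_closed bounded_subset)
 ultimately show ?thesis using assms by (auto simp: test_fun_def)
qed

lemma test_funE:
 assumes "phi \<in> test_fun U"
 obtains S where "C1c S phi" "S \<subseteq> U" "!!m. Ck_on m UNIV phi"
proof
 let ?S = "closure {x. phi x \<noteq> 0}"
 show smooth: "Ck_on m UNIV phi" for m using assms by (simp add: test_fun_def)
 show "?S \<subseteq> U" using assms by (simp add: test_fun_def)
 show "C1c ?S phi"
 proof (rule smooth_imp_C1c[OF smooth])
  show "compact ?S" using assms by (auto simp: test_fun_def)
  show "phi x = 0" if "x \<notin> ?S" for x using that closure_subset[of "{x. phi x \<noteq> 0}"] by blast
 qed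
qed

lemma test_fun_mono: "phi \<in> test_fun V ==> V \<subseteq> U ==> phi \<in> test_fun U"
 by (auto simp: test_fun_def)

lemma test_fun_lincomb:
 assumes "phi \<in> test_fun U" "psi \<in> test_fun U"
 shows "(%x. s * phi x + t * psi x) \<in> test_fun U"
proof -
 obtain S where S: "C1c S phi" "S \<subseteq> U" "!!m. Ck_on m UNIV phi"
  by (rule test_funE[OF assms(1)]) blast
 obtain S' where S': "C1c S' psi" "S' \<subseteq> U" "!!m. Ck_on m UNIV psi"
  by (rule test_funE[OF assms(2)]) blast
 have outside: "s * phi x + t * psi x = 0" if "x \<notin> S \<union> S'" for x
  using that C1c_zero[OF S(1)] C1c_zero[OF S'(1)] by auto
 note compact = compact_Un[OF C1c_compact[OF S(1)] C1c_compact[OF S'(1)]]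
 show ?thesis
  by (rule test_funI[OF _ compact outside]) (use S(2,3) S'(2,3) in \<open>auto intro!: Ck_on_add Ck_on_mult
    Ck_on_const\<close>)
qed

lemma C1cI:
 assumes "compact S" "open U" "S \<subseteq> U" "!!x. x \<in> U ==> GDERIV k x :> G x" "continuous_on U G"
  "!!x. x \<notin> S ==> k x = 0"
 shows "C1c S k" "!!x. x \<in> U ==> grad k x = G x"
proof -
 have cl: "closed S" using assms(1) compact_imp_closed by blast
 have outside: "GDERIV k x :> 0" if "x \<notin> S" for x
  by (rule GDERIV_outside_support[OF cl assms(6) that])
 show grad: "grad k x = G x" if "x \<in> U" for x using assms(4)[OF that]
  by (simp add: GDERIV_iff_grad)
 have "continuous_on (U \<union> - S) (grad k)"
 proof (rule continuous_on_open_Un)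
  show "continuous_on U (grad k)" using assms(5) grad by (auto cong: continuous_on_cong)
  have "grad k x = 0" if "x \<in> - S" for x using outside[of x] that by (simp add: GDERIV_iff_grad)
  then show "continuous_on (- S) (grad k)" by (subst continuous_on_cong[OF refl]) auto
 qed (use assms cl in auto)
 moreover have "U \<union> - S = UNIV" using assms(3) by auto
 moreover have "k differentiable at x" for x
  using outside[of x] assms(3) assms(4)[of x] by (cases "x \<in> S") (auto simp: GDERIV_iff_grad)
 ultimately show "C1c S k" using assms by (auto simp: C1c_def)
qed

lemma C1c_translate:
 assumes "C1c S phi"
 shows "C1c ((%x. x + c) ` S) (%x. phi (x - c))" "grad (%x. phi (x - c)) x = grad phi (x - c)"
proof -
 have deriv: "GDERIV (%x. phi (x - c)) x :> grad phi (x - c)" for x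
  using GDERIV_translate[of phi x "-c"] C1c_GDERIV[OF assms, of "x - c"] by simp
 have cont: "continuous_on UNIV (%x. grad phi (x - c))"
  by (intro continuous_on_compose2[OF C1c_continuous_grad[OF assms]] continuous_intros) auto
 have outside: "phi (x - c) = 0" if "x \<notin> (%x. x + c) ` S" for x
  using that by (intro C1c_zero[OF assms]) (metis diff_add_cancel image_eqI)
 have "compact ((%x. x + c) ` S)"
  by (intro compact_continuous_image continuous_intros C1c_compact[OF assms])
 note C1cI[OF this open_UNIV subset_UNIV deriv cont outside]
 then show "C1c ((%x. x + c) ` S) (%x. phi (x - c))" "grad (%x. phi (x - c)) x = grad phi (x - c)"
  by auto
qed

lemma C1c_reflect:
 assumes "C1c S phi"
 shows "C1c ((%x. c - x) ` S) (%x. phi (c - x))" "grad (%x. phi (c - x)) x = - grad phi (c - x)"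
proof -
 have deriv: "GDERIV (%x. phi (c - x)) x :> - grad phi (c - x)" for x
  by (intro GDERIV_minus_arg C1c_GDERIV[OF assms])
 have cont: "continuous_on UNIV (%x. - grad phi (c - x))"
  by (intro continuous_intros continuous_on_compose2[OF C1c_continuous_grad[OF assms]]) auto
 have outside: "phi (c - x) = 0" if "x \<notin> (%x. c - x) ` S" for x
  using that by (intro C1c_zero[OF assms]) (metis diff_diff_eq2 add_diff_cancel_left' image_eqI)
 have "compact ((%x. c - x) ` S)"
  by (intro compact_continuous_image continuous_intros C1c_compact[OF assms])
 note C1cI[OF this open_UNIV subset_UNIV deriv cont outside]
 then show "C1c ((%x. c - x) ` S) (%x. phi (c - x))" "grad (%x. phi (c - x)) x = - grad phi (c - x)"
  by auto
qed

lemma C1c_mult: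
 assumes U: "open U" "S \<subseteq> U" "!!x. x \<in> U ==> g differentiable (at x)" "continuous_on U (grad g)"
  and phi: "C1c S phi"
 shows "C1c S (%x. g x * phi x)"
  "pderiv_at i (%x. g x * phi x) x = g x * pderiv_at i phi x + phi x * pderiv_at i g x"
proof -
 let ?G = "%x. g x *\<^sub>R grad phi x + phi x *\<^sub>R grad g x"
 have S: "compact S" and outside: "!!x. x \<notin> S ==> g x * phi x = 0"
  using C1c_compact[OF phi] C1c_zero[OF phi] by auto
 have G: "GDERIV (%x. g x * phi x) x :> ?G x" if "x \<in> U" for x
  using U(3)[OF that] phi by (intro GDERIV_mult GDERIV_grad) (auto simp: C1c_def)
 have cG: "continuous_on U ?G"
  by (intro continuous_intros differentiable_imp_continuous_on U(3,4) C1c_continuous[OF phi]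
    C1c_continuous_grad[OF phi])
 show C: "C1c S (%x. g x * phi x)" by (rule C1cI(1)[OF S U(1,2) G cG outside])
 show "pderiv_at i (%x. g x * phi x) x = g x * pderiv_at i phi x + phi x * pderiv_at i g x"
 proof (cases "x \<in> U")
  case True
  have "grad (%x. g x * phi x) x = ?G x" by (rule C1cI(2)[OF S U(1,2) G cG outside True])
  then have "grad (%x. g x * phi x) x $ i = ?G x $ i" by simp
  then show ?thesis by simp
 next
  case False
  then have "x \<notin> S" using U(2) by auto
  then show ?thesis using C1c_pderiv_0[OF C] C1c_pderiv_0[OF phi] C1c_zero[OF phi] by simp
 qed
qed

lemma GDERIV_power2_mult:
 fixes w psi :: "real^'n => real"
 assumes "GDERIV psi x :> P" "GDERIV w x :> W"
 shows "GDERIV (%x. (psi x)^2 * w x) x :> (psi x)^2 *\<^sub>R W + (2 * psi x * w x) *\<^sub>R P"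
proof -
 have "GDERIV (%x. (psi x * psi x) * w x) x :> (psi x * psi x) *\<^sub>R W + w x *\<^sub>R (psi x *\<^sub>R P + psi x *\<^sub>R P)"
  by (intro GDERIV_mult assms)
 then have "GDERIV (%x. (psi x * psi x) * w x) x :> (psi x)^2 *\<^sub>R W + (2 * psi x * w x) *\<^sub>R P"
  by (rule GDERIV_subst) (simp add: power2_eq_square algebra_simps flip: scaleR_2)
 then show ?thesis by (simp add: power2_eq_square)
qed

lemma C1c_power2:
 assumes "C1c S psi"
 shows "C1c S (%x. (psi x)^2)" "grad (%x. (psi x)^2) x = (2 * psi x) *\<^sub>R grad psi x"
proof -
 have "GDERIV (%x. (psi x)^2) x :> (2 * psi x) *\<^sub>R grad psi x" for x
  using GDERIV_power2_mult[OF C1c_GDERIV[OF assms] GDERIV_const[of 1]] by simp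
 note R = C1cI[OF C1c_compact[OF assms] open_UNIV subset_UNIV this]
 show "C1c S (%x. (psi x)^2)" "grad (%x. (psi x)^2) x = (2 * psi x) *\<^sub>R grad psi x"
  by (rule R; auto intro!: continuous_intros C1c_continuous[OF assms] C1c_continuous_grad[OF
    assms]
    simp: C1c_zero[OF assms])+
qed

subsection \<open>Convolution and mollification\<close>

lemma GDERIV_linearization_bound:
 fixes f :: "real^'n => real"
 assumes "!!x. f differentiable (at x)" and "!!y. norm (y - z) <= norm v ==> norm (grad f y - grad f
   z) <= e"
 shows "\<bar>f (z + v) - f z - inner v (grad f z)\<bar> <= e * norm v"
proof -
 let ?S = "cball z (norm v)"
 have "norm (f (z + v) - f z - inner (z + v - z) (grad f z)) <= norm (z + v - z) * e"
 proof (rule differentiable_bound_linearization[where S = ?S and f' = "%x h. inner h (grad f x)"])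
  show "z + t *\<^sub>R (z + v - z) \<in> ?S" if "t \<in> {0..1}" for t
   using that by (simp add: dist_norm mult_left_le_one_le)
  show "(f has_derivative (%h. inner h (grad f x))) (at x within ?S)" for x
   using GDERIV_grad[OF assms(1)] by (auto simp: gderiv_def intro: has_derivative_at_withinI)
  show "onorm ((%h. inner h (grad f x)) - (%h. inner h (grad f z))) <= e" if "x \<in> ?S" for x
  proof (rule onorm_le)
   fix h
   have "\<bar>inner h (grad f x - grad f z)\<bar> <= norm h * norm (grad f x - grad f z)"
    by (rule Cauchy_Schwarz_ineq2)
   also have "... <= e * norm h" using assms(2)[of x] that
    by (subst mult.commute) (auto simp: dist_norm norm_minus_commute intro!: mult_right_mono)
   finally show "norm (((%h. inner h (grad f x)) - (%h. inner h (grad f z))) h) <= e * norm h"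
    by (simp add: inner_diff_right)
  qed
 qed auto
 then show ?thesis by (simp add: mult.commute)
qed

definition conv_along :: "'a measure => ('a => real) => ('a => real^'n) => (real^'n => real) => real^'n =>
  real"
 where "conv_along M g k phi x = (\<integral>t. g t * phi (x - k t) \<partial>M)"

lemma conv_along_integrable:
 fixes k :: "'a => real^'n" and phi :: "real^'n => real"
 assumes g: "integrable M g" and k: "k \<in> borel_measurable M"
  and phi: "phi \<in> borel_measurable borel" "!!x. \<bar>phi x\<bar> <= C"
 shows "integrable M (%t. g t * phi (x - k t))"
proof (rule Bochner_Integration.integrable_bound[where f = "%t. C * g t"])
 note [measurable] = k phi(1)
 show "(%t. g t * phi (x - k t)) \<in> borel_measurable M" using g by measurable
 have "norm (g t * phi (x - k t)) <= norm (C * g t)" for t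
 proof -
  have "\<bar>phi (x - k t)\<bar> <= \<bar>C\<bar>" using phi(2)[of "x - k t"] by linarith
  from mult_left_mono[OF this, of "\<bar>g t\<bar>"] show ?thesis by (simp add: abs_mult mult.commute)
 qed
 then show "AE t in M. norm (g t * phi (x - k t)) <= norm (C * g t)" by simp
qed (use g in simp)

lemma conv_along_eq_0:
 assumes "!!t. g t \<noteq> 0 ==> phi (x - k t) = 0"
 shows "conv_along M g k phi x = 0"
proof -
 have "(%t. g t * phi (x - k t)) = (%t. 0)" using assms by fastforce
 then show ?thesis by (simp add: conv_along_def)
qed

lemma conv_along_linearization_bound:
 fixes k :: "'a => real^'n"
 assumes g: "integrable M g" and k: "k \<in> borel_measurable M" and phi: "C1c S phi"
  and e: "!!y z. dist y z <= norm v ==> norm (grad phi y - grad phi z) <= e"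
 shows "\<bar>conv_along M g k phi (x + v) - conv_along M g k phi x
      - v \<bullet> (\<chi> i. conv_along M g k (pderiv_at i phi) x)\<bar> <= (\<integral>t. \<bar>g t\<bar> \<partial>M) * e * norm v"
proof -
 obtain C where C: "!!x. \<bar>phi x\<bar> <= C" "!!i x. \<bar>pderiv_at i phi x\<bar> <= C" using C1c_bounded[OF phi] by metis
 note I = conv_along_integrable[OF g k C1c_measurable[OF phi] C(1)]
  and Ip = conv_along_integrable[OF g k C1c_measurable_pderiv[OF phi] C(2)]
 have inner: "g t * (v \<bullet> grad phi (x - k t)) = (\<Sum>i\<in>UNIV. v $ i * (g t * pderiv_at i phi (x - k t)))"
   for t
  by (simp add: inner_vec_def sum_distrib_left mult_ac)
 have Ig: "integrable M (%t. g t * (v \<bullet> grad phi (x - k t)))" unfolding inner using Ip by simp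
 have eq: "v \<bullet> (\<chi> i. conv_along M g k (pderiv_at i phi) x) = (\<integral>t. g t * (v \<bullet> grad phi (x - k t)) \<partial>M)"
  unfolding inner using Ip by (simp add: conv_along_def inner_vec_def)
 let ?D = "%t. phi (x + v - k t) - phi (x - k t) - v \<bullet> grad phi (x - k t)"
 have D: "\<bar>?D t\<bar> <= e * norm v" for t
 proof -
  have "\<bar>phi (x - k t + v) - phi (x - k t) - v \<bullet> grad phi (x - k t)\<bar> <= e * norm v"
   by (rule GDERIV_linearization_bound[OF C1c_differentiable[OF phi] e]) (simp add: dist_norm)
  then show ?thesis by (simp add: diff_add_eq)
 qed
 have remainder: "conv_along M g k phi (x + v) - conv_along M g k phi x
   - v \<bullet> (\<chi> i. conv_along M g k (pderiv_at i phi) x) = (\<integral>t. g t * ?D t \<partial>M)"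
  unfolding eq unfolding conv_along_def using I Ig by (simp add: right_diff_distrib)
 have "\<bar>\<integral>t. g t * ?D t \<partial>M\<bar> <= (\<integral>t. \<bar>g t * ?D t\<bar> \<partial>M)" by (rule integral_abs_bound)
 also have "... <= (\<integral>t. \<bar>g t\<bar> * (e * norm v) \<partial>M)"
 proof (rule integral_mono)
  show "integrable M (%t. \<bar>g t * ?D t\<bar>)"
   unfolding right_diff_distrib by (intro integrable_abs Bochner_Integration.integrable_diff I
     Ig)
  show "\<bar>g t * ?D t\<bar> <= \<bar>g t\<bar> * (e * norm v)" for t
   unfolding abs_mult by (rule mult_left_mono[OF D]) simp
 qed (use g in simp)
 finally show ?thesis unfolding remainder by simp
qed

lemma conv_along_GDERIV:
 fixes k :: "'a => real^'n"
 assumes g: "integrable M g" and k: "k \<in> borel_measurable M" and phi: "C1c S phi"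
 shows "GDERIV (conv_along M g k phi) x :> (\<chi> i. conv_along M g k (pderiv_at i phi) x)"
 unfolding gderiv_def has_derivative_at_alt
proof (intro conjI allI impI bounded_linear_inner_left)
 fix e :: real assume "e > 0"
 define N where "N = (\<integral>t. \<bar>g t\<bar> \<partial>M)"
 have N: "N >= 0" by (simp add: N_def)
 define e' where "e' = e / (N + 1)"
 have e': "e' > 0" "N * e' <= e" using \<open>e > 0\<close> N by (auto simp: e'_def field_simps)
 have "uniformly_continuous_on UNIV (grad phi)"
  by (rule uniformly_continuous_compact_support[OF C1c_compact[OF phi] C1c_continuous_grad[OF phi]
     C1c_grad_0[OF phi]])
 then obtain d where d: "d > 0" "!!y z. dist y z < d ==> dist (grad phi y) (grad phi z) < e'"
  using e'(1) unfolding uniformly_continuous_on_def by (metis UNIV_I)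
 have "norm (conv_along M g k phi y - conv_along M g k phi x
   - (y - x) \<bullet> (\<chi> i. conv_along M g k (pderiv_at i phi) x)) <= e * norm (y - x)"
  if y: "norm (y - x) < d" for y
 proof -
  have "norm (grad phi w - grad phi z) <= e'" if "dist w z <= norm (y - x)" for w z
   using d(2)[of w z] that y by (simp add: dist_norm)
  then have "norm (conv_along M g k phi y - conv_along M g k phi x
    - (y - x) \<bullet> (\<chi> i. conv_along M g k (pderiv_at i phi) x)) <= N * e' * norm (y - x)"
   using conv_along_linearization_bound[OF g k phi, of "y - x" e' x] by (simp add: N_def)
  also have "... <= e * norm (y - x)" by (rule mult_right_mono[OF e'(2)]) simp
  finally show ?thesis .
 qed
 then show "\<exists>d>0. \<forall>y. norm (y - x) < d --> norm (conv_along M g k phi y - conv_along M g k phi x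
   - (y - x) \<bullet> (\<chi> i. conv_along M g k (pderiv_at i phi) x)) <= e * norm (y - x)" using d(1) by blast
qed

lemma conv_along_smooth:
 fixes k :: "'a => real^'n" and phi :: "real^'n => real"
 assumes g: "integrable M g" and k: "k \<in> borel_measurable M"
  and phi: "!!m. Ck_on m UNIV phi" "compact S" "!!x. x \<notin> S ==> phi x = 0"
 shows "Ck_on m UNIV (conv_along M g k phi)"
 using phi(1,3)
proof (induction m arbitrary: phi)
 case (0 phi)
 then have "C1c S phi" using smooth_imp_C1c phi(2) by blast
 from conv_along_GDERIV[OF g k this] show ?case
  by (auto intro!: differentiable_imp_continuous_on simp: GDERIV_iff_grad)
next
 case (Suc m phi)
 then have C: "C1c S phi" using smooth_imp_C1c phi(2) by blast
 note G = conv_along_GDERIV[OF g k C]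
 have "pderiv_at i (conv_along M g k phi) = conv_along M g k (pderiv_at i phi)" for i
  using GDERIV_imp_pderiv_at[OF G] by (intro ext) simp
 moreover have "Ck_on m UNIV (conv_along M g k (pderiv_at i phi))" for i
 proof (rule Suc.IH)
  show "Ck_on n UNIV (pderiv_at i phi)" for n using Suc.prems(1)[of "Suc n"] by simp
 qed (rule C1c_pderiv_0[OF C])
 ultimately show ?case using G by (auto simp: GDERIV_iff_grad)
qed

lemma lborel_integral_shift:
 fixes f :: "'a::euclidean_space => 'b::{banach, second_countable_topology}"
 assumes "f \<in> borel_measurable borel"
 shows "(LBINT x. f (x + c)) = (LBINT x. f x)"
proof -
 have "(LBINT x. f x) = (\<integral>x. f x \<partial>distr lborel borel ((+) c))" by (simp add: lborel_distr_plus)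
 also have "... = (LBINT x. f (c + x))" by (subst integral_distr) (use assms in auto)
 finally show ?thesis by (simp add: add.commute)
qed

lemma lborel_integrable_shift:
 fixes f :: "'a::euclidean_space => 'b::{banach, second_countable_topology}"
 assumes "integrable lborel f"
 shows "integrable lborel (%x. f (x + c))"
proof -
 have [measurable]: "f \<in> borel_measurable borel" using borel_measurable_integrable[OF assms]
  by simp
 have "integrable (distr lborel borel ((+) c)) f" by (simp add: lborel_distr_plus assms)
 then show ?thesis by (subst (asm) integrable_distr_eq) (auto simp: add.commute)
qed

lemma lborel_integral_reflect:
 fixes f :: "'a::euclidean_space => real"
 assumes "f \<in> borel_measurable borel"
 shows "(LBINT x. f (c - x)) = (LBINT x. f x)"
proof -
 have "lborel = distr lborel borel (%x::'a. c + (-1) *\<^sub>R x)"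
  using lborel_affine[of "-1" c] by (simp add: density_1)
 then have "(LBINT x. f x) = (\<integral>x. f x \<partial>distr lborel borel (%x. c + (-1) *\<^sub>R x))" by simp
 also have "... = (LBINT x. f (c + (-1) *\<^sub>R x))" by (subst integral_distr) (use assms in auto)
 finally show ?thesis by simp
qed

definition mollifier :: "real => real^'n => real" where
 "mollifier d x = bump_fun 0 (d^2 - (norm x)^2) / (LBINT x. bump_fun 0
   (d^2 - (norm (x::real^'n))^2))"

lemma bump_fun_nonneg: "bump_fun 0 t >= 0" by (simp add: bump_fun_def)

lemma mollifier_nonneg: "mollifier d x >= 0"
 unfolding mollifier_def
 by (intro divide_nonneg_nonneg bump_fun_nonneg Bochner_Integration.integral_nonneg)

lemma mollifier_minus: "mollifier d (- x) = mollifier d x"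
 by (simp add: mollifier_def)

lemma Ck_on_bump_fun_norm: "Ck_on m UNIV (%x::real^'n. bump_fun 0 (c - (norm x)^2))"
 by (rule Ck_on_compose_real[of bump_fun, OF DERIV_bump_fun Ck_on_diff_norm_sq])

lemma mollifier_smooth: "Ck_on m UNIV (mollifier d :: real^'n => real)"
 unfolding mollifier_def[abs_def] divide_inverse
 by (intro Ck_on_mult Ck_on_bump_fun_norm Ck_on_const)

lemma bump_fun_norm_eq_0: "0 <= d ==> x \<notin> cball 0 d ==> bump_fun 0 (d^2 - (norm x)^2) = 0"
 using power_mono[of d "norm x" 2] by (auto simp: bump_fun_def not_less)

lemma mollifier_eq_0: "0 <= d ==> x \<notin> cball 0 d ==> mollifier d x = 0"
 using bump_fun_norm_eq_0[of d x] by (simp add: mollifier_def)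

lemma mollifier_C1c: "0 <= d ==> C1c (cball 0 d) (mollifier d)"
 by (rule smooth_imp_C1c[OF mollifier_smooth compact_cball mollifier_eq_0])

lemma mollifier_integrable: "0 <= d ==> integrable lborel (mollifier d)"
 by (rule C1c_integrable(1)[OF mollifier_C1c])

lemma mollifier_integral:
 assumes "d > 0" shows "(LBINT x. mollifier d (x::real^'n)) = 1"
proof -
 let ?b = "%x::real^'n. bump_fun 0 (d^2 - (norm x)^2)"
 have int: "integrable lborel ?b"
  using assms by (intro C1c_integrable(1)[of "cball 0 d"] smooth_imp_C1c Ck_on_bump_fun_norm
    bump_fun_norm_eq_0) auto
 have "(LBINT x. ?b x) \<noteq> 0"
 proof
  assume "(LBINT x. ?b x) = 0"
  then have "AE x in lborel. ?b x = 0"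
   using integral_nonneg_eq_0_iff_AE[OF int] bump_fun_nonneg by auto
  then have "AE x in lborel. x \<notin> ball (0::real^'n) d"
   by eventually_elim
    (use assms in \<open>auto simp: bump_fun_def power_strict_mono split: if_splits\<close>)
  then have "ball (0::real^'n) d \<in> null_sets lborel" by (subst AE_iff_null_sets) auto
  then have "emeasure lborel (ball (0::real^'n) d) = 0" by (simp add: null_sets_def)
  moreover have "measure lebesgue (ball (0::real^'n) d) > 0"
   using content_ball_pos[OF assms] by simp
  ultimately show False by (simp add: measure_def)
 qed
 then show ?thesis by (simp add: mollifier_def[abs_def])
qed

definition mollify :: "real => (real^'n => real) => real^'n => real" where
 "mollify d = conv_along lborel (mollifier d) (%y. y)"

lemma mollify_eq_conv_along:
 fixes phi :: "real^'n => real"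
 assumes [measurable]: "phi \<in> borel_measurable borel" and "d > 0"
 shows "mollify d phi = conv_along lborel phi (%y. y) (mollifier d)"
proof
 fix x
 have [measurable]: "mollifier d \<in> borel_measurable (borel :: (real^'n) measure)"
  using assms(2) by (intro C1c_measurable[OF mollifier_C1c]) simp
 have "mollify d phi x = (LBINT y. mollifier d (x - (x - y)) * phi (x - y))"
  by (simp add: mollify_def conv_along_def)
 also have "... = (LBINT y. mollifier d (x - y) * phi y)"
  by (rule lborel_integral_reflect[of "%y. mollifier d (x - y) * phi y"]) measurable
 finally show "mollify d phi x = conv_along lborel phi (%y. y) (mollifier d) x"
  by (simp add: conv_along_def mult.commute)
qed

lemma mollify_smooth:
 assumes "integrable lborel phi" "d > 0"
 shows "Ck_on m UNIV (mollify d phi)"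
proof -
 have "phi \<in> borel_measurable borel" using borel_measurable_integrable[OF assms(1)] by simp
 from mollify_eq_conv_along[OF this assms(2)] show ?thesis
  using assms by (auto intro!: conv_along_smooth mollifier_smooth compact_cball mollifier_eq_0)
qed

lemma mollify_eq_0:
 fixes phi :: "real^'n => real"
 assumes "!!y. y \<notin> S ==> phi y = 0" "0 < d" "d <= r" "x \<notin> thicken r S"
 shows "mollify d phi x = 0"
 unfolding mollify_def
proof (rule conv_along_eq_0)
 fix y :: "real^'n" assume "mollifier d y \<noteq> 0"
 then have "norm y <= d" using mollifier_eq_0[of d y] assms(2) by auto
 then have "x - y \<notin> S" using thickenI[of "x - y" S x r] assms(3,4) by auto
 then show "phi (x - y) = 0" by (rule assms(1))
qed

lemma mollify_bound:
 fixes phi :: "real^'n => real"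
 assumes [measurable]: "phi \<in> borel_measurable borel" and d: "d > 0"
  and bound: "!!y. norm y <= d ==> \<bar>phi (x - y)\<bar> <= C"
 shows "integrable lborel (%y. mollifier d y * phi (x - y))" "\<bar>mollify d phi x\<bar> <= C"
proof -
 let ?eta = "mollifier d :: real^'n => real"
 have eta: "C1c (cball 0 d) ?eta" using d by (intro mollifier_C1c) simp
 note [measurable] = C1c_measurable[OF eta]
 have le: "\<bar>?eta y * phi (x - y)\<bar> <= ?eta y * C" for y
  using bound[of y] mollifier_eq_0[of d y] mollifier_nonneg[of d y] d
  by (cases "norm y <= d") (auto simp: abs_mult intro: mult_left_mono)
 have iC: "integrable lborel (%y. ?eta y * C)" using d by (simp add: mollifier_integrable)
 show i: "integrable lborel (%y. ?eta y * phi (x - y))"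
  by (rule Bochner_Integration.integrable_bound[OF iC])
   (use le order_trans[OF _ abs_ge_self] in \<open>auto intro!: AE_I2\<close>)
 have "\<bar>mollify d phi x\<bar> <= (LBINT y. \<bar>?eta y * phi (x - y)\<bar>)"
  unfolding mollify_def conv_along_def by (rule integral_abs_bound)
 also have "... <= (LBINT y. ?eta y * C)" by (intro integral_mono integrable_abs i iC le)
 finally show "\<bar>mollify d phi x\<bar> <= C"
  using mollifier_integral[OF d, where 'n = 'n] by simp
qed

lemma mollify_close:
 fixes phi :: "real^'n => real"
 assumes phi: "phi \<in> borel_measurable borel" and d: "d > 0"
  and close: "!!y. norm y <= d ==> \<bar>phi (x - y) - phi x\<bar> <= e"
 shows "\<bar>mollify d phi x - phi x\<bar> <= e"
proof -
 have eta: "integrable lborel (%y::real^'n. mollifier d y * phi x)"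
  using d by (simp add: mollifier_integrable)
 have "\<bar>phi (x - y)\<bar> <= \<bar>phi x\<bar> + e" if "norm y <= d" for y using close[OF that] by linarith
 from mollify_bound(1)[OF phi d this]
 have "mollify d (%z. phi z - phi x) x = mollify d phi x - phi x"
  using mollifier_integral[OF d, where 'n = 'n]
  by (simp add: mollify_def conv_along_def right_diff_distrib
    Bochner_Integration.integral_diff[OF _ eta])
 with mollify_bound(2)[of "%z. phi z - phi x" d x e] phi d close show ?thesis by simp
qed

lemma mollify_tendsto:
 fixes phi :: "real^'n => real"
 assumes phi: "phi \<in> borel_measurable borel" "isCont phi x" and d: "!!n. d n > 0" "d \<longlonglongrightarrow> 0"
 shows "(%n. mollify (d n) phi x) \<longlonglongrightarrow> phi x"
proof (rule LIMSEQ_I)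
 fix e :: real assume "e > 0"
 then obtain \<delta> where \<delta>: "\<delta> > 0" "!!y. dist y x < \<delta> ==> dist (phi y) (phi x) < e / 2"
  using phi(2) unfolding continuous_at_eps_delta by (metis half_gt_zero)
 obtain N where N: "!!n. n >= N ==> d n < \<delta>"
  using order_tendstoD(2)[OF d(2) \<delta>(1)] unfolding eventually_sequentially by blast
 have "norm (mollify (d n) phi x - phi x) < e" if "n >= N" for n
 proof -
  have "\<bar>phi (x - y) - phi x\<bar> <= e / 2" if "norm y <= d n" for y
   using \<delta>(2)[of "x - y"] that N[OF \<open>n >= N\<close>] by (simp add: dist_norm)
  then have "\<bar>mollify (d n) phi x - phi x\<bar> <= e / 2" by (rule mollify_close[OF phi(1) d(1)])
  then show ?thesis using \<open>e > 0\<close> by simp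
 qed
 then show "\<exists>N. \<forall>n\<ge>N. norm (mollify (d n) phi x - phi x) < e" by blast
qed

lemma smooth_cutoff:
 fixes K :: "(real^'n) set"
 assumes "compact K" "open U" "K \<subseteq> U"
 obtains psi where "psi \<in> test_fun U" "!!x. 0 <= psi x" "!!x. psi x <= 1" "!!x. x \<in> K ==> psi x = 1"
proof -
 obtain e where e: "e > 0" "thicken e K \<subseteq> U" using thicken_subset_open[OF assms] .
 define d where "d = e / 2"
 have d: "d > 0" "d + d <= e" using e by (auto simp: d_def)
 let ?\<chi> = "indicator (thicken d K) :: real^'n => real"
 have cK: "compact (thicken d K)" by (rule compact_thicken[OF assms(1)])
 then have \<chi>: "?\<chi> \<in> borel_measurable borel"
  by (intro borel_measurable_indicator) (simp add: borel_compact)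
 have eta: "integrable lborel (mollifier d :: real^'n => real)"
  using d by (intro mollifier_integrable) simp
 have int: "integrable lborel (%y. mollifier d y * ?\<chi> (x - y))" for x
  by (rule conv_along_integrable[OF eta _ \<chi>, of _ 1]) (auto simp: indicator_def)
 show ?thesis
 proof
  show "mollify d ?\<chi> \<in> test_fun U"
  proof (rule test_funI[OF _ compact_thicken[OF cK, of d]])
   show "Ck_on m UNIV (mollify d ?\<chi>)" for m
    by (intro mollify_smooth integrable_indicator_compact cK d)
   show "mollify d ?\<chi> x = 0" if "x \<notin> thicken d (thicken d K)" for x
    by (rule mollify_eq_0[OF _ d(1) order_refl that]) simp
   show "thicken d (thicken d K) \<subseteq> U"
    using thicken_thicken[of d d K] thicken_mono[OF d(2), of K] e(2) by blast
  qed
  show "0 <= mollify d ?\<chi> x" for x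
   unfolding mollify_def conv_along_def
   by (intro Bochner_Integration.integral_nonneg mult_nonneg_nonneg mollifier_nonneg) auto
  show "mollify d ?\<chi> x <= 1" for x
  proof -
   have "mollify d ?\<chi> x <= (LBINT y. mollifier d (y :: real^'n))"
    unfolding mollify_def conv_along_def
    by (intro integral_mono int eta) (auto simp: indicator_def mollifier_nonneg)
   then show ?thesis using mollifier_integral[OF d(1), where 'n = 'n] by simp
  qed
  show "mollify d ?\<chi> x = 1" if "x \<in> K" for x
  proof -
   have "x - y \<in> thicken d K" if "norm y <= d" for y
    by (rule thickenI[OF \<open>x \<in> K\<close>]) (use that in simp)
   then have "\<bar>mollify d ?\<chi> x - ?\<chi> x\<bar> <= 0"
    using d(1) that thicken_superset[of d K] by (intro mollify_close[OF \<chi> d(1)]) auto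
   then show ?thesis using that thicken_superset[of d K] d(1) by (auto simp: indicator_def)
  qed
 qed
qed

section \<open>Weak derivatives\<close>

definition step :: "nat => real" where
 "step n = inverse (real (Suc n))"

lemma step_pos: "step n > 0"
 and step_le_1: "step n <= 1"
 and step_tendsto_0: "step \<longlonglongrightarrow> 0"
 using LIMSEQ_inverse_real_of_nat by (auto simp: step_def[abs_def] inverse_le_1_iff)

lemma filterlim_step_at_0: "filterlim step (at 0) sequentially"
 using step_tendsto_0 step_pos
 by (auto simp: filterlim_at intro!: always_eventually less_imp_neq[symmetric])

lemma eventually_step_less: "d > 0 ==> \<forall>\<^sub>F n in sequentially. step n < d"
 using order_tendstoD(2)[OF step_tendsto_0] .

lemma step_lessE:
 assumes "d > 0"
 obtains N where "!!n. n >= N ==> step n < d"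
 using eventually_step_less[OF assms] unfolding eventually_sequentially by blast

lemma DERIV_imp_step_quotient_tendsto:
 fixes g :: "real^'n => real"
 assumes "((%t. g (x + t *\<^sub>R e)) has_real_derivative c) (at 0)"
 shows "(%n. (g (x + step n *\<^sub>R e) - g x) / step n) \<longlonglongrightarrow> c"
proof -
 have "((%t. (g (x + t *\<^sub>R e) - g x) / t) \<longlongrightarrow> c) (at 0)" using assms by (simp add: DERIV_def)
 then show ?thesis by (rule filterlim_compose[OF _ filterlim_step_at_0])
qed

lemma pderiv_step_quotient_tendsto:
 fixes g :: "real^'n => real"
 assumes "g differentiable (at x)"
 shows "(%n. (g (x + step n *\<^sub>R axis i 1) - g x) / step n) \<longlonglongrightarrow> pderiv_at i g x"
  "(%n. (g (x - step n *\<^sub>R axis i 1) - g x) / step n) \<longlonglongrightarrow> - pderiv_at i g x"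
proof -
 have "((%t. g (x + t *\<^sub>R e)) has_real_derivative e \<bullet> grad g x) (at 0)" for e
  using GDERIV_line[of g x 0 e] GDERIV_grad[OF assms] by simp
 from this[THEN DERIV_imp_step_quotient_tendsto, of "axis i 1"]
  this[THEN DERIV_imp_step_quotient_tendsto, of "- axis i 1"]
 show "(%n. (g (x + step n *\<^sub>R axis i 1) - g x) / step n) \<longlonglongrightarrow> pderiv_at i g x"
  "(%n. (g (x - step n *\<^sub>R axis i 1) - g x) / step n) \<longlonglongrightarrow> - pderiv_at i g x"
  by (simp_all add: inner_axis')
qed

lemma C1c_diff_quotient_bound:
 assumes "C1c S phi" "!!x. norm (grad phi x) <= C" "0 < h"
 shows "\<bar>phi (x + h *\<^sub>R axis i 1) - phi x\<bar> <= C * h"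
proof -
 obtain z where "phi (x + h *\<^sub>R axis i 1) - phi x = h * (axis i 1 \<bullet> grad phi (x + z *\<^sub>R axis i 1))"
  by (rule mvt_direction[OF assms(3) C1c_differentiable[OF assms(1)]])
 moreover have "\<bar>axis i 1 \<bullet> grad phi (x + z *\<^sub>R axis i 1)\<bar> <= C"
  using Cauchy_Schwarz_ineq2[of "axis i 1" "grad phi (x + z *\<^sub>R axis i 1)"] assms(2)
  by (simp add: order_trans)
 ultimately show ?thesis using assms(3) by (simp add: abs_mult mult.commute)
qed

lemma C1c_integral_pderiv:
 fixes phi :: "real^'n => real"
 assumes phi: "C1c S phi"
 shows "(LBINT x. pderiv_at i phi x) = 0"
proof -
 let ?e = "axis i 1 :: real^'n"
 note [measurable] = C1c_measurable[OF phi] C1c_measurable_pderiv[OF phi]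
 obtain C where C: "C > 0" "!!x. norm (grad phi x) <= C" using C1c_bounded[OF phi] by metis
 define q where "q n x = (phi (x + step n *\<^sub>R ?e) - phi x) / step n" for n x
 have [measurable]: "q n \<in> borel_measurable borel" for n unfolding q_def by measurable
 have "(%n. LBINT x. q n x) \<longlonglongrightarrow> (LBINT x. pderiv_at i phi x)"
 proof (rule integral_dominated_convergence[where w = "%x. C * indicator (thicken 1 S) x"])
  show "integrable lborel (%x. C * indicator (thicken 1 S) x)"
   by (intro integrable_mult_right integrable_indicator_compact compact_thicken C1c_compact[OF
     phi])
  show "AE x in lborel. (%n. q n x) \<longlonglongrightarrow> pderiv_at i phi x"
   unfolding q_def by (intro AE_I2 pderiv_step_quotient_tendsto C1c_differentiable[OF phi])
  have "norm (q n x) <= C * indicator (thicken 1 S) x" for n x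
  proof (cases "x \<in> thicken 1 S")
   case True
   then show ?thesis
    using C1c_diff_quotient_bound[OF phi C(2) step_pos, of x n i] step_pos[of n]
    by (simp add: q_def divide_le_eq)
  next
   case False
   then have "x \<notin> S" "x + step n *\<^sub>R ?e \<notin> S"
    using thickenI[of x S x 1] thickenI[of "x + step n *\<^sub>R ?e" S x 1] step_pos[of n]
      step_le_1[of n]
    by auto
   then show ?thesis using C1c_zero[OF phi] C(1) by (simp add: q_def)
  qed
  then show "AE x in lborel. norm (q n x) <= C * indicator (thicken 1 S) x" for n by simp
 qed measurable
 moreover have "(LBINT x. q n x) = 0" for n
  unfolding q_def
  using C1c_integrable(1)[OF phi] lborel_integrable_shift[of phi] lborel_integral_shift[of phi]
  by (simp add: diff_divide_distrib)
 ultimately show ?thesis by (simp add: LIMSEQ_const_iff)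
qed

subsection \<open>Local integrability and the fundamental lemma\<close>

definition locally_integrable :: "(real^'n) set => (real^'n => real) => bool" where
 "locally_integrable U g \<longleftrightarrow> g \<in> borel_measurable borel \<and>
   (\<forall>K. compact K \<and> K \<subseteq> U --> set_integrable lborel K g)"

lemma locally_integrable_measurable: "locally_integrable U g ==> g \<in> borel_measurable borel"
 and locally_integrableD:
  "locally_integrable U g ==> compact K ==> K \<subseteq> U ==> set_integrable lborel K g"
 by (auto simp: locally_integrable_def)

lemma locally_integrable_mono: "locally_integrable U g ==> V \<subseteq> U ==> locally_integrable V g"
 by (auto simp: locally_integrable_def)

lemma locally_integrable_diff:
 "locally_integrable U f ==> locally_integrable U g ==> locally_integrable U (%x. f x - g x)"
 by (auto simp: locally_integrable_def)

lemma locally_integrable_continuous: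
 "g \<in> borel_measurable borel ==> continuous_on U g ==> locally_integrable U g"
 by (auto simp: locally_integrable_def intro: set_integrable_continuous continuous_on_subset)

lemma locally_integrable_cong_AE:
 assumes "locally_integrable U g" "g' \<in> borel_measurable borel" "AE x\<in>U in lborel. g x = g' x"
 shows "locally_integrable U g'"
 unfolding locally_integrable_def
proof (intro conjI allI impI assms(2))
 fix K assume K: "compact K \<and> K \<subseteq> U"
 have [measurable]: "K \<in> sets borel" "g' \<in> borel_measurable borel"
  using K assms(2) by (auto simp: borel_compact)
 have "AE x in lborel. indicator K x *\<^sub>R g x = indicator K x *\<^sub>R g' x"
  using assms(3) by eventually_elim (use K in \<open>auto simp: indicator_def\<close>)
 moreover have "integrable lborel (%x. indicator K x *\<^sub>R g x)"
  using locally_integrableD[OF assms(1), of K] K by (simp add: set_integrable_def)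
 ultimately show "set_integrable lborel K g'"
  unfolding set_integrable_def by (rule integrable_cong_AE_imp[rotated 2]) measurable
qed

lemma locally_integrable_mult_C1c:
 assumes "locally_integrable U g" "C1c S phi" "S \<subseteq> U"
 shows "integrable lborel (%x. g x * phi x)" "integrable lborel (%x. g x * pderiv_at i phi x)"
 using C1c_integrable_mult[OF assms(2) locally_integrableD[OF assms(1) C1c_compact[OF assms(2)]
   assms(3)]]
 by auto

lemma AE_open_from_compact:
 fixes U :: "'a::euclidean_space set"
 assumes "open U" "!!K. compact K ==> K \<subseteq> U ==> AE x in M. x \<in> K --> P x"
 shows "AE x in M. x \<in> U --> P x"
proof -
 obtain C :: "nat => 'a set" where C: "!!n. compact (C n)" "!!n. C n \<subseteq> U" "\<Union>(range C) = U"
  by (rule open_Union_compact_subsets[OF assms(1)]) blast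
 have "AE x in M. \<forall>n. x \<in> C n --> P x" unfolding AE_all_countable using assms(2) C by blast
 then show ?thesis by eventually_elim (use C(3) in blast)
qed

lemma cutoff_tendsto_indicator:
 fixes K :: "(real^'n) set"
 assumes K: "compact K" and U: "open U" "K \<subseteq> U"
 obtains psi K' where "!!n::nat. psi n \<in> test_fun U" "compact K'" "K' \<subseteq> U"
  "!!n x. \<bar>psi n x\<bar> <= indicator K' x" "!!x. (%n. psi n x) \<longlonglongrightarrow> indicator K x"
proof -
 obtain e where e: "e > 0" "thicken e K \<subseteq> U" using thicken_subset_open[OF K U] .
 define W where "W n = (\<Union>x\<in>K. ball x (e * step n))" for n
 have W: "open (W n)" "K \<subseteq> W n" for n using e step_pos[of n] by (auto simp: W_def)
 have W_thicken: "W n \<subseteq> thicken (e * step n) K" for n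
  by (auto simp: W_def dist_norm norm_minus_commute intro!: thickenI)
 have "thicken (e * step n) K \<subseteq> thicken e K" for n
  using e step_le_1[of n] by (intro thicken_mono) auto
 then have W_subset: "W n \<subseteq> thicken e K" for n using W_thicken by blast
 have "\<exists>psi. psi \<in> test_fun (W n) \<and> (\<forall>x. 0 <= psi x \<and> psi x <= 1) \<and> (\<forall>x\<in>K. psi x = 1)" for n
  by (rule smooth_cutoff[OF K W]) blast
 then obtain psi where psi: "!!n. psi n \<in> test_fun (W n)" "!!n x. 0 <= psi n x" "!!n x. psi n x <= 1"
  "!!n x. x \<in> K ==> psi n x = 1" by metis
 have outside: "psi n x = 0" if "x \<notin> W n" for n x
  using psi(1)[of n] that C1c_zero by (auto elim!: test_funE)
 show ?thesis
 proof (rule that[of psi "thicken e K"])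
  show "psi n \<in> test_fun U" for n
   using W_subset[of n] e(2) by (intro test_fun_mono[OF psi(1)]) blast
  show "\<bar>psi n x\<bar> <= indicator (thicken e K) x" for n x
   using psi(2,3)[of n x] outside[of x n] W_subset[of n] by (auto simp: indicator_def)
  show "(%n. psi n x) \<longlonglongrightarrow> indicator K x" for x
  proof (cases "x \<in> K")
   case False
   have "open (- K)" "x \<in> - K" using False compact_imp_closed[OF K] by auto
   then obtain r where r: "r > 0" "ball x r \<subseteq> - K" using open_contains_ball by metis
   have "\<forall>\<^sub>F n in sequentially. step n < r / e" using r e by (intro eventually_step_less) simp
   then have "\<forall>\<^sub>F n in sequentially. psi n x = indicator K x"
   proof eventually_elim
    case (elim n)
    then have "e * step n < r" using e by (simp add: field_simps)
    then have "x \<notin> W n" using r(2) by (force simp: W_def dist_commute subset_eq)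
    then show ?case using outside False by simp
   qed
   then show ?thesis by (rule tendsto_eventually)
  qed (use psi(4) in simp)
 qed (use compact_thicken[OF K] e(2) in auto)
qed

lemma AE_eq_0_if_compact_integrals_0:
 fixes h :: "real^'n => real"
 assumes U: "open U" and h: "locally_integrable U h"
  and vanish: "!!K. compact K ==> K \<subseteq> U ==> (LINT x:K|lborel. h x) = 0"
 shows "AE x\<in>U in lborel. h x = 0"
proof -
 have pos: "AE x\<in>U in lborel. \<not> 0 < g x"
  if g: "locally_integrable U g" "!!K. compact K ==> K \<subseteq> U ==> (LINT x:K|lborel. g x) = 0" for g
 proof -
  note [measurable] = locally_integrable_measurable[OF g(1)]
  have [measurable]: "U \<in> sets borel" using U by simp
  have "{x \<in> U. 0 < g x} \<in> sets lebesgue" by (intro sets_completionI_sets) measurable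
  then obtain C T where C: "fsigma C" "T \<in> null_sets lebesgue" "C \<union> T = {x \<in> U. 0 < g x}"
   by (rule lebesgue_set_almost_fsigma)
  then obtain F :: "nat => _" where "range F \<subseteq> Collect compact" and F_Union: "C = \<Union>(range F)"
   unfolding fsigma_Union_compact by blast
  then have F: "compact (F n)" for n by blast
  have "AE x in lborel. x \<notin> F n" for n
  proof -
   have sub: "F n \<subseteq> {x \<in> U. 0 < g x}" using C(3) F_Union by blast
   then have int: "integrable lborel (%x. indicator (F n) x *\<^sub>R g x)"
    using locally_integrableD[OF g(1) F[of n]] by (auto simp: set_integrable_def)
   have "(LBINT x. indicator (F n) x *\<^sub>R g x) = 0"
    using g(2)[OF F[of n]] sub by (auto simp: set_lebesgue_integral_def)
   moreover have "0 <= indicator (F n) x *\<^sub>R g x" for x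
    using sub by (auto simp: indicator_def)
   ultimately have "AE x in lborel. indicator (F n) x *\<^sub>R g x = 0"
    using integral_nonneg_eq_0_iff_AE[OF int] by simp
   then show ?thesis by eventually_elim (use sub in \<open>auto simp: indicator_def split:
     if_splits\<close>)
  qed
  then have "AE x in lborel. \<forall>n. x \<notin> F n" unfolding AE_all_countable by blast
  moreover have "AE x in lborel. x \<notin> T"
   using AE_not_in[OF C(2)] by (simp add: AE_completion_iff)
  ultimately show ?thesis by eventually_elim (use C(3) F_Union in blast)
 qed
 have "locally_integrable U (%x. - h x)"
  using h by (auto simp: locally_integrable_def set_integrable_def)
 moreover have "(LINT x:K|lborel. - h x) = 0" if "compact K" "K \<subseteq> U" for K
  using vanish[OF that] by (simp add: set_lebesgue_integral_def)
 ultimately show ?thesis using pos[OF h vanish] pos[of "%x. - h x"] by (auto simp: antisym_conv1)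
qed

theorem fundamental_lemma:
 fixes h :: "real^'n => real"
 assumes U: "open U" and h: "locally_integrable U h"
  and vanish: "!!phi. phi \<in> test_fun U ==> (LBINT x. h x * phi x) = 0"
 shows "AE x\<in>U in lborel. h x = 0"
proof (rule AE_eq_0_if_compact_integrals_0[OF U h])
 fix K assume K: "compact K" "K \<subseteq> U"
 note [measurable] = locally_integrable_measurable[OF h]
 obtain psi K' where psi: "!!n::nat. psi n \<in> test_fun U" "compact K'" "K' \<subseteq> U"
  "!!n x. \<bar>psi n x\<bar> <= indicator K' x" "!!x. (%n. psi n x) \<longlonglongrightarrow> indicator K x"
  by (rule cutoff_tendsto_indicator[OF K(1) U K(2)]) blast
 have [measurable]: "psi n \<in> borel_measurable borel" for n
  using psi(1)[of n] by (auto elim!: test_funE intro: C1c_measurable)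
 have [measurable]: "K \<in> sets borel" using K by (simp add: borel_compact)
 have "(%n. LBINT x. h x * psi n x) \<longlonglongrightarrow> (LBINT x. h x * indicator K x)"
 proof (rule integral_dominated_convergence[where w = "%x. \<bar>indicator K' x *\<^sub>R h x\<bar>"])
  show "integrable lborel (%x. \<bar>indicator K' x *\<^sub>R h x\<bar>)"
   using locally_integrableD[OF h psi(2,3)] by (simp add: set_integrable_def)
  have "norm (h x * psi n x) <= \<bar>indicator K' x *\<^sub>R h x\<bar>" for n x
   using mult_left_mono[OF psi(4)[of n x], of "\<bar>h x\<bar>"] by (simp add: abs_mult mult.commute)
  then show "AE x in lborel. norm (h x * psi n x) <= \<bar>indicator K' x *\<^sub>R h x\<bar>" for n by simp
  show "AE x in lborel. (%n. h x * psi n x) \<longlonglongrightarrow> h x * indicator K x"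
   by (intro AE_I2 tendsto_intros psi(5))
 qed measurable
 moreover have "(LBINT x. h x * psi n x) = 0" for n by (rule vanish[OF psi(1)])
 ultimately show "(LINT x:K|lborel. h x) = 0"
  by (simp add: set_lebesgue_integral_def LIMSEQ_const_iff mult.commute)
qed

subsection \<open>Weak derivatives of Borel functions\<close>

definition wderiv :: "(real^'n) set => 'n => (real^'n => real) => (real^'n => real) => bool" where
 "wderiv U i g h \<longleftrightarrow> locally_integrable U g \<and> locally_integrable U h \<and>
   (\<forall>phi\<in>test_fun U. (LBINT x. g x * pderiv_at i phi x) = - (LBINT x. h x * phi x))"

lemma wderivD:
 assumes "wderiv U i g h"
 shows "locally_integrable U g" "locally_integrable U h"
  "g \<in> borel_measurable borel" "h \<in> borel_measurable borel"
  "phi \<in> test_fun U ==> (LBINT x. g x * pderiv_at i phi x) = - (LBINT x. h x * phi x)"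
 using assms by (auto simp: wderiv_def locally_integrable_def)

lemma wderiv_mono: "wderiv U i g h ==> V \<subseteq> U ==> wderiv V i g h"
 unfolding wderiv_def using locally_integrable_mono test_fun_mono by blast

lemma wderiv_cong:
 assumes w: "wderiv U j v g" and m: "v' \<in> borel_measurable borel" "g' \<in> borel_measurable borel"
  and ae: "AE x\<in>U in lborel. v x = v' x" "AE x\<in>U in lborel. g x = g' x"
 shows "wderiv U j v' g'"
 unfolding wderiv_def
proof (intro conjI ballI)
 fix phi assume phi: "phi \<in> test_fun U"
 obtain S where S: "C1c S phi" "S \<subseteq> U" by (rule test_funE[OF phi]) blast
 note [measurable] = m wderivD(3,4)[OF w] C1c_measurable[OF S(1)] C1c_measurable_pderiv[OF S(1)]
 have "AE x in lborel. v x * pderiv_at j phi x = v' x * pderiv_at j phi x"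
  using ae(1) by eventually_elim (use S(2) C1c_pderiv_0[OF S(1)] in fastforce)
 then have "(LBINT x. v' x * pderiv_at j phi x) = (LBINT x. v x * pderiv_at j phi x)"
  by (intro integral_cong_AE) (auto elim: eventually_mono)
 moreover have "AE x in lborel. g x * phi x = g' x * phi x"
  using ae(2) by eventually_elim (use S(2) C1c_zero[OF S(1)] in fastforce)
 then have "(LBINT x. g' x * phi x) = (LBINT x. g x * phi x)"
  by (intro integral_cong_AE) (auto elim: eventually_mono)
 ultimately show "(LBINT x. v' x * pderiv_at j phi x) = - (LBINT x. g' x * phi x)"
  using wderivD(5)[OF w phi] by simp
qed (use locally_integrable_cong_AE[OF wderivD(1)[OF w] m(1) ae(1)]
  locally_integrable_cong_AE[OF wderivD(2)[OF w] m(2) ae(2)] in auto)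

lemma wderiv_unique:
 assumes U: "open U" and w: "wderiv U i g h" "wderiv U i g' h'"
  and ae: "AE x\<in>U in lborel. g x = g' x"
 shows "AE x\<in>U in lborel. h x = h' x"
proof -
 have w': "wderiv U i g' h" by (rule wderiv_cong[OF w(1) wderivD(3)[OF w(2)] wderivD(4)[OF w(1)]
   ae]) simp
 have "AE x\<in>U in lborel. h x - h' x = 0"
 proof (rule fundamental_lemma[OF U locally_integrable_diff[OF wderivD(2)[OF w(1)] wderivD(2)[OF
   w(2)]]])
  fix phi assume phi: "phi \<in> test_fun U"
  obtain S where S: "C1c S phi" "S \<subseteq> U" by (rule test_funE[OF phi]) blast
  show "(LBINT x. (h x - h' x) * phi x) = 0"
   using wderivD(5)[OF w' phi] wderivD(5)[OF w(2) phi]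
    locally_integrable_mult_C1c(1)[OF wderivD(2)[OF w'] S]
    locally_integrable_mult_C1c(1)[OF wderivD(2)[OF w(2)] S]
   by (simp add: left_diff_distrib)
 qed
 then show ?thesis by eventually_elim simp
qed

lemma wderiv_C1:
 fixes g :: "real^'n => real"
 assumes U: "open U" and g: "!!x. x \<in> U ==> g differentiable (at x)" "continuous_on U (grad g)"
 shows "wderiv U i (%x. indicator U x * g x) (%x. indicator U x * pderiv_at i g x)"
 unfolding wderiv_def
proof (intro conjI ballI)
 have cont: "continuous_on U g" "continuous_on U (pderiv_at i g)"
  using g continuous_on_grad_iff by (blast intro: differentiable_imp_continuous_on)+
 have loc: "locally_integrable U (%x. indicator U x * k x)"
  if "continuous_on U k" for k :: "real^'n => real"
 proof (rule locally_integrable_continuous)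
  show "(%x. indicator U x * k x) \<in> borel_measurable borel"
   using borel_measurable_continuous_on_indicator[OF _ that] U by simp
  show "continuous_on U (%x. indicator U x * k x)"
   using that by (rule continuous_on_eq) simp
 qed
 show l: "locally_integrable U (%x. indicator U x * g x)"
  "locally_integrable U (%x. indicator U x * pderiv_at i g x)" by (intro loc cont)+
 fix phi assume "phi \<in> test_fun U"
 then obtain S where S: "C1c S phi" "S \<subseteq> U" by (rule test_funE)
 have "pderiv_at i (%x. g x * phi x) = (%x. g x * pderiv_at i phi x + phi x * pderiv_at i g x)"
  by (intro ext C1c_mult(2)[OF U S(2) g S(1)])
 then have "0 = (LBINT x. g x * pderiv_at i phi x + phi x * pderiv_at i g x)"
  using C1c_integral_pderiv[OF C1c_mult(1)[OF U S(2) g S(1)], of i] by simp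
 also have "... = (LBINT x. (indicator U x * g x) * pderiv_at i phi x
   + (indicator U x * pderiv_at i g x) * phi x)"
  using S(2) C1c_zero[OF S(1)] C1c_pderiv_0[OF S(1)]
  by (intro Bochner_Integration.integral_cong refl) (auto simp: indicator_def mult.commute
    subset_eq)
 finally show "(LBINT x. (indicator U x * g x) * pderiv_at i phi x)
   = - (LBINT x. (indicator U x * pderiv_at i g x) * phi x)"
  using locally_integrable_mult_C1c(2)[OF l(1) S, of i] locally_integrable_mult_C1c(1)[OF l(2)
    S]
  by simp
qed

lemma Lp_loc_1_borel:
 fixes g :: "real^'n => real"
 assumes U: "open U" and g: "g \<in> Lp_loc 1 U"
 obtains g' where "locally_integrable U g'" "AE x\<in>U in lborel. g x = g' x"
  "(%x. indicator U x * g x) \<in> borel_measurable lebesgue"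
proof -
 obtain C :: "nat => (real^'n) set" where C: "!!n. compact (C n)" "!!n. C n \<subseteq> U"
  "!!K. compact K ==> K \<subseteq> U ==> \<exists>N. \<forall>n\<ge>N. K \<subseteq> C n"
  by (rule open_Union_compact_subsets[OF U]) blast
 have gK: "set_borel_measurable lebesgue K g \<and> (%x. \<bar>g x\<bar> powr 1) absolutely_integrable_on K"
  if "compact K" "K \<subseteq> U" for K
  using g that by (auto simp: Lp_loc_def Lp_on_def)
 have meas: "(%x. indicator U x * g x) \<in> borel_measurable lebesgue"
 proof (rule borel_measurable_LIMSEQ_real)
  show "(%n. indicator (C n) x *\<^sub>R g x) \<longlonglongrightarrow> indicator U x * g x" for x
  proof (cases "x \<in> U")
   case True
   then obtain N where "\<forall>n\<ge>N. x \<in> C n" using C(3)[of "{x}"] by auto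
   then have "\<forall>\<^sub>F n in sequentially. indicator (C n) x *\<^sub>R g x = indicator U x * g x"
    using True by (intro eventually_sequentiallyI[of N]) auto
   then show ?thesis by (rule tendsto_eventually)
  next
   case False
   then have "x \<notin> C n" for n using C(2) by blast
   then show ?thesis using False by simp
  qed
  show "(%x. indicator (C n) x *\<^sub>R g x) \<in> borel_measurable lebesgue" for n
   using gK[OF C(1,2)] by (simp add: set_borel_measurable_def)
 qed
 then obtain g' where g': "g' \<in> borel_measurable lborel" "AE x in lborel. indicator U x * g x = g' x"
  using completion_ex_borel_measurable_real by blast
 have g'_borel[measurable]: "g' \<in> borel_measurable borel" using g' by simp
 have "set_integrable lborel K g'" if K: "compact K" "K \<subseteq> U" for K
 proof -
  have [measurable]: "K \<in> sets borel" using K by (simp add: borel_compact)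
  have "integrable lebesgue (%x. indicator K x *\<^sub>R \<bar>g x\<bar>)"
   using gK[OF K] by (simp add: set_integrable_def)
  then have "integrable lebesgue (%x. indicator K x *\<^sub>R \<bar>g' x\<bar>)"
  proof (rule integrable_cong_AE_imp)
   show "(%x. indicator K x *\<^sub>R \<bar>g' x\<bar>) \<in> borel_measurable lebesgue"
    by (intro measurable_completion) measurable
   show "AE x in lebesgue. indicator K x *\<^sub>R \<bar>g x\<bar> = indicator K x *\<^sub>R \<bar>g' x\<bar>"
    unfolding AE_completion_iff using g'(2)
    by eventually_elim (use K in \<open>auto simp: indicator_def\<close>)
  qed
  then have "integrable lborel (%x. indicator K x *\<^sub>R \<bar>g' x\<bar>)"
   by (subst (asm) integrable_completion) auto
  then show ?thesis unfolding set_integrable_def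
   by (rule Bochner_Integration.integrable_bound) (auto simp: abs_mult)
 qed
 moreover have "AE x\<in>U in lborel. g x = g' x"
  using g'(2) by eventually_elim (auto simp: indicator_def)
 ultimately show ?thesis using meas by (intro that[of g']) (auto simp: locally_integrable_def)
qed

lemma LINT_eq_LBINT:
 fixes f g :: "real^'n => real"
 assumes f: "(%x. indicator U x * f x) \<in> borel_measurable lebesgue"
  and g: "g \<in> borel_measurable borel" and ae: "AE x\<in>U in lborel. f x = g x"
  and g0: "!!x. x \<notin> U ==> g x = 0"
 shows "(LINT x:U|lebesgue. f x) = (LBINT x. g x)"
proof -
 have "AE x in lebesgue. indicator U x *\<^sub>R f x = g x"
  unfolding AE_completion_iff using ae by eventually_elim (use g0 in \<open>auto simp: indicator_def\<close>)
 then have "(LINT x:U|lebesgue. f x) = (\<integral>x. g x \<partial>lebesgue)"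
  unfolding set_lebesgue_integral_def
  using f g by (intro integral_cong_AE) (auto intro: measurable_completion)
 then show ?thesis using g by (simp add: integral_completion)
qed

lemma weak_pderiv_imp_wderiv:
 fixes g h :: "real^'n => real"
 assumes U: "open U" and w: "weak_pderiv U i g h"
 obtains g' h' where "wderiv U i g' h'" "AE x\<in>U in lborel. g x = g' x \<and> h x = h' x"
proof -
 obtain g' where g': "locally_integrable U g'" "AE x\<in>U in lborel. g x = g' x"
  "(%x. indicator U x * g x) \<in> borel_measurable lebesgue"
  using Lp_loc_1_borel[OF U, of g] w by (auto simp: weak_pderiv_def)
 obtain h' where h': "locally_integrable U h'" "AE x\<in>U in lborel. h x = h' x"
  "(%x. indicator U x * h x) \<in> borel_measurable lebesgue"
  using Lp_loc_1_borel[OF U, of h] w by (auto simp: weak_pderiv_def)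
 note [measurable] = locally_integrable_measurable[OF g'(1)] locally_integrable_measurable[OF
   h'(1)]
 have "wderiv U i g' h'"
  unfolding wderiv_def
 proof (intro conjI ballI g' h')
  fix phi assume phi: "phi \<in> test_fun U"
  obtain S where S: "C1c S phi" "S \<subseteq> U" using phi by (rule test_funE)
  note [measurable] = C1c_measurable[OF S(1)] C1c_measurable_pderiv[OF S(1)]
  have phi_lebesgue: "phi \<in> borel_measurable lebesgue" "pderiv_at i phi \<in> borel_measurable lebesgue"
   by (intro measurable_completion; measurable)+
  have "(LINT x:U|lebesgue. g x * pderiv_at i phi x) = (LBINT x. g' x * pderiv_at i phi x)"
   using g'(2,3) S C1c_pderiv_0[OF S(1)]
   by (intro LINT_eq_LBINT)
    (auto simp: mult.assoc[symmetric] intro!: borel_measurable_times phi_lebesgue elim: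
      eventually_mono)
  moreover have "(LINT x:U|lebesgue. h x * phi x) = (LBINT x. h' x * phi x)"
   using h'(2,3) S C1c_zero[OF S(1)]
   by (intro LINT_eq_LBINT)
    (auto simp: mult.assoc[symmetric] intro!: borel_measurable_times phi_lebesgue elim:
      eventually_mono)
  ultimately show "(LBINT x. g' x * pderiv_at i phi x) = - (LBINT x. h' x * phi x)"
   using w phi by (simp add: weak_pderiv_def)
 qed
 moreover have "AE x\<in>U in lborel. g x = g' x \<and> h x = h' x"
  using g'(2) h'(2) by eventually_elim auto
 ultimately show ?thesis by (rule that)
qed

lemma Lp_on_borelI:
 fixes g g' :: "real^'n => real"
 assumes K: "K \<in> sets borel" and g': "g' \<in> borel_measurable borel"
  and eq: "!!x. x \<in> K ==> g x = g' x" and int: "integrable lborel (%x. indicator K x * \<bar>g' x\<bar> powr s)"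
 shows "g \<in> Lp_on s K"
proof -
 note [measurable] = K g'
 have *: "(%x. indicator K x *\<^sub>R g x) = (%x. indicator K x * g' x)"
  "(%x. indicator K x *\<^sub>R \<bar>g x\<bar> powr s) = (%x. indicator K x * \<bar>g' x\<bar> powr s)"
  using eq by (auto simp: indicator_def)
 show ?thesis
  unfolding Lp_on_def set_borel_measurable_def set_integrable_def mem_Collect_eq *
  using int by (auto intro!: measurable_completion simp: integrable_completion)
qed

lemma Lp_loc_1I:
 assumes "locally_integrable U g'" "!!x. x \<in> U ==> g x = g' x"
 shows "g \<in> Lp_loc 1 U"
 unfolding Lp_loc_def
proof (intro CollectI allI impI)
 fix K assume K: "compact K \<and> K \<subseteq> U"
 show "g \<in> Lp_on 1 K"
 proof (rule Lp_on_borelI[OF _ locally_integrable_measurable[OF assms(1)]])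
  show "integrable lborel (%x. indicator K x * \<bar>g' x\<bar> powr 1)"
   using integrable_abs[OF locally_integrableD[OF assms(1), unfolded set_integrable_def, of K]]
     K
   by (simp add: abs_mult)
 qed (use K assms(2) in \<open>auto simp: borel_compact\<close>)
qed

lemma wderiv_imp_weak_pderiv:
 assumes w: "wderiv U i g' h'" and U: "open U"
  and eq: "!!x. x \<in> U ==> g x = g' x" "!!x. x \<in> U ==> h x = h' x"
 shows "weak_pderiv U i g h"
 unfolding weak_pderiv_def
proof (intro conjI ballI)
 show "g \<in> Lp_loc 1 U" "h \<in> Lp_loc 1 U"
  using Lp_loc_1I[OF wderivD(1)[OF w] eq(1)] Lp_loc_1I[OF wderivD(2)[OF w] eq(2)] by auto
 fix phi assume phi: "phi \<in> test_fun U"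
 obtain S where S: "C1c S phi" "S \<subseteq> U" using phi by (rule test_funE)
 have [measurable]: "U \<in> sets borel" using U by simp
 note [measurable] = wderivD(3,4)[OF w] C1c_measurable[OF S(1)] C1c_measurable_pderiv[OF S(1)]
 have LINT: "(LINT x:U|lebesgue. f x) = (LBINT x. k x)"
  if [measurable]: "k \<in> borel_measurable borel" and k: "!!x. x \<in> U ==> f x = k x" "!!x. x \<notin> U ==> k x
    = 0"
  for f k :: "_ => real"
 proof (rule LINT_eq_LBINT)
  have "(%x. indicator U x * f x) = (%x. indicator U x * k x)" using k
   by (auto simp: indicator_def)
  then show "(%x. indicator U x * f x) \<in> borel_measurable lebesgue"
   by (auto intro!: measurable_completion)
 qed (use k in auto)
 have "(LINT x:U|lebesgue. g x * pderiv_at i phi x) = (LBINT x. g' x * pderiv_at i phi x)"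
  by (rule LINT) (use S C1c_pderiv_0[OF S(1)] eq in auto)
 moreover have "(LINT x:U|lebesgue. h x * phi x) = (LBINT x. h' x * phi x)"
  by (rule LINT) (use S C1c_zero[OF S(1)] eq in auto)
 ultimately show "(LINT x:U|lebesgue. g x * pderiv_at i phi x) = - (LINT x:U|lebesgue. h x * phi x)"
  using wderivD(5)[OF w phi] by simp
qed

subsection \<open>Continuous functions with integrable weak gradient\<close>

text \<open>The test functions to which a weak equation with continuous coefficients extends.\<close>
definition W11c :: "(real^'n) set => (real^'n => real) => (real^'n => real^'n) => bool" where
 "W11c S phi \<Phi> \<longleftrightarrow> compact S \<and> continuous_on UNIV phi \<and> integrable lborel \<Phi> \<and>
   (\<forall>x. x \<notin> S --> phi x = 0 \<and> \<Phi> x = 0) \<and>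
   (\<forall>T \<zeta> i. C1c T \<zeta> --> (LBINT x. phi x * pderiv_at i \<zeta> x) = - (LBINT x. \<Phi> x $ i * \<zeta> x))"

lemma W11cD:
 assumes "W11c S phi \<Phi>"
 shows "compact S" "continuous_on A phi" "integrable lborel \<Phi>"
  "x \<notin> S ==> phi x = 0" "x \<notin> S ==> \<Phi> x = 0"
  "phi \<in> borel_measurable borel" "\<Phi> \<in> borel_measurable borel"
  "C1c T \<zeta> ==> (LBINT x. phi x * pderiv_at i \<zeta> x) = - (LBINT x. \<Phi> x $ i * \<zeta> x)"
 using assms
 by (auto simp: W11c_def intro: continuous_on_subset borel_measurable_continuous_onI
   dest: borel_measurable_integrable)

lemma integrable_vec_nth:
 fixes F :: "'a => real^'n"
 assumes "integrable M F"
 shows "integrable M (%x. F x $ i)"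
 using integrable_inner_left[OF assms, of "axis i 1"] by (simp add: inner_axis)

lemma C1c_imp_W11c:
 fixes phi :: "real^'n => real"
 assumes "C1c S phi"
 shows "W11c S phi (grad phi)"
 unfolding W11c_def
proof (intro conjI allI impI)
 fix T i and \<zeta> :: "real^'n => real" assume \<zeta>: "C1c T \<zeta>"
 note prod = C1c_mult[OF open_UNIV subset_UNIV C1c_differentiable[OF assms]
   C1c_continuous_grad[OF assms] \<zeta>]
 have int: "integrable lborel (%x. phi x * pderiv_at i \<zeta> x)" "integrable lborel (%x. pderiv_at i phi x
   * \<zeta> x)"
  by (rule C1c_integrable_mult[OF \<zeta> set_integrable_continuous[OF C1c_compact[OF \<zeta>]]];
    intro C1c_continuous[OF assms] C1c_continuous_pderiv[OF assms])+
 have "pderiv_at i (%x. phi x * \<zeta> x) = (%x. phi x * pderiv_at i \<zeta> x + pderiv_at i phi x * \<zeta> x)"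
  unfolding prod(2)[abs_def] by (simp add: mult.commute)
 then show "(LBINT x. phi x * pderiv_at i \<zeta> x) = - (LBINT x. grad phi x $ i * \<zeta> x)"
  using C1c_integral_pderiv[OF prod(1), of i] int by simp
qed (use C1c_compact[OF assms] C1c_continuous[OF assms] C1c_integrable(3)[OF assms]
  C1c_zero[OF assms] C1c_grad_0[OF assms] in auto)

lemma W11c_translate:
 fixes phi :: "real^'n => real"
 assumes W: "W11c S phi \<Phi>"
 shows "W11c ((%x. x + c) ` S) (%x. phi (x - c)) (%x. \<Phi> (x - c))"
 unfolding W11c_def
proof (intro conjI allI impI)
 note [measurable] = W11cD(6,7)[OF W] borel_measurable_vec_nth[OF W11cD(7)[OF W]]
 show "compact ((%x. x + c) ` S)"
  by (intro compact_continuous_image continuous_intros W11cD(1)[OF W])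
 show "continuous_on UNIV (%x. phi (x - c))"
  by (intro continuous_on_compose2[OF W11cD(2)[OF W, of UNIV]] continuous_intros) auto
 show "integrable lborel (%x. \<Phi> (x - c))"
  using lborel_integrable_shift[OF W11cD(3)[OF W], of "- c"] by simp
 have "x - c \<notin> S" if "x \<notin> (%x. x + c) ` S" for x
  using that by (metis diff_add_cancel image_eqI)
 then show "phi (x - c) = 0" "\<Phi> (x - c) = 0" if "x \<notin> (%x. x + c) ` S" for x
  using that W11cD(4,5)[OF W] by auto
 fix T i and \<zeta> :: "real^'n => real" assume \<zeta>: "C1c T \<zeta>"
 note shift = C1c_translate[OF \<zeta>, of "- c", simplified]
 have "pderiv_at i (%x. \<zeta> (x + c)) x = pderiv_at i \<zeta> (x + c)" for x
  using arg_cong[OF shift(2), of "%v. v $ i"] by simp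
 then have "(LBINT x. phi x * pderiv_at i \<zeta> (x + c)) = - (LBINT x. \<Phi> x $ i * \<zeta> (x + c))"
  using W11cD(8)[OF W shift(1), of i] by simp
 then show "(LBINT x. phi (x - c) * pderiv_at i \<zeta> x) = - (LBINT x. \<Phi> (x - c) $ i * \<zeta> x)"
  using lborel_integral_shift[of "%x. phi (x - c) * pderiv_at i \<zeta> x" c]
   lborel_integral_shift[of "%x. \<Phi> (x - c) $ i * \<zeta> x" c]
   C1c_measurable[OF \<zeta>] C1c_measurable_pderiv[OF \<zeta>, of i] by simp
qed

lemma mollify_measurable:
 fixes phi :: "real^'n => real"
 assumes [measurable]: "phi \<in> borel_measurable borel" and "0 < d"
 shows "mollify d phi \<in> borel_measurable borel"
proof -
 have [measurable]: "mollifier d \<in> borel_measurable (borel :: (real^'n) measure)"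
  using assms(2) by (intro C1c_measurable[OF mollifier_C1c]) simp
 show ?thesis unfolding mollify_def conv_along_def[abs_def] by measurable
qed

lemma (in pair_sigma_finite) integrable_product_mult:
 fixes f :: "'a => real" and g :: "'b => real"
 assumes "integrable M1 f" "integrable M2 g"
 shows "integrable (M1 \<Otimes>\<^sub>M M2) (%(x, y). f x * g y)"
proof (rule Fubini_integrable)
 note [measurable] = borel_measurable_integrable[OF assms(1)] borel_measurable_integrable[OF
   assms(2)]
 show "(%(x, y). f x * g y) \<in> borel_measurable (M1 \<Otimes>\<^sub>M M2)" by measurable
 have "integrable M1 (%x. \<bar>f x\<bar> * (\<integral>y. \<bar>g y\<bar> \<partial>M2))" using assms(1) by simp
 then show "integrable M1 (%x. \<integral>y. norm (case (x, y) of (x, y) => f x * g y) \<partial>M2)"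
  by (simp add: abs_mult)
qed (use assms(2) in simp)

lemma mollify_adjoint:
 fixes q f :: "real^'n => real"
 assumes f: "integrable lborel f" "!!x. x \<notin> S ==> f x = 0" and S: "compact S" and d: "d > 0"
  and q: "q \<in> borel_measurable borel" "!!x. x \<in> thicken d S ==> \<bar>q x\<bar> <= C"
 shows "(LBINT x. q x * mollify d f x) = (LBINT y. mollify d q y * f y)"
proof -
 let ?eta = "mollifier d :: real^'n => real" and ?K = "thicken d S"
 define F where "F x y = q x * (f y * ?eta (x - y))" for x y
 have eta: "C1c (cball 0 d) ?eta" using d by (intro mollifier_C1c) simp
 have [measurable]: "q \<in> borel_measurable borel" "f \<in> borel_measurable borel"
  "?eta \<in> borel_measurable borel" "?K \<in> sets borel"
  using q(1) borel_measurable_integrable[OF f(1)] C1c_measurable[OF eta] compact_thicken[OF S]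
  by (auto simp: borel_compact)
 obtain Ceta where Ceta: "!!x. \<bar>?eta x\<bar> <= Ceta" using C1c_bounded[OF eta] by metis
 have "integrable (lborel \<Otimes>\<^sub>M lborel) (%(x, y). (C * Ceta * indicator ?K x) * f y)"
  by (intro lborel_pair.integrable_product_mult integrable_mult_right
    integrable_indicator_compact
    compact_thicken S f(1))
 then have "integrable (lborel \<Otimes>\<^sub>M lborel) (%(x, y). F x y)"
 proof (rule Bochner_Integration.integrable_bound)
  have "\<bar>F x y\<bar> <= \<bar>C * Ceta * indicator ?K x * f y\<bar>" for x y
  proof (cases "y \<in> S \<and> norm (x - y) <= d")
   case True
   then have x: "x \<in> ?K" by (auto intro: thickenI)
   have "\<bar>q x\<bar> * \<bar>?eta (x - y)\<bar> <= \<bar>C\<bar> * \<bar>Ceta\<bar>"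
    using q(2)[OF x] Ceta[of "x - y"] by (intro mult_mono) auto
   from mult_left_mono[OF this, of "\<bar>f y\<bar>"] x show ?thesis
    by (simp add: F_def abs_mult mult_ac)
  next
   case False
   then show ?thesis using f(2)[of y] mollifier_eq_0[of d "x - y"] d by (auto simp: F_def)
  qed
  then show "AE p in lborel \<Otimes>\<^sub>M lborel. norm (case p of (x, y) => F x y)
    <= norm (case p of (x, y) => C * Ceta * indicator ?K x * f y)" by (auto intro!: AE_I2)
 qed (simp add: F_def)
 then have Fubini: "(LBINT y. LBINT x. F x y) = (LBINT x. LBINT y. F x y)"
  by (rule lborel_pair.Fubini_integral)
 have "mollify d f x = (LBINT y. f y * ?eta (x - y))" for x
  by (subst mollify_eq_conv_along) (simp_all add: d conv_along_def)
 moreover have "mollify d q y = (LBINT x. q x * ?eta (x - y))" for y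
  using mollifier_minus[of d "y - _"] by (subst mollify_eq_conv_along) (simp_all add: d
    conv_along_def)
 ultimately show ?thesis using Fubini by (simp add: F_def mult_ac flip: integral_mult_right_zero)
qed

lemma W11c_pderiv_mollify:
 assumes W: "W11c S phi \<Phi>" and d: "d > 0"
 shows "pderiv_at i (mollify d phi) x = mollify d (%x. \<Phi> x $ i) x"
proof -
 let ?eta = "mollifier d"
 have eta: "C1c (cball 0 d) ?eta" using d by (intro mollifier_C1c) simp
 note [measurable] = W11cD(6)[OF W] borel_measurable_vec_nth[OF W11cD(7)[OF W]]
 have int: "integrable lborel phi"
  by (rule integrable_compact_support[OF W11cD(1,2,4)[OF W]])
 have "pderiv_at i (mollify d phi) x = conv_along lborel phi (%y. y) (pderiv_at i ?eta) x"
  using GDERIV_imp_pderiv_at[OF conv_along_GDERIV[OF int _ eta, of "%y. y"], of i x]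
  by (simp add: mollify_eq_conv_along d)
 also have "... = - (LBINT y. phi y * pderiv_at i (%y. ?eta (x - y)) y)"
  using arg_cong[OF C1c_reflect(2)[OF eta, of x], of "%v. v $ i"] by (simp add: conv_along_def)
 also have "... = (LBINT y. \<Phi> y $ i * ?eta (x - y))"
  using W11cD(8)[OF W C1c_reflect(1)[OF eta, of x], of i] by simp
 also have "... = mollify d (%x. \<Phi> x $ i) x"
  by (subst mollify_eq_conv_along) (simp_all add: d conv_along_def)
 finally show ?thesis .
qed

lemma integral_mult_mollify_tendsto:
 fixes q f :: "real^'n => real"
 assumes f: "integrable lborel f" "!!x. x \<notin> S ==> f x = 0" and S: "compact S" "thicken r S \<subseteq> U"
  and q: "q \<in> borel_measurable borel" "continuous_on U q" and U: "open U"
  and d: "!!n. 0 < d n" "!!n. d n <= r" "d \<longlonglongrightarrow> 0"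
 shows "(%n. LBINT x. q x * mollify (d n) f x) \<longlonglongrightarrow> (LBINT x. q x * f x)"
proof -
 have r: "0 <= r" using d(1,2)[of 0] by linarith
 have "bounded (q ` thicken r S)"
  by (intro compact_imp_bounded compact_continuous_image continuous_on_subset[OF q(2)]
    compact_thicken S)
 then obtain C where C: "!!x. x \<in> thicken r S ==> \<bar>q x\<bar> <= C" by (auto simp: bounded_iff)
 have dC: "\<bar>q x\<bar> <= C" if "x \<in> thicken (d n) S" for n x
  using that C thicken_mono[OF d(2)] by blast
 note [measurable] = q(1) borel_measurable_integrable[OF f(1)]
 have "(%n. LBINT y. mollify (d n) q y * f y) \<longlonglongrightarrow> (LBINT y. q y * f y)"
 proof (rule integral_dominated_convergence[where w = "%y. C * \<bar>f y\<bar>"])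
  show "integrable lborel (%y. C * \<bar>f y\<bar>)" using f(1) by simp
  have "(%n. mollify (d n) q y * f y) \<longlonglongrightarrow> q y * f y" for y
  proof (cases "y \<in> S")
   case True
   then have "isCont q y"
    using q(2) U S(2) thicken_superset[OF r, of S]
     by (auto simp: continuous_on_eq_continuous_at)
   then show ?thesis by (intro tendsto_mult_right mollify_tendsto d q(1))
  qed (simp add: f(2))
  then show "AE y in lborel. (%n. mollify (d n) q y * f y) \<longlonglongrightarrow> q y * f y" by simp
  have "norm (mollify (d n) q y * f y) <= C * \<bar>f y\<bar>" for n y
  proof (cases "y \<in> S")
   case True
   have "\<bar>mollify (d n) q y\<bar> <= C"
    by (rule mollify_bound(2)[OF q(1) d(1)]) (auto intro!: dC thickenI[OF True])
   then show ?thesis by (simp add: abs_mult mult_right_mono)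
  qed (simp add: f(2))
  then show "AE y in lborel. norm (mollify (d n) q y * f y) <= C * \<bar>f y\<bar>" for n by simp
  show "(%y. mollify (d n) q y * f y) \<in> borel_measurable lborel" for n
   using mollify_measurable[OF q(1) d(1)] by measurable
 qed measurable
 then show ?thesis
  using mollify_adjoint[OF f S(1) d(1) q(1) dC] by simp
qed

lemma integrable_continuous_mult_compact_support:
 fixes q f :: "real^'n => real"
 assumes q: "q \<in> borel_measurable borel" "continuous_on S q" and S: "compact S"
  and f: "integrable lborel f" "!!x. x \<notin> S ==> f x = 0"
 shows "integrable lborel (%x. q x * f x)"
proof -
 have [measurable]: "S \<in> sets borel" using S by (simp add: borel_compact)
 have "bounded (q ` S)" by (intro compact_imp_bounded compact_continuous_image q S)
 then obtain B where "\<forall>x\<in>S. \<bar>q x\<bar> <= B" by (auto simp: bounded_iff)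
 then have "\<bar>indicator S x * q x\<bar> <= \<bar>B\<bar>" for x by (fastforce simp: indicator_def)
 moreover have "set_integrable lborel S f"
  unfolding set_integrable_def by (rule integrable_mult_indicator[OF _ f(1)]) simp
 moreover have "(%x. indicator S x * q x) \<in> borel_measurable borel" using q(1) by measurable
 ultimately have "integrable lborel (%x. f x * (indicator S x * q x))"
  using S by (intro integrable_mult_compact_support) auto
 moreover have "f x * (indicator S x * q x) = q x * f x" for x using f(2)[of x]
  by (auto simp: indicator_def)
 ultimately show ?thesis by simp
qed

lemma locally_integrable_mult_mollify_tendsto:
 fixes phi :: "real^'n => real"
 assumes q: "locally_integrable U q" and phi: "continuous_on UNIV phi" "!!x. x \<notin> S ==> phi x = 0"
  and S: "compact S" "thicken r S \<subseteq> U" and d: "!!n. 0 < d n" "!!n. d n <= r" "d \<longlonglongrightarrow> 0"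
 shows "(%n. LBINT x. q x * mollify (d n) phi x) \<longlonglongrightarrow> (LBINT x. q x * phi x)"
proof -
 obtain C where C: "!!x. \<bar>phi x\<bar> <= C" using bounded_compact_support[OF S(1) phi]
  by (metis real_norm_def)
 note phi_meas = borel_measurable_continuous_onI[OF phi(1)]
 note [measurable] = phi_meas locally_integrable_measurable[OF q] mollify_measurable[OF phi_meas
   d(1)]
 show ?thesis
 proof (rule integral_dominated_convergence[where w = "%x. C * \<bar>indicator (thicken r S) x *\<^sub>R q x\<bar>"])
  show "integrable lborel (%x. C * \<bar>indicator (thicken r S) x *\<^sub>R q x\<bar>)"
   using locally_integrableD[OF q compact_thicken[OF S(1)] S(2)]
    by (simp add: set_integrable_def)
  have "isCont phi x" for x using phi(1) by (simp add: continuous_on_eq_continuous_at)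
  then show "AE x in lborel. (%n. q x * mollify (d n) phi x) \<longlonglongrightarrow> q x * phi x"
   by (intro AE_I2 tendsto_intros mollify_tendsto d) auto
  have "norm (q x * mollify (d n) phi x) <= C * \<bar>indicator (thicken r S) x *\<^sub>R q x\<bar>" for n x
   using mollify_bound(2)[OF phi_meas d(1), of n x C] C
    mollify_eq_0[of S phi "d n" r x, OF phi(2) d(1,2)]
   by (cases "x \<in> thicken r S") (auto simp: abs_mult mult.commute[of C] intro!: mult_left_mono)
  then show "AE x in lborel. norm (q x * mollify (d n) phi x) <= C * \<bar>indicator (thicken r S) x *\<^sub>R q x\<bar>"
   for n by simp
 qed measurable
qed

theorem weak_equation_extends_to_W11c:
 fixes q :: "real^'n => real^'n"
 assumes U: "open U" and q: "q \<in> borel_measurable borel" "continuous_on U q"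
  and q0: "locally_integrable U q0"
  and eq: "!!\<zeta>. \<zeta> \<in> test_fun U ==> (LBINT x. q x \<bullet> grad \<zeta> x) + (LBINT x. q0 x * \<zeta> x) = 0"
  and W: "W11c S phi \<Phi>" "S \<subseteq> U"
 shows "integrable lborel (%x. q x \<bullet> \<Phi> x)" "integrable lborel (%x. q0 x * phi x)"
  "(LBINT x. q x \<bullet> \<Phi> x) + (LBINT x. q0 x * phi x) = 0"
proof -
 note S = W11cD(1)[OF W(1)]
 obtain r where r: "r > 0" "thicken r S \<subseteq> U" using thicken_subset_open[OF S U W(2)] .
 define d where "d n = r * step n" for n
 have d: "0 < d n" "d n <= r" for n
  using r(1) step_pos[of n] step_le_1[of n] by (auto simp: d_def)
 have d0: "d \<longlonglongrightarrow> 0" unfolding d_def using tendsto_mult_right_zero[OF step_tendsto_0] .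
 obtain C where C: "!!x. \<bar>phi x\<bar> <= C"
  using bounded_compact_support[OF S W11cD(2,4)[OF W(1)]] by (metis real_norm_def)
 note [measurable] = W11cD(6)[OF W(1)]
 have iphi: "integrable lborel phi" by (rule integrable_compact_support[OF S W11cD(2,4)[OF W(1)]])
 have mollify_test: "mollify (d n) phi \<in> test_fun U" for n
  by (rule test_funI[OF mollify_smooth[OF iphi d(1)] compact_thicken[OF S]
     mollify_eq_0[OF W11cD(4)[OF W(1)] d] r(2)])
 have q_nth: "(%x. q x $ i) \<in> borel_measurable borel" "continuous_on U (%x. q x $ i)" for i
  by (intro borel_measurable_vec_nth q continuous_on_component)+
 have q_comp: "integrable lborel (%x. q x $ i * \<Phi> x $ i)" for i
  by (rule integrable_continuous_mult_compact_support[OF q_nth(1) continuous_on_subset[OF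
    q_nth(2) W(2)]
     S integrable_vec_nth[OF W11cD(3)[OF W(1)]]]) (simp add: W11cD(5)[OF W(1)])
 show "integrable lborel (%x. q x \<bullet> \<Phi> x)" unfolding inner_vec_def using q_comp by simp
 show q0phi: "integrable lborel (%x. q0 x * phi x)"
  by (rule integrable_mult_compact_support[OF locally_integrableD[OF q0 S W(2)] S _ C])
   (auto simp: W11cD(4)[OF W(1)])
 have lim: "(%n. LBINT x. q x $ i * mollify (d n) (%x. \<Phi> x $ i) x) \<longlonglongrightarrow> (LBINT x. q x $ i * \<Phi> x $ i)" for i
  by (rule integral_mult_mollify_tendsto[OF integrable_vec_nth[OF W11cD(3)[OF W(1)]] _ S r(2)
     q_nth U d d0]) (simp add: W11cD(5)[OF W(1)])
 have "(LBINT x. q x \<bullet> grad (mollify (d n) phi) x)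
   = (\<Sum>i\<in>UNIV. LBINT x. q x $ i * mollify (d n) (%x. \<Phi> x $ i) x)" for n
 proof -
  obtain T where T: "C1c T (mollify (d n) phi)" "T \<subseteq> U" using mollify_test by (rule test_funE)
  have "integrable lborel (%x. q x $ i * pderiv_at i (mollify (d n) phi) x)" for i
   by (rule locally_integrable_mult_C1c(2)[OF locally_integrable_continuous[OF q_nth] T])
  then show ?thesis
   by (simp add: inner_vec_def W11c_pderiv_mollify[OF W(1) d(1)] del: grad_nth add: grad_nth)
 qed
 then have lim_grad: "(%n. LBINT x. q x \<bullet> grad (mollify (d n) phi) x) \<longlonglongrightarrow> (LBINT x. q x \<bullet> \<Phi> x)"
  using tendsto_sum[of UNIV, OF lim] q_comp by (simp add: inner_vec_def)
 have "(%n. LBINT x. q0 x * mollify (d n) phi x) \<longlonglongrightarrow> (LBINT x. q0 x * phi x)"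
  by (rule locally_integrable_mult_mollify_tendsto[OF q0 W11cD(2,4)[OF W(1)] S r(2) d d0])
 from tendsto_add[OF lim_grad this] show "(LBINT x. q x \<bullet> \<Phi> x) + (LBINT x. q0 x * phi x) = 0"
  using eq[OF mollify_test] by (simp add: LIMSEQ_const_iff)
qed

section \<open>Weak derivatives along lines\<close>

subsection \<open>Differentiation of the indefinite integral\<close>

lemma AE_tendsto_right_average:
 fixes f :: "real => real"
 assumes "!!a b. f integrable_on {a..b}"
 shows "AE t in lborel. ((%h. integral {t..t + h} f / h) \<longlongrightarrow> f t) (at_right 0)"
proof -
 obtain N where N: "negligible N" "!!x e. x \<notin> N ==> 0 < e ==>
   \<exists>d>0. \<forall>h. 0 < h \<and> h < d --> norm (integral (cbox x (x + h *\<^sub>R One)) f /\<^sub>R h ^ DIM(real) - f x) < e"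
  using integrable_ccontinuous_explicit[of f] assms by auto
 have "((%h. integral {t..t + h} f / h) \<longlongrightarrow> f t) (at_right 0)" if "t \<notin> N" for t
 proof (rule tendstoI)
  fix e :: real assume "e > 0"
  from N(2)[OF that this] obtain d where "d > 0"
   "!!h. 0 < h ==> h < d ==> norm (integral (cbox t (t + h *\<^sub>R One)) f /\<^sub>R h ^ DIM(real) - f t) < e"
   by blast
  then have "d > 0" "!!h. 0 < h ==> h < d ==> \<bar>integral {t..t + h} f / h - f t\<bar> < e"
   by (simp_all add: divide_inverse mult.commute)
  then show "\<forall>\<^sub>F h in at_right 0. dist (integral {t..t + h} f / h) (f t) < e"
   unfolding eventually_at_right_field dist_real_def by (intro exI[of _ d]) auto
 qed
 moreover have "AE t in lborel. t \<notin> N"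
  using N(1) AE_not_in[of N lebesgue] by (simp add: negligible_iff_null_sets AE_completion_iff)
 ultimately show ?thesis by (auto elim: eventually_mono)
qed

lemma AE_lborel_uminus:
 assumes "AE t::real in lborel. P t"
 shows "AE t in lborel. P (- t)"
proof -
 have reflect: "distr lborel borel (uminus :: real => real) = lborel"
  using lborel_real_affine[of "-1" 0] by (simp add: density_1)
 have "AE t in distr lborel borel uminus. P (t :: real)" unfolding reflect by (rule assms)
 then show ?thesis by (rule AE_distrD[rotated]) simp
qed

theorem AE_DERIV_integral:
 fixes k :: "real => real"
 assumes k: "k integrable_on {a..b}"
 shows "AE t in lborel. a < t --> t < b --> ((%s. integral {a..s} k) has_real_derivative k t) (at t)"
proof -
 define f where "f t = (if t \<in> {a..b} then k t else 0)" for t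
 have f: "f integrable_on {c..d}" for c d
 proof (rule integrable_on_subinterval)
  show "f integrable_on UNIV" unfolding f_def using k by (simp only: integrable_restrict_UNIV)
 qed simp
 have f_reflect: "(%t. f (- t)) integrable_on {c..d}" for c d
  using f[of "- d" "- c"] Henstock_Kurzweil_Integration.integrable_reflect_real[where f = f and
    a = "- d" and b = "- c"] by simp
 have diff: "integral {a..s} k - integral {a..t} k = integral {t..s} f"
   if "a <= t" "t <= s" "s <= b" for s t
 proof -
  have "integral {a..t} k + integral {t..s} k = integral {a..s} k"
   by (rule Henstock_Kurzweil_Integration.integral_combine)
    (use that k in \<open>auto intro: integrable_on_subinterval\<close>)
  moreover have "integral {t..s} k = integral {t..s} f"
   using that by (intro Henstock_Kurzweil_Integration.integral_cong) (auto simp: f_def)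
  ultimately show ?thesis by simp
 qed
 show ?thesis
  using AE_tendsto_right_average[OF f] AE_lborel_uminus[OF AE_tendsto_right_average[OF
    f_reflect]]
 proof eventually_elim
  case (elim t)
  show ?case
  proof (intro impI)
   assume t: "a < t" "t < b"
   let ?q = "%h. (integral {a..t + h} k - integral {a..t} k) / h"
   have "\<forall>\<^sub>F h in at_right 0. integral {t..t + h} f / h = ?q h"
    unfolding eventually_at_right_field using t diff by (intro exI[of _ "b - t"]) auto
   with elim(1) have "(?q \<longlongrightarrow> f t) (at_right 0)" by (rule Lim_transform_eventually)
   moreover have "\<forall>\<^sub>F h in at_right 0. integral {- t..- t + h} (%t. f (- t)) / h = ?q (- h)"
    unfolding eventually_at_right_field
   proof (intro exI[of _ "t - a"] conjI allI impI)
    fix h assume "0 < h" "h < t - a"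
    then show "integral {- t..- t + h} (%t. f (- t)) / h = ?q (- h)"
     using diff[of "t - h" t] t Henstock_Kurzweil_Integration.integral_reflect_real
       [where a = "t - h" and b = t and f = f] by (simp add: field_simps)
   qed (use t in simp)
   with elim(2) have "((%h. ?q (- h)) \<longlongrightarrow> f t) (at_right 0)"
    by (auto dest: Lim_transform_eventually)
   then have "(?q \<longlongrightarrow> f t) (at_left 0)"
    by (subst filterlim_at_left_to_right[of _ _ 0, simplified])
   ultimately have "(?q \<longlongrightarrow> f t) (at 0)" by (simp add: filterlim_split_at)
   then show "((%s. integral {a..s} k) has_real_derivative k t) (at t)"
    using t by (simp add: DERIV_def f_def)
  qed
 qed
qed

subsection \<open>Almost every line\<close>

lemma AE_lborel_shift:
 fixes P :: "'a::euclidean_space => bool"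
 assumes "AE x in lborel. P x"
 shows "AE x in lborel. P (x + c)"
proof -
 have "AE x in distr lborel borel ((+) c). P x" using assms unfolding lborel_distr_plus .
 then have "AE x in lborel. P (c + x)" by (rule AE_distrD[rotated]) simp
 then show ?thesis by (simp add: add.commute)
qed

lemma AE_lborel_obtain:
 assumes "AE x in lborel. P x" "open S" "S \<noteq> {}"
 obtains x :: "'a::euclidean_space" where "x \<in> S" "P x"
proof -
 obtain N where N: "N \<in> null_sets lborel" "{x. \<not> P x} \<subseteq> N"
  using assms(1) unfolding eventually_ae_filter by auto
 have "\<not> S \<subseteq> N"
 proof
  assume "S \<subseteq> N"
  then have "S \<in> null_sets lborel" using N(1) assms(2) by (auto intro: null_sets_subset)
  then have "negligible S" by (simp add: negligible_iff_null_sets null_sets_completionI)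
  then show False using open_not_negligible[OF assms(2,3)] by blast
 qed
 then show ?thesis using N(2) that by blast
qed

definition segment_interior :: "(real^'n) set => real^'n => real => (real^'n) set" where
 "segment_interior U e b = {x. \<forall>t\<in>{0..b}. x + t *\<^sub>R e \<in> U}"

definition segment_hull :: "(real^'n) set => real^'n => real => (real^'n) set" where
 "segment_hull K e b = (%(x, t). x + t *\<^sub>R e) ` (K \<times> {0..b})"

lemma segment_interiorD: "x \<in> segment_interior U e b ==> 0 <= t ==> t <= b ==> x + t *\<^sub>R e \<in> U"
 by (simp add: segment_interior_def)

lemma segment_interior_antimono: "s <= b ==> segment_interior U e b \<subseteq> segment_interior U e s"
 by (auto simp: segment_interior_def)

lemma segment_hullI: "x \<in> K ==> 0 <= t ==> t <= b ==> x + t *\<^sub>R e \<in> segment_hull K e b"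
 by (force simp: segment_hull_def)

lemma compact_segment_hull: "compact K ==> compact (segment_hull K e b)"
 unfolding segment_hull_def case_prod_beta
 by (intro compact_continuous_image compact_Times compact_Icc) (auto intro!: continuous_intros)

lemma segment_hull_subset: "K \<subseteq> segment_interior U e b ==> segment_hull K e b \<subseteq> U"
 by (auto simp: segment_hull_def segment_interior_def)

lemma open_segment_interior:
 assumes "open U"
 shows "open (segment_interior U e b)"
 unfolding open_contains_ball
proof
 fix x assume "x \<in> segment_interior U e b"
 then have "segment_hull {x} e b \<subseteq> U" by (intro segment_hull_subset) simp
 then obtain d where d: "d > 0" "thicken d (segment_hull {x} e b) \<subseteq> U"
  using thicken_subset_open[OF compact_segment_hull assms] by (metis compact_sing)
 have "y + t *\<^sub>R e \<in> U" if "y \<in> ball x d" "0 <= t" "t <= b" for y t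
  using that by (intro subsetD[OF d(2)] thickenI[OF segment_hullI[of x "{x}"]])
   (auto simp: dist_norm norm_minus_commute)
 then show "\<exists>d>0. ball x d \<subseteq> segment_interior U e b"
  using d(1) by (intro exI[of _ d]) (auto simp: segment_interior_def)
qed

text \<open>Fubini without splitting off a coordinate: each point is reached from the base point of a
 short segment by a translation along \<^term>\<open>e\<close>, which does not depend on the point.\<close>
lemma AE_from_AE_segments:
 fixes U :: "(real^'n) set"
 assumes U: "open U" and N: "N \<in> sets borel" "N \<subseteq> U"
  and ae: "!!b. 0 < b ==> AE x in lborel. x \<in> segment_interior U e b -->
   (AE t in lborel. 0 < t --> t < b --> x + t *\<^sub>R e \<notin> N)"
 shows "AE x in lborel. x \<notin> N"
proof -
 have translate: "\<exists>s. 0 < s \<and> s < b \<and> (AE y in lborel. y - s *\<^sub>R e \<in> segment_interior U e b --> y \<notin> N)"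
  if b: "0 < b" for b
 proof -
  let ?I = "segment_interior U e b"
  have [measurable]: "?I \<in> sets borel" "N \<in> sets borel"
   using open_segment_interior[OF U] N(1) by auto
  have meas: "{p \<in> space (lborel \<Otimes>\<^sub>M lborel). fst p \<in> ?I --> 0 < snd p --> snd p < b -->
    fst p + snd p *\<^sub>R e \<notin> N} \<in> sets (lborel \<Otimes>\<^sub>M lborel)" by measurable
  have "AE x in lborel. AE t in lborel. x \<in> ?I --> 0 < t --> t < b --> x + t *\<^sub>R e \<notin> N"
   using ae[OF b] by (auto elim: eventually_mono)
  then have "AE t in lborel. AE x\<in>?I in lborel. 0 < t --> t < b --> x + t *\<^sub>R e \<notin> N"
   using lborel_pair.AE_commute[OF meas[unfolded case_prod_beta]] by simp
  then obtain s where s: "s \<in> {0<..<b}"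
   "AE x\<in>?I in lborel. 0 < s --> s < b --> x + s *\<^sub>R e \<notin> N"
   by (rule AE_lborel_obtain[of _ "{0<..<b}"]) (use b in auto)
  from AE_lborel_shift[OF s(2), of "- s *\<^sub>R e"]
  have "AE y in lborel. y - s *\<^sub>R e \<in> segment_interior U e b --> y \<notin> N" using s(1) by simp
  with s(1) show ?thesis by (intro exI[of _ s]) simp
 qed
 have "\<exists>s. \<forall>n. 0 < s n \<and> s n < step n \<and>
   (AE y in lborel. y - s n *\<^sub>R e \<in> segment_interior U e (step n) --> y \<notin> N)"
  by (intro choice allI translate step_pos)
 then obtain s where s: "!!n. 0 < s n" "!!n. s n < step n"
  "!!n. AE y in lborel. y - s n *\<^sub>R e \<in> segment_interior U e (step n) --> y \<notin> N" by blast
 have reached: "\<exists>n. y - s n *\<^sub>R e \<in> segment_interior U e (step n)" if y: "y \<in> U" for y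
 proof -
  obtain r where r: "r > 0" "ball y r \<subseteq> U" using U y open_contains_ball by blast
  obtain n where n: "step n < r / (norm e + 1)"
   by (rule step_lessE[of "r / (norm e + 1)"]) (use r in \<open>auto simp: add_nonneg_pos\<close>)
  have "y - s n *\<^sub>R e + t *\<^sub>R e \<in> ball y r" if "0 <= t" "t <= step n" for t
  proof -
   have "\<bar>s n - t\<bar> * norm e <= step n * (norm e + 1)"
    using that s(1,2)[of n] by (intro mult_mono) auto
   also have "... < r" using n by (simp add: pos_less_divide_eq add_nonneg_pos)
   finally show ?thesis by (simp add: dist_norm scaleR_diff_left[symmetric])
  qed
  then have "y - s n *\<^sub>R e \<in> segment_interior U e (step n)"
   using r(2) by (auto simp: segment_interior_def simp del: mem_ball)
  then show ?thesis ..
 qed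
 have "AE y in lborel. \<forall>n. y - s n *\<^sub>R e \<in> segment_interior U e (step n) --> y \<notin> N"
  unfolding AE_all_countable using s(3) by simp
 then show ?thesis
 proof eventually_elim
  case (elim y)
  then show ?case using reached[of y] N(2) by blast
 qed
qed

lemma AE_on_AE_line:
 fixes P :: "'a::euclidean_space => bool"
 assumes ae: "AE x in lborel. P x"
 shows "AE x in lborel. AE t::real in lborel. P (x + t *\<^sub>R e)"
proof -
 obtain N where N: "N \<in> null_sets lborel" "{x. \<not> P x} \<subseteq> N"
  using ae unfolding eventually_ae_filter by auto
 then have [measurable]: "N \<in> sets borel" by auto
 have meas: "{p \<in> space (lborel \<Otimes>\<^sub>M lborel). fst p + (snd p :: real) *\<^sub>R e \<notin> N}
   \<in> sets (lborel \<Otimes>\<^sub>M lborel)" by measurable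
 have "AE x in lborel. x \<notin> N" using N(1) by (rule AE_not_in)
 from AE_lborel_shift[OF this] have "AE t::real in lborel. AE x in lborel. x + t *\<^sub>R e \<notin> N"
  by simp
 then have "AE x in lborel. AE t::real in lborel. x + t *\<^sub>R e \<notin> N"
  using lborel_pair.AE_commute[OF meas] by simp
 then show ?thesis
 proof eventually_elim
  case (elim x)
  then show ?case by eventually_elim (use N(2) in blast)
 qed
qed

subsection \<open>Increments of weakly differentiable functions\<close>

lemma lborel_pair_shear:
 fixes F :: "real => 'a::euclidean_space => real"
 assumes F: "integrable (lborel \<Otimes>\<^sub>M lborel) (%(t, y). F t y)"
 shows "integrable (lborel \<Otimes>\<^sub>M lborel) (%(t, x). F t (x + t *\<^sub>R e))"
  "(LBINT t. LBINT x. F t (x + t *\<^sub>R e)) = (LBINT t. LBINT y. F t y)"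
proof -
 have Fm[measurable]: "(%(t, y). F t y) \<in> borel_measurable (lborel \<Otimes>\<^sub>M lborel)"
  using F by (rule borel_measurable_integrable)
 have F_t[measurable]: "F t \<in> borel_measurable borel" for t
  using measurable_compose[OF measurable_Pair1'[of t lborel lborel] Fm] by simp
 show "(LBINT t. LBINT x. F t (x + t *\<^sub>R e)) = (LBINT t. LBINT y. F t y)"
  by (intro Bochner_Integration.integral_cong refl lborel_integral_shift F_t)
 show "integrable (lborel \<Otimes>\<^sub>M lborel) (%(t, x). F t (x + t *\<^sub>R e))"
 proof (rule lborel_pair.Fubini_integrable)
  have "(%p. case (fst p, snd p + fst p *\<^sub>R e) of (t, y) => F t y)
    \<in> borel_measurable (lborel \<Otimes>\<^sub>M lborel)"
   by (rule measurable_compose[OF _ Fm]) measurable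
  then show "(%(t, x). F t (x + t *\<^sub>R e)) \<in> borel_measurable (lborel \<Otimes>\<^sub>M lborel)"
   by (simp add: case_prod_beta)
  have "(LBINT x. norm (F t (x + t *\<^sub>R e))) = (LBINT y. norm (F t y))" for t
   by (rule lborel_integral_shift[of "%y. norm (F t y)"]) measurable
  then show "integrable lborel (%t. LBINT x. norm (case (t, x) of (t, x) => F t (x + t *\<^sub>R e)))"
   using lborel_pair.integrable_fst'[OF integrable_norm[OF F]] by simp
  have "AE t in lborel. integrable lborel (F t)"
   using lborel_pair.AE_integrable_fst'[OF F] by simp
  then show "AE t in lborel. integrable lborel (%x. case (t, x) of (t, x) => F t (x + t *\<^sub>R e))"
   by eventually_elim (simp add: lborel_integrable_shift)
 qed
qed

definition segment_integral :: "(real^'n => real) => real^'n => real => real^'n => real" where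
 "segment_integral h e b x = (LBINT t. indicator {0..b} t * h (x + t *\<^sub>R e))"

lemma integrable_segment_product:
 assumes h: "locally_integrable U h" and K: "compact K" "K \<subseteq> segment_interior U e b"
 shows "integrable (lborel \<Otimes>\<^sub>M lborel) (%(t, x). indicator K x * (indicator {0..b} t * h (x + t *\<^sub>R e)))"
proof -
 let ?K' = "segment_hull K e b"
 let ?F = "%(t, x). indicator {0..b} t * (indicator ?K' (x + t *\<^sub>R e) * h (x + t *\<^sub>R e))"
 have [measurable]: "K \<in> sets borel" using K by (simp add: borel_compact)
 have [measurable]: "h \<in> borel_measurable borel" using h by (rule locally_integrable_measurable)
 have "integrable lborel (%y. indicator ?K' y * h y)"
  using locally_integrableD[OF h compact_segment_hull segment_hull_subset] K
  by (simp add: set_integrable_def)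
 then have "integrable (lborel \<Otimes>\<^sub>M lborel) ?F"
  using lborel_pair_shear(1)[OF lborel_pair.integrable_product_mult
    [OF integrable_indicator_compact[OF compact_Icc]]] by blast
 then show ?thesis
 proof (rule Bochner_Integration.integrable_bound)
  show "AE p in lborel \<Otimes>\<^sub>M lborel.
    norm (case p of (t, x) => indicator K x * (indicator {0..b} t * h (x + t *\<^sub>R e))) <= norm (?F p)"
   by (auto intro!: AE_I2 simp: indicator_def segment_hullI split: prod.split)
 qed measurable
qed

lemma locally_integrable_segment_integral:
 assumes h: "locally_integrable U h"
 shows "locally_integrable (segment_interior U e b) (segment_integral h e b)"
 unfolding locally_integrable_def
proof (intro conjI allI impI)
 have [measurable]: "h \<in> borel_measurable borel" using h by (rule locally_integrable_measurable)
 show "segment_integral h e b \<in> borel_measurable borel"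
  unfolding segment_integral_def[abs_def] by measurable
 fix K assume K: "compact K \<and> K \<subseteq> segment_interior U e b"
 have "integrable lborel (%x. LBINT t. indicator K x * (indicator {0..b} t * h (x + t *\<^sub>R e)))"
  using lborel_pair.integrable_snd integrable_segment_product[OF h] K by blast
 then show "set_integrable lborel K (segment_integral h e b)"
  by (simp add: segment_integral_def[abs_def] set_integrable_def)
qed

lemma AE_segment_integrable:
 assumes U: "open U" and h: "locally_integrable U h"
 shows "AE x in lborel. x \<in> segment_interior U e b -->
  set_integrable lborel {0..b} (%t. h (x + t *\<^sub>R e))"
proof (rule AE_open_from_compact[OF open_segment_interior[OF U]])
 fix K assume K: "compact K" "K \<subseteq> segment_interior U e b"
 show "AE x\<in>K in lborel. set_integrable lborel {0..b} (%t. h (x + t *\<^sub>R e))"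
  using lborel_pair.AE_integrable_snd[OF integrable_segment_product[OF h K]]
  by eventually_elim (auto simp: set_integrable_def indicator_def)
qed

lemma segment_average_test_fun:
 assumes phi: "phi \<in> test_fun (segment_interior U e b)"
 shows "conv_along lborel (indicator {0..b}) (%t. t *\<^sub>R e) phi \<in> test_fun U"
proof -
 obtain S where S: "C1c S phi" "S \<subseteq> segment_interior U e b" "!!m. Ck_on m UNIV phi"
  using phi by (rule test_funE) blast
 show ?thesis
 proof (rule test_funI[OF _ compact_segment_hull[OF C1c_compact[OF S(1)]] _
   segment_hull_subset[OF S(2)]])
  show "Ck_on m UNIV (conv_along lborel (indicator {0..b}) (%t. t *\<^sub>R e) phi)" for m
   by (rule conv_along_smooth[OF integrable_indicator_compact[OF compact_Icc] _ S(3)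
      C1c_compact[OF S(1)] C1c_zero[OF S(1)]]) measurable
  show "conv_along lborel (indicator {0..b}) (%t. t *\<^sub>R e) phi y = 0" if "y \<notin> segment_hull S e b"
    for y
  proof (rule conv_along_eq_0)
   fix t assume "indicator {0..b} t \<noteq> (0::real)"
   then have "y - t *\<^sub>R e \<notin> S"
    using that segment_hullI[of "y - t *\<^sub>R e" S t b e]
     by (auto simp: indicator_def split: if_splits)
   then show "phi (y - t *\<^sub>R e) = 0" by (rule C1c_zero[OF S(1)])
  qed
 qed
qed

lemma pderiv_segment_average:
 assumes phi: "C1c S phi" and b: "0 < b" and e: "e = axis j 1"
 shows "pderiv_at j (conv_along lborel (indicator {0..b}) (%t. t *\<^sub>R e) phi) y = phi y - phi (y - b *\<^sub>R
   e)"
proof -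
 have "GDERIV (conv_along lborel (indicator {0..b}) (%t. t *\<^sub>R e) phi) y
   :> (\<chi> i. conv_along lborel (indicator {0..b}) (%t. t *\<^sub>R e) (pderiv_at i phi) y)"
  by (rule conv_along_GDERIV[OF integrable_indicator_compact[OF compact_Icc] _ phi]) measurable
 then have "pderiv_at j (conv_along lborel (indicator {0..b}) (%t. t *\<^sub>R e) phi) y
   = (LBINT t. indicator {0..b} t * pderiv_at j phi (y - t *\<^sub>R e))"
  by (simp add: GDERIV_imp_pderiv_at conv_along_def)
 also have "... = (LBINT t. pderiv_at j phi (y - t *\<^sub>R e) * indicator {0..b} t)"
  by (simp add: mult.commute)
 also have "... = - phi (y - b *\<^sub>R e) - - phi (y - 0 *\<^sub>R e)"
 proof (rule integral_FTC_Icc_real)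
  show "((%t. - phi (y - t *\<^sub>R e)) has_real_derivative pderiv_at j phi (y - t *\<^sub>R e)) (at t)" for t
  proof -
   have "((%t. phi (y + t *\<^sub>R (- e))) has_real_derivative - pderiv_at j phi (y - t *\<^sub>R e)) (at t)"
    using GDERIV_line[OF C1c_GDERIV[OF phi], of y "- e" t]
    by (simp add: e inner_axis inner_axis')
   from DERIV_minus[OF this] show ?thesis by simp
  qed
  have "continuous_on UNIV (%t. pderiv_at j phi (y - t *\<^sub>R e))"
   by (intro continuous_on_compose2[OF C1c_continuous_pderiv[OF phi]] continuous_intros) auto
  then show "isCont (%t. pderiv_at j phi (y - t *\<^sub>R e)) t" for t
   by (simp add: continuous_on_eq_continuous_at)
 qed (use b in auto)
 finally show ?thesis by simp
qed

lemma segment_integral_adjoint: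
 assumes h: "locally_integrable U h" and phi: "C1c S phi" "S \<subseteq> segment_interior U e b"
 shows "(LBINT y. h y * conv_along lborel (indicator {0..b}) (%t. t *\<^sub>R e) phi y)
  = (LBINT x. segment_integral h e b x * phi x)"
proof -
 let ?K = "segment_hull S e b"
 define F where "F t y = indicator {0..b} t * (indicator ?K y * h y) * phi (y - t *\<^sub>R e)" for t y
 have [measurable]: "?K \<in> sets borel" "h \<in> borel_measurable borel" "phi \<in> borel_measurable borel"
  using compact_segment_hull[OF C1c_compact[OF phi(1)]] locally_integrable_measurable[OF h]
   C1c_measurable[OF phi(1)] by (auto simp: borel_compact)
 obtain C where C: "!!x. \<bar>phi x\<bar> <= C" using C1c_bounded[OF phi(1)] by metis
 have "integrable lborel (%y. indicator ?K y * h y)"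
  using locally_integrableD[OF h compact_segment_hull[OF C1c_compact[OF phi(1)]]
    segment_hull_subset[OF phi(2)]]
  by (simp add: set_integrable_def)
 from lborel_pair.integrable_product_mult[OF integrable_indicator_compact[OF compact_Icc] this]
 have "integrable (lborel \<Otimes>\<^sub>M lborel) (%(t, y). indicator {0..b::real} t * (indicator ?K y * h y) * C)"
  unfolding case_prod_beta by (rule integrable_mult_left)
 then have F: "integrable (lborel \<Otimes>\<^sub>M lborel) (%(t, y). F t y)"
 proof (rule Bochner_Integration.integrable_bound)
  have "\<bar>F t y\<bar> <= \<bar>indicator {0..b} t * (indicator ?K y * h y) * C\<bar>" for t y
   unfolding F_def abs_mult by (intro mult_left_mono order_trans[OF C abs_ge_self]) simp
  then show "AE p in lborel \<Otimes>\<^sub>M lborel. norm (case p of (t, y) => F t y)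
    <= norm (case p of (t, y) => indicator {0..b} t * (indicator ?K y * h y) * C)"
   by (auto intro!: AE_I2)
 qed (simp add: F_def)
 have "F t y = h y * (indicator {0..b} t * phi (y - t *\<^sub>R e))" for t y
  using segment_hullI[of "y - t *\<^sub>R e" S t b e] C1c_zero[OF phi(1), of "y - t *\<^sub>R e"]
  by (auto simp: F_def indicator_def)
 then have "(LBINT y. h y * conv_along lborel (indicator {0..b}) (%t. t *\<^sub>R e) phi y)
   = (LBINT y. LBINT t. F t y)" by (simp add: conv_along_def)
 also have "... = (LBINT t. LBINT y. F t y)" by (rule lborel_pair.Fubini_integral[OF F])
 also have "... = (LBINT t. LBINT x. F t (x + t *\<^sub>R e))"
  by (rule lborel_pair_shear(2)[OF F, symmetric])
 also have "... = (LBINT x. LBINT t. F t (x + t *\<^sub>R e))"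
  by (rule lborel_pair.Fubini_integral[OF lborel_pair_shear(1)[OF F], symmetric])
 also have "... = (LBINT x. LBINT t. indicator {0..b} t * h (x + t *\<^sub>R e) * phi x)"
  using segment_hullI[of _ S _ b e] C1c_zero[OF phi(1)]
  by (intro Bochner_Integration.integral_cong refl) (auto simp: F_def indicator_def)
 finally show ?thesis by (simp add: segment_integral_def)
qed

theorem wderiv_increment:
 fixes v h :: "real^'n => real"
 assumes U: "open U" and w: "wderiv U j v h" and b: "b > 0" and e: "e = axis j 1"
 shows "AE x in lborel. x \<in> segment_interior U e b -->
  set_integrable lborel {0..b} (%t. h (x + t *\<^sub>R e)) \<and>
  v (x + b *\<^sub>R e) - v x = (LINT t:{0..b}|lborel. h (x + t *\<^sub>R e))"
proof -
 let ?I = "segment_interior U e b" and ?H = "segment_integral h e b"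
 have [measurable]: "v \<in> borel_measurable borel" by (rule wderivD(3)[OF w])
 have H: "locally_integrable ?I ?H" by (rule locally_integrable_segment_integral[OF wderivD(2)[OF
   w]])
 have "?I \<subseteq> U" using b segment_interiorD[of _ U e b 0] by auto
 then have v: "locally_integrable ?I v" by (rule locally_integrable_mono[OF wderivD(1)[OF w]])
 have v_shift: "locally_integrable ?I (%x. v (x + b *\<^sub>R e))"
  unfolding locally_integrable_def
 proof (intro conjI allI impI)
  fix K assume K: "compact K \<and> K \<subseteq> ?I"
  let ?K' = "(%x. b *\<^sub>R e + x) ` K"
  have "compact ?K'" using K by (simp add: compact_translation)
  moreover have "?K' \<subseteq> U" using K b segment_interiorD[of _ U e b b] by (auto simp: add.commute)
  ultimately have "integrable lborel (%x. indicator ?K' x *\<^sub>R v x)"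
   using locally_integrableD[OF wderivD(1)[OF w]] by (simp add: set_integrable_def)
  from lborel_integrable_shift[OF this, of "b *\<^sub>R e"]
  have "integrable lborel (%x. indicator ?K' (x + b *\<^sub>R e) *\<^sub>R v (x + b *\<^sub>R e))" .
  moreover have "indicator ?K' (x + b *\<^sub>R e) = (indicator K x :: real)" for x
   by (auto simp: indicator_def image_def add.commute)
  ultimately show "set_integrable lborel K (%x. v (x + b *\<^sub>R e))"
   by (simp add: set_integrable_def)
 qed measurable
 have "AE x\<in>?I in lborel. v (x + b *\<^sub>R e) - v x - ?H x = 0"
 proof (rule fundamental_lemma[OF open_segment_interior[OF U]])
  show "locally_integrable ?I (%x. v (x + b *\<^sub>R e) - v x - ?H x)"
   by (intro locally_integrable_diff v v_shift H)
  fix phi assume phi: "phi \<in> test_fun ?I"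
  obtain S where S: "C1c S phi" "S \<subseteq> ?I" using phi by (rule test_funE)
  note [measurable] = C1c_measurable[OF S(1)]
  note i = locally_integrable_mult_C1c(1)[OF _ S]
  let ?\<Phi> = "conv_along lborel (indicator {0..b}) (%t. t *\<^sub>R e) phi"
  have shift: "(LBINT x. v (x + b *\<^sub>R e) * phi x) = (LBINT y. v y * phi (y - b *\<^sub>R e))"
   "integrable lborel (%y. v y * phi (y - b *\<^sub>R e))"
   using lborel_integral_shift[of "%y. v y * phi (y - b *\<^sub>R e)" "b *\<^sub>R e"]
    lborel_integrable_shift[OF i[OF v_shift], of "- (b *\<^sub>R e)"] by simp_all
  have "(LBINT y. v y * phi y) - (LBINT y. v y * phi (y - b *\<^sub>R e)) = (LBINT y. v y * pderiv_at j ?\<Phi>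
    y)"
   unfolding pderiv_segment_average[OF S(1) b e] using i[OF v] shift(2)
    by (simp add: right_diff_distrib)
  also have "... = - (LBINT x. ?H x * phi x)"
   unfolding segment_integral_adjoint[OF wderivD(2)[OF w] S, symmetric]
   by (rule wderivD(5)[OF w segment_average_test_fun[OF phi]])
  finally show "(LBINT x. (v (x + b *\<^sub>R e) - v x - ?H x) * phi x) = 0"
   using i[OF v] i[OF v_shift] i[OF H] shift(1) by (simp add: left_diff_distrib)
 qed
 with AE_segment_integrable[OF U wderivD(2)[OF w], of e b] show ?thesis
  by eventually_elim (auto simp: segment_integral_def set_lebesgue_integral_def)
qed

theorem wderiv_bounded_lipschitz:
 fixes v h :: "real^'n => real"
 assumes U: "open U" and w: "wderiv U j v h" and C: "AE x\<in>U in lborel. \<bar>h x\<bar> <= C"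
  and b: "b > 0" and e: "e = axis j 1"
 shows "AE x in lborel. x \<in> segment_interior U e b --> \<bar>v (x + b *\<^sub>R e) - v x\<bar> <= C * b"
 using wderiv_increment[OF U w b e] AE_on_AE_line[OF C, of e]
proof eventually_elim
 case (elim x)
 show ?case
 proof
  assume x: "x \<in> segment_interior U e b"
  let ?h = "%t. h (x + t *\<^sub>R e)"
  have int: "integrable lborel (%t. indicator {0..b} t *\<^sub>R ?h t)"
   and eq: "v (x + b *\<^sub>R e) - v x = (LBINT t. indicator {0..b} t *\<^sub>R ?h t)"
   using elim(1) x by (auto simp: set_integrable_def set_lebesgue_integral_def)
  have "\<bar>LBINT t. indicator {0..b} t *\<^sub>R ?h t\<bar> <= (LBINT t. C * indicator {0..b} t)"
  proof (rule order_trans[OF integral_abs_bound integral_mono_AE[OF integrable_abs[OF int]]])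
   show "AE t in lborel. \<bar>indicator {0..b} t *\<^sub>R ?h t\<bar> <= C * indicator {0..b} t"
    using elim(2) by eventually_elim (use x in \<open>auto simp: indicator_def
      segment_interior_def\<close>)
  qed (use b in simp)
  also have "... = C * b" using b by simp
  finally show "\<bar>v (x + b *\<^sub>R e) - v x\<bar> <= C * b" unfolding eq .
 qed
qed

subsection \<open>Classical derivatives along lines\<close>

lemma continuous_le_on_rationals:
 fixes f :: "real => real"
 assumes "continuous_on {a..b} f" and "!!q. a < of_rat q ==> of_rat q < b ==> f (of_rat q) <= c"
  and "s \<in> {a<..<b}"
 shows "f s <= c"
proof (rule continuous_le_on_closure[of "{a<..<b} \<inter> \<rat>" f])
 have "closure ({a<..<b} \<inter> \<rat>) = {a..b}"
  using closure_open_Int_superset[of "{a<..<b}" \<rat>] assms(3)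
  by (simp add: Rats_closure_real closure_greaterThanLessThan)
 then show "continuous_on (closure ({a<..<b} \<inter> \<rat>)) f" "s \<in> closure ({a<..<b} \<inter> \<rat>)"
  using assms(1,3) by auto
 show "f q <= c" if "q \<in> {a<..<b} \<inter> \<rat>" for q
  using that assms(2) by (auto simp: Rats_def)
qed

text \<open>This characterization is measurable in parameters.\<close>
lemma DERIV_0_iff_rationals:
 fixes g :: "real => real"
 assumes d: "d > 0" and g: "continuous_on {-d..d} g"
 shows "(g has_real_derivative l) (at 0) \<longleftrightarrow> (\<forall>k. \<exists>m. \<forall>q. \<bar>of_rat q :: real\<bar> < step m -->
  \<bar>g (of_rat q) - g 0 - of_rat q * l\<bar> <= step k * \<bar>of_rat q\<bar>)" (is "_ \<longleftrightarrow> ?R")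
proof -
 have alt: "(g has_real_derivative l) (at 0) \<longleftrightarrow>
   (\<forall>eps>0. \<exists>\<delta>>0. \<forall>t. \<bar>t\<bar> < \<delta> --> \<bar>g t - g 0 - t * l\<bar> <= eps * \<bar>t\<bar>)"
  by (simp add: has_field_derivative_def has_derivative_at_alt bounded_linear_mult_right
    mult.commute)
 show ?thesis
 proof
  assume D: "(g has_real_derivative l) (at 0)"
  show ?R
  proof
   fix k
   obtain \<delta> where "\<delta> > 0" and \<delta>: "!!t. \<bar>t\<bar> < \<delta> ==> \<bar>g t - g 0 - t * l\<bar> <= step k * \<bar>t\<bar>"
    using D step_pos[of k] unfolding alt by blast
   obtain m where "!!n. n >= m ==> step n < \<delta>" using step_lessE[OF \<open>\<delta> > 0\<close>] by blast
   then have "step m < \<delta>" by simp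
   then show "\<exists>m. \<forall>q. \<bar>of_rat q :: real\<bar> < step m -->
     \<bar>g (of_rat q) - g 0 - of_rat q * l\<bar> <= step k * \<bar>of_rat q\<bar>"
    by (intro exI[of _ m] allI impI \<delta>) simp
  qed
 next
  assume R: ?R
  show "(g has_real_derivative l) (at 0)" unfolding alt
  proof (intro allI impI)
   fix eps :: real assume "eps > 0"
   then obtain k where "!!n. n >= k ==> step n < eps" using step_lessE by blast
   then have k: "step k < eps" by simp
   obtain m where m: "!!q. \<bar>of_rat q :: real\<bar> < step m ==>
     \<bar>g (of_rat q) - g 0 - of_rat q * l\<bar> <= step k * \<bar>of_rat q\<bar>" using R by blast
   define \<delta> where "\<delta> = min d (step m)"
   have cont: "continuous_on {- \<delta>..\<delta>} (%t. \<bar>g t - g 0 - t * l\<bar> - step k * \<bar>t\<bar>)"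
    by (intro continuous_intros continuous_on_subset[OF g]) (auto simp: \<delta>_def)
   have "\<bar>g t - g 0 - t * l\<bar> <= eps * \<bar>t\<bar>" if t: "\<bar>t\<bar> < \<delta>" for t
   proof -
    have "\<bar>g t - g 0 - t * l\<bar> - step k * \<bar>t\<bar> <= 0"
    proof (rule continuous_le_on_rationals[OF cont])
     fix q :: rat assume "- \<delta> < of_rat q" "of_rat q < \<delta>"
     then have "\<bar>of_rat q :: real\<bar> < step m" by (simp only: abs_less_iff \<delta>_def) linarith
     from m[OF this] show "\<bar>g (of_rat q) - g 0 - of_rat q * l\<bar> - step k * \<bar>of_rat q\<bar> <= 0"
      by (simp only: diff_le_0_iff_le)
    qed (use t in auto)
    then show ?thesis using mult_right_mono[of "step k" eps "\<bar>t\<bar>"] k by simp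
   qed
   moreover have "\<delta> > 0" using d step_pos by (simp add: \<delta>_def)
   ultimately show "\<exists>\<delta>>0. \<forall>t. \<bar>t\<bar> < \<delta> --> \<bar>g t - g 0 - t * l\<bar> <= eps * \<bar>t\<bar>" by blast
  qed
 qed
qed

lemma AE_DERIV_if_rational_increments:
 fixes v h :: "real => real"
 assumes h: "h integrable_on {0..b}" and v: "continuous_on {0..b} v"
  and increments: "!!q. 0 < (of_rat q :: real) ==> of_rat q < b ==> v (of_rat q)
   = v 0 + integral {0..of_rat q} h"
 shows "AE t in lborel. 0 < t --> t < b --> (v has_real_derivative h t) (at t)"
 using AE_DERIV_integral[OF h]
proof eventually_elim
 case (elim t)
 have FTC: "v s = v 0 + integral {0..s} h" if s: "s \<in> {0<..<b}" for s
 proof -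
  have "\<bar>v s - (v 0 + integral {0..s} h)\<bar> <= 0"
  proof (rule continuous_le_on_rationals[OF _ _ s])
   show "continuous_on {0..b} (%s. \<bar>v s - (v 0 + integral {0..s} h)\<bar>)"
    by (intro continuous_intros v indefinite_integral_continuous_1 h)
  qed (simp add: increments)
  then show ?thesis by simp
 qed
 show ?case
 proof (intro impI)
  assume t: "0 < t" "t < b"
  then have "((%s. v 0 + integral {0..s} h) has_real_derivative h t) (at t)"
   using elim by (auto intro!: derivative_eq_intros)
  then show "(v has_real_derivative h t) (at t)"
   by (rule has_field_derivative_transform_within_open[of _ _ _ "{0<..<b}"]) (use t FTC in auto)
 qed
qed

lemma AE_segment_DERIV:
 fixes v h :: "real^'n => real"
 assumes U: "open U" and w: "wderiv U j v h" and cont: "continuous_on U v" and b: "0 < b"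
  and e: "e = axis j 1"
 shows "AE x in lborel. x \<in> segment_interior U e b --> (AE t in lborel. 0 < t --> t < b -->
  ((%s. v (x + s *\<^sub>R e)) has_real_derivative h (x + t *\<^sub>R e)) (at t))"
proof -
 let ?increment = "%c x. x \<in> segment_interior U e c -->
   set_integrable lborel {0..c} (%t. h (x + t *\<^sub>R e)) \<and>
   v (x + c *\<^sub>R e) - v x = (LINT t:{0..c}|lborel. h (x + t *\<^sub>R e))"
 have "AE x in lborel. \<forall>q. 0 < q --> ?increment (of_rat q) x"
  unfolding AE_all_countable
 proof
  fix q :: rat
  show "AE x in lborel. 0 < q --> ?increment (of_rat q) x"
   using wderiv_increment[OF U w _ e, of "of_rat q"] by (cases "0 < q") simp_all
 qed
 with wderiv_increment[OF U w b e] show ?thesis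
 proof eventually_elim
  case (elim x)
  show ?case
  proof
   assume x: "x \<in> segment_interior U e b"
   let ?h = "%t. h (x + t *\<^sub>R e)" and ?v = "%t. v (x + t *\<^sub>R e)"
   have h: "?h integrable_on {0..b}"
    using elim(1) x by (auto intro: set_borel_integral_eq_integral(1))
   moreover have "continuous_on {0..b} ?v"
    by (rule continuous_on_compose2[OF cont])
     (use x in \<open>auto simp: segment_interior_def intro!: continuous_intros\<close>)
   moreover have "?v (of_rat q) = ?v 0 + integral {0..of_rat q} ?h"
    if q: "0 < (of_rat q :: real)" "of_rat q < b" for q
   proof -
    have "x \<in> segment_interior U e (of_rat q)"
     using x q segment_interior_antimono[of "of_rat q" b] by auto
    then show ?thesis
     using elim(2) q(1) set_borel_integral_eq_integral(2)[of "{0..of_rat q}" ?h] by auto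
   qed
   ultimately show "AE t in lborel. 0 < t --> t < b --> (?v has_real_derivative ?h t) (at t)"
    by (rule AE_DERIV_if_rational_increments)
  qed
 qed
qed

theorem AE_DERIV_of_wderiv:
 fixes v h :: "real^'n => real"
 assumes U: "open U" and w: "wderiv U j v h" and cont: "continuous_on U v" and e: "e = axis j 1"
 shows "AE x\<in>U in lborel. ((%t. v (x + t *\<^sub>R e)) has_real_derivative h x) (at 0)"
proof -
 have [measurable]: "v \<in> borel_measurable borel" "h \<in> borel_measurable borel" "U \<in> sets borel"
  using wderivD(3,4)[OF w] U by auto
 define G where "G = {x \<in> U. \<forall>k. \<exists>m. \<forall>q. \<bar>of_rat q :: real\<bar> < step m -->
   \<bar>v (x + of_rat q *\<^sub>R e) - v x - of_rat q * h x\<bar> <= step k * \<bar>of_rat q\<bar>}"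
 have G: "x \<in> G \<longleftrightarrow> ((%t. v (x + t *\<^sub>R e)) has_real_derivative h x) (at 0)" if x: "x \<in> U" for x
 proof -
  have "open ((%t::real. x + t *\<^sub>R e) -` U)" by (intro open_vimage[OF U] continuous_intros)
  then obtain d where d: "d > 0" "cball 0 d \<subseteq> (%t. x + t *\<^sub>R e) -` U"
   using x open_contains_cball[of "(%t::real. x + t *\<^sub>R e) -` U"] by force
  have "continuous_on {-d..d} (%t. v (x + t *\<^sub>R e))"
   by (rule continuous_on_compose2[OF cont])
    (use d in \<open>auto simp: subset_eq dist_real_def intro!: continuous_intros\<close>)
  from DERIV_0_iff_rationals[OF d(1) this] x show ?thesis by (simp add: G_def)
 qed
 have "AE x in lborel. x \<notin> U - G"
 proof (rule AE_from_AE_segments[OF U])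
  show "U - G \<in> sets borel" unfolding G_def by measurable
  fix b :: real assume b: "0 < b"
  show "AE x in lborel. x \<in> segment_interior U e b -->
    (AE t in lborel. 0 < t --> t < b --> x + t *\<^sub>R e \<notin> U - G)"
   using AE_segment_DERIV[OF U w cont b e]
  proof eventually_elim
   case (elim x)
   show ?case
   proof
    assume "x \<in> segment_interior U e b"
    with elim have "AE t in lborel. 0 < t --> t < b -->
      ((%s. v (x + s *\<^sub>R e)) has_real_derivative h (x + t *\<^sub>R e)) (at t)" ..
    then show "AE t in lborel. 0 < t --> t < b --> x + t *\<^sub>R e \<notin> U - G"
    proof eventually_elim
     case (elim t)
     then show ?case using DERIV_shift[of "%s. v (x + s *\<^sub>R e)" "h (x + t *\<^sub>R e)" 0 t] G
      by (auto simp: algebra_simps)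
    qed
   qed
  qed
 qed auto
 then show ?thesis by eventually_elim (use G in blast)
qed

lemma countable_isolated_points:
 fixes S :: "'a::second_countable_topology set"
 shows "countable {x. x isolated_in S}"
proof -
 obtain B :: "'a set set" where B: "countable B" "topological_basis B" using ex_countable_basis
  by blast
 have "{x. x isolated_in S} \<subseteq> (%A. the_elem (A \<inter> S)) ` B"
 proof
  fix x assume "x \<in> {x. x isolated_in S}"
  then obtain T where T: "open T" "T \<inter> S = {x}" by (auto elim: isolated_inE)
  then obtain A where A: "A \<in> B" "x \<in> A" "A \<subseteq> T" using topological_basisE[OF B(2), of T x]
   by blast
  then have "A \<inter> S = {x}" using T(2) by blast
  with A(1) show "x \<in> (%A. the_elem (A \<inter> S)) ` B" by (auto intro!: rev_image_eqI)
 qed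
 then show ?thesis using B(1) by (auto intro: countable_subset)
qed

lemma DERIV_nonzero_imp_isolated_zero:
 fixes g :: "real => real"
 assumes "(g has_real_derivative c) (at t)" "c \<noteq> 0" "g t = 0"
 shows "t isolated_in {s. g s = 0}"
proof -
 have "((%s. g s / (s - t)) \<longlongrightarrow> c) (at t)"
  using assms(1,3) by (simp add: has_field_derivative_iff)
 then have "\<forall>\<^sub>F s in at t. g s / (s - t) \<noteq> 0" using assms(2) by (rule tendsto_imp_eventually_ne)
 then have "\<forall>\<^sub>F s in at t. g s \<noteq> 0" by (rule eventually_mono) auto
 then show ?thesis using assms(3) by (simp add: isolated_in_islimpt_iff islimpt_iff_eventually)
qed

theorem wderiv_zero_on_zeros:
 fixes v h :: "real^'n => real"
 assumes U: "open U" and w: "wderiv U j v h" and cont: "continuous_on U v"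
 shows "AE x\<in>U in lborel. v x = 0 --> h x = 0"
proof -
 define e :: "real^'n" where "e = axis j 1"
 have [measurable]: "v \<in> borel_measurable borel" "h \<in> borel_measurable borel" "U \<in> sets borel"
  using wderivD(3,4)[OF w] U by auto
 define N where "N = {x \<in> U. v x = 0 \<and> h x \<noteq> 0}"
 have "AE x in lborel. x \<notin> N"
 proof (rule AE_from_AE_segments[OF U])
  show "N \<in> sets borel" unfolding N_def by measurable
  fix b :: real assume "0 < b"
  from AE_segment_DERIV[OF U w cont this e_def]
  show "AE x in lborel. x \<in> segment_interior U e b -->
    (AE t in lborel. 0 < t --> t < b --> x + t *\<^sub>R e \<notin> N)"
  proof eventually_elim
   case (elim x)
   let ?Z = "{t. v (x + t *\<^sub>R e) = 0}"
   have isolated: "AE t in lborel. t \<notin> {t. t isolated_in ?Z}"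
    by (intro AE_not_in countable_imp_null_set_lborel countable_isolated_points)
   show ?case
   proof
    assume "x \<in> segment_interior U e b"
    with elim have "AE t in lborel. 0 < t --> t < b -->
      ((%s. v (x + s *\<^sub>R e)) has_real_derivative h (x + t *\<^sub>R e)) (at t)" ..
    with isolated show "AE t in lborel. 0 < t --> t < b --> x + t *\<^sub>R e \<notin> N"
     by eventually_elim (auto simp: N_def dest: DERIV_nonzero_imp_isolated_zero)
   qed
  qed
 qed (auto simp: N_def)
 then show ?thesis by eventually_elim (auto simp: N_def)
qed

section \<open>Square integrable functions\<close>

definition square_integrable :: "'a measure => ('a => real) => bool" where
 "square_integrable M f \<longleftrightarrow> f \<in> borel_measurable M \<and> integrable M (%x. (f x)\<^sup>2)"

lemma square_integrable_measurable: "square_integrable M f ==> f \<in> borel_measurable M"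
 and square_integrable_power2: "square_integrable M f ==> integrable M (%x. (f x)\<^sup>2)"
 by (auto simp: square_integrable_def)

lemma square_integrable_mult:
 assumes f: "square_integrable M f" and g: "square_integrable M g"
 shows "integrable M (%x. f x * g x)"
proof (rule Bochner_Integration.integrable_bound)
 show "integrable M (%x. (f x)\<^sup>2 + (g x)\<^sup>2)" using f g by (simp add: square_integrable_def)
 have "2 * \<bar>f x * g x\<bar> <= (f x)\<^sup>2 + (g x)\<^sup>2" for x
  using sum_squares_bound[of "\<bar>f x\<bar>" "\<bar>g x\<bar>"] by (simp add: abs_mult mult.assoc)
 then have "\<bar>f x * g x\<bar> <= (f x)\<^sup>2 + (g x)\<^sup>2" for x
  using abs_ge_zero[of "f x * g x"] by (smt (verit))
 then show "AE x in M. norm (f x * g x) <= norm ((f x)\<^sup>2 + (g x)\<^sup>2)" by simp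
qed (use f g in \<open>auto simp: square_integrable_def\<close>)

lemma square_integrable_lincomb:
 fixes s t :: real
 assumes f: "square_integrable M f" and g: "square_integrable M g"
 shows "square_integrable M (%x. s * f x + t * g x)"
  "(\<integral>x. (s * f x + t * g x)\<^sup>2 \<partial>M)
   = s\<^sup>2 * (\<integral>x. (f x)\<^sup>2 \<partial>M) + 2 * s * t * (\<integral>x. f x * g x \<partial>M) + t\<^sup>2 * (\<integral>x. (g x)\<^sup>2 \<partial>M)"
proof -
 have expand: "(%x. (s * f x + t * g x)\<^sup>2)
   = (%x. s\<^sup>2 * (f x)\<^sup>2 + 2 * s * t * (f x * g x) + t\<^sup>2 * (g x)\<^sup>2)"
  by (intro ext) (simp add: power2_eq_square algebra_simps)
 note i = square_integrable_power2[OF f] square_integrable_power2[OF g] square_integrable_mult[OF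
   f g]
 show "square_integrable M (%x. s * f x + t * g x)"
  using i f g unfolding square_integrable_def expand by auto
 show "(\<integral>x. (s * f x + t * g x)\<^sup>2 \<partial>M)
   = s\<^sup>2 * (\<integral>x. (f x)\<^sup>2 \<partial>M) + 2 * s * t * (\<integral>x. f x * g x \<partial>M) + t\<^sup>2 * (\<integral>x. (g x)\<^sup>2 \<partial>M)"
  unfolding expand using i by simp
qed

lemma square_integrable_diff:
 assumes "square_integrable M f" "square_integrable M g"
 shows "square_integrable M (%x. f x - g x)"
 using square_integrable_lincomb(1)[OF assms, of 1 "-1"] by simp

lemma square_integrable_add:
 assumes "square_integrable M f" "square_integrable M g"
 shows "square_integrable M (%x. f x + g x)"
 using square_integrable_lincomb(1)[OF assms, of 1 1] by simp

lemma square_integrable_sum: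
 "(!!i. i \<in> I ==> square_integrable M (f i)) ==> square_integrable M (%x. \<Sum>i\<in>I. f i x)"
 by (induction I rule: infinite_finite_induct)
  (auto simp: square_integrable_def[of M "%x. 0"] intro: square_integrable_add)

lemma set_integrable_of_square_integrable:
 fixes g :: "real^'n => real"
 assumes g: "square_integrable lborel g" and K: "compact K"
 shows "set_integrable lborel K g"
proof -
 have "square_integrable lborel (indicator K :: real^'n => real)"
  using integrable_indicator_compact[OF K] K
  by (simp add: square_integrable_def borel_compact power2_eq_square flip:
    indicator_inter_arith)
 from square_integrable_mult[OF this g] show ?thesis by (simp add: set_integrable_def)
qed

lemma integrable_Fatou:
 fixes f :: "nat => 'a => real"
 assumes f: "!!n. integrable M (f n)" "!!n x. 0 <= f n x" "!!n. (\<integral>x. f n x \<partial>M) <= C"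
  and g: "g \<in> borel_measurable M" "AE x in M. (%n. f n x) \<longlonglongrightarrow> g x"
 shows "integrable M g"
proof (rule integrableI_bounded)
 have [measurable]: "f n \<in> borel_measurable M" for n using f(1) by auto
 have "(\<integral>\<^sup>+x. ennreal (norm (g x)) \<partial>M) = (\<integral>\<^sup>+x. liminf (%n. ennreal (f n x)) \<partial>M)"
 proof (rule nn_integral_cong_AE)
  show "AE x in M. ennreal (norm (g x)) = liminf (%n. ennreal (f n x))"
   using g(2)
  proof eventually_elim
   case (elim x)
   have "g x >= 0" by (rule LIMSEQ_le_const[OF elim]) (use f(2) in auto)
   moreover have "(%n. ennreal (f n x)) \<longlonglongrightarrow> ennreal (g x)" by (rule tendsto_ennrealI[OF elim])
   then have "liminf (%n. ennreal (f n x)) = ennreal (g x)"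
    by (rule lim_imp_Liminf[rotated]) simp
   ultimately show ?case by simp
  qed
 qed
 also have "... <= liminf (%n. \<integral>\<^sup>+x. ennreal (f n x) \<partial>M)" by (rule nn_integral_liminf) simp
 also have "... <= ennreal C"
 proof -
  have "(\<integral>\<^sup>+x. ennreal (f n x) \<partial>M) <= ennreal C" for n
   using f by (subst nn_integral_eq_integral) (auto intro: ennreal_leI)
  then have "liminf (%n. \<integral>\<^sup>+x. ennreal (f n x) \<partial>M) <= limsup (%n. ennreal C)"
   by (intro order_trans[OF Liminf_mono[OF always_eventually] Liminf_le_Limsup]) auto
  then show ?thesis by (simp add: Limsup_const)
 qed
 finally show "(\<integral>\<^sup>+x. ennreal (norm (g x)) \<partial>M) < \<infinity>" by (simp add: le_less_trans)
qed (use g in simp)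

lemma abs_mult_le_min_plus_square:
 fixes d g m :: real
 assumes m: "m > 0"
 shows "\<bar>d * g\<bar> <= min \<bar>d * g\<bar> (m * g\<^sup>2) + d\<^sup>2 / m"
proof (cases "\<bar>d\<bar> <= m * \<bar>g\<bar>")
 case True
 then have "\<bar>d * g\<bar> <= m * g\<^sup>2"
  using mult_right_mono[OF True, of "\<bar>g\<bar>"] by (simp add: abs_mult power2_eq_square)
 then show ?thesis using m by simp
next
 case False
 then have "\<bar>d\<bar> * (m * \<bar>g\<bar>) <= \<bar>d\<bar> * \<bar>d\<bar>" by (intro mult_left_mono) auto
 then have "\<bar>d * g\<bar> <= d\<^sup>2 / m" using m by (simp add: abs_mult power2_eq_square field_simps)
 moreover have "0 <= min \<bar>d * g\<bar> (m * g\<^sup>2)" using m by simp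
 ultimately show ?thesis by linarith
qed

text \<open>The first summand of \<^term>\<open>min \<bar>d * g\<bar> (m * g\<^sup>2) + d\<^sup>2 / m\<close> is dominated by an integrable
 function, and the integral of the second one is small for large \<^term>\<open>m\<close>.\<close>
lemma square_integrable_tendsto_0_weakly:
 assumes d: "!!n. square_integrable M (d n)" "!!n. (\<integral>x. (d n x)\<^sup>2 \<partial>M) <= C"
  and lim: "AE x in M. (%n. d n x) \<longlonglongrightarrow> 0" and g: "square_integrable M g"
 shows "(%n. \<integral>x. d n x * g x \<partial>M) \<longlonglongrightarrow> 0"
proof (rule LIMSEQ_I)
 fix eps :: real assume eps: "eps > 0"
 note [measurable] = square_integrable_measurable[OF d(1)] square_integrable_measurable[OF g]
 have C: "C >= 0" using order_trans[OF integral_nonneg_AE d(2)[of 0]] by simp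
 define m where "m = 2 * (C + 1) / eps"
 have m: "m > 0" using C eps by (simp add: m_def)
 let ?min = "%n x. min \<bar>d n x * g x\<bar> (m * (g x)\<^sup>2)"
 have "(%n. \<integral>x. ?min n x \<partial>M) \<longlonglongrightarrow> (\<integral>x. 0 \<partial>M)"
 proof (rule integral_dominated_convergence[where w = "%x. m * (g x)\<^sup>2"])
  show "AE x in M. (%n. ?min n x) \<longlonglongrightarrow> 0"
   using lim
  proof eventually_elim
   case (elim x)
   then have "(%n. ?min n x) \<longlonglongrightarrow> min \<bar>0 * g x\<bar> (m * (g x)\<^sup>2)" by (intro tendsto_intros)
   then show ?case using m by simp
  qed
 qed (use m square_integrable_power2[OF g] in auto)
 from LIMSEQ_D[OF this, of "eps / 2"] obtain N where N: "!!n. n >= N ==> \<bar>\<integral>x. ?min n x \<partial>M\<bar> < eps / 2"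
  using eps by auto
 have "\<bar>\<integral>x. d n x * g x \<partial>M\<bar> < eps" if n: "n >= N" for n
 proof -
  have dg: "integrable M (%x. d n x * g x)" by (rule square_integrable_mult[OF d(1) g])
  have min: "integrable M (?min n)" using dg square_integrable_power2[OF g]
   by (intro integrable_min) auto
  have "\<bar>\<integral>x. d n x * g x \<partial>M\<bar> <= (\<integral>x. \<bar>d n x * g x\<bar> \<partial>M)" by (rule integral_abs_bound)
  also have "... <= (\<integral>x. ?min n x + (d n x)\<^sup>2 / m \<partial>M)"
   using abs_mult_le_min_plus_square[OF m] dg min square_integrable_power2[OF d(1)]
   by (intro integral_mono) auto
  also have "... = (\<integral>x. ?min n x \<partial>M) + (\<integral>x. (d n x)\<^sup>2 \<partial>M) / m"
   using min square_integrable_power2[OF d(1)] by simp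
  finally have "\<bar>\<integral>x. d n x * g x \<partial>M\<bar> <= (\<integral>x. ?min n x \<partial>M) + (\<integral>x. (d n x)\<^sup>2 \<partial>M) / m" .
  moreover have "(\<integral>x. (d n x)\<^sup>2 \<partial>M) / m <= C / m" using d(2) m by (intro divide_right_mono) auto
  moreover have "C / m <= eps / 2" using C eps by (simp add: m_def field_simps)
  ultimately show ?thesis using N[OF n] by linarith
 qed
 then show "\<exists>N. \<forall>n\<ge>N. norm ((\<integral>x. d n x * g x \<partial>M) - 0) < eps" by auto
qed

theorem square_integrable_tendsto_weakly:
 assumes f: "!!n. square_integrable M (f n)" "!!n. (\<integral>x. (f n x)\<^sup>2 \<partial>M) <= C"
  and lim: "AE x in M. (%n. f n x) \<longlonglongrightarrow> f' x" and f': "f' \<in> borel_measurable M"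
 shows "square_integrable M f'"
  "square_integrable M g ==> (%n. \<integral>x. f n x * g x \<partial>M) \<longlonglongrightarrow> (\<integral>x. f' x * g x \<partial>M)"
proof -
 have lim2: "AE x in M. (%n. (f n x)\<^sup>2) \<longlonglongrightarrow> (f' x)\<^sup>2"
  using lim by eventually_elim (rule tendsto_power)
 have "integrable M (%x. (f' x)\<^sup>2)"
  by (rule integrable_Fatou[of M "%n x. (f n x)\<^sup>2" C, OF square_integrable_power2[OF f(1)]])
   (use f(2) f' lim2 in auto)
 then show f'2: "square_integrable M f'" using f' by (simp add: square_integrable_def)
 assume g: "square_integrable M g"
 have "(%n. \<integral>x. (f n x - f' x) * g x \<partial>M) \<longlonglongrightarrow> 0"
 proof (rule square_integrable_tendsto_0_weakly[OF _ _ _ g])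
  show d: "square_integrable M (%x. f n x - f' x)" for n
   by (rule square_integrable_diff[OF f(1) f'2])
  show "(\<integral>x. (f n x - f' x)\<^sup>2 \<partial>M) <= 2 * C + 2 * (\<integral>x. (f' x)\<^sup>2 \<partial>M)" for n
  proof -
   have "(f n x - f' x)\<^sup>2 <= 2 * (f n x)\<^sup>2 + 2 * (f' x)\<^sup>2" for x
    using sum_squares_bound[of "f n x" "- f' x"] by (simp add: power2_diff)
   then have "(\<integral>x. (f n x - f' x)\<^sup>2 \<partial>M) <= (\<integral>x. 2 * (f n x)\<^sup>2 + 2 * (f' x)\<^sup>2 \<partial>M)"
    by (intro integral_mono square_integrable_power2[OF d] Bochner_Integration.integrable_add
      integrable_mult_right square_integrable_power2[OF f(1)] square_integrable_power2[OF
        f'2])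
   also have "... = 2 * (\<integral>x. (f n x)\<^sup>2 \<partial>M) + 2 * (\<integral>x. (f' x)\<^sup>2 \<partial>M)"
    using square_integrable_power2[OF f(1)] square_integrable_power2[OF f'2] by simp
   finally show ?thesis using f(2)[of n] by linarith
  qed
  show "AE x in M. (%n. f n x - f' x) \<longlonglongrightarrow> 0" using lim by eventually_elim (rule LIM_zero)
 qed
 moreover have "(\<integral>x. (f n x - f' x) * g x \<partial>M) = (\<integral>x. f n x * g x \<partial>M) - (\<integral>x. f' x * g x \<partial>M)" for n
  unfolding left_diff_distrib
  by (intro Bochner_Integration.integral_diff square_integrable_mult[OF f(1) g]
    square_integrable_mult[OF f'2 g])
 ultimately show "(%n. \<integral>x. f n x * g x \<partial>M) \<longlonglongrightarrow> (\<integral>x. f' x * g x \<partial>M)" by (simp only: LIM_zero_iff)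
qed

subsection \<open>Riesz representation\<close>

lemma nonneg_quadratic_imp:
 fixes a b c :: real
 assumes "!!t. 0 <= c + 2 * t * b + t\<^sup>2 * a" "0 <= a"
 shows "b\<^sup>2 <= c * a"
proof (cases "a = 0")
 case True
 then have "b = 0" using assms(1)[of "- (c + 1) / (2 * b)"]
  by (cases "b = 0") (auto simp: field_simps)
 then show ?thesis using True by simp
next
 case False
 then show ?thesis using assms(1)[of "- b / a"] assms(2)
  by (simp add: field_simps power2_eq_square)
qed

lemma square_integrable_fast_Cauchy_convergent:
 assumes phi: "!!n. square_integrable M (phi n)"
  and Cauchy: "!!n k. n <= k ==> (\<integral>x. (phi n x - phi k x)\<^sup>2 \<partial>M) <= 4 * (1/8)^n"
 shows "AE x in M. (%n. phi n x) \<longlonglongrightarrow> lim (%n. phi n x)"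
proof -
 note [measurable] = square_integrable_measurable[OF phi]
 let ?d = "%n x. phi n x - phi (Suc n) x"
 let ?s = "%n x. 2^n * (?d n x)\<^sup>2"
 have s_le: "(\<integral>\<^sup>+x. ennreal (?s n x) \<partial>M) <= ennreal (4 * (1/4)^n)" for n
 proof -
  have "(\<integral>\<^sup>+x. ennreal (?s n x) \<partial>M) = ennreal (\<integral>x. ?s n x \<partial>M)"
   by (intro nn_integral_eq_integral integrable_mult_right AE_I2)
    (simp_all add: square_integrable_power2 square_integrable_diff phi)
  also have "... <= ennreal (2^n * (4 * (1/8)^n))"
   using Cauchy[of n "Suc n"] by (auto intro!: ennreal_leI mult_left_mono)
  finally show ?thesis by (simp add: power_mult_distrib[symmetric] mult.left_commute)
 qed
 have "(\<integral>\<^sup>+x. (\<Sum>n. ennreal (?s n x)) \<partial>M) = (\<Sum>n. \<integral>\<^sup>+x. ennreal (?s n x) \<partial>M)"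
  by (rule nn_integral_suminf) measurable
 also have "... <= (\<Sum>n. ennreal (4 * (1/4)^n))" by (intro suminf_le s_le) auto
 also have "... = ennreal (\<Sum>n. 4 * (1/4)^n)"
  by (intro suminf_ennreal2) (auto intro!: summable_mult summable_geometric)
 finally have "(\<integral>\<^sup>+x. (\<Sum>n. ennreal (?s n x)) \<partial>M) \<noteq> \<infinity>" by (auto simp: top_unique)
 then have "AE x in M. (\<Sum>n. ennreal (?s n x)) \<noteq> \<infinity>" by (intro nn_integral_PInf_AE) auto
 then show ?thesis
 proof eventually_elim
  case (elim x)
  have "\<bar>d\<bar> <= 2^n * d\<^sup>2 + (1/2)^n" for d :: real and n :: nat
  proof -
   have "2 * \<bar>d\<bar> <= 2^n * d\<^sup>2 + (1/2)^n"
    using zero_le_power2[of "2^n * \<bar>d\<bar> - 1"]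
    by (simp add: power2_diff power_mult_distrib field_simps power2_eq_square)
   then show ?thesis by (smt (verit) abs_ge_zero)
  qed
  then have d_le: "\<bar>?d n x\<bar> <= ?s n x + (1/2)^n" for n .
  have s: "summable (%n. ?s n x + (1/2)^n)"
   using elim by (intro summable_add summable_geometric summable_suminf_not_top) auto
  have "summable (%n. ?d n x)"
   by (rule summable_comparison_test'[OF s, of 0]) (simp only: real_norm_def d_le)
  from summable_minus[OF this] have "summable (%n. phi (Suc n) x - phi n x)"
   by (simp only: minus_diff_eq)
  then have "convergent (%n. phi n x - phi 0 x)"
   by (simp only: summable_iff_convergent sum_lessThan_telescope[of "%n. phi n x"])
  then have "convergent (%n. phi n x)" using convergent_add_const_right_iff[of "%n. phi n x"
    "- phi 0 x"] by simp
  then show ?case by (simp add: convergent_LIMSEQ_iff)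
 qed
qed

locale bounded_L2_functional =
 fixes M :: "'a measure" and T :: "('a => real) set" and l :: "('a => real) => real" and C :: real
 assumes T_nonempty: "T \<noteq> {}" and T_square_integrable: "phi \<in> T ==> square_integrable M phi"
  and T_lincomb: "phi \<in> T ==> psi \<in> T ==> (%x. s * phi x + t * psi x) \<in> T"
  and l_lincomb: "phi \<in> T ==> psi \<in> T ==> l (%x. s * phi x + t * psi x) = s * l phi + t * l psi"
  and energy_bounded_below: "phi \<in> T ==> 2 * l phi <= C + (\<integral>x. (phi x)\<^sup>2 \<partial>M)"
begin

definition energy :: "('a => real) => real" where
 "energy phi = (\<integral>x. (phi x)\<^sup>2 \<partial>M) - 2 * l phi"

lemma minimizing_sequence:
 obtains phi where "!!n::nat. phi n \<in> T" "!!n psi. psi \<in> T ==> energy (phi n) <= energy psi + (1/8)^n"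
proof -
 have "- C <= energy phi" if "phi \<in> T" for phi using energy_bounded_below[OF that]
  by (simp add: energy_def)
 then have bdd: "bdd_below (energy ` T)" by (rule bdd_belowI2)
 have "\<exists>phi\<in>T. energy phi < Inf (energy ` T) + (1/8)^n" for n :: nat
  using cInf_less_iff[of "energy ` T" "Inf (energy ` T) + (1/8)^n"] T_nonempty bdd by auto
 then obtain phi where phi: "!!n::nat. phi n \<in> T" "!!n. energy (phi n) < Inf (energy ` T) + (1/8)^n"
  by metis
 have "energy (phi n) <= energy psi + (1/8)^n" if "psi \<in> T" for n psi
  using phi(2)[of n] cInf_lower[OF imageI[OF that] bdd] by linarith
 with phi(1) show ?thesis by (rule that)
qed

lemma almost_minimizer_almost_represents:
 assumes phi: "phi \<in> T" "!!psi. psi \<in> T ==> energy phi <= energy psi + eps" and psi: "psi \<in> T"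
 shows "((\<integral>x. phi x * psi x \<partial>M) - l psi)\<^sup>2 <= eps * (\<integral>x. (psi x)\<^sup>2 \<partial>M)"
proof (rule nonneg_quadratic_imp)
 fix t
 have "energy phi <= energy (%x. 1 * phi x + t * psi x) + eps" by (intro phi(2) T_lincomb phi(1) psi)
 also have "energy (%x. 1 * phi x + t * psi x)
   = energy phi + 2 * t * ((\<integral>x. phi x * psi x \<partial>M) - l psi) + t\<^sup>2 * (\<integral>x. (psi x)\<^sup>2 \<partial>M)"
  unfolding energy_def l_lincomb[OF phi(1) psi]
   square_integrable_lincomb(2)[OF T_square_integrable[OF phi(1)] T_square_integrable[OF psi]]
  by (simp add: algebra_simps)
 finally show "0 <= eps + 2 * t * ((\<integral>x. phi x * psi x \<partial>M) - l psi) + t\<^sup>2 * (\<integral>x. (psi x)\<^sup>2 \<partial>M)" by simp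
qed simp

lemma almost_minimizers_close:
 assumes phi: "phi \<in> T" "!!psi. psi \<in> T ==> energy phi <= energy psi + eps"
  and phi': "phi' \<in> T" "!!psi. psi \<in> T ==> energy phi' <= energy psi + eps"
 shows "(\<integral>x. (phi x - phi' x)\<^sup>2 \<partial>M) <= 4 * eps"
proof -
 let ?psi = "%x. phi x - phi' x"
 define S where "S = (\<integral>x. (?psi x)\<^sup>2 \<partial>M)"
 have psi: "?psi \<in> T" using T_lincomb[OF phi(1) phi'(1), of 1 "-1"] by simp
 note sq = T_square_integrable[OF phi(1)] T_square_integrable[OF phi'(1)] T_square_integrable[OF psi]
 define X X' where "X = (\<integral>x. phi x * ?psi x \<partial>M) - l ?psi" and "X' = (\<integral>x. phi' x * ?psi x \<partial>M) - l ?psi"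
 have "S = (\<integral>x. phi x * ?psi x - phi' x * ?psi x \<partial>M)"
  unfolding S_def by (simp add: power2_eq_square left_diff_distrib)
 also have "... = X - X'"
  using square_integrable_mult[OF sq(1,3)] square_integrable_mult[OF sq(2,3)]
   by (simp add: X_def X'_def)
 finally have "S\<^sup>2 <= 2 * X\<^sup>2 + 2 * X'\<^sup>2"
  using sum_squares_bound[of X "- X'"] by (simp add: power2_diff)
 also have "... <= 4 * eps * S"
  using almost_minimizer_almost_represents[OF phi psi] almost_minimizer_almost_represents[OF phi' psi]
  by (simp add: X_def X'_def S_def)
 finally have "S * S <= (4 * eps) * S" by (simp add: power2_eq_square)
 moreover have "S >= 0" by (simp add: S_def)
 moreover have "eps >= 0" using phi(2)[OF phi(1)] by simp
 ultimately show ?thesis unfolding S_def[symmetric]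
  by (cases "S = 0") (auto simp: mult_le_cancel_right)
qed

theorem L2_representation:
 obtains g where "square_integrable M g" "!!psi. psi \<in> T ==> l psi = (\<integral>x. g x * psi x \<partial>M)"
proof -
 obtain phi where phi: "!!n::nat. phi n \<in> T" "!!n psi. psi \<in> T ==> energy (phi n) <= energy psi + (1/8)^n"
  by (rule minimizing_sequence) blast
 note sq = T_square_integrable[OF phi(1)]
 have close: "(\<integral>x. (phi n x - phi k x)\<^sup>2 \<partial>M) <= 4 * (1/8)^n" if "n <= k" for n k
 proof (rule almost_minimizers_close[OF phi(1) phi(2) phi(1)])
  have "(1/8::real)^k <= (1/8)^n" using that by (intro power_decreasing) auto
  then show "energy (phi k) <= energy psi + (1/8)^n" if "psi \<in> T" for psi using phi(2)[OF that, of k]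
   by linarith
 qed
 define g where "g x = lim (%n. phi n x)" for x
 have AE_lim: "AE x in M. (%n. phi n x) \<longlonglongrightarrow> g x"
  unfolding g_def by (rule square_integrable_fast_Cauchy_convergent[OF sq close])
 have g: "g \<in> borel_measurable M"
  unfolding g_def by (intro borel_measurable_lim_metric square_integrable_measurable[OF sq])
 have bounded: "(\<integral>x. (phi n x)\<^sup>2 \<partial>M) <= 2 * (\<integral>x. (phi 0 x)\<^sup>2 \<partial>M) + 8" for n
 proof -
  have "(phi n x)\<^sup>2 <= 2 * (phi 0 x)\<^sup>2 + 2 * (phi 0 x - phi n x)\<^sup>2" for x
   using zero_le_power2[of "2 * phi 0 x - phi n x"] by (simp add: power2_diff power_mult_distrib)
  then have "(\<integral>x. (phi n x)\<^sup>2 \<partial>M) <= (\<integral>x. 2 * (phi 0 x)\<^sup>2 + 2 * (phi 0 x - phi n x)\<^sup>2 \<partial>M)"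
   by (intro integral_mono square_integrable_power2 Bochner_Integration.integrable_add
     integrable_mult_right square_integrable_diff sq)
  also have "... = 2 * (\<integral>x. (phi 0 x)\<^sup>2 \<partial>M) + 2 * (\<integral>x. (phi 0 x - phi n x)\<^sup>2 \<partial>M)"
   by (simp add: square_integrable_power2 square_integrable_diff sq)
  finally show ?thesis using close[of 0 n] by simp
 qed
 note weak = square_integrable_tendsto_weakly[OF sq bounded AE_lim g]
 have "l psi = (\<integral>x. g x * psi x \<partial>M)" if psi: "psi \<in> T" for psi
 proof -
  have "((\<integral>x. g x * psi x \<partial>M) - l psi)\<^sup>2 <= 0 * (\<integral>x. (psi x)\<^sup>2 \<partial>M)"
  proof (rule LIMSEQ_le)
   show "(%n. ((\<integral>x. phi n x * psi x \<partial>M) - l psi)\<^sup>2) \<longlonglongrightarrow> ((\<integral>x. g x * psi x \<partial>M) - l psi)\<^sup>2"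
    by (intro tendsto_intros weak(2) T_square_integrable psi)
   show "(%n. (1/8)^n * (\<integral>x. (psi x)\<^sup>2 \<partial>M)) \<longlonglongrightarrow> 0 * (\<integral>x. (psi x)\<^sup>2 \<partial>M)"
    by (intro tendsto_intros LIMSEQ_power_zero) auto
   show "\<exists>N. \<forall>n\<ge>N. ((\<integral>x. phi n x * psi x \<partial>M) - l psi)\<^sup>2 <= (1/8)^n * (\<integral>x. (psi x)\<^sup>2 \<partial>M)"
    by (intro exI allI impI almost_minimizer_almost_represents[OF phi(1) phi(2) psi])
  qed
  then show ?thesis by simp
 qed
 with weak(1) show ?thesis by (rule that)
qed

end

subsection \<open>Difference quotients\<close>

lemma difference_quotient_adjoint:
 fixes v phi :: "real^'n => real"
 assumes v: "locally_integrable W v" and phi: "C1c S phi" "thicken d S \<subseteq> W" and e: "0 <= d"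
   "norm e <= d"
 shows "integrable lborel (%x. (v (x + e) - v x) * phi x)"
  "(LBINT x. (v (x + e) - v x) * phi x) = (LBINT x. v x * (phi (x - e) - phi x))"
proof -
 have "S \<subseteq> W" using thicken_superset[OF e(1), of S] phi(2) by blast
 then have vphi: "integrable lborel (%x. v x * phi x)"
  by (rule locally_integrable_mult_C1c(1)[OF v phi(1)])
 have "(%x. x + e) ` S \<subseteq> W" using phi(2) e thickenI[of _ S _ d] by force
 then have shifted: "integrable lborel (%x. v x * phi (x - e))"
  by (rule locally_integrable_mult_C1c(1)[OF v C1c_translate(1)[OF phi(1)]])
 from lborel_integrable_shift[OF this, of e]
 have unshifted: "integrable lborel (%x. v (x + e) * phi x)" by simp
 with vphi show "integrable lborel (%x. (v (x + e) - v x) * phi x)" by (simp add: left_diff_distrib)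
 have "(LBINT x. v (x + e) * phi x) = (LBINT x. v x * phi (x - e))"
  using lborel_integral_shift[OF borel_measurable_integrable[OF shifted, simplified], of e]
   by simp
 then show "(LBINT x. (v (x + e) - v x) * phi x) = (LBINT x. v x * (phi (x - e) - phi x))"
  using vphi shifted unshifted by (simp add: left_diff_distrib right_diff_distrib)
qed

lemma difference_quotient_tendsto_weakly:
 fixes v phi :: "real^'n => real"
 assumes W: "open W" and v: "locally_integrable W v" and phi: "C1c S phi" "S \<subseteq> W"
 shows "(%n. LBINT x. ((v (x + step n *\<^sub>R axis j 1) - v x) / step n) * phi x)
  \<longlonglongrightarrow> - (LBINT x. v x * pderiv_at j phi x)"
proof -
 define e :: "real^'n" where "e = axis j 1"
 have norm_e: "norm (step n *\<^sub>R e) = step n" for n using step_pos[of n] by (simp add: e_def)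
 note [measurable] = C1c_measurable[OF phi(1)] C1c_measurable_pderiv[OF phi(1)]
   locally_integrable_measurable[OF v]
 obtain d where d: "d > 0" "thicken d S \<subseteq> W" using thicken_subset_open[OF C1c_compact[OF phi(1)] W
   phi(2)] .
 let ?S' = "thicken d S"
 have S': "compact ?S'" by (rule compact_thicken[OF C1c_compact[OF phi(1)]])
 obtain N where N: "!!n. n >= N ==> step n < d" using step_lessE[OF d(1)] by blast
 obtain C where C: "C > 0" "!!x. norm (grad phi x) <= C" using C1c_bounded[OF phi(1)] by metis
 let ?q = "%n x. (phi (x - step n *\<^sub>R e) - phi x) / step n"
 have q_le: "\<bar>?q n x\<bar> <= C * indicator ?S' x" if n: "n >= N" for n x
 proof (cases "x \<in> ?S'")
  case True
  have "\<bar>phi (x - step n *\<^sub>R e) - phi x\<bar> <= C * step n"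
   using C1c_diff_quotient_bound[OF phi(1) C(2) step_pos, of "x - step n *\<^sub>R e" n j]
   by (simp add: e_def abs_minus_commute)
  then show ?thesis using True step_pos[of n] by (simp add: divide_le_eq)
 next
  case False
  then have "x \<notin> S" "x - step n *\<^sub>R e \<notin> S"
   using thickenI[of x S x d] thickenI[of "x - step n *\<^sub>R e" S x d] d(1) N[OF n] norm_e[of n]
    by auto
  then show ?thesis using False C1c_zero[OF phi(1)] by simp
 qed
 have "(%n. LBINT x. v x * ?q (n + N) x) \<longlonglongrightarrow> (LBINT x. v x * - pderiv_at j phi x)"
 proof (rule integral_dominated_convergence[where w = "%x. C * \<bar>indicator ?S' x * v x\<bar>"])
  show "integrable lborel (%x. C * \<bar>indicator ?S' x * v x\<bar>)"
   using locally_integrableD[OF v S' d(2)]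
   by (intro integrable_mult_right integrable_abs) (simp add: set_integrable_def)
  have "(%n. ?q n x) \<longlonglongrightarrow> - pderiv_at j phi x" for x
   unfolding e_def by (rule pderiv_step_quotient_tendsto(2)[OF C1c_differentiable[OF phi(1)]])
  then show "AE x in lborel. (%n. v x * ?q (n + N) x) \<longlonglongrightarrow> v x * - pderiv_at j phi x"
   by (intro AE_I2 tendsto_mult tendsto_const LIMSEQ_ignore_initial_segment)
  have "\<bar>v x * ?q (n + N) x\<bar> <= \<bar>v x\<bar> * (C * indicator ?S' x)" for n x
   unfolding abs_mult by (intro mult_left_mono q_le) auto
  then show "AE x in lborel. norm (v x * ?q (n + N) x) <= C * \<bar>indicator ?S' x * v x\<bar>" for n
   by (intro AE_I2) (simp add: abs_mult mult_ac)
 qed measurable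
 moreover have "(LBINT x. ((v (x + step (n + N) *\<^sub>R e) - v x) / step (n + N)) * phi x)
   = (LBINT x. v x * ?q (n + N) x)" for n
  using difference_quotient_adjoint(2)[OF v phi(1) d(2), of "step (n + N) *\<^sub>R e"] d(1)
   N[of "n + N"] norm_e[of "n + N"] by simp
 ultimately have "(%n. LBINT x. ((v (x + step (n + N) *\<^sub>R e) - v x) / step (n + N)) * phi x)
   \<longlonglongrightarrow> - (LBINT x. v x * pderiv_at j phi x)"
  by (simp only: mult_minus_right Bochner_Integration.integral_minus)
 then show ?thesis unfolding e_def by (rule LIMSEQ_offset)
qed

lemma C1c_pderiv_lincomb:
 assumes "C1c S phi" "C1c S' psi"
 shows "pderiv_at j (%x. s * phi x + t * psi x) x = s * pderiv_at j phi x + t * pderiv_at j psi x"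
proof -
 have "GDERIV (%x. s * phi x + t * psi x) x :> s *\<^sub>R grad phi x + t *\<^sub>R grad psi x"
  using GDERIV_add[OF GDERIV_mult[OF GDERIV_const C1c_GDERIV[OF assms(1)]]
    GDERIV_mult[OF GDERIV_const C1c_GDERIV[OF assms(2)]]] by simp
 then show ?thesis by (simp add: GDERIV_imp_pderiv_at)
qed

lemma C1c_square_integrable:
 fixes phi :: "real^'n => real"
 assumes "C1c S phi"
 shows "square_integrable lborel phi"
 using C1c_measurable[OF assms] C1c_integrable(1)[OF C1c_power2(1)[OF assms]]
 by (simp add: square_integrable_def)

lemma weak_difference_quotient_bound:
 fixes v :: "real^'n => real"
 assumes W: "open W" and v: "locally_integrable W v"
  and quotients: "!!n. n >= N ==> square_integrable lborel
   (%x. indicator W x * ((v (x + step n *\<^sub>R axis j 1) - v x) / step n))"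
  and bounded: "!!n. n >= N ==>
   (LBINT x. (indicator W x * ((v (x + step n *\<^sub>R axis j 1) - v x) / step n))\<^sup>2) <= C"
  and phi: "C1c S phi" "S \<subseteq> W"
 shows "2 * - (LBINT x. v x * pderiv_at j phi x) <= C + (LBINT x. (phi x)\<^sup>2)"
proof (rule LIMSEQ_le_const2)
 define q where "q n x = (v (x + step n *\<^sub>R axis j 1) - v x) / step n" for n x
 note quotients = quotients[folded q_def] and bounded = bounded[folded q_def]
 show "(%n. 2 * (LBINT x. q n x * phi x)) \<longlonglongrightarrow> 2 * - (LBINT x. v x * pderiv_at j phi x)"
  unfolding q_def
  using tendsto_mult[OF tendsto_const[of 2] difference_quotient_tendsto_weakly[OF W v phi, of j]]
  by simp
 have "2 * (LBINT x. q n x * phi x) <= C + (LBINT x. (phi x)\<^sup>2)" if n: "n >= N" for n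
 proof -
  let ?q = "%x. indicator W x * q n x"
  have q: "q n x * phi x = ?q x * phi x" for x
   using C1c_zero[OF phi(1), of x] phi(2) by (auto simp: indicator_def)
  have "2 * (LBINT x. q n x * phi x) = (LBINT x. 2 * (?q x * phi x))" unfolding q by simp
  also have "... <= (LBINT x. (?q x)\<^sup>2 + (phi x)\<^sup>2)"
   using sum_squares_bound[of "?q _" "phi _"]
   by (intro integral_mono integrable_mult_right square_integrable_mult
     Bochner_Integration.integrable_add square_integrable_power2 quotients n C1c_square_integrable[OF phi(1)])
    (simp add: mult.assoc)
  also have "... = (LBINT x. (?q x)\<^sup>2) + (LBINT x. (phi x)\<^sup>2)"
   by (intro Bochner_Integration.integral_add square_integrable_power2 quotients n
     C1c_square_integrable[OF phi(1)])
  finally show ?thesis using bounded[OF n] by linarith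
 qed
 then show "\<exists>N. \<forall>n\<ge>N. 2 * (LBINT x. q n x * phi x) <= C + (LBINT x. (phi x)\<^sup>2)" by blast
qed

theorem wderiv_of_bounded_difference_quotients:
 fixes v :: "real^'n => real"
 assumes W: "open W" and v: "locally_integrable W v"
  and quotients: "!!n. n >= N ==> square_integrable lborel
   (%x. indicator W x * ((v (x + step n *\<^sub>R axis j 1) - v x) / step n))"
  and bounded: "!!n. n >= N ==>
   (LBINT x. (indicator W x * ((v (x + step n *\<^sub>R axis j 1) - v x) / step n))\<^sup>2) <= C"
 obtains g where "wderiv W j v g" "square_integrable lborel g"
proof -
 define l where "l phi = - (LBINT x. v x * pderiv_at j phi x)" for phi
 interpret bounded_L2_functional lborel "test_fun W" l C
 proof
  show "test_fun W \<noteq> {}" using test_funI[of "%x. 0" "{}" W] Ck_on_const by fastforce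
  fix phi assume phi: "phi \<in> test_fun W"
  obtain S where S: "C1c S phi" "S \<subseteq> W" using phi by (rule test_funE)
  show "square_integrable lborel phi" by (rule C1c_square_integrable[OF S(1)])
  show "2 * l phi <= C + (LBINT x. (phi x)\<^sup>2)"
   unfolding l_def by (rule weak_difference_quotient_bound[OF W v quotients bounded S])
  fix psi s t assume psi: "psi \<in> test_fun W"
  obtain S' where S': "C1c S' psi" "S' \<subseteq> W" using psi by (rule test_funE)
  show "(%x. s * phi x + t * psi x) \<in> test_fun W" by (rule test_fun_lincomb[OF phi psi])
  show "l (%x. s * phi x + t * psi x) = s * l phi + t * l psi"
   using locally_integrable_mult_C1c(2)[OF v S, of j] locally_integrable_mult_C1c(2)[OF v S',
     of j]
   by (simp add: l_def C1c_pderiv_lincomb[OF S(1) S'(1)] distrib_left mult.left_commute)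
 qed
 obtain g where g: "square_integrable lborel g" "!!psi. psi \<in> test_fun W ==> l psi = (LBINT x. g x * psi x)"
  using L2_representation by auto
 have "locally_integrable W g"
  unfolding locally_integrable_def
  using square_integrable_measurable[OF g(1)] set_integrable_of_square_integrable[OF g(1)]
   by simp
 moreover have "(LBINT x. v x * pderiv_at j phi x) = - (LBINT x. g x * phi x)" if "phi \<in> test_fun W"
   for phi
  using g(2)[OF that] by (simp add: l_def)
 ultimately show ?thesis using v by (intro that[OF _ g(1)]) (simp add: wderiv_def)
qed

subsection \<open>Further properties of weak derivatives\<close>

lemma wderiv_C1c:
 fixes v h :: "real^'n => real"
 assumes U: "open U" and w: "wderiv U i v h" and v: "continuous_on U v" and \<zeta>: "C1c S \<zeta>" "S \<subseteq> U"
 shows "(LBINT x. v x * pderiv_at i \<zeta> x) = - (LBINT x. h x * \<zeta> x)"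
proof -
 have "(LBINT x. (v x *\<^sub>R axis i 1) \<bullet> grad \<zeta> x) + (LBINT x. h x * \<zeta> x) = 0"
 proof (rule weak_equation_extends_to_W11c(3)[OF U _ _ wderivD(2)[OF w] _ C1c_imp_W11c[OF \<zeta>(1)]
   \<zeta>(2)])
  note [measurable] = wderivD(3)[OF w]
  show "(%x. v x *\<^sub>R axis i 1 :: real^'n) \<in> borel_measurable borel" by measurable
  show "continuous_on U (%x. v x *\<^sub>R axis i (1::real))" by (intro continuous_intros v)
  show "(LBINT x. (v x *\<^sub>R axis i 1) \<bullet> grad \<zeta> x) + (LBINT x. h x * \<zeta> x) = 0" if "\<zeta> \<in> test_fun U"
    for \<zeta>
   using wderivD(5)[OF w that] by (simp add: inner_axis')
 qed
 then show ?thesis by (simp add: inner_axis')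
qed

lemma W11c_mult:
 fixes v psi :: "real^'n => real" and \<Phi> :: "real^'n => real^'n"
 assumes U: "open U" and v: "continuous_on U v" and w: "!!i. wderiv U i v (V i)" and psi: "C1c S psi"
   "S \<subseteq> U"
  and \<Phi>: "\<Phi> \<in> borel_measurable borel" "!!i. AE x in lborel. \<Phi> x $ i = v x * pderiv_at i psi x
    + V i x * psi x"
   "!!x. x \<notin> S ==> \<Phi> x = 0"
 shows "W11c S (%x. v x * psi x) \<Phi>"
 unfolding W11c_def
proof (intro conjI allI impI)
 note S = C1c_compact[OF psi(1)]
 have components: "integrable lborel (%x. v x * pderiv_at i psi x + V i x * psi x)" for i
  by (intro Bochner_Integration.integrable_add locally_integrable_mult_C1c[OF _ psi]
    wderivD(1,2)[OF w])
 have "integrable lborel (%x. \<Phi> x $ i)" for i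
  using borel_measurable_vec_nth[OF \<Phi>(1)] \<Phi>(2)[of i]
  by (intro integrable_cong_AE_imp[OF components[of i]]) (auto elim: eventually_mono)
 then have "integrable lborel (%x. \<Sum>i\<in>UNIV. (\<Phi> x $ i) *\<^sub>R axis i (1::real) :: real^'n)"
  by (intro Bochner_Integration.integrable_sum integrable_scaleR_left)
 then show "integrable lborel \<Phi>" unfolding vec_lambda_eq_sum_axis[symmetric] by simp
 have "continuous_on (U \<union> - S) (%x. v x * psi x)"
 proof (rule continuous_on_open_Un[OF U])
  show "open (- S)" using compact_imp_closed[OF S] by blast
  show "continuous_on U (%x. v x * psi x)" by (intro continuous_intros v C1c_continuous[OF psi(1)])
  show "continuous_on (- S) (%x. v x * psi x)"
   using C1c_zero[OF psi(1)] by (subst continuous_on_cong[OF refl, of _ _ "%_. 0"]) auto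
 qed
 moreover have "U \<union> - S = UNIV" using psi(2) by auto
 ultimately show "continuous_on UNIV (%x. v x * psi x)" by simp
 fix T i and \<zeta> :: "real^'n => real" assume \<zeta>: "C1c T \<zeta>"
 note prod = C1c_mult[OF open_UNIV subset_UNIV C1c_differentiable[OF \<zeta>] C1c_continuous_grad[OF \<zeta>]
   psi(1)]
 have product: "integrable lborel (%x. v x * pderiv_at i (%x. \<zeta> x * psi x) x)"
  "(LBINT x. v x * pderiv_at i (%x. \<zeta> x * psi x) x) = - (LBINT x. V i x * (\<zeta> x * psi x))"
  by (rule locally_integrable_mult_C1c(2)[OF wderivD(1)[OF w] prod(1) psi(2)]
    wderiv_C1c[OF U w v prod(1) psi(2)])+
 have cross: "integrable lborel (%x. (v x * \<zeta> x) * pderiv_at i psi x)"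
  by (intro C1c_integrable_mult(2)[OF psi(1)] set_integrable_continuous[OF S] continuous_intros
    continuous_on_subset[OF v psi(2)] C1c_continuous[OF \<zeta>])
 have V: "integrable lborel (%x. V i x * (\<zeta> x * psi x))"
  by (rule locally_integrable_mult_C1c(1)[OF wderivD(2)[OF w] prod(1) psi(2)])
 have "(LBINT x. v x * psi x * pderiv_at i \<zeta> x)
   = (LBINT x. v x * pderiv_at i (%x. \<zeta> x * psi x) x - (v x * \<zeta> x) * pderiv_at i psi x)"
  unfolding prod(2) by (intro Bochner_Integration.integral_cong refl) (simp add: algebra_simps)
 also have "... = - ((LBINT x. V i x * (\<zeta> x * psi x)) + (LBINT x. (v x * \<zeta> x) * pderiv_at i psi x))"
  using product cross by simp
 also have "(LBINT x. V i x * (\<zeta> x * psi x)) + (LBINT x. (v x * \<zeta> x) * pderiv_at i psi x)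
   = (LBINT x. (v x * pderiv_at i psi x + V i x * psi x) * \<zeta> x)"
  using V cross by (subst Bochner_Integration.integral_add[symmetric])
   (auto intro!: Bochner_Integration.integral_cong simp: algebra_simps)
 also have "... = (LBINT x. \<Phi> x $ i * \<zeta> x)"
 proof (rule integral_cong_AE)
  note [measurable] = wderivD(3,4)[OF w[of i]] C1c_measurable[OF \<zeta>] C1c_measurable[OF psi(1)]
   C1c_measurable_pderiv[OF psi(1)] borel_measurable_vec_nth[OF \<Phi>(1)]
  show "(%x. (v x * pderiv_at i psi x + V i x * psi x) * \<zeta> x) \<in> borel_measurable lborel"
   "(%x. \<Phi> x $ i * \<zeta> x) \<in> borel_measurable lborel" by measurable
 qed (use \<Phi>(2)[of i] in \<open>auto elim: eventually_mono\<close>)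
 finally show "(LBINT x. v x * psi x * pderiv_at i \<zeta> x) = - (LBINT x. \<Phi> x $ i * \<zeta> x)" .
qed (use C1c_compact[OF psi(1)] C1c_zero[OF psi(1)] \<Phi>(3) in auto)

lemma translation_adjoint_pderiv:
 fixes v \<zeta> :: "real^'n => real"
 assumes W: "open W" and w: "wderiv W j v d" "continuous_on W v"
  and \<zeta>: "C1c S \<zeta>" "thicken r S \<subseteq> W" and e: "0 <= r" "norm e <= r"
 shows "(LBINT x. v x * (pderiv_at j \<zeta> (x - e) - pderiv_at j \<zeta> x)) = - (LBINT x. d x * (\<zeta> (x - e)
   - \<zeta> x))"
proof -
 have S: "S \<subseteq> W" "(%x. x + e) ` S \<subseteq> W"
  using \<zeta>(2) e thicken_superset[OF e(1), of S] thickenI[of _ S _ r] by force+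
 note shifted = C1c_translate(1)[OF \<zeta>(1), of e]
 have pderiv_shifted: "pderiv_at j (%x. \<zeta> (x - e)) x = pderiv_at j \<zeta> (x - e)" for x
  using C1c_translate(2)[OF \<zeta>(1), of e x] by (metis grad_nth)
 note i = locally_integrable_mult_C1c(2)[OF wderivD(1)[OF w(1)] \<zeta>(1) S(1), of j]
  locally_integrable_mult_C1c(1)[OF wderivD(2)[OF w(1)] \<zeta>(1) S(1)]
  locally_integrable_mult_C1c(2)[OF wderivD(1)[OF w(1)] shifted S(2), of j, unfolded
    pderiv_shifted]
  locally_integrable_mult_C1c(1)[OF wderivD(2)[OF w(1)] shifted S(2)]
 show ?thesis
  using i wderiv_C1c[OF W w \<zeta>(1) S(1)] wderiv_C1c[OF W w shifted S(2)]
  by (simp add: pderiv_shifted right_diff_distrib)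
qed

theorem wderiv_symmetric:
 fixes v :: "real^'n => real"
 assumes W: "open W" and v: "continuous_on W v" and d: "wderiv W i v d\<^sub>i" "wderiv W j v d\<^sub>j"
  and h: "wderiv W j d\<^sub>i h" "wderiv W i d\<^sub>j h'"
 shows "AE x\<in>W in lborel. h x = h' x"
proof -
 have eq: "(LBINT x. h x * \<zeta> x) = (LBINT x. h' x * \<zeta> x)" if \<zeta>: "\<zeta> \<in> test_fun W" for \<zeta>
 proof -
  obtain S where S: "C1c S \<zeta>" "S \<subseteq> W" "!!m. Ck_on m UNIV \<zeta>" by (rule test_funE[OF \<zeta>]) blast
  have smooth: "Ck_on m UNIV (pderiv_at l \<zeta>)" for m l using S(3)[of "Suc m"] by simp
  have d\<zeta>: "C1c S (pderiv_at l \<zeta>)" "pderiv_at l \<zeta> \<in> test_fun W" for l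
   using C1c_pderiv_0[OF S(1)] C1c_compact[OF S(1)]
   by (auto intro!: smooth_imp_C1c[OF smooth] test_funI[OF smooth _ _ S(2)])
  let ?e = "axis i 1 :: real^'n"
  let ?q = "%w n x. (w (x + step n *\<^sub>R ?e) - w x) / step n"
  have "(%n. LBINT x. ?q v n x * pderiv_at j \<zeta> x) \<longlonglongrightarrow> - (LBINT x. v x * pderiv_at i (pderiv_at j \<zeta>) x)"
   by (rule difference_quotient_tendsto_weakly[OF W wderivD(1)[OF d(1)] d\<zeta>(1) S(2)])
  then have "(%n. LBINT x. ?q v n x * pderiv_at j \<zeta> x) \<longlonglongrightarrow> - (LBINT x. h x * \<zeta> x)"
   using wderivD(5)[OF d(1) d\<zeta>(2)] wderivD(5)[OF h(1) \<zeta>] by simp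
  moreover have "\<forall>\<^sub>F n in sequentially. (LBINT x. ?q v n x * pderiv_at j \<zeta> x)
    = - (LBINT x. ?q d\<^sub>j n x * \<zeta> x)"
  proof -
   obtain r where r: "r > 0" "thicken r S \<subseteq> W"
    using thicken_subset_open[OF C1c_compact[OF S(1)] W S(2)] .
   show ?thesis
    using eventually_step_less[OF r(1)]
   proof eventually_elim
    case (elim n)
    have e: "0 <= r" "norm (step n *\<^sub>R ?e) <= r" using elim r(1) step_pos[of n] by auto
    show ?case
     using difference_quotient_adjoint(2)[OF wderivD(1)[OF d(1)] d\<zeta>(1) r(2) e, of j]
      difference_quotient_adjoint(2)[OF wderivD(1)[OF h(2)] S(1) r(2) e]
      translation_adjoint_pderiv[OF W d(2) v S(1) r(2) e]
     by simp
   qed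
  qed
  ultimately have "(%n. - (LBINT x. ?q d\<^sub>j n x * \<zeta> x)) \<longlonglongrightarrow> - (LBINT x. h x * \<zeta> x)"
   by (rule Lim_transform_eventually)
  moreover have "(%n. - (LBINT x. ?q d\<^sub>j n x * \<zeta> x)) \<longlonglongrightarrow> - (LBINT x. h' x * \<zeta> x)"
   using tendsto_minus[OF difference_quotient_tendsto_weakly[OF W wderivD(1)[OF h(2)] S(1,2),
     of i]]
    wderivD(5)[OF h(2) \<zeta>] by simp
  ultimately show ?thesis using LIMSEQ_unique by fastforce
 qed
 have "AE x\<in>W in lborel. h x - h' x = 0"
 proof (rule fundamental_lemma[OF W locally_integrable_diff[OF wderivD(2)[OF h(1)] wderivD(2)[OF
   h(2)]]])
  fix \<zeta> assume \<zeta>: "\<zeta> \<in> test_fun W"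
  obtain S where S: "C1c S \<zeta>" "S \<subseteq> W" by (rule test_funE[OF \<zeta>]) blast
  show "(LBINT x. (h x - h' x) * \<zeta> x) = 0"
   using eq[OF \<zeta>] locally_integrable_mult_C1c(1)[OF wderivD(2)[OF h(1)] S]
    locally_integrable_mult_C1c(1)[OF wderivD(2)[OF h(2)] S]
   by (simp add: left_diff_distrib)
 qed
 then show ?thesis by eventually_elim simp
qed

section \<open>The local problem\<close>

lemma powr_ge_min:
 fixes r s \<alpha> \<beta> :: real
 assumes "0 < \<alpha>" "\<alpha> <= s" "s <= \<beta>"
 shows "min (\<alpha> powr r) (\<beta> powr r) <= s powr r"
proof (cases "r >= 0")
 case True then have "\<alpha> powr r <= s powr r" using assms by (intro powr_mono2) auto
 then show ?thesis by linarith
next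
 case False then have "\<beta> powr r <= s powr r" using assms by (intro powr_mono2') auto
 then show ?thesis by linarith
qed

lemma real_C1_lipschitz:
 fixes g g' :: "real => real"
 assumes "!!t. t \<in> {a..b} ==> (g has_real_derivative g' t) (at t within {a..b})"
   "continuous_on {a..b} g'"
 obtains L where "L > 0" "!!s t. s \<in> {a..b} ==> t \<in> {a..b} ==> \<bar>g s - g t\<bar> <= L * \<bar>s - t\<bar>"
proof -
 have "bounded (g' ` {a..b})" using assms(2)
  by (intro compact_imp_bounded compact_continuous_image) auto
 then obtain L where L: "L > 0" "!!t. t \<in> {a..b} ==> \<bar>g' t\<bar> <= L" by (auto simp: bounded_pos)
 show ?thesis
 proof (rule that[OF L(1)])
  fix s t assume "s \<in> {a..b}" "t \<in> {a..b}"
  then have "norm (g s - g t) <= L * norm (s - t)"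
   by (intro field_differentiable_bound[where S = "{a..b}" and f' = g']) (use assms(1) L in
   auto)
  then show "\<bar>g s - g t\<bar> <= L * \<bar>s - t\<bar>" by simp
 qed
qed

locale local_solution = fixes U :: "(real^'n) set" and u :: "real^'n => real" and A B B' :: "real => real"
  and G :: "real^'n => real" and p c2 m M CB :: real
 assumes U: "open U"
  and u_diff: "x \<in> U ==> u differentiable (at x)" and u_cont: "continuous_on U (grad u)"
  and A_pos: "t > 0 ==> A t > 0" and A_diff: "t > 0 ==> A differentiable (at t)"
  and A_cont: "continuous_on {0<..} (deriv A)" and A_mono: "mono_on {0<..} (%t. t * A t)"
  and c2: "c2 > 0" and A_ell: "eta \<noteq> 0 \<or> eta' \<noteq> 0 ==>
   (A (norm eta) *\<^sub>R eta - A (norm eta') *\<^sub>R eta') \<bullet> (eta - eta')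
    >= c2 * (norm eta + norm eta') powr (p - 2) * (norm (eta - eta' :: real^'n))\<^sup>2"
  and m: "- 1 < m" and A_m: "t > 0 ==> m <= t * deriv A t / A t"
  and A_M: "t > 0 ==> t * deriv A t / A t <= M"
  and B_nonneg: "t >= 0 ==> B t >= 0" and B_0: "B 0 = 0"
  and B_der: "t >= 0 ==> (B has_real_derivative B' t) (at t within {0..})"
  and B_cont: "continuous_on {0..} B'" and CB: "CB > 0" and B_le: "t > 0 ==> B' t <= CB * (t * A t)"
  and G_meas: "G \<in> borel_measurable borel"
  and G_bd: "compact K ==> K \<subseteq> U ==> \<exists>L>0. AE x\<in>K in lborel. \<bar>G x\<bar> <= L"
  and G_lip: "compact K ==> K \<subseteq> U ==> \<exists>L>0. \<exists>\<delta>>0. \<forall>i h. 0 < h \<and> h < \<delta> -->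
   (AE x\<in>K in lborel. \<bar>G (x + h *\<^sub>R axis i 1) - G x\<bar> <= L * h)"
  and G_pos: "compact K ==> K \<subseteq> U ==> \<exists>c>0. AE x\<in>K in lborel. c <= G x"
  and equation: "phi \<in> test_fun U ==>
   (LBINT x. A (norm (grad u x)) * (grad u x \<bullet> grad phi x)) + (LBINT x. B (norm (grad u x)) * phi x)
    = (LBINT x. G x * phi x)"
begin

definition D :: "real^'n => real^'n" where "D x = (if x \<in> U then grad u x else 0)"
definition a :: "real^'n => real^'n" where "a eta = A (norm eta) *\<^sub>R eta"
definition \<beta> :: "real^'n => real" where "\<beta> eta = B (norm eta)"

lemma D_U: "x \<in> U ==> D x = grad u x" by (simp add: D_def)

lemma D_cont: "continuous_on U D"
 using u_cont by (rule continuous_on_cong[THEN iffD1, rotated 2]) (auto simp: D_U)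

lemma D_nth_cont: "continuous_on U (%x. D x $ i)" by (intro continuous_intros D_cont)

lemma D_meas[measurable]: "D \<in> borel_measurable borel"
proof -
 have "D = (%x. indicator U x *\<^sub>R grad u x)" by (auto simp: D_def)
 then show ?thesis using borel_measurable_continuous_on_indicator[OF _ u_cont] U by simp
qed

lemma D_nth_meas[measurable]: "(%x. D x $ i) \<in> borel_measurable borel"
 by (rule borel_measurable_vec_nth[OF D_meas])

lemma D_bound:
 assumes "compact K" "K \<subseteq> U"
 obtains R where "R > 0" "!!x. x \<in> K ==> norm (D x) <= R"
proof -
 have "bounded (D ` K)" by (intro compact_imp_bounded compact_continuous_image
   continuous_on_subset[OF D_cont] assms)
 then show ?thesis using that by (auto simp: bounded_pos)
qed

lemma A_isCont: "t > 0 ==> isCont A t"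
 using A_diff differentiable_imp_continuous_within by blast

lemma A_contOn: "continuous_on {0<..} A" by (intro continuous_at_imp_continuous_on) (auto intro:
  A_isCont)

lemma A_DERIV: "t > 0 ==> (A has_real_derivative deriv A t) (at t)"
 using A_diff real_differentiable_def DERIV_deriv_iff_real_differentiable by blast

lemma tA_mono: "0 < s ==> s <= t ==> s * A s <= t * A t"
 using A_mono by (auto simp: mono_on_def)

text \<open>By the lower bound \<^term>\<open>m\<close> for \<^term>\<open>t * deriv A t / A t\<close>, the function
 \<^term>\<open>A t * t powr (- m)\<close> is nondecreasing.\<close>
lemma A_le_powr:
 assumes t: "0 < t" "t <= 1"
 shows "A t <= A 1 * t powr m"
proof -
 have "A t * t powr (- m) <= A 1 * 1 powr (- m)"
 proof (rule DERIV_nonneg_imp_nondecreasing[OF t(2)])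
  fix s assume "t <= s" "s <= 1"
  then have s: "s > 0" using t by simp
  have "((%s. A s * s powr (- m)) has_real_derivative
    deriv A s * s powr (- m) + A s * (- m * s powr (- m - 1))) (at s)"
   using s by (auto intro!: derivative_eq_intros A_DERIV)
  moreover have "deriv A s * s powr (- m) + A s * (- m * s powr (- m - 1))
    = A s * s powr (- m - 1) * (s * deriv A s / A s - m)"
   using s A_pos[OF s] by (simp add: powr_diff field_simps)
  ultimately show "\<exists>y. ((%s. A s * s powr (- m)) has_real_derivative y) (at s) \<and> 0 <= y"
   using A_m[OF s] A_pos[OF s] by auto
 qed
 then show ?thesis using t by (simp add: powr_minus field_simps)
qed

lemma a_cont: "continuous_on S a"
proof -
 have "isCont a eta" for eta
 proof (cases "eta = 0")
  case False
  have "isCont (%eta. A (norm eta)) eta"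
   by (rule isCont_o2[where g = A and f = norm]) (use False A_isCont in simp_all)
  from continuous_scaleR[OF this continuous_ident] show ?thesis by (simp add: a_def[abs_def])
 next
  case True
  have "((%eta::real^'n. norm eta powr (1 + m)) \<longlongrightarrow> 0) (at 0)"
   by (rule tendsto_zero_powrI[of norm _ "%_. 1 + m" "1 + m"])
    (use m in \<open>auto intro: tendsto_norm_zero tendsto_ident_at\<close>)
  from tendsto_mult_right_zero[OF this, of "A 1"] have "(a \<longlongrightarrow> 0) (at 0)"
  proof (rule Lim_null_comparison[rotated])
   show "\<forall>\<^sub>F eta in at 0. norm (a eta) <= A 1 * norm eta powr (1 + m)"
    using eventually_at_ball'[of 1 "0 :: real^'n" UNIV, OF zero_less_one]
   proof eventually_elim
    case (elim eta)
    then show ?case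
     using A_le_powr[of "norm eta"] A_pos[of "norm eta"] by (simp add: a_def powr_add)
   qed
  qed
  then show ?thesis using True by (simp add: isCont_def a_def)
 qed
 then show ?thesis by (auto intro: continuous_at_imp_continuous_on)
qed

lemma a_meas[measurable]: "a \<in> borel_measurable borel"
 by (rule borel_measurable_continuous_onI[OF a_cont])

lemma B_contOn: "continuous_on {0..} B"
 using B_der by (meson DERIV_continuous_on atLeast_iff)

lemma \<beta>_cont: "continuous_on S \<beta>"
 unfolding \<beta>_def[abs_def] by (intro continuous_on_compose2[OF B_contOn] continuous_intros) auto

lemma \<beta>_meas[measurable]: "\<beta> \<in> borel_measurable borel"
 by (rule borel_measurable_continuous_onI[OF \<beta>_cont])

lemma B_lipschitz:
 obtains L where "L > 0" "!!s t. 0 <= s ==> s <= R ==> 0 <= t ==> t <= R ==> \<bar>B s - B t\<bar> <= L * \<bar>s - t\<bar>"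
proof -
 obtain L where L: "L > 0" "!!s t. s \<in> {0..R} ==> t \<in> {0..R} ==> \<bar>B s - B t\<bar> <= L * \<bar>s - t\<bar>"
 proof (rule real_C1_lipschitz[of 0 R B B'])
  show "(B has_real_derivative B' t) (at t within {0..R})" if "t \<in> {0..R}" for t
   using DERIV_subset[OF B_der] that by auto
 qed (use continuous_on_subset[OF B_cont] in auto)
 show ?thesis by (rule that[OF L(1)]) (use L(2) in auto)
qed

lemma \<beta>_lipschitz:
 obtains L where "L > 0" "!!eta eta'. norm eta <= R ==> norm eta' <= R ==> \<bar>\<beta> eta - \<beta> eta'\<bar>
  <= L * norm (eta - eta')"
proof -
 obtain L where L: "L > 0" "!!s t. 0 <= s ==> s <= R ==> 0 <= t ==> t <= R ==> \<bar>B s - B t\<bar> <= L * \<bar>s - t\<bar>"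
  by (rule B_lipschitz[of R]) blast
 show ?thesis
 proof (rule that[OF L(1)])
  fix eta eta' :: "real^'n" assume "norm eta <= R" "norm eta' <= R"
  then have "\<bar>\<beta> eta - \<beta> eta'\<bar> <= L * \<bar>norm eta - norm eta'\<bar>" unfolding \<beta>_def by (intro L(2)) auto
  also have "... <= L * norm (eta - eta')" using norm_triangle_ineq3 L(1)
   by (intro mult_left_mono) auto
  finally show "\<bar>\<beta> eta - \<beta> eta'\<bar> <= L * norm (eta - eta')" .
 qed
qed

lemma a_lipschitz:
 assumes "eps > 0" "eps <= R"
 obtains L where "L > 0" "!!eta eta'. eps <= norm eta ==> norm eta <= R ==> eps <= norm eta' ==>
  norm eta' <= R ==> norm (a eta - a eta') <= L * norm (eta - eta')"
proof -
 obtain L where L: "L > 0" "!!s t. s \<in> {eps..R} ==> t \<in> {eps..R} ==> \<bar>A s - A t\<bar> <= L * \<bar>s - t\<bar>"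
 proof (rule real_C1_lipschitz[of eps R A "deriv A"])
  show "(A has_real_derivative deriv A t) (at t within {eps..R})" if "t \<in> {eps..R}" for t
   using A_DERIV[of t] that assms by (auto intro: DERIV_subset)
 qed (rule continuous_on_subset[OF A_cont], use assms in auto)
 have RA: "R * A R > 0" using assms A_pos[of R] by simp
 show ?thesis
 proof (rule that[of "R * A R / eps + L * R"])
  show "R * A R / eps + L * R > 0" using RA assms L by (simp add: add_pos_pos)
  fix eta eta' :: "real^'n" assume n: "eps <= norm eta" "norm eta <= R" "eps <= norm eta'" "norm eta' <= R"
  have An: "A (norm eta) > 0" using n(1) assms(1) by (intro A_pos) linarith
  have "a eta - a eta' = A (norm eta) *\<^sub>R (eta - eta') + (A (norm eta) - A (norm eta')) *\<^sub>R eta'"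
   by (simp add: a_def algebra_simps)
  then have "norm (a eta - a eta') <= \<bar>A (norm eta)\<bar> * norm (eta - eta') + \<bar>A (norm eta) - A (norm eta')\<bar> *
    norm eta'"
   by (metis norm_triangle_ineq norm_scaleR)
  also have "\<bar>A (norm eta)\<bar> * norm (eta - eta') <= R * A R / eps * norm (eta - eta')"
  proof (rule mult_right_mono)
   have "eps * A (norm eta) <= norm eta * A (norm eta)" using n An by (intro mult_right_mono) auto
   also have "... <= R * A R" using n assms by (intro tA_mono) auto
   finally show "\<bar>A (norm eta)\<bar> <= R * A R / eps" using An assms by (simp add: field_simps)
  qed simp
  also have "\<bar>A (norm eta) - A (norm eta')\<bar> * norm eta' <= (L * norm (eta - eta')) * R"
  proof (rule mult_mono)
   have "\<bar>A (norm eta) - A (norm eta')\<bar> <= L * \<bar>norm eta - norm eta'\<bar>" using n by (intro L(2)) auto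
   also have "... <= L * norm (eta - eta')" using norm_triangle_ineq3 L(1)
    by (intro mult_left_mono) auto
   finally show "\<bar>A (norm eta) - A (norm eta')\<bar> <= L * norm (eta - eta')" .
  qed (use n L in auto)
  finally show "norm (a eta - a eta') <= (R * A R / eps + L * R) * norm (eta - eta')"
   by (simp add: algebra_simps)
 qed
qed

lemma a_monotone:
 assumes "eps > 0" "eps <= R"
 obtains c where "c > 0" "!!eta eta'. eps <= norm eta ==> norm eta <= R ==> eps <= norm eta' ==>
  norm eta' <= R ==> c * (norm (eta - eta'))\<^sup>2 <= (a eta - a eta') \<bullet> (eta - eta')"
proof (rule that)
 let ?c = "c2 * min ((2 * eps) powr (p - 2)) ((2 * R) powr (p - 2))"
 show "?c > 0" using c2 assms by simp
 fix eta eta' :: "real^'n" assume n: "eps <= norm eta" "norm eta <= R" "eps <= norm eta'" "norm eta' <= R"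
 have "?c * (norm (eta - eta'))\<^sup>2 <= c2 * (norm eta + norm eta') powr (p - 2) * (norm (eta - eta'))\<^sup>2"
  using n assms c2 by (intro mult_right_mono mult_left_mono powr_ge_min) auto
 also have "... <= (a eta - a eta') \<bullet> (eta - eta')"
  unfolding a_def by (rule A_ell) (use n assms in auto)
 finally show "?c * (norm (eta - eta'))\<^sup>2 <= (a eta - a eta') \<bullet> (eta - eta')" .
qed

lemma G_locally_integrable: "locally_integrable U G"
 unfolding locally_integrable_def
proof (intro conjI allI impI G_meas)
 fix K assume K: "compact K \<and> K \<subseteq> U"
 note [measurable] = G_meas borel_compact[OF conjunct1[OF K]]
 obtain L where L: "AE x\<in>K in lborel. \<bar>G x\<bar> <= L" using G_bd K by blast
 show "set_integrable lborel K G"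
  unfolding set_integrable_def
  by (rule integrable_bounded_compact[of K _ L]) (use K L in \<open>auto elim: eventually_mono\<close>)
qed

lemma locally_integrable_compose_D: "continuous_on UNIV k ==> locally_integrable U (%x. k (D x))"
 using continuous_on_compose2[OF _ D_cont] borel_measurable_continuous_onI
 by (intro locally_integrable_continuous measurable_compose[OF D_meas]) auto

definition lower_order :: "real^'n => real" where
 "lower_order x = \<beta> (D x) - G x"

lemma lower_order_locally_integrable: "locally_integrable U lower_order"
 unfolding lower_order_def[abs_def]
 by (intro locally_integrable_diff G_locally_integrable locally_integrable_compose_D \<beta>_cont)

lemma equation_W11c:
 assumes "W11c S phi \<Phi>" "S \<subseteq> U"
 shows "integrable lborel (%x. a (D x) \<bullet> \<Phi> x)" "integrable lborel (%x. lower_order x * phi x)"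
  "(LBINT x. a (D x) \<bullet> \<Phi> x) + (LBINT x. lower_order x * phi x) = 0"
proof -
 have "(LBINT x. a (D x) \<bullet> grad \<zeta> x) + (LBINT x. lower_order x * \<zeta> x) = 0" if \<zeta>: "\<zeta> \<in> test_fun U"
   for \<zeta>
 proof -
  obtain S where S: "C1c S \<zeta>" "S \<subseteq> U" by (rule test_funE[OF \<zeta>]) blast
  have "(LBINT x. a (D x) \<bullet> grad \<zeta> x) = (LBINT x. A (norm (grad u x)) * (grad u x \<bullet> grad \<zeta> x))"
   using C1c_grad_0[OF S(1)] S(2)
   by (intro Bochner_Integration.integral_cong refl) (auto simp: a_def D_def subset_eq)
  moreover have "(LBINT x. \<beta> (D x) * \<zeta> x) = (LBINT x. B (norm (grad u x)) * \<zeta> x)"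
   using C1c_zero[OF S(1)] S(2)
   by (intro Bochner_Integration.integral_cong refl) (auto simp: \<beta>_def D_def subset_eq)
  moreover have "(LBINT x. lower_order x * \<zeta> x) = (LBINT x. \<beta> (D x) * \<zeta> x) - (LBINT x. G x * \<zeta>
    x)"
   using locally_integrable_mult_C1c(1)[OF locally_integrable_compose_D[OF \<beta>_cont] S]
    locally_integrable_mult_C1c(1)[OF G_locally_integrable S]
   by (simp add: lower_order_def left_diff_distrib)
  ultimately show ?thesis using equation[OF \<zeta>] by simp
 qed
 note * = weak_equation_extends_to_W11c[OF U _ _ lower_order_locally_integrable this assms]
 show "integrable lborel (%x. a (D x) \<bullet> \<Phi> x)" "integrable lborel (%x. lower_order x * phi x)"
  "(LBINT x. a (D x) \<bullet> \<Phi> x) + (LBINT x. lower_order x * phi x) = 0"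
  by (rule *; auto intro!: continuous_on_compose2[OF a_cont[of UNIV] D_cont])+
qed

lemma difference_equation:
 assumes W: "W11c S phi \<Phi>" and S: "S \<subseteq> U" "(%x. x + c) ` S \<subseteq> U"
 shows "integrable lborel (%x. (a (D (x + c)) - a (D x)) \<bullet> \<Phi> x)"
  "integrable lborel (%x. (lower_order (x + c) - lower_order x) * phi x)"
  "(LBINT x. (a (D (x + c)) - a (D x)) \<bullet> \<Phi> x)
   + (LBINT x. (lower_order (x + c) - lower_order x) * phi x) = 0"
proof -
 note here = equation_W11c[OF W S(1)] and there = equation_W11c[OF W11c_translate[OF W] S(2)]
 have shifted: "integrable lborel (%x. a (D (x + c)) \<bullet> \<Phi> x)" "integrable lborel (%x. lower_order
   (x + c) * phi x)"
  using lborel_integrable_shift[OF there(1), of c] lborel_integrable_shift[OF there(2), of c]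
   by simp_all
 show "integrable lborel (%x. (a (D (x + c)) - a (D x)) \<bullet> \<Phi> x)"
  "integrable lborel (%x. (lower_order (x + c) - lower_order x) * phi x)"
  unfolding inner_diff_left left_diff_distrib
  by (intro Bochner_Integration.integrable_diff shifted here(1,2))+
 have "(LBINT x. a (D (x + c)) \<bullet> \<Phi> x) = (LBINT x. a (D x) \<bullet> \<Phi> (x - c))"
  using lborel_integral_shift[OF borel_measurable_integrable[OF there(1), unfolded
    measurable_lborel2], of c]
  by (simp only: add_diff_cancel_right')
 moreover have "(LBINT x. lower_order (x + c) * phi x) = (LBINT x. lower_order x * phi (x - c))"
  using lborel_integral_shift[OF borel_measurable_integrable[OF there(2), unfolded
    measurable_lborel2], of c]
  by (simp only: add_diff_cancel_right')
 moreover have "(LBINT x. (a (D (x + c)) - a (D x)) \<bullet> \<Phi> x)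
   = (LBINT x. a (D (x + c)) \<bullet> \<Phi> x) - (LBINT x. a (D x) \<bullet> \<Phi> x)"
  unfolding inner_diff_left by (rule Bochner_Integration.integral_diff[OF shifted(1) here(1)])
 moreover have "(LBINT x. (lower_order (x + c) - lower_order x) * phi x)
   = (LBINT x. lower_order (x + c) * phi x) - (LBINT x. lower_order x * phi x)"
  unfolding left_diff_distrib by (rule Bochner_Integration.integral_diff[OF shifted(2) here(2)])
 ultimately show "(LBINT x. (a (D (x + c)) - a (D x)) \<bullet> \<Phi> x)
   + (LBINT x. (lower_order (x + c) - lower_order x) * phi x) = 0"
  using here(3) there(3) by linarith
qed

end

section \<open>Second derivatives off the critical set\<close>

lemma young_quadratic:
 fixes c x y :: real
 assumes "c > 0"
 shows "x * y <= c / 2 * y\<^sup>2 + x\<^sup>2 / (2 * c)"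
proof -
 have "0 <= (c * y - x)\<^sup>2 / (2 * c)" using assms by simp
 also have "... = c / 2 * y\<^sup>2 - x * y + x\<^sup>2 / (2 * c)"
  using assms by (simp add: power2_diff power_mult_distrib field_simps power2_eq_square)
 finally show ?thesis by linarith
qed

text \<open>The pointwise form of the Caccioppoli estimate: \<^term>\<open>\<delta>a\<close>, \<^term>\<open>\<delta>b\<close> and \<^term>\<open>\<delta>g\<close> are the
 increments of the principal part, of the gradient term and of the right-hand side, \<^term>\<open>\<delta>\<close> is the
 increment of the gradient over a step \<^term>\<open>h\<close>, and \<^term>\<open>w\<close> is the difference quotient of the
 solution.\<close>
lemma caccioppoli_pointwise:
 fixes \<delta> \<delta>a P :: "real^'n" and \<delta>b \<delta>g psi w c L Lb Lg R Q h :: real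
 assumes monotone: "c * (norm \<delta>)\<^sup>2 <= \<delta>a \<bullet> \<delta>" and lipschitz: "norm \<delta>a <= L * norm \<delta>"
   "\<bar>\<delta>b\<bar> <= Lb * norm \<delta>"
  and \<delta>g: "\<bar>\<delta>g\<bar> <= Lg * h" and w: "\<bar>w\<bar> <= R" and psi: "0 <= psi" "psi <= 1" "norm P <= C"
  and pos: "0 < c" "0 <= L" "0 <= Lb" "0 <= R" "0 < h" and Q: "Q = 2 * R * L * C + Lb * R"
 shows "c / (2 * h) * (psi\<^sup>2 * (norm \<delta>)\<^sup>2) - (Q\<^sup>2 / (2 * c) + Lg * R) * h
  <= \<delta>a \<bullet> ((psi\<^sup>2 / h) *\<^sub>R \<delta> + (2 * psi * w) *\<^sub>R P) + (\<delta>b - \<delta>g) * (psi\<^sup>2 * w)"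
proof -
 define s where "s = psi * norm \<delta>"
 have psi2: "\<bar>psi\<^sup>2\<bar> <= 1" "psi\<^sup>2 <= psi" using psi by (auto simp: power2_eq_square mult_left_le mult_le_one)
 have "psi\<^sup>2 / h * (c * (norm \<delta>)\<^sup>2) <= psi\<^sup>2 / h * (\<delta>a \<bullet> \<delta>)" using pos
  by (intro mult_left_mono monotone) auto
 then have principal: "c * s\<^sup>2 / h <= psi\<^sup>2 / h * (\<delta>a \<bullet> \<delta>)"
  by (simp add: s_def power_mult_distrib mult_ac)
 have "\<bar>\<delta>a \<bullet> P\<bar> <= norm \<delta>a * norm P" by (rule Cauchy_Schwarz_ineq2)
 also have "... <= (L * norm \<delta>) * C" using pos by (intro mult_mono lipschitz psi) auto
 finally have "\<bar>w\<bar> * \<bar>\<delta>a \<bullet> P\<bar> <= R * (L * norm \<delta> * C)" using w pos by (intro mult_mono) auto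
 then have "2 * psi * (\<bar>w\<bar> * \<bar>\<delta>a \<bullet> P\<bar>) <= 2 * psi * (R * (L * norm \<delta> * C))" using psi
  by (intro mult_left_mono) auto
 then have cutoff: "\<bar>2 * psi * w * (\<delta>a \<bullet> P)\<bar> <= (2 * R * L * C) * s"
  using psi by (simp add: abs_mult s_def mult_ac)
 have "\<bar>\<delta>b\<bar> * (\<bar>psi\<^sup>2\<bar> * \<bar>w\<bar>) <= (Lb * norm \<delta>) * (psi * R)"
  using lipschitz(2) w psi psi2 pos by (intro mult_mono) auto
 then have gradient_term: "\<bar>\<delta>b * (psi\<^sup>2 * w)\<bar> <= (Lb * R) * s" by (simp add: abs_mult s_def mult_ac)
 have "\<bar>\<delta>g\<bar> * (\<bar>psi\<^sup>2\<bar> * \<bar>w\<bar>) <= (Lg * h) * (1 * R)"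
  using \<delta>g w psi2 pos order_trans[OF abs_ge_zero \<delta>g] by (intro mult_mono) auto
 then have right_hand_side: "\<bar>\<delta>g * (psi\<^sup>2 * w)\<bar> <= Lg * R * h" by (simp add: abs_mult mult_ac)
 have "c / 2 * s\<^sup>2 / h - Q\<^sup>2 / (2 * c) * h = c * s\<^sup>2 / h - (c / h / 2 * s\<^sup>2 + Q\<^sup>2 / (2 * (c / h)))"
  using pos by (simp add: field_simps)
 also have "... <= c * s\<^sup>2 / h - Q * s" by (intro diff_left_mono young_quadratic) (use pos in simp)
 also have "... <= psi\<^sup>2 / h * (\<delta>a \<bullet> \<delta>) + 2 * psi * w * (\<delta>a \<bullet> P) + \<delta>b * (psi\<^sup>2 * w)"
  using principal abs_le_D2[OF cutoff] abs_le_D2[OF gradient_term] unfolding Q distrib_right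
   by linarith
 finally show ?thesis
  using abs_le_D1[OF right_hand_side]
  by (simp add: inner_add_right s_def power_mult_distrib distrib_right left_diff_distrib)
qed

context local_solution
begin

definition V :: "(real^'n) set" where "V = {x \<in> U. D x \<noteq> 0}"

lemma V_open: "open V"
proof -
 have "open (U \<inter> D -` (- {0}))" by (rule continuous_open_preimage[OF D_cont U]) auto
 moreover have "U \<inter> D -` (- {0}) = V" by (auto simp: V_def)
 ultimately show ?thesis by simp
qed

lemma V_subset: "V \<subseteq> U" by (auto simp: V_def)

lemma V_meas[measurable]: "V \<in> sets borel" using V_open by simp

lemma D_nondegenerate:
 assumes K: "compact K" "K \<subseteq> V"
 obtains eps R where "0 < eps" "eps <= R" "!!x. x \<in> K ==> eps <= norm (D x)" "!!x. x \<in> K ==> norm (D x) <= R"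
proof (cases "K = {}")
 case False
 have cont: "continuous_on K (%x. norm (D x))"
  using K(2) V_subset by (intro continuous_intros continuous_on_subset[OF D_cont]) auto
 obtain x where x: "x \<in> K" "!!y. y \<in> K ==> norm (D x) <= norm (D y)"
  using continuous_attains_inf[OF K(1) False cont] by blast
 obtain y where y: "y \<in> K" "!!x. x \<in> K ==> norm (D x) <= norm (D y)"
  using continuous_attains_sup[OF K(1) False cont] by blast
 show ?thesis by (rule that[of "norm (D x)" "norm (D y)"]) (use x y K(2) in \<open>auto simp: V_def\<close>)
qed (auto intro: that[of 1 1])

definition u_quotient :: "real => 'n => real^'n => real" where
 "u_quotient h i x = (u (x + h *\<^sub>R axis i 1) - u x) / h"

lemma u_quotient_GDERIV:
 assumes "x \<in> U" "x + h *\<^sub>R axis i 1 \<in> U"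
 shows "GDERIV (u_quotient h i) x :> (1 / h) *\<^sub>R (D (x + h *\<^sub>R axis i 1) - D x)"
proof -
 have "GDERIV (%x. (1 / h) * (u (x + h *\<^sub>R axis i 1) - u x)) x :>
   (1 / h) *\<^sub>R (D (x + h *\<^sub>R axis i 1) - D x) + (u (x + h *\<^sub>R axis i 1) - u x) *\<^sub>R 0"
  unfolding D_U[OF assms(1)] D_U[OF assms(2)] by (intro GDERIV_mult GDERIV_const GDERIV_diff
    GDERIV_translate[OF GDERIV_grad] GDERIV_grad u_diff assms)
 then show ?thesis by (simp add: u_quotient_def[abs_def])
qed

lemma u_quotient_bound:
 assumes "h > 0" "!!t. t \<in> {0..h} ==> x + t *\<^sub>R axis i 1 \<in> U \<and> norm (D (x + t *\<^sub>R axis i 1)) <= R"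
 shows "\<bar>u_quotient h i x\<bar> <= R"
proof -
 obtain z where z: "0 < z" "z < h" "u (x + h *\<^sub>R axis i 1) - u x = h * (axis i 1 \<bullet> grad u (x
   + z *\<^sub>R axis i 1))"
  by (rule mvt_direction[OF assms(1)]) (use assms(2) u_diff in auto)
 have "\<bar>u_quotient h i x\<bar> = \<bar>axis i 1 \<bullet> D (x + z *\<^sub>R axis i 1)\<bar>"
  using z assms D_U[of "x + z *\<^sub>R axis i 1"] by (simp add: u_quotient_def abs_mult)
 also have "... <= norm (axis i (1::real)) * norm (D (x + z *\<^sub>R axis i 1))"
  by (rule Cauchy_Schwarz_ineq2)
 also have "... <= R" using assms(2)[of z] z by simp
 finally show ?thesis .
qed

lemma u_quotient_test:
 fixes i :: 'n
 assumes psi: "C1c S psi" and thick: "thicken r S \<subseteq> U" and h: "0 < h" "h < r"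
 defines "e \<equiv> axis i 1 :: real^'n"
 shows "C1c S (%x. (psi x)\<^sup>2 * u_quotient h i x)"
  "x \<in> S ==> grad (%x. (psi x)\<^sup>2 * u_quotient h i x) x
   = ((psi x)\<^sup>2 / h) *\<^sub>R (D (x + h *\<^sub>R e) - D x) + (2 * psi x * u_quotient h i x) *\<^sub>R grad psi x"
proof -
 define W where "W = U \<inter> (%x. x + h *\<^sub>R e) -` U"
 have W: "open W" unfolding W_def
  by (intro open_Int U open_vimage[OF U] continuous_intros)
 have SW: "S \<subseteq> W"
  using thick h thickenI[of _ S _ r] by (force simp: W_def e_def)
 let ?G = "%x. (psi x)\<^sup>2 *\<^sub>R ((1 / h) *\<^sub>R (D (x + h *\<^sub>R e) - D x)) + (2 * psi x * u_quotient h i x)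
   *\<^sub>R grad psi x"
 have quotient: "GDERIV (u_quotient h i) x :> (1 / h) *\<^sub>R (D (x + h *\<^sub>R e) - D x)" if "x \<in> W"
   for x
  unfolding e_def by (rule u_quotient_GDERIV) (use that in \<open>auto simp: W_def e_def\<close>)
 have "GDERIV (%x. (psi x)\<^sup>2 * u_quotient h i x) x :> ?G x" if "x \<in> W" for x
  by (rule GDERIV_power2_mult[OF C1c_GDERIV[OF psi] quotient[OF that]])
 moreover have "continuous_on W (u_quotient h i)"
  using quotient by (intro differentiable_imp_continuous_on) (auto simp: GDERIV_iff_grad)
 then have "continuous_on W ?G"
  by (intro continuous_intros continuous_on_compose2[OF D_cont] C1c_continuous[OF psi]
    C1c_continuous_grad[OF psi]) (auto simp: W_def)
 moreover have "(psi x)\<^sup>2 * u_quotient h i x = 0" if "x \<notin> S" for x using C1c_zero[OF psi that]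
  by simp
 ultimately have C1c: "C1c S (%x. (psi x)\<^sup>2 * u_quotient h i x)"
  and grad: "!!x. x \<in> W ==> grad (%x. (psi x)\<^sup>2 * u_quotient h i x) x = ?G x"
  using C1cI[OF C1c_compact[OF psi] W SW, of "%x. (psi x)\<^sup>2 * u_quotient h i x" ?G] by blast+
 show "C1c S (%x. (psi x)\<^sup>2 * u_quotient h i x)" by (rule C1c)
 show "x \<in> S ==> grad (%x. (psi x)\<^sup>2 * u_quotient h i x) x
   = ((psi x)\<^sup>2 / h) *\<^sub>R (D (x + h *\<^sub>R e) - D x) + (2 * psi x * u_quotient h i x) *\<^sub>R grad psi x"
  using grad SW by auto
qed

definition nondegenerate_increments ::
  "(real^'n) set => real => real => real => real => real => bool" where
 "nondegenerate_increments S r R c L Lb \<longleftrightarrow> 0 < R \<and> 0 < c \<and> 0 < L \<and> 0 < Lb \<and>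
  (\<forall>x\<in>S. \<forall>e. norm e <= r --> x + e \<in> U \<and> norm (D (x + e)) <= R \<and>
   c * (norm (D (x + e) - D x))\<^sup>2 <= (a (D (x + e)) - a (D x)) \<bullet> (D (x + e) - D x) \<and>
   norm (a (D (x + e)) - a (D x)) <= L * norm (D (x + e) - D x) \<and>
   \<bar>\<beta> (D (x + e)) - \<beta> (D x)\<bar> <= Lb * norm (D (x + e) - D x))"

lemma ex_nondegenerate_increments:
 assumes S: "compact S" "thicken r S \<subseteq> V" and r: "0 <= r"
 obtains R c L Lb where "nondegenerate_increments S r R c L Lb"
proof -
 obtain eps R where epsR: "0 < eps" "eps <= R" "!!x. x \<in> thicken r S ==> eps <= norm (D x)"
  "!!x. x \<in> thicken r S ==> norm (D x) <= R"
  by (rule D_nondegenerate[OF compact_thicken[OF S(1)] S(2)]) auto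
 obtain L where L: "L > 0" "!!eta eta'. eps <= norm eta ==> norm eta <= R ==> eps <= norm eta' ==>
  norm eta' <= R ==> norm (a eta - a eta') <= L * norm (eta - eta')"
  by (rule a_lipschitz[OF epsR(1,2)]) blast
 obtain c where c: "c > 0" "!!eta eta'. eps <= norm eta ==> norm eta <= R ==> eps <= norm eta' ==>
  norm eta' <= R ==> c * (norm (eta - eta'))\<^sup>2 <= (a eta - a eta') \<bullet> (eta - eta')"
  by (rule a_monotone[OF epsR(1,2)]) blast
 obtain Lb where Lb: "Lb > 0" "!!eta eta'. norm eta <= R ==> norm eta' <= R ==> \<bar>\<beta> eta - \<beta> eta'\<bar>
   <= Lb * norm (eta - eta')"
  by (rule \<beta>_lipschitz[of R]) blast
 show ?thesis
 proof (rule that[of R c L Lb], unfold nondegenerate_increments_def, intro conjI ballI allI impI)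
  fix x e :: "real^'n" assume x: "x \<in> S" and e: "norm e <= r"
  have thick: "x \<in> thicken r S" "x + e \<in> thicken r S"
   using thickenI[OF x, of x r] thickenI[OF x, of "x + e" r] e r by auto
  then show "x + e \<in> U" using S(2) V_subset by blast
  show "norm (D (x + e)) <= R" by (rule epsR(4)[OF thick(2)])
  show "c * (norm (D (x + e) - D x))\<^sup>2 <= (a (D (x + e)) - a (D x)) \<bullet> (D (x + e) - D x)"
   "norm (a (D (x + e)) - a (D x)) <= L * norm (D (x + e) - D x)"
   "\<bar>\<beta> (D (x + e)) - \<beta> (D x)\<bar> <= Lb * norm (D (x + e) - D x)"
   by (intro c(2) L(2) Lb(2) epsR(3,4) thick)+
 qed (use epsR c L Lb in auto)
qed

lemma caccioppoli_AE:
 fixes i :: 'n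
 assumes psi: "C1c S psi" "!!x. 0 <= psi x" "!!x. psi x <= 1" and thick: "thicken r S \<subseteq> U"
  and incr: "nondegenerate_increments S r R c L Lb" and h: "0 < h" "h < r"
  and C: "!!x. norm (grad psi x) <= C"
  and Lg: "AE x\<in>S in lborel. \<bar>G (x + h *\<^sub>R axis i 1) - G x\<bar> <= Lg * h"
 defines "e \<equiv> h *\<^sub>R axis i 1 :: real^'n" and "Q \<equiv> 2 * R * L * C + Lb * R"
  and "w \<equiv> %x. (psi x)\<^sup>2 * u_quotient h i x"
 shows "AE x in lborel. c / (2 * h) * ((psi x)\<^sup>2 * (norm (D (x + e) - D x))\<^sup>2)
   - (Q\<^sup>2 / (2 * c) + Lg * R) * h * indicator S x
  <= (a (D (x + e)) - a (D x)) \<bullet> grad w x + (lower_order (x + e) - lower_order x) * w x"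
 using Lg
proof eventually_elim
 case (elim x)
 note test = u_quotient_test[OF psi(1) thick h, where i = i, folded w_def e_def]
 show ?case
 proof (cases "x \<in> S")
  case False
  then show ?thesis
   using C1c_zero[OF psi(1)] C1c_grad_0[OF test(1)] by (simp add: w_def)
 next
  case True
  have incr_x: "x + d \<in> U" "norm (D (x + d)) <= R"
   "c * (norm (D (x + d) - D x))\<^sup>2 <= (a (D (x + d)) - a (D x)) \<bullet> (D (x + d) - D x)"
   "norm (a (D (x + d)) - a (D x)) <= L * norm (D (x + d) - D x)"
   "\<bar>\<beta> (D (x + d)) - \<beta> (D x)\<bar> <= Lb * norm (D (x + d) - D x)" if "norm d <= r" for d
   using incr True that by (auto simp: nondegenerate_increments_def)
  have e: "norm e <= r" using h by (simp add: e_def)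
  have w_le: "\<bar>u_quotient h i x\<bar> <= R"
   by (rule u_quotient_bound[OF h(1)]) (use incr_x h in auto)
  have "c / (2 * h) * ((psi x)\<^sup>2 * (norm (D (x + e) - D x))\<^sup>2) - (Q\<^sup>2 / (2 * c) + Lg * R) * h
    <= (a (D (x + e)) - a (D x)) \<bullet>
     (((psi x)\<^sup>2 / h) *\<^sub>R (D (x + e) - D x) + (2 * psi x * u_quotient h i x) *\<^sub>R grad psi x)
     + ((\<beta> (D (x + e)) - \<beta> (D x)) - (G (x + e) - G x)) * ((psi x)\<^sup>2 * u_quotient h i x)"
  proof (rule caccioppoli_pointwise[OF incr_x(3-5)[OF e] _ w_le psi(2,3) C])
   show "\<bar>G (x + e) - G x\<bar> <= Lg * h" using elim True by (simp add: e_def)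
  qed (use incr h in \<open>auto simp: nondegenerate_increments_def Q_def\<close>)
  also have "... = (a (D (x + e)) - a (D x)) \<bullet> grad w x + (lower_order (x + e) - lower_order x) * w x"
   unfolding test(2)[OF True] by (simp add: lower_order_def w_def e_def algebra_simps)
  finally show ?thesis using True by simp
 qed
qed

lemma cutoff_energy_bound:
 fixes i :: 'n
 assumes psi: "C1c S psi" "!!x. 0 <= psi x" "!!x. psi x <= 1" and thick: "thicken r S \<subseteq> U"
  and incr: "nondegenerate_increments S r R c L Lb" and h: "0 < h" "h < r"
  and C: "!!x. norm (grad psi x) <= C"
  and Lg: "AE x\<in>S in lborel. \<bar>G (x + h *\<^sub>R axis i 1) - G x\<bar> <= Lg * h"
 defines "K \<equiv> (2 * R * L * C + Lb * R)\<^sup>2 / (2 * c) + Lg * R"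
 shows "integrable lborel (%x. (psi x)\<^sup>2 * (norm (D (x + h *\<^sub>R axis i 1) - D x))\<^sup>2)"
  "(LBINT x. (psi x)\<^sup>2 * (norm (D (x + h *\<^sub>R axis i 1) - D x))\<^sup>2)
   <= (2 * K * (LBINT x. indicator S x) / c) * h\<^sup>2"
proof -
 let ?e = "h *\<^sub>R axis i 1 :: real^'n"
 let ?w = "%x. (psi x)\<^sup>2 * u_quotient h i x"
 define F where "F x = (psi x)\<^sup>2 * (norm (D (x + ?e) - D x))\<^sup>2" for x
 note S = C1c_compact[OF psi(1)] and [measurable] = C1c_measurable[OF psi(1)]
 have pos: "0 < c" "0 < R"
  and D: "!!x d. x \<in> S ==> norm d <= r ==> x + d \<in> U" "!!x d. x \<in> S ==> norm d <= r ==> norm (D (x + d))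
    <= R"
  using incr by (auto simp: nondegenerate_increments_def)
 have S_U: "S \<subseteq> U" "(%x. x + ?e) ` S \<subseteq> U" using D(1)[of _ 0] D(1)[of _ ?e] h by auto
 have F: "integrable lborel F"
 proof (rule integrable_bounded_compact[OF S, of _ "(2 * R)\<^sup>2"])
  have "F x <= 1 * (2 * R)\<^sup>2" if x: "x \<in> S" for x
   unfolding F_def
  proof (intro mult_mono power_mono)
   show "norm (D (x + ?e) - D x) <= 2 * R"
    using norm_triangle_ineq4[of "D (x + ?e)" "D x"] D(2)[OF x, of ?e] D(2)[OF x, of 0] h
     by simp
  qed (use psi(2,3)[of x] in \<open>auto intro: power_le_one\<close>)
  then show "AE x\<in>S in lborel. norm (F x) <= (2 * R)\<^sup>2" by (simp add: F_def)
 qed (use C1c_zero[OF psi(1)] in \<open>auto simp: F_def[abs_def]\<close>)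
 then show "integrable lborel (%x. (psi x)\<^sup>2 * (norm (D (x + ?e) - D x))\<^sup>2)"
  by (simp add: F_def[abs_def])
 note test = C1c_imp_W11c[OF u_quotient_test(1)[OF psi(1) thick h, where i = i]]
 note diff = difference_equation[OF test S_U]
 have "(LBINT x. c / (2 * h) * F x - K * h * indicator S x)
   <= (LBINT x. (a (D (x + ?e)) - a (D x)) \<bullet> grad ?w x + (lower_order (x + ?e) - lower_order x) * ?w x)"
  unfolding F_def K_def
  by (rule integral_mono_AE[OF _ Bochner_Integration.integrable_add[OF diff(1,2)]
     caccioppoli_AE[OF psi thick incr h C Lg]])
   (intro Bochner_Integration.integrable_diff integrable_mult_right F[unfolded F_def]
    integrable_indicator_compact[OF S])
 also have "... = 0" using diff by simp
 finally have "c / (2 * h) * (LBINT x. F x) <= K * h * (LBINT x. indicator S x)"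
  using F integrable_indicator_compact[OF S] by simp
 then show "(LBINT x. (psi x)\<^sup>2 * (norm (D (x + ?e) - D x))\<^sup>2) <= (2 * K * (LBINT x. indicator S x)
   / c) * h\<^sup>2"
  unfolding F_def[symmetric] using pos h(1) by (simp add: field_simps power2_eq_square)
qed

theorem difference_quotient_bound:
 assumes C: "compact C" "C \<subseteq> V"
 obtains r K where "r > 0"
  "!!i h. 0 < h ==> h < r ==> integrable lborel (%x. indicator C x * (norm (D (x + h *\<^sub>R axis i 1) -
    D x))\<^sup>2)"
  "!!i h. 0 < h ==> h < r ==>
   (LBINT x. indicator C x * (norm (D (x + h *\<^sub>R axis i 1) - D x))\<^sup>2) <= K * h\<^sup>2"
proof -
 obtain psi where psi: "psi \<in> test_fun V" "!!x. 0 <= psi x" "!!x. psi x <= 1" "!!x. x \<in> C ==> psi x = 1"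
  by (rule smooth_cutoff[OF C(1) V_open C(2)]) blast
 obtain S where S: "C1c S psi" "S \<subseteq> V" by (rule test_funE[OF psi(1)]) blast
 obtain r where r: "r > 0" "thicken r S \<subseteq> V" using thicken_subset_open[OF C1c_compact[OF S(1)]
   V_open S(2)] .
 have thick: "thicken r S \<subseteq> U" using r(2) V_subset by blast
 obtain R c L Lb where incr: "nondegenerate_increments S r R c L Lb"
  by (rule ex_nondegenerate_increments[OF C1c_compact[OF S(1)] r(2)]) (use r(1) in auto)
 obtain P where P: "!!x. norm (grad psi x) <= P" using C1c_bounded[OF S(1)] by metis
 obtain Lg \<delta> where Lg: "\<delta> > 0" "!!i h. 0 < h ==> h < \<delta> ==>
   AE x\<in>S in lborel. \<bar>G (x + h *\<^sub>R axis i 1) - G x\<bar> <= Lg * h"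
  using G_lip[OF C1c_compact[OF S(1)]] S(2) V_subset by blast
 note bound = cutoff_energy_bound[OF S(1) psi(2,3) thick incr _ _ P Lg(2)]
 have le: "indicator C x * (norm (D (x + e) - D x))\<^sup>2 <= (psi x)\<^sup>2 * (norm (D (x + e) - D x))\<^sup>2"
   for x e
  using psi(4)[of x] by (auto simp: indicator_def)
 have [measurable]: "C \<in> sets borel" using C(1) by (simp add: borel_compact)
 have int: "integrable lborel (%x. indicator C x * (norm (D (x + h *\<^sub>R axis i 1) - D x))\<^sup>2)"
  if "0 < h" "h < min r \<delta>" for i h
 proof (rule Bochner_Integration.integrable_bound[OF bound(1)])
  show "AE x in lborel. norm (indicator C x * (norm (D (x + h *\<^sub>R axis i 1) - D x))\<^sup>2)
    <= norm ((psi x)\<^sup>2 * (norm (D (x + h *\<^sub>R axis i 1) - D x))\<^sup>2)"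
   using le by (intro AE_I2) (simp add: abs_mult)
 qed (use that in auto)
 show ?thesis
 proof (rule that[of "min r \<delta>"])
  show "(LBINT x. indicator C x * (norm (D (x + h *\<^sub>R axis i 1) - D x))\<^sup>2)
    <= (2 * ((2 * R * L * P + Lb * R)\<^sup>2 / (2 * c) + Lg * R) * (LBINT x. indicator S x) / c) * h\<^sup>2"
   if "0 < h" "h < min r \<delta>" for i h
   using that by (intro order_trans[OF integral_mono[OF int bound(1) le] bound(2)]) auto
 qed (use r Lg int in auto)
qed

definition Hq :: "nat => 'n => 'n => real^'n => real" where
 "Hq n i j x = (D (x + step n *\<^sub>R axis j 1) $ i - D x $ i) / step n"

definition H :: "'n => 'n => real^'n => real" where
 "H i j x = lim (%n. Hq n i j x)"

lemma Hq_meas[measurable]: "Hq n i j \<in> borel_measurable borel"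
 unfolding Hq_def by (intro borel_measurable_divide borel_measurable_diff
   measurable_compose[OF _ D_nth_meas] D_nth_meas) measurable

lemma H_meas[measurable]: "H i j \<in> borel_measurable borel"
 unfolding H_def by measurable

lemma H_eqI: "((%t. D (x + t *\<^sub>R axis j 1) $ i) has_real_derivative c) (at 0) ==> H i j x = c"
 unfolding H_def Hq_def by (intro limI) (rule DERIV_imp_step_quotient_tendsto[of "%x. D x $ i"])

lemma quotient_L2_bound:
 assumes C: "compact C" "C \<subseteq> V"
 obtains N K where "!!n i. n >= N ==> integrable lborel
   (%x. indicator C x * (norm (D (x + step n *\<^sub>R axis i 1) - D x) / step n)\<^sup>2)"
  "!!n i. n >= N ==>
   (LBINT x. indicator C x * (norm (D (x + step n *\<^sub>R axis i 1) - D x) / step n)\<^sup>2) <= K"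
proof -
 obtain r K where r: "r > 0"
  "!!i h. 0 < h ==> h < r ==> integrable lborel (%x. indicator C x * (norm (D (x + h *\<^sub>R axis i 1) -
    D x))\<^sup>2)"
  "!!i h. 0 < h ==> h < r ==>
   (LBINT x. indicator C x * (norm (D (x + h *\<^sub>R axis i 1) - D x))\<^sup>2) <= K * h\<^sup>2"
  by (rule difference_quotient_bound[OF C]) blast
 obtain N where N: "!!n. n >= N ==> step n < r" using step_lessE[OF r(1)] by blast
 have eq: "indicator C x * (norm (D (x + step n *\<^sub>R axis i 1) - D x) / step n)\<^sup>2
   = (indicator C x * (norm (D (x + step n *\<^sub>R axis i 1) - D x))\<^sup>2) / (step n)\<^sup>2" for n i x
  by (simp add: power_divide)
 show ?thesis
 proof (rule that[of N K], unfold eq)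
  fix n i assume n: "n >= N"
  show "integrable lborel
    (%x. indicator C x * (norm (D (x + step n *\<^sub>R axis i 1) - D x))\<^sup>2 / (step n)\<^sup>2)"
   by (intro integrable_divide r(2) step_pos N n)
  show "(LBINT x. indicator C x * (norm (D (x + step n *\<^sub>R axis i 1) - D x))\<^sup>2 / (step n)\<^sup>2) <= K"
   using r(3)[OF step_pos N[OF n], of i] step_pos[of n] by (simp add: divide_le_eq)
 qed
qed

lemma dominated_quotient_square_integrable:
 assumes C: "compact C" "C \<subseteq> V"
  and q: "!!n. q n \<in> borel_measurable borel" "!!n x. n >= N ==> x \<in> C ==>
   \<bar>q n x\<bar> <= L * (norm (D (x + step n *\<^sub>R axis i 1) - D x) / step n)"
 obtains N' K where "!!n. n >= N' ==> square_integrable lborel (%x. indicator C x * q n x)"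
  "!!n. n >= N' ==> (LBINT x. (indicator C x * q n x)\<^sup>2) <= K"
proof -
 let ?d = "%n x. norm (D (x + step n *\<^sub>R axis i 1) - D x) / step n"
 obtain N0 K where K: "!!n i. n >= N0 ==> integrable lborel
   (%x. indicator C x * (norm (D (x + step n *\<^sub>R axis i 1) - D x) / step n)\<^sup>2)"
  "!!n i. n >= N0 ==>
   (LBINT x. indicator C x * (norm (D (x + step n *\<^sub>R axis i 1) - D x) / step n)\<^sup>2) <= K"
  by (rule quotient_L2_bound[OF C]) blast
 note [measurable] = q(1) borel_compact[OF C(1)]
 have le: "(indicator C x * q n x)\<^sup>2 <= L\<^sup>2 * (indicator C x * (?d n x)\<^sup>2)" if n: "n >= N" for n x
 proof (cases "x \<in> C")
  case True
  then have "\<bar>q n x\<bar>\<^sup>2 <= (L * ?d n x)\<^sup>2" using q(2)[OF n] by (intro power_mono) auto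
  then show ?thesis using True by (simp add: power_mult_distrib power_divide)
 qed simp
 have L2: "square_integrable lborel (%x. indicator C x * q n x)" if n: "n >= max N N0" for n
  unfolding square_integrable_def
 proof (intro conjI)
  show "integrable lborel (%x. (indicator C x * q n x)\<^sup>2)"
  proof (rule Bochner_Integration.integrable_bound[OF integrable_mult_right[OF K(1)]])
   show "AE x in lborel. norm ((indicator C x * q n x)\<^sup>2) <= norm (L\<^sup>2 * (indicator C x * (?d n x)\<^sup>2))"
    using le[of n] n by (intro AE_I2) (simp add: abs_mult)
  qed (use n in auto)
 qed measurable
 show ?thesis
 proof (rule that[of "max N N0" "L\<^sup>2 * K"])
  fix n assume n: "n >= max N N0"
  show "square_integrable lborel (%x. indicator C x * q n x)" by (rule L2[OF n])
  have "(LBINT x. (indicator C x * q n x)\<^sup>2) <= (LBINT x. L\<^sup>2 * (indicator C x * (?d n x)\<^sup>2))"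
   by (intro integral_mono square_integrable_power2[OF L2[OF n]] integrable_mult_right K(1) le)
    (use n in auto)
  also have "... <= L\<^sup>2 * K" using K(2)[of n i] n by (auto intro: mult_left_mono)
  finally show "(LBINT x. (indicator C x * q n x)\<^sup>2) <= L\<^sup>2 * K" .
 qed
qed

lemma Hq_square_integrable:
 assumes C: "compact C" "C \<subseteq> V"
 obtains N K where "!!n. n >= N ==> square_integrable lborel (%x. indicator C x * Hq n i j x)"
  "!!n. n >= N ==> (LBINT x. (indicator C x * Hq n i j x)\<^sup>2) <= K"
proof (rule dominated_quotient_square_integrable[OF C])
 show "\<bar>Hq n i j x\<bar> <= 1 * (norm (D (x + step n *\<^sub>R axis j 1) - D x) / step n)" for n x
  using component_le_norm_cart[of "D (x + step n *\<^sub>R axis j 1) - D x" i] step_pos[of n]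
  by (simp add: Hq_def divide_right_mono)
qed auto

lemma H_near_compact:
 assumes K: "compact K" "K \<subseteq> V"
 obtains W where "open W" "K \<subseteq> W" "W \<subseteq> V" "!!i j. wderiv W j (%x. D x $ i) (H i j)"
  "!!i j. AE x\<in>W in lborel. ((%t. D (x + t *\<^sub>R axis j 1) $ i) has_real_derivative H i j x) (at 0)"
proof -
 obtain d where d: "d > 0" "thicken d K \<subseteq> V" using thicken_subset_open[OF K(1) V_open K(2)] .
 define W where "W = (\<Union>x\<in>K. ball x d)"
 have W: "open W" "K \<subseteq> W" "W \<subseteq> thicken d K"
  using d(1) by (auto simp: W_def dist_norm norm_minus_commute intro!: thickenI)
 note C = compact_thicken[OF K(1), of d] d(2)
 have WV: "W \<subseteq> V" and WU: "W \<subseteq> U" using W(3) d(2) V_subset by auto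
 have [measurable]: "W \<in> sets borel" using W(1) by simp
 have "wderiv W j (%x. D x $ i) (H i j) \<and>
   (AE x\<in>W in lborel. ((%t. D (x + t *\<^sub>R axis j 1) $ i) has_real_derivative H i j x) (at 0))" for i j
 proof -
  obtain N K' where N: "!!n. n >= N ==> square_integrable lborel (%x. indicator (thicken d K) x * Hq
    n i j x)"
   "!!n. n >= N ==> (LBINT x. (indicator (thicken d K) x * Hq n i j x)\<^sup>2) <= K'"
   by (rule Hq_square_integrable[OF C]) blast
  have le: "(indicator W x * Hq n i j x)\<^sup>2 <= (indicator (thicken d K) x * Hq n i j x)\<^sup>2" for n x
   using W(3) by (auto simp: indicator_def)
  have L2: "square_integrable lborel (%x. indicator W x * Hq n i j x)" if "n >= N" for n
   unfolding square_integrable_def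
   by (intro conjI Bochner_Integration.integrable_bound[OF square_integrable_power2[OF
     N(1)[OF that]]])
    (use le in auto)
  obtain g where g: "wderiv W j (%x. D x $ i) g"
  proof (rule wderiv_of_bounded_difference_quotients[OF W(1), of "%x. D x $ i" N j K', folded
    Hq_def])
   show "locally_integrable W (%x. D x $ i)"
    by (intro locally_integrable_continuous D_nth_meas continuous_on_subset[OF D_nth_cont WU])
   show "(LBINT x. (indicator W x * Hq n i j x)\<^sup>2) <= K'" if "n >= N" for n
    by (intro order_trans[OF integral_mono N(2)[OF that]] square_integrable_power2 L2 N(1)
      that le)
  qed (rule L2)
  have der: "AE x\<in>W in lborel. ((%t. D (x + t *\<^sub>R axis j 1) $ i) has_real_derivative g x) (at 0)"
   by (rule AE_DERIV_of_wderiv[OF W(1) g continuous_on_subset[OF D_nth_cont WU] refl])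
  then have eq: "AE x\<in>W in lborel. g x = H i j x"
   by eventually_elim (auto dest: H_eqI)
  show ?thesis
  proof
   show "wderiv W j (%x. D x $ i) (H i j)"
    by (rule wderiv_cong[OF g D_nth_meas H_meas AE_I2 eq]) simp
   show "AE x\<in>W in lborel. ((%t. D (x + t *\<^sub>R axis j 1) $ i) has_real_derivative H i j x) (at 0)"
    using der eq by eventually_elim auto
  qed
 qed
 then show ?thesis by (intro that[OF W(1,2) WV]) auto
qed

theorem AE_DERIV_H:
 "AE x\<in>V in lborel. (\<forall>i j. ((%t. D (x + t *\<^sub>R axis j 1) $ i) has_real_derivative H i j x) (at 0))"
proof (rule AE_open_from_compact[OF V_open])
 fix K assume K: "compact K" "K \<subseteq> V"
 obtain W where W: "K \<subseteq> W"
  "!!i j. AE x\<in>W in lborel. ((%t. D (x + t *\<^sub>R axis j 1) $ i) has_real_derivative H i j x) (at 0)"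
  by (rule H_near_compact[OF K]) blast
 have "AE x in lborel. \<forall>i j. x \<in> W --> ((%t. D (x + t *\<^sub>R axis j 1) $ i) has_real_derivative H i j
   x) (at 0)"
  unfolding AE_all_countable using W(2) by blast
 then show "AE x\<in>K in lborel. (\<forall>i j. ((%t. D (x + t *\<^sub>R axis j 1) $ i) has_real_derivative H i j x) (at 0))"
  by eventually_elim (use W(1) in blast)
qed

theorem AE_H_symmetric: "AE x\<in>V in lborel. (\<forall>i j. H i j x = H j i x)"
proof (rule AE_open_from_compact[OF V_open])
 fix K assume K: "compact K" "K \<subseteq> V"
 obtain W where W: "open W" "K \<subseteq> W" "W \<subseteq> V" and H: "!!i j. wderiv W j (%x. D x $ i) (H i j)"
  by (rule H_near_compact[OF K]) blast
 have WU: "W \<subseteq> U" using W(3) V_subset by blast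
 have "(%x. indicator U x * pderiv_at i u x) = (%x. D x $ i)" for i by (auto simp: D_def)
 then have u: "wderiv W i (%x. indicator U x * u x) (%x. D x $ i)" for i
  using wderiv_mono[OF wderiv_C1[OF U u_diff u_cont] WU, of i] by simp
 have "continuous_on W (%x. indicator U x * u x)"
  using continuous_on_subset[OF differentiable_imp_continuous_on[OF u_diff] WU] WU
  by (auto simp: indicator_def subset_eq cong: continuous_on_cong)
 then have "AE x\<in>W in lborel. H i j x = H j i x" for i j
  by (rule wderiv_symmetric[OF W(1) _ u u H H])
 then have "AE x in lborel. \<forall>i j. x \<in> W --> H i j x = H j i x"
  unfolding AE_all_countable by blast
 then show "AE x\<in>K in lborel. (\<forall>i j. H i j x = H j i x)"
  by eventually_elim (use W(2) in blast)
qed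

lemma Hq_tendsto: "AE x\<in>V in lborel. (\<forall>i j. (%n. Hq n i j x) \<longlonglongrightarrow> H i j x)"
 using AE_DERIV_H
 by eventually_elim (auto simp: Hq_def intro: DERIV_imp_step_quotient_tendsto[of "%x. D x $ _"])

lemma H_square_integrable:
 assumes C: "compact C" "C \<subseteq> V"
 shows "square_integrable lborel (%x. indicator C x * H i j x)"
proof -
 obtain N K where N: "!!n. n >= N ==> square_integrable lborel (%x. indicator C x * Hq n i j x)"
  "!!n. n >= N ==> (LBINT x. (indicator C x * Hq n i j x)\<^sup>2) <= K"
  by (rule Hq_square_integrable[OF C]) blast
 note [measurable] = borel_compact[OF C(1)]
 show ?thesis
 proof (rule square_integrable_tendsto_weakly(1)[of lborel "%n x. indicator C x * Hq (n + N) i j x" K])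
  show "AE x in lborel. (%n. indicator C x * Hq (n + N) i j x) \<longlonglongrightarrow> indicator C x * H i j x"
   using Hq_tendsto
  proof eventually_elim
   case (elim x)
   then show ?case using C(2)
    by (cases "x \<in> C") (auto intro!: LIMSEQ_ignore_initial_segment)
  qed
 qed (use N in auto)
qed

definition Hv :: "'n => real^'n => real^'n" where "Hv i x = (\<chi> j. H j i x)"

definition Hqv :: "nat => 'n => real^'n => real^'n" where
 "Hqv n i x = (1 / step n) *\<^sub>R (D (x + step n *\<^sub>R axis i 1) - D x)"

lemma Hv_meas[measurable]: "Hv i \<in> borel_measurable borel"
 unfolding Hv_def[abs_def] vec_lambda_eq_sum_axis by measurable

lemma Hqv_tendsto: "AE x\<in>V in lborel. (\<forall>i. (%n. Hqv n i x) \<longlonglongrightarrow> Hv i x)"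
 using Hq_tendsto
 by eventually_elim (auto simp: Hqv_def Hq_def Hv_def intro!: vec_tendstoI)

end

section \<open>The linearised equation\<close>

lemma GDERIV_isCont: "GDERIV (g :: real^'n => real) x :> w ==> isCont g x"
 unfolding gderiv_def by (rule has_derivative_continuous)

lemma GDERIV_lipschitz_ball:
 fixes g :: "real^'n => real"
 assumes g: "!!eta. GDERIV g eta :> gg eta" and c: "continuous_on UNIV gg"
 obtains L where "L > 0" "!!eta eta'. norm eta <= R ==> norm eta' <= R ==> \<bar>g eta - g eta'\<bar>
  <= L * norm (eta - eta')"
  "!!eta. norm eta <= R ==> norm (gg eta) <= L" "!!eta. norm eta <= R ==> \<bar>g eta\<bar> <= L"
proof -
 have cg: "continuous_on UNIV g" using GDERIV_isCont[OF g]
  by (simp add: continuous_at_imp_continuous_on)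
 have "bounded (gg ` cball 0 R)" "bounded (g ` cball 0 R)"
  by (intro compact_imp_bounded compact_continuous_image continuous_on_subset[OF c]
    continuous_on_subset[OF cg]; simp)+
 then obtain L1 L2 where L: "L1 > 0" "!!eta. norm eta <= R ==> norm (gg eta) <= L1" "L2 > 0"
  "!!eta. norm eta <= R ==> norm (g eta) <= L2"
  unfolding bounded_pos by auto
 have lip: "\<bar>g eta - g eta'\<bar> <= (L1 + L2) * norm (eta - eta')"
  if "norm eta <= R" "norm eta' <= R" for eta eta'
 proof -
  have "norm (g eta - g eta') <= (L1 + L2) * norm (eta - eta')"
  proof (rule differentiable_bound[of "cball 0 R" g "%eta h. h \<bullet> gg eta"])
   show "(g has_derivative (%h. h \<bullet> gg eta)) (at eta within cball 0 R)" for eta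
    using g[of eta] by (auto simp: gderiv_def intro: has_derivative_at_withinI)
   show "onorm (%h. h \<bullet> gg eta) <= L1 + L2" if "eta \<in> cball 0 R" for eta
   proof (rule onorm_le)
    fix h
    have "norm (h \<bullet> gg eta) <= norm h * norm (gg eta)" using Cauchy_Schwarz_ineq2 by auto
    also have "... <= norm h * (L1 + L2)" using L(2)[of eta] L(3) that
     by (intro mult_left_mono) auto
    finally show "norm (h \<bullet> gg eta) <= (L1 + L2) * norm h" by (simp add: mult.commute)
   qed
  qed (use that in auto)
  then show ?thesis by simp
 qed
 show ?thesis by (rule that[of "L1 + L2"]) (use L lip in \<open>force+\<close>)
qed

lemma GDERIV_zero_imp_constant:
 fixes g :: "real^'n => real"
 assumes "!!eta. norm eta < eps ==> GDERIV g eta :> 0" "norm eta < eps" "norm eta' < eps"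
 shows "g eta = g eta'"
proof -
 have "(g has_derivative (%h. 0)) (at eta within ball 0 eps)" if "eta \<in> ball 0 eps" for eta
  using assms(1)[of eta] that by (auto simp: gderiv_def intro: has_derivative_at_withinI)
 from has_derivative_zero_constant[OF convex_ball this] show ?thesis using assms(2,3) by force
qed

lemma tendsto_chain_difference_quotient:
 fixes g :: "real^'n => 'b::real_normed_vector"
 assumes g: "(g has_derivative g') (at y)" and d: "(%n. (1 / step n) *\<^sub>R (z n - y)) \<longlonglongrightarrow> v"
 shows "(%n. (1 / step n) *\<^sub>R (g (z n) - g y)) \<longlonglongrightarrow> g' v"
proof -
 have linear: "bounded_linear g'" using g by (rule has_derivative_bounded_linear)
 have z_lim: "z \<longlonglongrightarrow> y"
 proof -
  have "(%n. step n *\<^sub>R ((1 / step n) *\<^sub>R (z n - y)) + y) \<longlonglongrightarrow> 0 *\<^sub>R v + y"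
   by (intro tendsto_intros step_tendsto_0 d)
  moreover have "step n *\<^sub>R ((1 / step n) *\<^sub>R (z n - y)) + y = z n" for n using step_pos[of n]
   by simp
  ultimately show ?thesis by simp
 qed
 obtain r where r: "!!y'. g y' = g y + g' (y' - y) + norm (y' - y) *\<^sub>R r y'" "r y = 0"
   "(r \<longlongrightarrow> 0) (at y)"
 proof
  let ?r = "%y'. (1 / norm (y' - y)) *\<^sub>R (g y' - g y - g' (y' - y))"
  show "g y' = g y + g' (y' - y) + norm (y' - y) *\<^sub>R ?r y'" for y'
   using linear_0[OF bounded_linear.linear[OF linear]] by (cases "y' = y") auto
  show "?r y = 0" by simp
  show "(?r \<longlongrightarrow> 0) (at y)" using g unfolding has_derivative_def
   by (simp add: divide_inverse Lim_ident_at netlimit_at)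
 qed
 have rz: "(%n. r (z n)) \<longlonglongrightarrow> 0"
 proof -
  have "isCont r y" using r(2,3) by (simp add: isCont_def)
  from isCont_tendsto_compose[OF this z_lim] show ?thesis by (simp add: r(2))
 qed
 have "(%n. g' ((1 / step n) *\<^sub>R (z n - y)) + norm ((1 / step n) *\<^sub>R (z n - y)) *\<^sub>R r (z n)) \<longlonglongrightarrow> g'
   v + norm v *\<^sub>R 0"
  by (intro tendsto_intros bounded_linear.tendsto[OF linear] d rz)
 moreover have "g' ((1 / step n) *\<^sub>R (z n - y)) + norm ((1 / step n) *\<^sub>R (z n - y)) *\<^sub>R r (z n)
   = (1 / step n) *\<^sub>R (g (z n) - g y)" for n
 proof -
  have linear_part: "g' ((1 / step n) *\<^sub>R (z n - y)) = (1 / step n) *\<^sub>R g' (z n - y)"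
   by (rule linear_cmul[OF bounded_linear.linear[OF linear]])
  have norm_part: "norm ((1 / step n) *\<^sub>R (z n - y)) = norm (z n - y) / step n" unfolding norm_scaleR
   using step_pos[of n] by simp
  have expansion: "g (z n) - g y = g' (z n - y) + norm (z n - y) *\<^sub>R r (z n)" using r(1)[of "z n"]
   by simp
  show ?thesis unfolding linear_part norm_part expansion scaleR_add_right by simp
 qed
 ultimately show ?thesis by simp
qed

lemma square_integrable_bounded_mult:
 assumes f: "square_integrable M f" and k: "k \<in> borel_measurable M" "!!x. \<bar>k x\<bar> <= C"
 shows "square_integrable M (%x. k x * f x)"
 unfolding square_integrable_def
proof (intro conjI)
 note [measurable] = k(1) square_integrable_measurable[OF f]
 show "(%x. k x * f x) \<in> borel_measurable M" by measurable
 show "integrable M (%x. (k x * f x)\<^sup>2)"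
 proof (rule Bochner_Integration.integrable_bound)
  show "integrable M (%x. C\<^sup>2 * (f x)\<^sup>2)"
   by (intro integrable_mult_right square_integrable_power2 f)
  have "(k x)\<^sup>2 <= C\<^sup>2" for x using k(2)[of x] by (metis abs_ge_zero power2_abs power_mono)
  then show "AE x in M. norm ((k x * f x)\<^sup>2) <= norm (C\<^sup>2 * (f x)\<^sup>2)"
   by (intro AE_I2) (simp add: power_mult_distrib mult_right_mono)
 qed measurable
qed

context local_solution
begin

lemma compact_nondegenerate:
 assumes "compact S" "S \<subseteq> U" "eps > 0"
 shows "compact {x \<in> S. eps <= norm (D x)}" "{x \<in> S. eps <= norm (D x)} \<subseteq> V"
proof -
 have "closedin (top_of_set S) (S \<inter> (%x. norm (D x)) -` {eps..})"
  by (intro continuous_closedin_preimage continuous_intros continuous_on_subset[OF D_cont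
    assms(2)])
 then have "closed (S \<inter> (%x. norm (D x)) -` {eps..})" using assms(1) closedin_closed_trans
   compact_imp_closed by blast
 then have "compact (S \<inter> (S \<inter> (%x. norm (D x)) -` {eps..}))" using assms(1)
  by (rule compact_Int_closed[rotated])
 moreover have "S \<inter> (S \<inter> (%x. norm (D x)) -` {eps..}) = {x \<in> S. eps <= norm (D x)}" by auto
 ultimately show "compact {x \<in> S. eps <= norm (D x)}" by simp
 show "{x \<in> S. eps <= norm (D x)} \<subseteq> V" using assms by (auto simp: V_def)
qed

lemma D_uniform:
 assumes S: "compact S" "thicken \<delta> S \<subseteq> U" "\<delta> > 0" and "eps > 0"
 obtains d where "0 < d" "d <= \<delta>" "!!x y. x \<in> S ==> norm (y - x) <= d ==> norm (D y - D x) < eps"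
proof -
 have "uniformly_continuous_on (thicken \<delta> S) D"
  by (intro compact_uniformly_continuous continuous_on_subset[OF D_cont] S compact_thicken)
 then obtain d where d: "d > 0" "!!x y. x \<in> thicken \<delta> S ==> y \<in> thicken \<delta> S ==> dist y x < d
   ==> dist (D y) (D x) < eps"
  using \<open>eps > 0\<close> unfolding uniformly_continuous_on_def by metis
 show ?thesis
 proof (rule that[of "min (d / 2) \<delta>"])
  fix x y assume xy: "x \<in> S" "norm (y - x) <= min (d / 2) \<delta>"
  then have "x \<in> thicken \<delta> S" "y \<in> thicken \<delta> S" using S(3) thickenI[of x S x \<delta>] thickenI[of x S
    y \<delta>] by auto
  then have "dist (D y) (D x) < eps" using xy d(1) by (intro d(2)) (auto simp: dist_norm)
  then show "norm (D y - D x) < eps" by (simp add: dist_norm)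
 qed (use d S in auto)
qed

theorem composed_quotient_tendsto_weakly:
 fixes \<kappa> :: "real^'n => real"
 assumes C: "compact C" "C \<subseteq> V" and \<kappa>: "\<kappa> \<in> borel_measurable borel"
  and lipschitz: "!!eps R. 0 < eps ==> eps <= R ==> \<exists>L. \<forall>eta eta'.
   eps <= norm eta \<and> norm eta <= R \<and> eps <= norm eta'
    \<and> norm eta' <= R -->
   \<bar>\<kappa> eta - \<kappa> eta'\<bar> <= L * norm (eta - eta')"
  and derivative: "!!eta. eta \<noteq> 0 ==> (\<kappa> has_derivative \<kappa>' eta) (at eta)"
  and \<kappa>': "(%x. indicator C x * \<kappa>' (D x) (Hv i x)) \<in> borel_measurable borel"
 defines "q \<equiv> %n x. indicator C x * ((\<kappa> (D (x + step n *\<^sub>R axis i 1)) - \<kappa> (D x)) / step n)"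
 shows "square_integrable lborel (%x. indicator C x * \<kappa>' (D x) (Hv i x))"
  "\<forall>\<^sub>F n in sequentially. square_integrable lborel (q n)"
  "square_integrable lborel k ==>
   (%n. LBINT x. q n x * k x) \<longlonglongrightarrow> (LBINT x. indicator C x * \<kappa>' (D x) (Hv i x) * k x)"
proof -
 let ?e = "axis i 1 :: real^'n"
 let ?q = "%n x. (\<kappa> (D (x + step n *\<^sub>R ?e)) - \<kappa> (D x)) / step n"
 have q: "q n = (%x. indicator C x * ?q n x)" for n by (simp add: q_def)
 note [measurable] = \<kappa> borel_compact[OF C(1)]
 obtain d where d: "d > 0" "thicken d C \<subseteq> V" using thicken_subset_open[OF C(1) V_open C(2)] .
 obtain eps R where epsR: "0 < eps" "eps <= R" "!!x. x \<in> thicken d C ==> eps <= norm (D x)"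
  "!!x. x \<in> thicken d C ==> norm (D x) <= R"
  by (rule D_nondegenerate[OF compact_thicken[OF C(1)] d(2)]) auto
 obtain L where L: "!!eta eta'. eps <= norm eta ==> norm eta <= R ==> eps <= norm eta' ==> norm eta' <= R ==>
   \<bar>\<kappa> eta - \<kappa> eta'\<bar> <= L * norm (eta - eta')" using lipschitz[OF epsR(1,2)] by blast
 obtain N where N: "!!n. n >= N ==> step n < d" using step_lessE[OF d(1)] by blast
 have q_le: "\<bar>?q n x\<bar> <= L * (norm (D (x + step n *\<^sub>R ?e) - D x) / step n)" if "n >= N" "x \<in> C"
   for n x
 proof -
  have "x \<in> thicken d C" "x + step n *\<^sub>R ?e \<in> thicken d C"
   using thickenI[OF that(2), of x d] thickenI[OF that(2), of "x + step n *\<^sub>R ?e" d]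
    d(1) N[OF that(1)] step_pos[of n] by auto
  then have "\<bar>\<kappa> (D (x + step n *\<^sub>R ?e)) - \<kappa> (D x)\<bar> <= L * norm (D (x + step n *\<^sub>R ?e) - D x)"
   by (intro L epsR(3,4))
  then show ?thesis using step_pos[of n] by (simp add: divide_right_mono)
 qed
 have "\<exists>N' K. (\<forall>n\<ge>N'. square_integrable lborel (q n)) \<and> (\<forall>n\<ge>N'. (LBINT x. (q n x)\<^sup>2) <= K)"
  unfolding q by (rule dominated_quotient_square_integrable[OF C _ q_le]) (measurable, blast)
 then obtain N' K where N': "!!n. n >= N' ==> square_integrable lborel (q n)"
  "!!n. n >= N' ==> (LBINT x. (q n x)\<^sup>2) <= K" by blast
 show "\<forall>\<^sub>F n in sequentially. square_integrable lborel (q n)"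
  using N'(1) by (rule eventually_sequentiallyI)
 have lim: "AE x in lborel. (%n. q (n + N') x) \<longlonglongrightarrow> indicator C x * \<kappa>' (D x) (Hv i x)"
  using Hqv_tendsto
 proof eventually_elim
  case (elim x)
  show ?case
  proof (cases "x \<in> C")
   case True
   then have x: "x \<in> V" "D x \<noteq> 0" using C(2) by (auto simp: V_def)
   then have "(%n. (1 / step n) *\<^sub>R (D (x + step n *\<^sub>R ?e) - D x)) \<longlonglongrightarrow> Hv i x"
    using elim by (simp add: Hqv_def)
   from tendsto_chain_difference_quotient[OF derivative[OF x(2)] this]
   have "(%n. ?q n x) \<longlonglongrightarrow> \<kappa>' (D x) (Hv i x)" by simp
   then have "(%n. ?q (n + N') x) \<longlonglongrightarrow> \<kappa>' (D x) (Hv i x)" by (rule LIMSEQ_ignore_initial_segment)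
   then show ?thesis using True by (simp add: q_def)
  qed (simp add: q_def)
 qed
 have "(%x. indicator C x * \<kappa>' (D x) (Hv i x)) \<in> borel_measurable lborel" using \<kappa>' by simp
 note weak = square_integrable_tendsto_weakly[OF N'(1)[OF le_add2] N'(2)[OF le_add2] lim this]
 show "square_integrable lborel (%x. indicator C x * \<kappa>' (D x) (Hv i x))" by (rule weak(1))
 assume "square_integrable lborel k"
 then have "(%n. LBINT x. q (n + N') x * k x) \<longlonglongrightarrow> (LBINT x. indicator C x * \<kappa>' (D x) (Hv i x) * k x)"
  by (rule weak(2))
 then show "(%n. LBINT x. q n x * k x) \<longlonglongrightarrow> (LBINT x. indicator C x * \<kappa>' (D x) (Hv i x) * k x)"
  by (rule LIMSEQ_offset)
qed

lemma chain_quotient_tendsto_weakly: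
 fixes g :: "real^'n => real"
 assumes g: "!!eta. GDERIV g eta :> gg eta" "continuous_on UNIV gg" and eps: "eps > 0" "!!eta. norm eta < eps
   ==> gg eta = 0"
  and S: "compact S" "S \<subseteq> U"
 shows "square_integrable lborel (%x. indicator S x * (gg (D x) \<bullet> Hv i x))"
  "square_integrable lborel k ==> (!!x. x \<notin> S ==> k x = 0) ==>
   (%n. LBINT x. (g (D (x + step n *\<^sub>R axis i 1)) - g (D x)) / step n * k x)
    \<longlonglongrightarrow> (LBINT x. (gg (D x) \<bullet> Hv i x) * k x)"
proof -
 let ?e = "axis i 1 :: real^'n" and ?h = "%x. gg (D x) \<bullet> Hv i x"
 let ?q = "%n x. (g (D (x + step n *\<^sub>R ?e)) - g (D x)) / step n"
 define C where "C = {x \<in> S. eps / 2 <= norm (D x)}"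
 have C: "compact C" "C \<subseteq> V" using compact_nondegenerate[OF S, of "eps / 2"] eps(1)
  by (simp_all add: C_def)
 have h_C: "indicator C x * ?h x = ?h x" if "x \<in> S" for x
  using that eps by (cases "x \<in> C") (auto simp: C_def)
 have cont: "continuous_on UNIV g"
  using GDERIV_isCont[OF g(1)] by (simp add: continuous_at_imp_continuous_on)
 note [measurable] = borel_measurable_continuous_onI[OF g(2)] borel_compact[OF C(1)]
 have lipschitz: "\<exists>L. \<forall>eta eta'. eps <= norm eta \<and> norm eta <= R \<and> eps <= norm eta' \<and> norm eta' <= R -->
   \<bar>g eta - g eta'\<bar> <= L * norm (eta - eta')" for eps R
  using GDERIV_lipschitz_ball[OF g, of R] by metis
 have derivative: "(g has_derivative (%v. gg eta \<bullet> v)) (at eta)" for eta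
  using g(1)[of eta] by (simp add: gderiv_def inner_commute)
 have "(%x. indicator C x * ?h x) \<in> borel_measurable borel" by measurable
 note weak = composed_quotient_tendsto_weakly[OF C borel_measurable_continuous_onI[OF cont]
   lipschitz derivative this]
 have "indicator S x * ?h x = indicator C x * ?h x" for x
  using h_C[of x] by (cases "x \<in> S") (auto simp: C_def)
 then show "square_integrable lborel (%x. indicator S x * ?h x)" using weak(1) by (simp only:)
 assume k: "square_integrable lborel k" and k0: "!!x. x \<notin> S ==> k x = 0"
 obtain r where r: "r > 0" "thicken r S \<subseteq> U" using thicken_subset_open[OF S(1) U S(2)] .
 obtain d where d: "0 < d" "!!x y. x \<in> S ==> norm (y - x) <= d ==> norm (D y - D x) < eps / 2"
  by (rule D_uniform[OF S(1) r(2,1), of "eps / 2"]) (use eps in auto)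
 have "\<forall>\<^sub>F n in sequentially. (LBINT x. indicator C x * ?q n x * k x) = (LBINT x. ?q n x * k x)"
  using eventually_step_less[OF d(1)]
 proof eventually_elim
  case (elim n)
  have "g (D (x + step n *\<^sub>R ?e)) = g (D x)" if x: "x \<in> S" "x \<notin> C" for x
  proof (rule GDERIV_zero_imp_constant)
   show "GDERIV g eta :> 0" if "norm eta < eps" for eta using g(1)[of eta] eps(2)[OF that] by simp
   have "norm (D (x + step n *\<^sub>R ?e) - D x) < eps / 2"
    using elim step_pos[of n] by (intro d(2) x(1)) simp
   then show "norm (D (x + step n *\<^sub>R ?e)) < eps" "norm (D x) < eps"
    using x eps(1) norm_triangle_sub[of "D (x + step n *\<^sub>R ?e)" "D x"] by (auto simp: C_def)
  qed
  then show ?case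
   using k0 by (intro Bochner_Integration.integral_cong refl) (auto simp: indicator_def)
 qed
 with weak(3)[OF k] have "(%n. LBINT x. ?q n x * k x) \<longlonglongrightarrow> (LBINT x. indicator C x * ?h x * k x)"
  by (rule Lim_transform_eventually)
 moreover have "indicator C x * ?h x * k x = ?h x * k x" for x
  using h_C[of x] k0[of x] by (cases "x \<in> S") auto
 ultimately show "(%n. LBINT x. ?q n x * k x) \<longlonglongrightarrow> (LBINT x. ?h x * k x)" by simp
qed

theorem chain_rule:
 fixes g :: "real^'n => real"
 assumes g: "!!eta. GDERIV g eta :> gg eta" "continuous_on UNIV gg" and eps: "eps > 0" "!!eta. norm eta < eps
   ==> gg eta = 0"
 shows "wderiv U i (%x. g (D x)) (%x. gg (D x) \<bullet> Hv i x)"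
 unfolding wderiv_def
proof (intro conjI ballI)
 have cont: "continuous_on UNIV g"
  using GDERIV_isCont[OF g(1)] by (simp add: continuous_at_imp_continuous_on)
 show loc: "locally_integrable U (%x. g (D x))" by (rule locally_integrable_compose_D[OF cont])
 note [measurable] = borel_measurable_continuous_onI[OF g(2)]
 show "locally_integrable U (%x. gg (D x) \<bullet> Hv i x)"
  unfolding locally_integrable_def
 proof (intro conjI allI impI)
  fix K assume K: "compact K \<and> K \<subseteq> U"
  then have "square_integrable lborel (%x. indicator K x * (gg (D x) \<bullet> Hv i x))"
   by (intro chain_quotient_tendsto_weakly(1)[OF g eps]) auto
  from set_integrable_of_square_integrable[OF this, of K] K
  show "set_integrable lborel K (%x. gg (D x) \<bullet> Hv i x)"
   by (simp add: set_integrable_def mult.assoc[symmetric] flip: indicator_inter_arith)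
 qed measurable
 fix \<zeta> assume \<zeta>: "\<zeta> \<in> test_fun U"
 obtain S where S: "C1c S \<zeta>" "S \<subseteq> U" by (rule test_funE[OF \<zeta>]) blast
 from chain_quotient_tendsto_weakly(2)[OF g eps C1c_compact[OF S(1)] S(2)
   C1c_square_integrable[OF S(1)] C1c_zero[OF S(1)]]
 have "(LBINT x. (gg (D x) \<bullet> Hv i x) * \<zeta> x) = - (LBINT x. g (D x) * pderiv_at i \<zeta> x)"
  using difference_quotient_tendsto_weakly[OF U loc S, of i] by (rule LIMSEQ_unique)
 then show "(LBINT x. g (D x) * pderiv_at i \<zeta> x) = - (LBINT x. (gg (D x) \<bullet> Hv i x) * \<zeta> x)"
  by simp
qed

lemma truncated_W11c:
 fixes g :: "real^'n => real"
 assumes g: "!!eta. GDERIV g eta :> gg eta" "continuous_on UNIV gg" and eps: "eps > 0" "!!eta. norm eta < eps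
   ==> gg eta = 0"
  and psi: "C1c S psi" "S \<subseteq> U"
 shows "W11c S (%x. g (D x) * psi x)
  (%x. g (D x) *\<^sub>R grad psi x + psi x *\<^sub>R (\<Sum>l\<in>UNIV. gg (D x) $ l *\<^sub>R Hv l x))"
proof (rule W11c_mult[OF U _ chain_rule[OF g eps] psi])
 have cont: "continuous_on UNIV g"
  using GDERIV_isCont[OF g(1)] by (simp add: continuous_at_imp_continuous_on)
 show "continuous_on U (%x. g (D x))" by (rule continuous_on_compose2[OF cont D_cont]) simp
 note [measurable] = borel_measurable_continuous_onI[OF cont] borel_measurable_continuous_onI[OF
   g(2)]
  C1c_measurable[OF psi(1)] C1c_measurable_grad[OF psi(1)]
  borel_measurable_vec_nth[OF measurable_compose[OF D_meas borel_measurable_continuous_onI[OF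
    g(2)]]]
 show "(%x. g (D x) *\<^sub>R grad psi x + psi x *\<^sub>R (\<Sum>l\<in>UNIV. gg (D x) $ l *\<^sub>R Hv l x)) \<in> borel_measurable
   borel"
  by measurable
 show "AE x in lborel. (g (D x) *\<^sub>R grad psi x + psi x *\<^sub>R (\<Sum>l\<in>UNIV. gg (D x) $ l *\<^sub>R Hv l x)) $ i
   = g (D x) * pderiv_at i psi x + (gg (D x) \<bullet> Hv i x) * psi x" for i
  using AE_H_symmetric
 proof eventually_elim
  case (elim x)
  have "(\<Sum>l\<in>UNIV. gg (D x) $ l * H i l x) = gg (D x) \<bullet> Hv i x"
  proof (cases "x \<in> V")
   case True
   then show ?thesis using elim by (simp add: inner_vec_def Hv_def)
  next
   case False
   then have "D x = 0" by (auto simp: V_def D_def)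
   then show ?thesis using eps by simp
  qed
  then show ?case by (simp add: Hv_def mult.commute)
 qed
qed (use C1c_zero[OF psi(1)] C1c_grad_0[OF psi(1)] in auto)

end

lemma locally_integrable_mult_W11c:
 fixes q phi :: "real^'n => real"
 assumes q: "locally_integrable U q" and W: "W11c S phi \<Phi>"
 shows "S \<subseteq> U ==> integrable lborel (%x. q x * phi x)"
  "(%x. x + c) ` S \<subseteq> U ==> integrable lborel (%x. q (x + c) * phi x)"
proof -
 have mult: "integrable lborel (%x. q x * phi x)" if "W11c S phi \<Phi>" "S \<subseteq> U"
   for S \<Phi> and phi :: "real^'n => real"
 proof -
  note S = W11cD(1,2,4)[OF that(1)]
  obtain C where "!!x. norm (phi x) <= C" using bounded_compact_support[OF S] by metis
  then show ?thesis
   by (intro integrable_mult_compact_support[OF locally_integrableD[OF q S(1) that(2)] S(1)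
      W11cD(6)[OF that(1)] _ S(3)]) simp_all
 qed
 show "S \<subseteq> U ==> integrable lborel (%x. q x * phi x)" by (rule mult[OF W])
 assume "(%x. x + c) ` S \<subseteq> U"
 from lborel_integrable_shift[OF mult[OF W11c_translate[OF W] this], of c]
 show "integrable lborel (%x. q (x + c) * phi x)" by simp
qed

context local_solution
begin

definition Da :: "real^'n => real^'n => real^'n" where
 "Da eta \<xi> = A (norm eta) *\<^sub>R \<xi> + (deriv A (norm eta) / norm eta * (eta \<bullet> \<xi>)) *\<^sub>R eta"

lemma a_has_derivative:
 assumes "eta \<noteq> 0" shows "(a has_derivative Da eta) (at eta)"
proof -
 have n: "norm eta > 0" using assms by simp
 have "(A has_derivative (%t. t * deriv A (norm eta))) (at (norm eta))"
  using A_DERIV[OF n] by (simp add: has_field_derivative_def mult_commute_abs)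
 from has_derivative_compose[OF has_derivative_norm[OF assms] this]
 have "((%eta. A (norm eta)) has_derivative (%h. (h \<bullet> sgn eta) * deriv A (norm eta))) (at eta)" .
 from has_derivative_scaleR[OF this has_derivative_ident]
 have "((%eta. A (norm eta) *\<^sub>R eta) has_derivative (%h. A (norm eta) *\<^sub>R h + ((h \<bullet> sgn eta) * deriv A
   (norm eta)) *\<^sub>R eta)) (at eta)" .
 moreover have "(%h. A (norm eta) *\<^sub>R h + ((h \<bullet> sgn eta) * deriv A (norm eta)) *\<^sub>R eta) = Da eta"
  by (intro ext) (simp add: Da_def sgn_div_norm inner_commute divide_inverse mult_ac)
 ultimately show ?thesis by (simp add: a_def[abs_def])
qed

lemma B_DERIV: "t > 0 ==> (B has_real_derivative B' t) (at t)"
proof -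
 assume t: "t > 0"
 then have "at t within {0..} = at t" by (intro at_within_interior) simp
 then show ?thesis using B_der[of t] t by simp
qed

lemma \<beta>_GDERIV:
 assumes "eta \<noteq> 0" shows "GDERIV \<beta> eta :> B' (norm eta) *\<^sub>R sgn eta"
 using GDERIV_DERIV_compose[OF GDERIV_norm[OF assms] B_DERIV] assms by (simp add: \<beta>_def[abs_def])

lemma A_meas[measurable]: "(%eta::real^'n. indicator (- {0}) eta *\<^sub>R A (norm eta)) \<in> borel_measurable
  borel"
proof (rule borel_measurable_continuous_on_indicator)
 show "continuous_on (- {0}) (%eta::real^'n. A (norm eta))"
  by (rule continuous_on_compose2[OF A_contOn]) (auto intro!: continuous_intros)
qed simp

lemma A'_meas[measurable]: "(%eta::real^'n. indicator (- {0}) eta *\<^sub>R deriv A (norm eta)) \<in>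
  borel_measurable borel"
proof (rule borel_measurable_continuous_on_indicator)
 show "continuous_on (- {0}) (%eta::real^'n. deriv A (norm eta))"
  by (rule continuous_on_compose2[OF A_cont]) (auto intro!: continuous_intros)
qed simp

lemma Da_D_meas[measurable]:
 assumes [measurable]: "f \<in> borel_measurable borel"
 shows "(%x. indicator V x *\<^sub>R Da (D x) (f x)) \<in> borel_measurable borel"
proof -
 have [measurable]: "V \<in> sets borel" using V_open by simp
 have A_D_meas: "(%x. indicator (- {0}) (D x) *\<^sub>R A (norm (D x))) \<in> borel_measurable borel"
  by (rule measurable_compose[OF D_meas A_meas])
 have A'_D_meas: "(%x. indicator (- {0}) (D x) *\<^sub>R deriv A (norm (D x))) \<in> borel_measurable borel"
  by (rule measurable_compose[OF D_meas A'_meas])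
 note [measurable] = A_D_meas A'_D_meas
 have eq: "(%x. indicator V x *\<^sub>R Da (D x) (f x)) = (%x. indicator V x *\<^sub>R
   ((indicator (- {0}) (D x) *\<^sub>R A (norm (D x))) *\<^sub>R f x + ((indicator (- {0}) (D x) *\<^sub>R deriv
     A (norm (D x))) / norm (D x) * (D x \<bullet> f x)) *\<^sub>R D x))"
  by (intro ext) (auto simp: indicator_def V_def Da_def)
 show ?thesis unfolding eq by measurable
qed

lemma B'_meas[measurable]: "(%x. B' (norm (D x))) \<in> borel_measurable borel"
proof -
 have "continuous_on UNIV (%t. B' (max 0 t))" by (rule continuous_on_compose2[OF B_cont])
   (auto intro!: continuous_intros)
 then have [measurable]: "(%t. B' (max 0 t)) \<in> borel_measurable borel"
  by (rule borel_measurable_continuous_onI)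
 have "(%x. B' (max 0 (norm (D x)))) \<in> borel_measurable borel" by measurable
 then show ?thesis by (simp add: max_absorb2)
qed

lemma flux_component_tendsto:
 fixes k :: "real^'n => real" and i j :: 'n
 assumes C: "compact C" "C \<subseteq> V" and k: "square_integrable lborel k"
 defines "q \<equiv> %n x. indicator C x * ((a (D (x + step n *\<^sub>R axis i 1)) $ j - a (D x) $ j) / step n)"
 shows "square_integrable lborel (%x. indicator C x * (Da (D x) (Hv i x) $ j))"
  "\<forall>\<^sub>F n in sequentially. square_integrable lborel (q n)"
  "(%n. LBINT x. q n x * k x) \<longlonglongrightarrow> (LBINT x. indicator C x * (Da (D x) (Hv i x) $ j) * k x)"
proof -
 let ?d = "%x. indicator C x * (Da (D x) (Hv i x) $ j)"
 have [measurable]: "C \<in> sets borel" by (rule borel_compact[OF C(1)])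
 note [measurable] = borel_measurable_vec_nth[OF a_meas, of j]
  borel_measurable_vec_nth[OF Da_D_meas[OF Hv_meas[of i]], of j]
 have "\<bar>a eta $ j - a eta' $ j\<bar> <= norm (a eta - a eta')" for eta eta'
  using component_le_norm_cart[of "a eta - a eta'" j] by simp
 then have lipschitz: "\<exists>L. \<forall>eta eta'. eps <= norm eta \<and> norm eta <= R \<and> eps <= norm eta' \<and> norm eta' <= R -->
   \<bar>a eta $ j - a eta' $ j\<bar> <= L * norm (eta - eta')" if "0 < eps" "eps <= R" for eps R
  using a_lipschitz[OF that] by (meson order_trans)
 have derivative: "((%eta. a eta $ j) has_derivative (%v. Da eta v $ j)) (at eta)" if "eta \<noteq> 0" for eta
  by (rule bounded_linear.has_derivative[OF bounded_linear_vec_nth a_has_derivative[OF that]])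
 have d: "?d = (%x. indicator C x * ((indicator V x *\<^sub>R Da (D x) (Hv i x)) $ j))"
  using C(2) by (intro ext) (auto simp: indicator_def)
 have "?d \<in> borel_measurable borel" unfolding d by measurable
 from composed_quotient_tendsto_weakly[OF C _ lipschitz derivative this]
 show "square_integrable lborel ?d" "\<forall>\<^sub>F n in sequentially. square_integrable lborel (q n)"
  "(%n. LBINT x. q n x * k x) \<longlonglongrightarrow> (LBINT x. ?d x * k x)"
  using k unfolding q_def by simp_all
qed

lemma principal_part_tendsto:
 fixes k :: "real^'n => real^'n"
 assumes C: "compact C" "C \<subseteq> V" and k: "!!j. square_integrable lborel (%x. k x $ j)"
   "!!x. x \<notin> C ==> k x = 0"
 shows "integrable lborel (%x. (indicator V x *\<^sub>R Da (D x) (Hv i x)) \<bullet> k x)"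
  "(%n. (LBINT x. (a (D (x + step n *\<^sub>R axis i 1)) - a (D x)) \<bullet> k x) / step n)
   \<longlonglongrightarrow> (LBINT x. (indicator V x *\<^sub>R Da (D x) (Hv i x)) \<bullet> k x)"
proof -
 let ?d = "%j x. indicator C x * (Da (D x) (Hv i x) $ j)"
 let ?q = "%j n x. indicator C x * ((a (D (x + step n *\<^sub>R axis i 1)) $ j - a (D x) $ j) / step n)"
 note component = flux_component_tendsto[OF C k(1)]
 have limit: "(indicator V x *\<^sub>R Da (D x) (Hv i x)) \<bullet> k x = (\<Sum>j\<in>UNIV. ?d j x * k x $ j)" for x
  using C(2) k(2)[of x] by (cases "x \<in> C") (auto simp: inner_vec_def)
 have int: "integrable lborel (%x. ?d j x * k x $ j)" for j
  by (rule square_integrable_mult[OF component(1) k(1)])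
 then show "integrable lborel (%x. (indicator V x *\<^sub>R Da (D x) (Hv i x)) \<bullet> k x)"
  unfolding limit by (intro Bochner_Integration.integrable_sum)
 have "(%n. \<Sum>j\<in>UNIV. LBINT x. ?q j n x * k x $ j) \<longlonglongrightarrow> (\<Sum>j\<in>UNIV. LBINT x. ?d j x * k x $ j)"
  by (intro tendsto_sum component(3))
 moreover have "\<forall>\<^sub>F n in sequentially. (\<Sum>j\<in>UNIV. LBINT x. ?q j n x * k x $ j)
   = (LBINT x. (a (D (x + step n *\<^sub>R axis i 1)) - a (D x)) \<bullet> k x) / step n"
 proof -
  have "\<forall>\<^sub>F n in sequentially. \<forall>j. square_integrable lborel (?q j n)"
   using component(2) by (simp add: eventually_all_finite)
  then show ?thesis
  proof eventually_elim
   case (elim n)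
   have "(\<Sum>j\<in>UNIV. LBINT x. ?q j n x * k x $ j) = (LBINT x. \<Sum>j\<in>UNIV. ?q j n x * k x $ j)"
    by (intro Bochner_Integration.integral_sum[symmetric] square_integrable_mult
      elim[rule_format] k(1))
   also have "... = (LBINT x. (a (D (x + step n *\<^sub>R axis i 1)) - a (D x)) \<bullet> k x / step n)"
   proof (intro Bochner_Integration.integral_cong refl)
    show "(\<Sum>j\<in>UNIV. ?q j n x * k x $ j) = (a (D (x + step n *\<^sub>R axis i 1)) - a (D x)) \<bullet> k x / step n" for x
     using k(2)[of x] by (cases "x \<in> C") (simp_all add: inner_vec_def sum_divide_distrib)
   qed
   finally show ?case by simp
  qed
 qed
 ultimately have "(%n. (LBINT x. (a (D (x + step n *\<^sub>R axis i 1)) - a (D x)) \<bullet> k x) / step n)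
   \<longlonglongrightarrow> (\<Sum>j\<in>UNIV. LBINT x. ?d j x * k x $ j)" by (rule Lim_transform_eventually)
 then show "(%n. (LBINT x. (a (D (x + step n *\<^sub>R axis i 1)) - a (D x)) \<bullet> k x) / step n)
   \<longlonglongrightarrow> (LBINT x. (indicator V x *\<^sub>R Da (D x) (Hv i x)) \<bullet> k x)"
  unfolding limit using int by (simp add: Bochner_Integration.integral_sum)
qed

lemma gradient_term_tendsto:
 assumes C: "compact C" "C \<subseteq> V" and k: "square_integrable lborel k" "!!x. x \<notin> C ==> k x = 0"
 shows "integrable lborel (%x. B' (norm (D x)) * (sgn (D x) \<bullet> Hv i x) * k x)"
  "(%n. (LBINT x. (\<beta> (D (x + step n *\<^sub>R axis i 1)) - \<beta> (D x)) * k x) / step n)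
   \<longlonglongrightarrow> (LBINT x. B' (norm (D x)) * (sgn (D x) \<bullet> Hv i x) * k x)"
proof -
 let ?d = "%eta \<xi>. B' (norm eta) * (sgn eta \<bullet> \<xi>)"
 have [measurable]: "C \<in> sets borel" by (rule borel_compact[OF C(1)])
 have lipschitz: "\<exists>L. \<forall>eta eta'. eps <= norm eta \<and> norm eta <= R \<and> eps <= norm eta' \<and> norm eta' <= R -->
   \<bar>\<beta> eta - \<beta> eta'\<bar> <= L * norm (eta - eta')" for eps R
  using \<beta>_lipschitz[of R] by metis
 have derivative: "(\<beta> has_derivative ?d eta) (at eta)" if "eta \<noteq> 0" for eta
  using \<beta>_GDERIV[OF that] by (simp add: gderiv_def inner_commute)
 have meas: "(%x. indicator C x * ?d (D x) (Hv i x)) \<in> borel_measurable borel"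
  unfolding sgn_div_norm by measurable
 have L2: "square_integrable lborel (%x. indicator C x * ?d (D x) (Hv i x))"
  by (rule composed_quotient_tendsto_weakly(1)[OF C \<beta>_meas lipschitz _ meas]) (rule derivative)
 have weak: "(%n. LBINT x. indicator C x * ((\<beta> (D (x + step n *\<^sub>R axis i 1)) - \<beta> (D x)) / step n) * k x)
   \<longlonglongrightarrow> (LBINT x. indicator C x * ?d (D x) (Hv i x) * k x)"
  by (rule composed_quotient_tendsto_weakly(3)[OF C \<beta>_meas lipschitz _ meas k(1)])
    (rule derivative)
 have limit: "indicator C x * ?d (D x) (Hv i x) * k x = ?d (D x) (Hv i x) * k x" for x
  using k(2)[of x] by (cases "x \<in> C") auto
 show "integrable lborel (%x. ?d (D x) (Hv i x) * k x)"
  using square_integrable_mult[OF L2 k(1)] unfolding limit .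
 have quotient: "indicator C x * ((\<beta> (D (x + step n *\<^sub>R axis i 1)) - \<beta> (D x)) / step n) * k x
   = (\<beta> (D (x + step n *\<^sub>R axis i 1)) - \<beta> (D x)) * k x / step n" for n x
  using k(2)[of x] by (cases "x \<in> C") auto
 show "(%n. (LBINT x. (\<beta> (D (x + step n *\<^sub>R axis i 1)) - \<beta> (D x)) * k x) / step n)
   \<longlonglongrightarrow> (LBINT x. ?d (D x) (Hv i x) * k x)"
  using weak by (simp only: limit quotient integral_divide_zero)
qed

definition lin_integrand ::
  "(real^'n => real) => (real^'n => real) => (real^'n => real^'n) => 'n => real^'n => real" where
 "lin_integrand psi F FF i x = indicator V x * (Da (D x) (Hv i x) \<bullet> ((2 * psi x * F (D x)) *\<^sub>R grad psi x
    + (psi x)\<^sup>2 *\<^sub>R (\<Sum>l\<in>UNIV. FF (D x) $ l *\<^sub>R Hv l x))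
   + B' (norm (D x)) * (sgn (D x) \<bullet> Hv i x) * ((psi x)\<^sup>2 * F (D x)))"

lemma truncated_gradient_square_integrable:
 fixes F :: "real^'n => real"
 assumes F: "!!eta. GDERIV F eta :> FF eta" "continuous_on UNIV FF" and eps: "eps > 0" "!!eta. norm eta < eps
   ==> FF eta = 0"
  and psi: "C1c S psi" "S \<subseteq> U"
 shows "square_integrable lborel
  (%x. (F (D x) *\<^sub>R grad psi x + psi x *\<^sub>R (\<Sum>l\<in>UNIV. FF (D x) $ l *\<^sub>R Hv l x)) $ j)"
proof -
 have cont: "continuous_on UNIV F"
  using GDERIV_isCont[OF F(1)] by (simp add: continuous_at_imp_continuous_on)
 note S = C1c_compact[OF psi(1)]
 define C where "C = {x \<in> S. eps <= norm (D x)}"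
 have C: "compact C" "C \<subseteq> V" using compact_nondegenerate[OF S psi(2) eps(1)] by (simp_all add: C_def)
 have FF_nth: "continuous_on UNIV (%eta. FF eta $ l)" for l by (intro continuous_intros F(2))
 note [measurable] = borel_measurable_continuous_onI[OF cont] C1c_measurable[OF psi(1)]
  C1c_measurable_pderiv[OF psi(1)] borel_measurable_continuous_onI[OF FF_nth]
 obtain R where R: "!!x. x \<in> S ==> norm (D x) <= R" by (rule D_bound[OF S psi(2)]) blast
 obtain L where L: "L > 0" "!!eta. norm eta <= R ==> norm (FF eta) <= L" "!!eta. norm eta <= R ==>
  \<bar>F eta\<bar> <= L"
  using GDERIV_lipschitz_ball[OF F, of R] by metis
 obtain K where K: "K > 0" "!!x. \<bar>psi x\<bar> <= K" "!!i x. \<bar>pderiv_at i psi x\<bar> <= K"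
  using C1c_bounded[OF psi(1)] by metis
 have bounded: "\<bar>psi x * FF (D x) $ l\<bar> <= K * L" if "x \<in> S" for x l
  unfolding abs_mult using K order_trans[OF component_le_norm_cart L(2)[OF R[OF that]]]
  by (intro mult_mono) auto
 have "square_integrable lborel (%x. F (D x) * pderiv_at j psi x)"
  unfolding square_integrable_def
 proof (intro conjI integrable_bounded_compact[OF S, of _ "(L * K)\<^sup>2"] AE_I2 impI)
  fix x assume "x \<in> S"
  then have "\<bar>F (D x) * pderiv_at j psi x\<bar> <= L * K"
   unfolding abs_mult using K order_trans[OF abs_ge_zero L(3)[OF R]]
    by (intro mult_mono L(3) R) auto
  from power_mono[OF this abs_ge_zero, of 2] show "norm ((F (D x) * pderiv_at j psi x)\<^sup>2)
    <= (L * K)\<^sup>2" by simp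
 qed (use C1c_pderiv_0[OF psi(1)] in auto)
 moreover have "square_integrable lborel (%x. psi x * FF (D x) $ l * Hv l x $ j)" for l
 proof -
  have "square_integrable lborel (%x. indicator C x * (psi x * FF (D x) $ l) * (indicator C x * H
    j l x))"
  proof (rule square_integrable_bounded_mult[OF H_square_integrable[OF C]])
   show "\<bar>indicator C x * (psi x * FF (D x) $ l)\<bar> <= K * L" for x
    using bounded[of x l] K(1) L(1) by (cases "x \<in> C") (auto simp: C_def)
   show "(%x. indicator C x * (psi x * FF (D x) $ l)) \<in> borel_measurable lborel"
    using borel_compact[OF C(1)] by measurable
  qed
  moreover have "indicator C x * (psi x * FF (D x) $ l) * (indicator C x * H j l x)
    = psi x * FF (D x) $ l * Hv l x $ j" for x
   using C1c_zero[OF psi(1), of x] eps(2)[of "D x"] by (auto simp: C_def Hv_def indicator_def)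
  ultimately show ?thesis by simp
 qed
 ultimately have "square_integrable lborel
   (%x. F (D x) * pderiv_at j psi x + (\<Sum>l\<in>UNIV. psi x * FF (D x) $ l * Hv l x $ j))"
  by (intro square_integrable_add square_integrable_sum)
 then show ?thesis by (simp add: sum_distrib_left mult.assoc)
qed

lemma difference_equation_split:
 assumes W: "W11c S phi \<Phi>" and S: "S \<subseteq> U" "(%x. x + c) ` S \<subseteq> U"
 shows "(LBINT x. (a (D (x + c)) - a (D x)) \<bullet> \<Phi> x) + (LBINT x. (\<beta> (D (x + c)) - \<beta> (D x)) * phi x)
  = (LBINT x. (G (x + c) - G x) * phi x)"
proof -
 have int: "integrable lborel (%x. (q (x + c) - q x) * phi x)" if "locally_integrable U q" for q
  unfolding left_diff_distrib
  by (intro Bochner_Integration.integrable_diff locally_integrable_mult_W11c[OF that W] S)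
 have "(LBINT x. (lower_order (x + c) - lower_order x) * phi x)
   = (LBINT x. (\<beta> (D (x + c)) - \<beta> (D x)) * phi x - (G (x + c) - G x) * phi x)"
  by (intro Bochner_Integration.integral_cong refl) (simp add: lower_order_def algebra_simps)
 also have "... = (LBINT x. (\<beta> (D (x + c)) - \<beta> (D x)) * phi x) - (LBINT x. (G (x + c) - G x) * phi x)"
  by (intro Bochner_Integration.integral_diff int locally_integrable_compose_D \<beta>_cont
    G_locally_integrable)
 finally show ?thesis using difference_equation[OF W S] by simp
qed

lemma linearized_limit:
 fixes F :: "real^'n => real"
 assumes F: "!!eta. GDERIV F eta :> FF eta" "continuous_on UNIV FF"
  and eps: "eps > 0" "!!eta. norm eta < eps ==> F eta = 0" "!!eta. norm eta < eps ==> FF eta = 0"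
  and psi: "C1c S psi" "S \<subseteq> U"
 shows "integrable lborel (lin_integrand psi F FF i)"
  "(%n. (LBINT x. (G (x + step n *\<^sub>R axis i 1) - G x) * (F (D x) * (psi x)\<^sup>2)) / step n)
   \<longlonglongrightarrow> (LBINT x. lin_integrand psi F FF i x)"
proof -
 let ?e = "axis i 1 :: real^'n"
 let ?phi = "%x. F (D x) * (psi x)\<^sup>2"
 let ?\<Phi> = "%x. F (D x) *\<^sub>R grad (%x. (psi x)\<^sup>2) x + (psi x)\<^sup>2 *\<^sub>R (\<Sum>l\<in>UNIV. FF (D x) $ l *\<^sub>R Hv l x)"
 note psi2 = C1c_power2(1)[OF psi(1)] and S = C1c_compact[OF psi(1)]
 define C where "C = {x \<in> S. eps <= norm (D x)}"
 have C: "compact C" "C \<subseteq> V" using compact_nondegenerate[OF S psi(2) eps(1)] by (simp_all add: C_def)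
 have outside: "?phi x = 0" "?\<Phi> x = 0" if "x \<notin> C" for x
  using that eps C1c_zero[OF psi(1), of x] C1c_grad_0[OF psi2, of x] by (auto simp: C_def not_le)
 have W: "W11c S ?phi ?\<Phi>" by (rule truncated_W11c[OF F eps(1,3) psi2 psi(2)])
 have phi: "square_integrable lborel ?phi"
 proof -
  have "integrable lborel (%x. (?phi x)\<^sup>2)"
   by (rule integrable_compact_support[OF S]) (use W11cD(2,4)[OF W] in \<open>auto intro!:
     continuous_on_power\<close>)
  then show ?thesis using W11cD(6)[OF W] by (simp add: square_integrable_def)
 qed
 note principal = principal_part_tendsto[OF C truncated_gradient_square_integrable[OF F eps(1,3) psi2
   psi(2)] outside(2), of i]
 note gradient = gradient_term_tendsto[OF C phi outside(1), of i]
 have lin: "lin_integrand psi F FF i = (%x. (indicator V x *\<^sub>R Da (D x) (Hv i x)) \<bullet> ?\<Phi> x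
   + B' (norm (D x)) * (sgn (D x) \<bullet> Hv i x) * ?phi x)"
 proof
  fix x
  show "lin_integrand psi F FF i x = (indicator V x *\<^sub>R Da (D x) (Hv i x)) \<bullet> ?\<Phi> x
    + B' (norm (D x)) * (sgn (D x) \<bullet> Hv i x) * ?phi x"
   using outside(1)[of x] C(2) C1c_power2(2)[OF psi(1), of x]
   by (cases "x \<in> V") (auto simp: lin_integrand_def mult_ac)
 qed
 show "integrable lborel (lin_integrand psi F FF i)"
  unfolding lin by (intro Bochner_Integration.integrable_add principal(1) gradient(1))
 have split: "(LBINT x. lin_integrand psi F FF i x)
   = (LBINT x. (indicator V x *\<^sub>R Da (D x) (Hv i x)) \<bullet> ?\<Phi> x)
    + (LBINT x. B' (norm (D x)) * (sgn (D x) \<bullet> Hv i x) * ?phi x)"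
  unfolding lin by (rule Bochner_Integration.integral_add[OF principal(1) gradient(1)])
 let ?\<Delta> = "%w n x. w (x + step n *\<^sub>R ?e) - w x"
 obtain r where r: "r > 0" "thicken r S \<subseteq> U" using thicken_subset_open[OF S U psi(2)] .
 have "\<forall>\<^sub>F n in sequentially. (LBINT x. ?\<Delta> (%x. a (D x)) n x \<bullet> ?\<Phi> x) / step n
   + (LBINT x. ?\<Delta> (%x. \<beta> (D x)) n x * ?phi x) / step n = (LBINT x. ?\<Delta> G n x * ?phi x) / step n"
  using eventually_step_less[OF r(1)]
 proof eventually_elim
  case (elim n)
  have "(%x. x + step n *\<^sub>R ?e) ` S \<subseteq> U"
   using r(2) elim step_pos[of n] thickenI[of _ S _ r] by force
  from difference_equation_split[OF W psi(2) this] show ?case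
   by (simp add: add_divide_distrib[symmetric])
 qed
 moreover have "(%n. (LBINT x. ?\<Delta> (%x. a (D x)) n x \<bullet> ?\<Phi> x) / step n
   + (LBINT x. ?\<Delta> (%x. \<beta> (D x)) n x * ?phi x) / step n) \<longlonglongrightarrow> (LBINT x. lin_integrand psi F FF i x)"
  unfolding split by (rule tendsto_add[OF principal(2) gradient(2)])
 ultimately show "(%n. (LBINT x. ?\<Delta> G n x * ?phi x) / step n) \<longlonglongrightarrow> (LBINT x. lin_integrand psi F FF i x)"
  by (rule Lim_transform_eventually[rotated])
qed

theorem linearized_equation:
 fixes psi :: "real^'n => real"
 assumes psi: "C1c S psi" "S \<subseteq> U" "!!x. 0 <= psi x" "!!x. psi x <= 1"
 obtains K0 R where "K0 > 0" "R > 0" "!!x. x \<in> S ==> norm (D x) <= R"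
  "!!F FF eps Fm i. (!!eta. GDERIV F eta :> FF eta) ==> continuous_on UNIV FF ==> eps > 0 ==>
   (!!eta. norm eta < eps ==> F eta = 0) ==> (!!eta. norm eta < eps ==> FF eta = 0) ==>
    (!!eta. norm eta <= R ==> \<bar>F eta\<bar> <= Fm) ==>
   integrable lborel (lin_integrand psi F FF i) \<and> \<bar>LBINT x. lin_integrand psi F FF i x\<bar> <= K0 * Fm"
proof -
 note S = C1c_compact[OF psi(1)] and psi2 = C1c_power2[OF psi(1)]
 obtain r where r: "r > 0" "thicken r S \<subseteq> U" using thicken_subset_open[OF S U psi(2)] .
 obtain R where R: "R > 0" "!!x. x \<in> S ==> norm (D x) <= R" by (rule D_bound[OF S psi(2)]) blast
 obtain Lg \<delta> where Lg: "Lg > 0" "\<delta> > 0" "!!i h. 0 < h ==> h < \<delta> ==>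
   AE x\<in>S in lborel. \<bar>G (x + h *\<^sub>R axis i 1) - G x\<bar> <= Lg * h"
  using G_lip[OF S psi(2)] by blast
 let ?mS = "LBINT x. indicator S x :: real"
 show ?thesis
 proof (rule that[of "Lg * ?mS + 1" R])
  fix F :: "real^'n => real" and FF eps Fm and i :: 'n
  assume F: "!!eta. GDERIV F eta :> FF eta" "continuous_on UNIV FF" and eps: "eps > 0"
   and F0: "!!eta. norm eta < eps ==> F eta = 0" "!!eta. norm eta < eps ==> FF eta = 0"
   and Fm: "!!eta. norm eta <= R ==> \<bar>F eta\<bar> <= Fm"
  let ?phi = "%x. F (D x) * (psi x)\<^sup>2"
  let ?e = "axis i 1 :: real^'n"
  have Fm0: "Fm >= 0" using Fm[of 0] R(1) by simp
  note limit = linearized_limit[OF F eps F0 psi(1,2)]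
  have "\<forall>\<^sub>F n in sequentially. \<bar>(LBINT x. (G (x + step n *\<^sub>R ?e) - G x) * ?phi x) / step n\<bar>
    <= Lg * ?mS * Fm"
   using eventually_step_less[OF Lg(2)]
  proof eventually_elim
   case (elim n)
   have phi_le: "\<bar>?phi x\<bar> <= Fm" if "x \<in> S" for x
    using mult_mono[OF Fm[OF R(2)[OF that]] power_le_one[OF psi(3,4), of x 2]] Fm0
     by (simp add: abs_mult)
   have "(LBINT x. \<bar>(G (x + step n *\<^sub>R ?e) - G x) * ?phi x\<bar>)
     <= (LBINT x. (Lg * step n * Fm) * indicator S x)"
   proof (rule integral_mono_AE')
    show "AE x in lborel. \<bar>(G (x + step n *\<^sub>R ?e) - G x) * ?phi x\<bar> <= (Lg * step n * Fm) * indicator S x"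
     using Lg(3)[of "step n" i, OF step_pos elim]
    proof eventually_elim
     case (elim x)
     show ?case
     proof (cases "x \<in> S")
      case True
      then show ?thesis
       using elim phi_le Lg(1) step_pos[of n] by (auto simp: abs_mult intro!: mult_mono)
     qed (simp add: C1c_zero[OF psi(1)])
    qed
   qed (use Lg(1) step_pos[of n] Fm0 integrable_indicator_compact[OF S] in auto)
   from order_trans[OF integral_abs_bound this] show ?case
    using step_pos[of n] by (simp add: abs_divide divide_le_eq mult_ac)
  qed
  then have "\<bar>LBINT x. lin_integrand psi F FF i x\<bar> <= Lg * ?mS * Fm"
   using tendsto_upperbound[OF tendsto_rabs[OF limit(2)]] by simp
  moreover have "Lg * ?mS * Fm <= (Lg * ?mS + 1) * Fm" using Fm0 by (simp add: distrib_right)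
  ultimately show "integrable lborel (lin_integrand psi F FF i)
    \<and> \<bar>LBINT x. lin_integrand psi F FF i x\<bar> <= (Lg * ?mS + 1) * Fm"
   using limit(1) by (meson order_trans)
 qed (use R Lg in \<open>auto intro!: add_nonneg_pos\<close>)
qed

theorem weighted_equation:
 fixes psi k :: "real^'n => real"
 assumes psi: "C1c S psi" "S \<subseteq> U" and k: "!!eta. GDERIV k eta :> kk eta" "continuous_on UNIV kk"
  and eps: "eps > 0" "!!eta. norm eta < eps ==> kk eta = 0"
 shows "integrable lborel (%x. (psi x)\<^sup>2 * (a (D x) \<bullet> (\<Sum>l\<in>UNIV. kk (D x) $ l *\<^sub>R Hv l x)))"
  "integrable lborel (%x. 2 * psi x * k (D x) * (a (D x) \<bullet> grad psi x))"
  "integrable lborel (%x. \<beta> (D x) * ((psi x)\<^sup>2 * k (D x)))"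
  "integrable lborel (%x. G x * ((psi x)\<^sup>2 * k (D x)))"
  "(LBINT x. (psi x)\<^sup>2 * (a (D x) \<bullet> (\<Sum>l\<in>UNIV. kk (D x) $ l *\<^sub>R Hv l x)))
   + (LBINT x. 2 * psi x * k (D x) * (a (D x) \<bullet> grad psi x))
   + (LBINT x. \<beta> (D x) * ((psi x)\<^sup>2 * k (D x))) = (LBINT x. G x * ((psi x)\<^sup>2 * k (D x)))"
proof -
 let ?Z = "%x. \<Sum>l\<in>UNIV. kk (D x) $ l *\<^sub>R Hv l x"
 let ?phi = "%x. k (D x) * (psi x)\<^sup>2"
 let ?\<Phi> = "%x. k (D x) *\<^sub>R grad (%x. (psi x)\<^sup>2) x + (psi x)\<^sup>2 *\<^sub>R ?Z x"
 note psi2 = C1c_power2[OF psi(1)] and S = C1c_compact[OF psi(1)]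
 have W: "W11c S ?phi ?\<Phi>" by (rule truncated_W11c[OF k eps psi2(1) psi(2)])
 have cont: "continuous_on UNIV k"
  using GDERIV_isCont[OF k(1)] by (simp add: continuous_at_imp_continuous_on)
 have "continuous_on S (%x. 2 * psi x * k (D x) * (a (D x) \<bullet> grad psi x))"
  by (intro continuous_intros C1c_continuous[OF psi(1)] C1c_continuous_grad[OF psi(1)]
    continuous_on_compose2[OF cont] continuous_on_compose2[OF a_cont[of UNIV]]
    continuous_on_subset[OF D_cont psi(2)]) auto
 from set_integrable_continuous[OF S this]
 show cutoff: "integrable lborel (%x. 2 * psi x * k (D x) * (a (D x) \<bullet> grad psi x))"
  unfolding set_integrable_def
  by (rule Bochner_Integration.integrable_cong[THEN iffD1, rotated 2])
   (auto simp: indicator_def C1c_zero[OF psi(1)])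
 have split: "a (D x) \<bullet> ?\<Phi> x - 2 * psi x * k (D x) * (a (D x) \<bullet> grad psi x) = (psi x)\<^sup>2 * (a (D x) \<bullet> ?Z
   x)" for x
  by (simp add: psi2(2) inner_add_right)
 note eq = equation_W11c[OF W psi(2)]
 show principal: "integrable lborel (%x. (psi x)\<^sup>2 * (a (D x) \<bullet> ?Z x))"
  using Bochner_Integration.integrable_diff[OF eq(1) cutoff] unfolding split .
 have commute: "?phi x = (psi x)\<^sup>2 * k (D x)" for x by simp
 show gradient: "integrable lborel (%x. \<beta> (D x) * ((psi x)\<^sup>2 * k (D x)))"
  and source: "integrable lborel (%x. G x * ((psi x)\<^sup>2 * k (D x)))"
  using locally_integrable_mult_W11c(1)[OF locally_integrable_compose_D[OF \<beta>_cont] W psi(2)]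
   locally_integrable_mult_W11c(1)[OF G_locally_integrable W psi(2)] unfolding commute .
 have "(LBINT x. (psi x)\<^sup>2 * (a (D x) \<bullet> ?Z x))
   = (LBINT x. a (D x) \<bullet> ?\<Phi> x) - (LBINT x. 2 * psi x * k (D x) * (a (D x) \<bullet> grad psi x))"
  unfolding split[symmetric] by (rule Bochner_Integration.integral_diff[OF eq(1) cutoff])
 moreover have "(LBINT x. lower_order x * ?phi x)
   = (LBINT x. \<beta> (D x) * ((psi x)\<^sup>2 * k (D x))) - (LBINT x. G x * ((psi x)\<^sup>2 * k (D x)))"
  unfolding lower_order_def left_diff_distrib commute
  by (rule Bochner_Integration.integral_diff[OF gradient source])
 ultimately show "(LBINT x. (psi x)\<^sup>2 * (a (D x) \<bullet> ?Z x))
   + (LBINT x. 2 * psi x * k (D x) * (a (D x) \<bullet> grad psi x))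
   + (LBINT x. \<beta> (D x) * ((psi x)\<^sup>2 * k (D x))) = (LBINT x. G x * ((psi x)\<^sup>2 * k (D x)))"
  using eq(3) by linarith
qed

end

section \<open>Weighted estimates\<close>

lemma DERIV_pos_part_sq: "((%x::real. (max 0 x)\<^sup>2) has_real_derivative 2 * max 0 x) (at x)"
proof -
 have "((%x::real. (max 0 x)\<^sup>2) has_real_derivative 0) (at 0)"
  unfolding DERIV_def
 proof (rule Lim_null_comparison[of _ "%h. \<bar>h\<bar>"])
  show "\<forall>\<^sub>F h in at 0. norm (((max 0 (0 + h))\<^sup>2 - (max 0 (0::real))\<^sup>2) / h) <= \<bar>h\<bar>"
   by (intro always_eventually) (auto simp: max_def power2_eq_square)
 qed (auto intro!: tendsto_eq_intros)
 moreover have "((%x::real. (max 0 x)\<^sup>2) has_real_derivative 2 * x) (at x)" if "x > 0"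
   for x :: real
 proof (rule has_field_derivative_transform_within_open[of "%x. x\<^sup>2" _ _ "{0<..}"])
 qed (use that in \<open>auto intro!: derivative_eq_intros\<close>)
 moreover have "((%x::real. (max 0 x)\<^sup>2) has_real_derivative 0) (at x)" if "x < 0" for x :: real
 proof (rule has_field_derivative_transform_within_open[of "%x. 0" _ _ "{..<0}"])
 qed (use that in auto)
 ultimately show ?thesis by (cases x "0::real" rule: linorder_cases) auto
qed

lemma radial_GDERIV:
 fixes K K' :: "real => real"
 assumes K: "!!t. t > 0 ==> (K has_real_derivative K' t) (at t)" "continuous_on {0<..} K'"
  and eps: "eps > 0" "!!t. 0 <= t ==> t < eps ==> K t = c" "!!t. 0 <= t ==> t < eps ==> K' t = 0"
 shows "GDERIV (%eta::real^'n. K (norm eta)) eta :> K' (norm eta) *\<^sub>R sgn eta"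
  "continuous_on UNIV (%eta::real^'n. K' (norm eta) *\<^sub>R sgn eta)"
proof -
 show "GDERIV (%eta::real^'n. K (norm eta)) eta :> K' (norm eta) *\<^sub>R sgn eta"
 proof (cases "eta = 0")
  case True
  have "((%eta::real^'n. K (norm eta)) has_derivative (%h. 0)) (at 0)"
   by (rule has_derivative_transform_within_open[of "%_. c" _ _ _ "ball 0 eps"]) (use eps in auto)
  then show ?thesis using True eps by (simp add: gderiv_def)
 next
  case False
  show ?thesis using GDERIV_DERIV_compose[OF GDERIV_norm[OF False] K(1)] False by simp
 qed
 have "continuous_on ((- {0}) \<union> ball 0 eps) (%eta::real^'n. K' (norm eta) *\<^sub>R sgn eta)"
 proof (rule continuous_on_open_Un)
  show "continuous_on (- {0}) (%eta::real^'n. K' (norm eta) *\<^sub>R sgn eta)"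
   by (intro continuous_intros continuous_on_compose2[OF K(2)]) (auto simp: sgn_div_norm
     intro!: continuous_intros)
  show "continuous_on (ball 0 eps) (%eta::real^'n. K' (norm eta) *\<^sub>R sgn eta)"
   by (rule continuous_on_eq[of _ "%_. 0"]) (use eps in auto)
 qed auto
 moreover have "(- {0}) \<union> ball (0::real^'n) eps = UNIV" using eps by auto
 ultimately show "continuous_on UNIV (%eta::real^'n. K' (norm eta) *\<^sub>R sgn eta)" by simp
qed

lemma radial_component:
 fixes K K' :: "real => real"
 assumes K: "!!t. t > 0 ==> (K has_real_derivative K' t) (at t)" "continuous_on {0<..} K'"
  and eps: "eps > 0" "!!t. 0 <= t ==> t < eps ==> K t = 0" "!!t. 0 <= t ==> t < eps ==> K' t = 0"
 shows "GDERIV (%eta::real^'n. K (norm eta) * eta $ i) eta :> K (norm eta) *\<^sub>R axis i 1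
   + (eta $ i * K' (norm eta)) *\<^sub>R sgn eta"
  "continuous_on UNIV (%eta::real^'n. K (norm eta) *\<^sub>R axis i 1 + (eta $ i * K' (norm eta)) *\<^sub>R sgn eta)"
proof -
 note r = radial_GDERIV[of K K' eps 0, OF assms]
 have "GDERIV (%eta::real^'n. eta $ i) eta :> axis i 1" for eta
  unfolding gderiv_def inner_axis by (simp add: bounded_linear_imp_has_derivative
    bounded_linear_vec_nth)
 from GDERIV_mult[OF r(1) this] show "GDERIV (%eta::real^'n. K (norm eta) * eta $ i) eta :> K (norm eta)
   *\<^sub>R axis i 1 + (eta $ i * K' (norm eta)) *\<^sub>R sgn eta" by simp
 have "continuous_on UNIV (%eta::real^'n. K (norm eta))"
  by (intro continuous_at_imp_continuous_on ballI GDERIV_isCont[OF r(1)])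
 then have "continuous_on UNIV (%eta::real^'n. K (norm eta) *\<^sub>R axis i 1 + eta $ i *\<^sub>R (K' (norm eta) *\<^sub>R
   sgn eta))" by (intro continuous_intros r(2))
 then show "continuous_on UNIV (%eta::real^'n. K (norm eta) *\<^sub>R axis i 1 + (eta $ i * K' (norm eta)) *\<^sub>R
   sgn eta)" by simp
qed

definition cut_powr :: "real => real => real => real" where
 "cut_powr b eps t = t powr (- b) * (max 0 (1 - eps / t))\<^sup>2"

definition cut_powr_rest :: "real => real => real => real" where
 "cut_powr_rest b eps t = 2 * t powr (- b) * max 0 (1 - eps / t) * (eps / t)"

definition cut_powr_deriv :: "real => real => real => real" where
 "cut_powr_deriv b eps t = (cut_powr_rest b eps t - b * cut_powr b eps t) / t"

lemma cut_powr_DERIV: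
 assumes t: "t > 0"
 shows "(cut_powr b eps has_real_derivative cut_powr_deriv b eps t) (at t)"
proof -
 have inner: "((%t. 1 - eps / t) has_real_derivative eps / t\<^sup>2) (at t)"
  using t by (auto intro!: derivative_eq_intros simp: power2_eq_square)
 have powr: "((%t. t powr (- b)) has_real_derivative - b * t powr (- b) / t) (at t)"
  using t by (auto intro!: derivative_eq_intros simp: powr_diff)
 show ?thesis
  unfolding cut_powr_def[abs_def]
  by (rule DERIV_cong[OF DERIV_mult'[OF powr DERIV_chain2[OF DERIV_pos_part_sq inner]]])
   (use t in \<open>simp add: cut_powr_deriv_def cut_powr_def cut_powr_rest_def field_simps
     power2_eq_square\<close>)
qed

lemma cut_powr_cont: "continuous_on {0<..} (cut_powr b eps)"
 by (rule DERIV_continuous_on[OF has_field_derivative_at_within[OF cut_powr_DERIV]]) simp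

lemma cut_powr_deriv_cont: "continuous_on {0<..} (cut_powr_deriv b eps)"
 unfolding cut_powr_deriv_def[abs_def] cut_powr_def cut_powr_rest_def
  by (intro continuous_intros) auto

lemma cut_powr_eq_0:
 assumes "0 <= t" "t < eps"
 shows "cut_powr b eps t = 0" "cut_powr_deriv b eps t = 0"
proof -
 have "t = 0 \<or> max 0 (1 - eps / t) = 0" using assms
  by (cases "t = 0") (auto simp: max_def field_simps)
 then show "cut_powr b eps t = 0" "cut_powr_deriv b eps t = 0"
  by (auto simp: cut_powr_def cut_powr_rest_def cut_powr_deriv_def)
qed

lemma cut_powr_nonneg: "0 <= cut_powr b eps t" by (simp add: cut_powr_def)

lemma cut_powr_le:
 assumes "0 <= t" "0 < eps"
 shows "cut_powr b eps t <= t powr (- b)"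
 unfolding cut_powr_def using assms by (intro mult_left_le power_le_one) auto

lemma cut_powr_rest_bounds:
 assumes t: "0 < t" and eps: "0 < eps"
 shows "0 <= cut_powr_rest b eps t"
  "cut_powr_rest b eps t <= 2 * sqrt (t powr (- b)) * sqrt (cut_powr b eps t)"
proof -
 show "0 <= cut_powr_rest b eps t" using t eps by (simp add: cut_powr_rest_def)
 have root: "2 * sqrt (t powr (- b)) * sqrt (cut_powr b eps t) = 2 * t powr (- b) * max 0 (1 - eps / t)"
  by (simp add: cut_powr_def real_sqrt_mult)
 have "max 0 (1 - eps / t) * (eps / t) <= max 0 (1 - eps / t) * 1"
 proof (cases "eps <= t")
  case True then show ?thesis using t eps by (intro mult_left_mono) auto
 next
  case False then have "max 0 (1 - eps / t) = 0" using t by (auto simp: max_def field_simps)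
  then show ?thesis by simp
 qed
 then have "2 * t powr (- b) * (max 0 (1 - eps / t) * (eps / t)) <= 2 * t powr (- b) *
   (max 0 (1 - eps / t) * 1)"
  by (rule mult_left_mono) simp
 then show "cut_powr_rest b eps t <= 2 * sqrt (t powr (- b)) * sqrt (cut_powr b eps t)"
  unfolding root cut_powr_rest_def by (simp add: mult.assoc)
qed

lemma cut_powr_tendsto: "t > 0 ==> (%n. cut_powr b (step n) t) \<longlonglongrightarrow> t powr (- b)"
 unfolding cut_powr_def by (auto intro!: tendsto_eq_intros step_tendsto_0)

lemma norm_weighted_sum_le:
 fixes w :: "real^'n" and h :: "'n => 'a::real_normed_vector"
 shows "norm (\<Sum>l\<in>UNIV. w $ l *\<^sub>R h l) <= norm w * sqrt (\<Sum>l\<in>UNIV. (norm (h l))\<^sup>2)"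
proof -
 have "norm (\<Sum>l\<in>UNIV. w $ l *\<^sub>R h l) <= (\<Sum>l\<in>UNIV. \<bar>w $ l\<bar> * \<bar>norm (h l)\<bar>)"
  by (rule order_trans[OF norm_sum]) simp
 also have "... <= L2_set (%l. w $ l) UNIV * L2_set (%l. norm (h l)) UNIV"
  by (rule L2_set_mult_ineq)
 finally show ?thesis by (simp add: L2_set_def norm_vec_def)
qed

context local_solution
begin

lemma Da_inner:
 assumes "eta \<noteq> 0"
 shows "Da eta \<xi> \<bullet> \<zeta> = A (norm eta) * (\<xi> \<bullet> \<zeta> + norm eta * deriv A (norm eta) / A (norm eta) * (sgn eta \<bullet> \<xi>) *
   (sgn eta \<bullet> \<zeta>))"
proof -
 have "A (norm eta) \<noteq> 0" using A_pos[of "norm eta"] assms by simp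
 then show ?thesis using assms by (simp add: Da_def sgn_div_norm inner_add_left field_simps)
qed

definition ell_min :: real where "ell_min = min 1 (1 + m)"
definition ell_max :: real where "ell_max = 1 + max \<bar>m\<bar> \<bar>M\<bar>"

lemma ell_min_pos: "ell_min > 0" and ell_max_pos: "ell_max > 0"
 using m by (auto simp: ell_min_def ell_max_def)

lemma sgn_inner_le: "\<bar>sgn eta \<bullet> \<xi>\<bar> <= norm (\<xi> :: real^'n)"
 using Cauchy_Schwarz_ineq2[of "sgn eta" \<xi>] by (cases "eta = 0") (auto simp: norm_sgn)

lemma Da_lower:
 assumes "eta \<noteq> 0" shows "ell_min * A (norm eta) * (norm \<xi>)\<^sup>2 <= Da eta \<xi> \<bullet> \<xi>"
proof -
 let ?r = "norm eta * deriv A (norm eta) / A (norm eta)" and ?s = "(sgn eta \<bullet> \<xi>)\<^sup>2"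
 have s: "?s <= (norm \<xi>)\<^sup>2" using sgn_inner_le[of eta \<xi>] by (simp add: abs_le_square_iff[symmetric])
 have b: "m <= ?r" using A_m assms by simp
 have "ell_min * (norm \<xi>)\<^sup>2 <= (norm \<xi>)\<^sup>2 + ?r * ?s"
 proof (cases "?r >= 0")
  case True
  have "ell_min * (norm \<xi>)\<^sup>2 <= 1 * (norm \<xi>)\<^sup>2"
   by (intro mult_right_mono) (auto simp: ell_min_def)
  moreover have "0 <= ?r * ?s" using True by (intro mult_nonneg_nonneg) auto
  ultimately show ?thesis by linarith
 next
  case False
  have "ell_min * (norm \<xi>)\<^sup>2 <= (1 + ?r) * (norm \<xi>)\<^sup>2" using b
   by (intro mult_right_mono) (auto simp: ell_min_def)
  moreover have "?r * (norm \<xi>)\<^sup>2 <= ?r * ?s" using False s by (intro mult_left_mono_neg) auto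
  ultimately show ?thesis by (simp add: distrib_right)
 qed
 then have "A (norm eta) * (ell_min * (norm \<xi>)\<^sup>2) <= A (norm eta) * ((norm \<xi>)\<^sup>2 + ?r * ?s)"
  using A_pos[of "norm eta"] assms by (intro mult_left_mono) auto
 then show ?thesis unfolding Da_inner[OF assms] dot_square_norm
  by (simp add: power2_eq_square mult_ac)
qed

lemma Da_upper:
 assumes "eta \<noteq> 0" shows "\<bar>Da eta \<xi> \<bullet> \<zeta>\<bar> <= ell_max * A (norm eta) * (norm \<xi> * norm \<zeta>)"
proof -
 let ?r = "norm eta * deriv A (norm eta) / A (norm eta)"
 have b: "\<bar>?r\<bar> <= max \<bar>m\<bar> \<bar>M\<bar>" using A_m[of "norm eta"] A_M[of "norm eta"] assms by auto
 have "\<bar>?r * ((sgn eta \<bullet> \<xi>) * (sgn eta \<bullet> \<zeta>))\<bar> <= max \<bar>m\<bar> \<bar>M\<bar> * (norm \<xi> * norm \<zeta>)"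
  unfolding abs_mult[of ?r] abs_mult[of "sgn eta \<bullet> \<xi>"] by (intro mult_mono b sgn_inner_le) auto
 then have "\<bar>\<xi> \<bullet> \<zeta> + ?r * (sgn eta \<bullet> \<xi>) * (sgn eta \<bullet> \<zeta>)\<bar> <= ell_max * (norm \<xi> * norm \<zeta>)"
  using Cauchy_Schwarz_ineq2[of \<xi> \<zeta>] unfolding ell_max_def distrib_right mult.assoc[of ?r]
   by linarith
 then have "A (norm eta) * \<bar>\<xi> \<bullet> \<zeta> + ?r * (sgn eta \<bullet> \<xi>) * (sgn eta \<bullet> \<zeta>)\<bar> <= A (norm eta) * (ell_max *
   (norm \<xi> * norm \<zeta>))"
  using A_pos[of "norm eta"] assms by (intro mult_left_mono) auto
 then show ?thesis unfolding Da_inner[OF assms] abs_mult using A_pos[of "norm eta"] assms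
  by (simp add: mult_ac)
qed

lemma Da_linear: "Da eta (\<xi> + \<zeta>) = Da eta \<xi> + Da eta \<zeta>" "Da eta (c *\<^sub>R \<xi>) = c *\<^sub>R Da eta \<xi>" "Da eta (\<xi> - \<zeta>)
  = Da eta \<xi> - Da eta \<zeta>" "Da eta 0 = 0"
 by (auto simp: Da_def algebra_simps inner_simps add_divide_distrib diff_divide_distrib)

lemma Da_sum: "Da eta (\<Sum>l\<in>I. f l) = (\<Sum>l\<in>I. Da eta (f l))"
 by (induction I rule: infinite_finite_induct) (auto simp: Da_linear)

lemma Da_sym: "eta \<noteq> 0 ==> Da eta \<xi> \<bullet> \<zeta> = Da eta \<zeta> \<bullet> \<xi>"
 by (simp add: Da_inner inner_commute[of \<xi> \<zeta>] mult_ac)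

lemma sum_sgn_sq: "eta \<noteq> 0 ==> (\<Sum>l\<in>UNIV. (sgn eta $ l)\<^sup>2) = (1::real)" for eta :: "real^'n"
 using norm_sgn[of eta] by (simp add: norm_vec_def L2_set_def)

lemma Da_Cauchy_Schwarz:
 fixes h :: "'n => real^'n"
 assumes "eta \<noteq> 0" and Z: "Z = (\<Sum>l\<in>UNIV. sgn eta $ l *\<^sub>R h l)"
 shows "Da eta Z \<bullet> Z <= (\<Sum>l\<in>UNIV. Da eta (h l) \<bullet> h l)"
proof -
 let ?n = "%l. sgn eta $ l"
 have nonneg: "0 <= Da eta \<xi> \<bullet> \<xi>" for \<xi>
  using Da_lower[OF assms(1), of \<xi>] ell_min_pos A_pos[of "norm eta"] assms(1)
   by (auto intro: order_trans[rotated])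
 have expand: "Da eta (h l - ?n l *\<^sub>R Z) \<bullet> (h l - ?n l *\<^sub>R Z) = Da eta (h l) \<bullet> h l - 2 * (Da eta (?n l *\<^sub>R h
   l) \<bullet> Z) + (?n l)\<^sup>2 * (Da eta Z \<bullet> Z)" for l
  using Da_sym[OF assms(1), of Z "h l"] by (simp add: Da_linear inner_diff_left inner_diff_right
    power2_eq_square algebra_simps)
 have "0 <= (\<Sum>l\<in>UNIV. Da eta (h l - ?n l *\<^sub>R Z) \<bullet> (h l - ?n l *\<^sub>R Z))" by (intro sum_nonneg nonneg)
 also have "... = (\<Sum>l\<in>UNIV. Da eta (h l) \<bullet> h l) - 2 * (\<Sum>l\<in>UNIV. Da eta (?n l *\<^sub>R h l) \<bullet> Z)
   + (\<Sum>l\<in>UNIV. (?n l)\<^sup>2) * (Da eta Z \<bullet> Z)"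
  unfolding expand by (simp add: sum.distrib sum_subtractf sum_distrib_left sum_distrib_right)
 also have "(\<Sum>l\<in>UNIV. Da eta (?n l *\<^sub>R h l) \<bullet> Z) = Da eta Z \<bullet> Z"
  by (simp only: Z Da_sum inner_sum_left)
 finally show ?thesis by (simp add: sum_sgn_sq[OF assms(1)])
qed

lemma A_lower: "t > 0 ==> c2 * t powr (p - 2) <= A t"
proof -
 assume t: "t > 0"
 fix i :: 'n
 have "c2 * t powr (p - 2) * t\<^sup>2 <= A t * t\<^sup>2"
  using A_ell[of "t *\<^sub>R axis i 1" 0] t by (simp add: power2_eq_square)
 then show ?thesis using t by simp
qed

lemma B_upper: "t >= 0 ==> B t <= CB * (t\<^sup>2 * A t)"
proof (cases "t = 0")
 case False
 assume "t >= 0"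
 then have t: "t > 0" using False by simp
 have "continuous_on {0..t} B" using B_contOn by (rule continuous_on_subset) auto
 then obtain z where "0 < z" "z < t" "B t - B 0 = (%h. h * B' z) (t - 0)"
  by (rule mvt[OF t, of B "%z h. h * B' z"]) (use B_DERIV in \<open>auto simp:
    has_field_derivative_def mult_commute_abs\<close>)
 then have z: "0 < z" "z < t" "B t = t * B' z" using B_0 by auto
 have "B' z <= CB * (t * A t)" using B_le[OF z(1)] tA_mono[OF z(1), of t] z CB
  by (meson less_imp_le mult_left_mono order_trans)
 then show ?thesis using z t by (simp add: power2_eq_square mult_ac)
qed (simp add: B_0)

lemma Da_nonneg: "eta \<noteq> 0 ==> 0 <= Da eta \<xi> \<bullet> \<xi>"
 using Da_lower[of eta \<xi>] ell_min_pos A_pos[of "norm eta"]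
 by (auto intro: order_trans[rotated])

text \<open>In the estimates for the tested linearised equation the vectors \<^term>\<open>h l\<close> stand for the derivatives
 of the gradient, \<^term>\<open>K\<close> for the cut-off weight and \<^term>\<open>P - b * K\<close> for its logarithmic derivative;
 \<^term>\<open>\<kappa>\<close> is the weight before the cut-off.\<close>
lemma Da_weighted_lower:
 fixes h :: "'n => real^'n"
 assumes eta: "eta \<noteq> 0" and b: "0 <= b" "b < 1" and K: "0 <= K" and P: "0 <= P"
  and Z: "Z = (\<Sum>l\<in>UNIV. sgn eta $ l *\<^sub>R h l)"
 shows "(1 - b) * ell_min * A (norm eta) * (K * (\<Sum>l\<in>UNIV. (norm (h l))\<^sup>2))
  <= K * (\<Sum>l\<in>UNIV. Da eta (h l) \<bullet> h l) + (P - b * K) * (Da eta Z \<bullet> Z)"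
proof -
 let ?q = "\<Sum>l\<in>UNIV. Da eta (h l) \<bullet> h l" and ?S = "\<Sum>l\<in>UNIV. (norm (h l))\<^sup>2"
 have "ell_min * A (norm eta) * ?S <= ?q" unfolding sum_distrib_left by (intro sum_mono Da_lower eta)
 then have "(1 - b) * K * (ell_min * A (norm eta) * ?S) <= (1 - b) * K * ?q"
  using b K by (intro mult_left_mono) auto
 moreover have "b * K * (Da eta Z \<bullet> Z) <= b * K * ?q"
  using b K Da_Cauchy_Schwarz[OF eta Z] by (intro mult_left_mono) auto
 moreover have "0 <= P * (Da eta Z \<bullet> Z)" using P Da_nonneg[OF eta] by simp
 ultimately show ?thesis by (simp add: algebra_simps)
qed

lemma norm_sgn_sum_le:
 fixes h :: "'n => real^'n" and eta :: "real^'n"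
 assumes "eta \<noteq> 0"
 shows "norm (\<Sum>l\<in>UNIV. sgn eta $ l *\<^sub>R h l) <= sqrt (\<Sum>l\<in>UNIV. (norm (h l))\<^sup>2)"
 using norm_weighted_sum_le[of "sgn eta" h] assms by (simp add: norm_sgn)

lemma le_sqrt_mult_sqrt: "0 <= K ==> K <= \<kappa> ==> K <= sqrt \<kappa> * sqrt K"
 using mult_right_mono[of "sqrt K" "sqrt \<kappa>" "sqrt K"] by simp

lemma cutoff_term_bound:
 fixes h :: "'n => real^'n"
 assumes eta: "eta \<noteq> 0" and K: "0 <= K" "K <= \<kappa>" and psi: "0 <= psi" and g: "norm g <= Pg"
  and Z: "Z = (\<Sum>l\<in>UNIV. sgn eta $ l *\<^sub>R h l)"
 shows "\<bar>2 * psi * K * norm eta * (Da eta Z \<bullet> g)\<bar> <= 2 * ell_max * Pg *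
  (A (norm eta) * (norm eta * sqrt \<kappa>) * (psi * sqrt K * sqrt (\<Sum>l\<in>UNIV. (norm (h l))\<^sup>2)))"
proof -
 let ?S = "\<Sum>l\<in>UNIV. (norm (h l))\<^sup>2"
 have S: "0 <= ?S" by (intro sum_nonneg) simp
 have A: "0 < A (norm eta)" using eta A_pos by simp
 have "\<bar>Da eta Z \<bullet> g\<bar> <= ell_max * A (norm eta) * (norm Z * norm g)" by (rule Da_upper[OF eta])
 also have "... <= ell_max * A (norm eta) * (sqrt ?S * Pg)"
  unfolding Z using ell_max_pos A S g by (intro mult_left_mono mult_mono norm_sgn_sum_le eta) auto
 finally have "K * \<bar>Da eta Z \<bullet> g\<bar> <= (sqrt \<kappa> * sqrt K) * (ell_max * A (norm eta) * (sqrt ?S * Pg))"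
  using K by (intro mult_mono le_sqrt_mult_sqrt) auto
 then have "(2 * psi * norm eta) * (K * \<bar>Da eta Z \<bullet> g\<bar>)
   <= (2 * psi * norm eta) * ((sqrt \<kappa> * sqrt K) * (ell_max * A (norm eta) * (sqrt ?S * Pg)))"
  using psi by (intro mult_left_mono) auto
 then show ?thesis using psi K by (simp add: abs_mult mult_ac)
qed

lemma gradient_term_bound:
 fixes h :: "'n => real^'n"
 assumes eta: "eta \<noteq> 0" "norm eta <= R" and b: "0 <= b" "b < 1" and K: "0 <= K" "K <= \<kappa>"
  and P: "0 <= P" "P <= 2 * sqrt \<kappa> * sqrt K" and psi: "0 <= psi" "psi <= 1"
  and Z: "Z = (\<Sum>l\<in>UNIV. sgn eta $ l *\<^sub>R h l)"
 shows "\<bar>psi\<^sup>2 * \<beta> eta * (K * (\<Sum>l\<in>UNIV. h l $ l) + (P - b * K) * (sgn eta \<bullet> Z))\<bar>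
  <= CB * R * (real CARD('n) + 3) *
   (A (norm eta) * (norm eta * sqrt \<kappa>) * (psi * sqrt K * sqrt (\<Sum>l\<in>UNIV. (norm (h l))\<^sup>2)))"
proof -
 define s where "s = sqrt (\<Sum>l\<in>UNIV. (norm (h l))\<^sup>2)"
 have s: "0 <= s" "norm (h l) <= s" "norm Z <= s" for l
  using norm_sgn_sum_le[OF eta(1), of h] member_le_sum[of l UNIV "%l. (norm (h l))\<^sup>2"]
  by (auto simp: s_def Z intro: real_le_rsqrt sum_nonneg)
 have t: "0 < norm eta" "0 < A (norm eta)" using eta A_pos by auto
 have K': "K <= sqrt \<kappa> * sqrt K" by (rule le_sqrt_mult_sqrt[OF K])
 have "\<bar>\<Sum>l\<in>UNIV. h l $ l\<bar> <= (\<Sum>l\<in>(UNIV::'n set). s)"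
  by (intro order_trans[OF sum_abs] sum_mono order_trans[OF component_le_norm_cart s(2)])
 then have "K * \<bar>\<Sum>l\<in>UNIV. h l $ l\<bar> <= (sqrt \<kappa> * sqrt K) * (real CARD('n) * s)"
  using K' K by (intro mult_mono) auto
 moreover have "\<bar>P - b * K\<bar> * \<bar>sgn eta \<bullet> Z\<bar> <= (3 * (sqrt \<kappa> * sqrt K)) * s"
 proof (intro mult_mono)
  have "b * K <= sqrt \<kappa> * sqrt K" "0 <= b * K" using mult_right_mono[of b 1 K] b K K' by auto
  then show "\<bar>P - b * K\<bar> <= 3 * (sqrt \<kappa> * sqrt K)" using P by (simp add: mult.assoc)
 qed (use order_trans[OF sgn_inner_le s(3)] K in auto)
 ultimately have factor: "\<bar>K * (\<Sum>l\<in>UNIV. h l $ l) + (P - b * K) * (sgn eta \<bullet> Z)\<bar>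
   <= (real CARD('n) + 3) * (sqrt \<kappa> * sqrt K * s)"
  using abs_triangle_ineq[of "K * (\<Sum>l\<in>UNIV. h l $ l)" "(P - b * K) * (sgn eta \<bullet> Z)"] K(1)
  unfolding abs_mult[of "P - b * K"] abs_mult[of K] distrib_right
   by (simp add: mult_ac distrib_left)
 have \<beta>: "0 <= \<beta> eta" using B_nonneg by (simp add: \<beta>_def)
 have "\<beta> eta <= CB * (norm eta * (norm eta * A (norm eta)))"
  using B_upper[of "norm eta"] by (simp add: \<beta>_def power2_eq_square mult.assoc)
 also have "... <= CB * (R * (norm eta * A (norm eta)))"
  using CB t eta(2) by (intro mult_left_mono mult_right_mono) auto
 finally have \<beta>psi: "psi\<^sup>2 * \<beta> eta <= psi * (CB * (R * (norm eta * A (norm eta))))"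
  using \<beta> psi by (intro mult_mono) (auto simp: power2_eq_square mult_left_le)
 have "(psi\<^sup>2 * \<beta> eta) * \<bar>K * (\<Sum>l\<in>UNIV. h l $ l) + (P - b * K) * (sgn eta \<bullet> Z)\<bar>
   <= (psi * (CB * (R * (norm eta * A (norm eta))))) * ((real CARD('n) + 3) * (sqrt \<kappa> * sqrt K * s))"
  by (rule mult_mono[OF \<beta>psi factor])
   (use psi CB t order_trans[OF less_imp_le[OF t(1)] eta(2)] in auto)
 then show ?thesis using \<beta> by (simp add: abs_mult s_def[symmetric] mult_ac)
qed

lemma hessian_pointwise:
 fixes h :: "'n => real^'n"
 assumes eta: "eta \<noteq> 0" "norm eta <= R" and b: "0 <= b" "b < 1" and K: "0 <= K" "K <= \<kappa>"
  and P: "0 <= P" "P <= 2 * sqrt \<kappa> * sqrt K" and psi: "0 <= psi" "psi <= 1" and g: "norm g <= Pg"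
  and Z: "Z = (\<Sum>l\<in>UNIV. sgn eta $ l *\<^sub>R h l)"
  and c: "c = (1 - b) * ell_min" and c': "c' = 2 * ell_max * Pg + CB * R * (real CARD('n) + 3)"
 shows "c / 2 * (A (norm eta) * (psi\<^sup>2 * K * (\<Sum>l\<in>UNIV. (norm (h l))\<^sup>2)))
   - (c'\<^sup>2 / (2 * c) + 2 * CB * R * Pg) * (A (norm eta) * ((norm eta)\<^sup>2 * \<kappa>))
  <= 2 * psi * K * norm eta * (Da eta Z \<bullet> g)
   + psi\<^sup>2 * (K * (\<Sum>l\<in>UNIV. Da eta (h l) \<bullet> h l) + (P - b * K) * (Da eta Z \<bullet> Z))
   - psi\<^sup>2 * \<beta> eta * (K * (\<Sum>l\<in>UNIV. h l $ l) + (P - b * K) * (sgn eta \<bullet> Z)) - 2 * psi * \<beta> eta * K *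
     (eta \<bullet> g)"
  (is "_ <= ?T")
proof -
 define a where "a = A (norm eta)"
 define S where "S = (\<Sum>l\<in>UNIV. (norm (h l))\<^sup>2)"
 define X y where "X = psi * sqrt K * sqrt S" and "y = norm eta * sqrt \<kappa>"
 have a: "0 < a" using eta A_pos by (simp add: a_def)
 have \<kappa>: "0 <= \<kappa>" and Pg: "0 <= Pg" and R: "0 <= R"
  using K g norm_ge_zero[of g] eta(2) norm_ge_zero[of eta] by linarith+
 have "0 <= S" unfolding S_def by (intro sum_nonneg) simp
 then have squares: "X\<^sup>2 = psi\<^sup>2 * K * S" "y\<^sup>2 = (norm eta)\<^sup>2 * \<kappa>"
  using K(1) \<kappa> by (simp_all add: X_def y_def power_mult_distrib)
 have principal: "c * a * X\<^sup>2 <= psi\<^sup>2 * (K * (\<Sum>l\<in>UNIV. Da eta (h l) \<bullet> h l) + (P - b * K) * (Da eta Z \<bullet>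
   Z))"
  using mult_left_mono[OF Da_weighted_lower[OF eta(1) b K(1) P(1) Z], of "psi\<^sup>2"]
  by (simp add: squares c a_def S_def mult_ac)
 have cutoff: "\<bar>2 * psi * K * norm eta * (Da eta Z \<bullet> g)\<bar> <= 2 * ell_max * Pg * (a * y * X)"
  using cutoff_term_bound[OF eta(1) K psi(1) g Z] by (simp add: a_def y_def X_def S_def)
 have gradient: "\<bar>psi\<^sup>2 * \<beta> eta * (K * (\<Sum>l\<in>UNIV. h l $ l) + (P - b * K) * (sgn eta \<bullet> Z))\<bar>
   <= CB * R * (real CARD('n) + 3) * (a * y * X)"
  using gradient_term_bound[OF eta b K P psi Z] by (simp add: a_def y_def X_def S_def)
 have mixed: "\<bar>2 * psi * \<beta> eta * K * (eta \<bullet> g)\<bar> <= 2 * CB * R * Pg * (a * y\<^sup>2)"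
 proof -
  have \<beta>: "0 <= \<beta> eta" "\<beta> eta <= CB * ((norm eta)\<^sup>2 * a)"
   using B_nonneg[of "norm eta"] B_upper[of "norm eta"] by (auto simp: \<beta>_def a_def)
  have "\<bar>eta \<bullet> g\<bar> <= R * Pg"
   using Cauchy_Schwarz_ineq2[of eta g] mult_mono[OF eta(2) g] R by auto
  then have "2 * psi * \<beta> eta * K * \<bar>eta \<bullet> g\<bar> <= 2 * 1 * (CB * ((norm eta)\<^sup>2 * a)) * \<kappa> * (R * Pg)"
   using psi \<beta> K Pg CB a \<kappa> by (intro mult_mono) auto
  then show ?thesis using psi \<beta> K by (simp add: abs_mult squares mult_ac)
 qed
 have "0 < c" using b ell_min_pos by (simp add: c)
 from young_quadratic[OF this, of "c' * y" X]
 have "a * (c' * y * X) <= a * (c / 2 * X\<^sup>2 + (c' * y)\<^sup>2 / (2 * c))" using a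
  by (intro mult_left_mono) auto
 moreover have "a * (c' * y * X)
   = 2 * ell_max * Pg * (a * y * X) + CB * R * (real CARD('n) + 3) * (a * y * X)"
  by (simp add: c' algebra_simps)
 ultimately have "c * a * X\<^sup>2 - a * (c / 2 * X\<^sup>2 + (c' * y)\<^sup>2 / (2 * c)) - 2 * CB * R * Pg * (a * y\<^sup>2) <= ?T"
  using principal cutoff gradient mixed by linarith
 moreover have "c * a * X\<^sup>2 - a * (c / 2 * X\<^sup>2 + (c' * y)\<^sup>2 / (2 * c)) - 2 * CB * R * Pg * (a * y\<^sup>2)
   = c / 2 * (a * X\<^sup>2) - (c'\<^sup>2 / (2 * c) + 2 * CB * R * Pg) * (a * y\<^sup>2)"
  by (simp add: power_mult_distrib algebra_simps)
 ultimately show ?thesis by (simp add: squares a_def S_def)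
qed

definition HH :: "real^'n => real" where "HH x = (\<Sum>i\<in>UNIV. (norm (Hv i x))\<^sup>2)"

lemma HH_meas[measurable]: "HH \<in> borel_measurable borel" unfolding HH_def by measurable

lemma HH_nonneg: "HH x >= 0" unfolding HH_def by (intro sum_nonneg) auto

lemma A_V_meas[measurable]: "(%x. indicator V x * A (norm (D x))) \<in> borel_measurable borel"
proof -
 have "(%x. indicator V x * A (norm (D x))) = (%x. indicator V x * (indicator (- {0}) (D x) *\<^sub>R A
   (norm (D x))))"
  by (auto simp: V_def indicator_def)
 moreover have "(%x. indicator (- {0}) (D x) *\<^sub>R A (norm (D x))) \<in> borel_measurable borel"
  by (rule measurable_compose[OF D_meas A_meas])
 ultimately show ?thesis by simp
qed

end

definition cut_component :: "real => real => 'n::finite => real^'n => real" where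
 "cut_component b eps i eta = cut_powr b eps (norm eta) * eta $ i"

definition cut_component_grad :: "real => real => 'n::finite => real^'n => real^'n" where
 "cut_component_grad b eps i eta
  = cut_powr b eps (norm eta) *\<^sub>R axis i 1 + (eta $ i * cut_powr_deriv b eps (norm eta)) *\<^sub>R sgn eta"

lemma cut_component_GDERIV:
 assumes "eps > 0"
 shows "GDERIV (cut_component b eps i) eta :> cut_component_grad b eps i eta"
  "continuous_on UNIV (cut_component_grad b eps i)"
 unfolding cut_component_def[abs_def] cut_component_grad_def[abs_def]
 by (rule radial_component[OF cut_powr_DERIV cut_powr_deriv_cont assms cut_powr_eq_0];
   assumption)+

lemma cut_component_eq_0:
 assumes "norm eta < eps"
 shows "cut_component b eps i eta = 0" "cut_component_grad b eps i eta = 0"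
 using cut_powr_eq_0[OF norm_ge_zero assms]
  by (simp_all add: cut_component_def cut_component_grad_def)

lemma cut_component_le:
 assumes "0 < eps" "b < 1" "norm eta <= R"
 shows "\<bar>cut_component b eps i eta\<bar> <= R powr (1 - b)"
proof (cases "eta = 0")
 case False
 have "\<bar>cut_component b eps i eta\<bar> <= norm eta powr (- b) * norm eta"
  unfolding cut_component_def abs_mult
  using cut_powr_nonneg[of b eps "norm eta"] cut_powr_le[OF norm_ge_zero assms(1)]
  by (intro mult_mono component_le_norm_cart) auto
 also have "... = norm eta powr (1 - b)" using False powr_add[of "norm eta" "- b" 1] by simp
 also have "... <= R powr (1 - b)" using assms by (intro powr_mono2) auto
 finally show ?thesis .
qed (simp add: cut_component_def)

lemma cut_powr_deriv_radial:
 fixes eta :: "real^'n"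
 assumes "eta \<noteq> 0"
 shows "eta $ i * cut_powr_deriv b eps (norm eta)
  = (cut_powr_rest b eps (norm eta) - b * cut_powr b eps (norm eta)) * sgn eta $ i"
 by (simp add: cut_powr_deriv_def sgn_div_norm divide_inverse mult_ac)

lemma cut_component_grad_sum:
 fixes h :: "'n::finite => real^'n"
 assumes "eta \<noteq> 0"
 shows "(\<Sum>l\<in>UNIV. cut_component_grad b eps i eta $ l *\<^sub>R h l) = cut_powr b eps (norm eta) *\<^sub>R h i
  + ((cut_powr_rest b eps (norm eta) - b * cut_powr b eps (norm eta)) * sgn eta $ i) *\<^sub>R (\<Sum>l\<in>UNIV. sgn eta $
    l *\<^sub>R h l)"
proof -
 let ?K = "cut_powr b eps (norm eta)" and ?q = "cut_powr_rest b eps (norm eta) - b * cut_powr b eps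
   (norm eta)"
 have "cut_component_grad b eps i eta $ l *\<^sub>R h l
   = ?K *\<^sub>R (if l = i then h l else 0) + (?q * sgn eta $ i) *\<^sub>R (sgn eta $ l *\<^sub>R h l)" for l
  unfolding cut_component_grad_def cut_powr_deriv_radial[OF assms]
  by (auto simp: axis_def algebra_simps)
 then have "(\<Sum>l\<in>UNIV. cut_component_grad b eps i eta $ l *\<^sub>R h l)
   = ?K *\<^sub>R (\<Sum>l\<in>UNIV. if l = i then h l else 0) + (?q * sgn eta $ i) *\<^sub>R (\<Sum>l\<in>UNIV. sgn eta $ l *\<^sub>R h l)"
  by (simp only: sum.distrib scaleR_sum_right)
 then show ?thesis by simp
qed

context local_solution
begin

definition cut_source_grad :: "real => real => 'n => real^'n => real^'n" where
 "cut_source_grad b eps i eta = (B (norm eta) * cut_powr b eps (norm eta)) *\<^sub>R axis i 1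
  + (eta $ i * (B (norm eta) * cut_powr_deriv b eps (norm eta) + B' (norm eta) * cut_powr b eps (norm eta)))
    *\<^sub>R sgn eta"

lemma cut_source_GDERIV:
 assumes "eps > 0"
 shows "GDERIV (%eta. \<beta> eta * cut_component b eps i eta) eta :> cut_source_grad b eps i eta"
  "continuous_on UNIV (cut_source_grad b eps i)"
proof -
 let ?K = "%t. B t * cut_powr b eps t" and ?K' = "%t. B t * cut_powr_deriv b eps t + B' t * cut_powr
   b eps t"
 have "(?K has_real_derivative ?K' t) (at t)" if "t > 0" for t
  by (rule DERIV_mult'[OF B_DERIV[OF that] cut_powr_DERIV[OF that]])
 moreover have "continuous_on {0<..} ?K'"
  by (intro continuous_intros cut_powr_cont cut_powr_deriv_cont
    continuous_on_subset[OF B_contOn] continuous_on_subset[OF B_cont]) auto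
 moreover have "?K t = 0" "?K' t = 0" if "0 <= t" "t < eps" for t
  using cut_powr_eq_0[OF that] by simp_all
 ultimately have "GDERIV (%eta::real^'n. ?K (norm eta) * eta $ i) eta
    :> ?K (norm eta) *\<^sub>R axis i 1 + (eta $ i * ?K' (norm eta)) *\<^sub>R sgn eta"
   "continuous_on UNIV (%eta::real^'n. ?K (norm eta) *\<^sub>R axis i 1 + (eta $ i * ?K' (norm eta)) *\<^sub>R sgn
     eta)"
  for eta using radial_component[of ?K ?K' eps] assms by blast+
 then show "GDERIV (%eta. \<beta> eta * cut_component b eps i eta) eta :> cut_source_grad b eps i eta"
  "continuous_on UNIV (cut_source_grad b eps i)"
  by (simp_all add: \<beta>_def cut_component_def cut_source_grad_def[abs_def] mult.assoc)
qed

lemma cut_source_grad_eq_0: "norm eta < eps ==> cut_source_grad b eps i eta = 0"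
 using cut_powr_eq_0[of "norm eta" eps b] by (simp add: cut_source_grad_def)

text \<open>The gradient term is integrated by parts, which trades \<^term>\<open>B'\<close> for \<^term>\<open>B\<close>: the second
 summand has integral \<^term>\<open>0 :: real\<close>.\<close>
definition energy_density :: "(real^'n => real) => real => real => 'n => real^'n => real" where
 "energy_density psi b eps i x
  = lin_integrand psi (cut_component b eps i) (cut_component_grad b eps i) i x
   - ((cut_source_grad b eps i (D x) \<bullet> Hv i x) * (psi x)\<^sup>2
     + \<beta> (D x) * cut_component b eps i (D x) * pderiv_at i (%x. (psi x)\<^sup>2) x)"

lemma energy_density_integral:
 assumes psi: "C1c S psi" "S \<subseteq> U" and eps: "eps > 0"
 shows "integrable lborel (energy_density psi b eps i)"
  "(LBINT x. energy_density psi b eps i x)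
   = (LBINT x. lin_integrand psi (cut_component b eps i) (cut_component_grad b eps i) i x)"
proof -
 let ?g = "%eta. \<beta> eta * cut_component b eps i eta" and ?psi2 = "%x. (psi x)\<^sup>2"
 let ?h = "%x. cut_source_grad b eps i (D x) \<bullet> Hv i x"
 note psi2 = C1c_power2(1)[OF psi(1)]
 have w: "wderiv U i (%x. ?g (D x)) ?h"
  by (rule chain_rule[OF cut_source_GDERIV[OF eps] eps cut_source_grad_eq_0])
 have "continuous_on UNIV ?g"
  using GDERIV_isCont[OF cut_source_GDERIV(1)[OF eps]]
   by (simp add: continuous_at_imp_continuous_on)
 then have "continuous_on U (%x. ?g (D x))" by (rule continuous_on_compose2[OF _ D_cont]) simp
 from wderiv_C1c[OF U w this psi2 psi(2)]
 have parts: "(LBINT x. ?h x * ?psi2 x) + (LBINT x. ?g (D x) * pderiv_at i ?psi2 x) = 0" by simp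
 have lin: "integrable lborel (lin_integrand psi (cut_component b eps i) (cut_component_grad b eps i)
   i)"
  by (rule linearized_limit(1)[OF cut_component_GDERIV[OF eps] eps cut_component_eq_0 psi])
 note int = locally_integrable_mult_C1c(1)[OF wderivD(2)[OF w] psi2 psi(2)]
  locally_integrable_mult_C1c(2)[OF wderivD(1)[OF w] psi2 psi(2), of i]
 show "integrable lborel (energy_density psi b eps i)"
  unfolding energy_density_def[abs_def]
  by (intro Bochner_Integration.integrable_diff Bochner_Integration.integrable_add lin int)
 show "(LBINT x. energy_density psi b eps i x)
   = (LBINT x. lin_integrand psi (cut_component b eps i) (cut_component_grad b eps i) i x)"
  unfolding energy_density_def
  using parts Bochner_Integration.integral_diff[OF lin Bochner_Integration.integrable_add[OF
    int]]
   Bochner_Integration.integral_add[OF int] by simp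
qed

lemma energy_density_eq:
 fixes b eps :: real
 assumes psi: "C1c S psi" and x: "x \<in> V"
 defines "eta \<equiv> D x" and "K \<equiv> cut_powr b eps (norm (D x))"
  and "q \<equiv> cut_powr_rest b eps (norm (D x)) - b * cut_powr b eps (norm (D x))"
  and "Z \<equiv> \<Sum>l\<in>UNIV. sgn (D x) $ l *\<^sub>R Hv l x"
 shows "energy_density psi b eps i x
  = 2 * psi x * K * norm eta * (Da eta (sgn eta $ i *\<^sub>R Hv i x) \<bullet> grad psi x)
   + (psi x)\<^sup>2 * (K * (Da eta (Hv i x) \<bullet> Hv i x) + q * (Da eta (sgn eta $ i *\<^sub>R Hv i x) \<bullet> Z))
   - (psi x)\<^sup>2 * \<beta> eta * (K * (Hv i x $ i) + q * (sgn eta \<bullet> (sgn eta $ i *\<^sub>R Hv i x)))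
   - 2 * psi x * \<beta> eta * K * (eta $ i * grad psi x $ i)"
proof -
 have eta: "eta \<noteq> 0" using x by (simp add: V_def eta_def)
 have component: "eta $ i = norm eta * sgn eta $ i" using eta by (simp add: sgn_div_norm)
 have "eta $ i * cut_powr_deriv b eps (norm eta) = q * sgn eta $ i"
  using cut_powr_deriv_radial[OF eta] by (simp add: q_def eta_def)
 then have source: "cut_source_grad b eps i eta \<bullet> Hv i x
   = \<beta> eta * K * (Hv i x $ i) + (\<beta> eta * q * sgn eta $ i + B' (norm eta) * K * eta $ i) * (sgn eta \<bullet> Hv i
     x)"
  by (simp add: cut_source_grad_def \<beta>_def K_def eta_def inner_add_left inner_axis' distrib_left
    mult_ac)
 have "(\<Sum>l\<in>UNIV. cut_component_grad b eps i eta $ l *\<^sub>R Hv l x) = K *\<^sub>R Hv i x + (q * sgn eta $ i) *\<^sub>R Z"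
  using cut_component_grad_sum[OF eta, of b eps i "%l. Hv l x"]
   by (simp add: K_def q_def Z_def eta_def)
 then show ?thesis
  using x source component C1c_power2(2)[OF psi, of x, THEN arg_cong[of _ _ "%v. v $ i"]]
  by (simp add: energy_density_def lin_integrand_def eta_def[symmetric] cut_component_def
    K_def[folded eta_def, symmetric] inner_add_right Da_linear algebra_simps power2_eq_square)
qed

lemma sum_energy_density:
 fixes b eps :: real
 assumes psi: "C1c S psi" and x: "x \<in> V"
 defines "eta \<equiv> D x" and "K \<equiv> cut_powr b eps (norm (D x))"
  and "q \<equiv> cut_powr_rest b eps (norm (D x)) - b * cut_powr b eps (norm (D x))"
  and "Z \<equiv> \<Sum>l\<in>UNIV. sgn (D x) $ l *\<^sub>R Hv l x"
 shows "(\<Sum>i\<in>UNIV. energy_density psi b eps i x) = 2 * psi x * K * norm eta * (Da eta Z \<bullet> grad psi x)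
   + (psi x)\<^sup>2 * (K * (\<Sum>l\<in>UNIV. Da eta (Hv l x) \<bullet> Hv l x) + q * (Da eta Z \<bullet> Z))
   - (psi x)\<^sup>2 * \<beta> eta * (K * (\<Sum>l\<in>UNIV. Hv l x $ l) + q * (sgn eta \<bullet> Z)) - 2 * psi x * \<beta> eta * K *
     (eta \<bullet> grad psi x)"
proof -
 have sums: "(\<Sum>i\<in>UNIV. Da eta (sgn eta $ i *\<^sub>R Hv i x) \<bullet> v) = Da eta Z \<bullet> v"
  "(\<Sum>i\<in>UNIV. sgn eta \<bullet> (sgn eta $ i *\<^sub>R Hv i x)) = sgn eta \<bullet> Z"
  "(\<Sum>i\<in>UNIV. eta $ i * grad psi x $ i) = eta \<bullet> grad psi x" for v
  by (simp only: Z_def eta_def Da_sum inner_sum_left, simp only: Z_def eta_def inner_sum_right,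
    simp add: inner_vec_def)
 show ?thesis
  unfolding energy_density_eq[OF psi x] eta_def[symmetric] Z_def[symmetric]
   sum.distrib sum_subtractf sum_distrib_left[symmetric] sums
  by (simp add: K_def q_def Z_def eta_def)
qed

lemma energy_density_outside:
 assumes psi: "C1c S psi" "S \<subseteq> U" and eps: "0 < eps" and x: "x \<notin> V \<or> x \<notin> S"
 shows "energy_density psi b eps i x = 0"
proof (cases "x \<in> S")
 case True
 then have "D x = 0" "x \<notin> V" using x psi(2) by (auto simp: V_def)
 then show ?thesis
  using cut_component_eq_0[of 0 eps b i] cut_source_grad_eq_0[of 0 eps b i] eps
  by (simp add: energy_density_def lin_integrand_def)
next
 case False
 then show ?thesis
  using C1c_zero[OF psi(1)] C1c_pderiv_0[OF C1c_power2(1)[OF psi(1)]]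
  by (simp add: energy_density_def lin_integrand_def)
qed

definition cut_hessian :: "(real^'n => real) => real => real => real^'n => real" where
 "cut_hessian psi b eps x = indicator V x * A (norm (D x)) * ((psi x)\<^sup>2 * cut_powr b eps (norm (D x)) *
   HH x)"

lemma cut_hessian_nonneg: "0 <= cut_hessian psi b eps x"
 using cut_powr_nonneg HH_nonneg A_pos[of "norm (D x)"]
 by (auto simp: cut_hessian_def V_def indicator_def intro!: mult_nonneg_nonneg)

lemma cut_hessian_le:
 assumes psi: "C1c S psi" "S \<subseteq> U" "!!x. 0 <= psi x" "!!x. psi x <= 1" and b: "0 <= b" "b < 1"
  and eps: "0 < eps"
  and R: "0 < R" "!!x. x \<in> S ==> norm (D x) <= R" and Pg: "!!x. norm (grad psi x) <= Pg"
  and c: "c = (1 - b) * ell_min" and c': "c' = 2 * ell_max * Pg + CB * R * (real CARD('n) + 3)"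
  and C: "C = c'\<^sup>2 / (2 * c) + 2 * CB * R * Pg"
 shows "c / 2 * cut_hessian psi b eps x
  <= (\<Sum>i\<in>UNIV. energy_density psi b eps i x) + C * (R * A R * R powr (1 - b)) * indicator S x"
proof -
 have "0 <= Pg" using Pg[of x] norm_ge_zero[of "grad psi x"] by linarith
 moreover have "0 < c" using b ell_min_pos by (simp add: c)
 ultimately have C_nonneg: "0 <= C" using CB R by (simp add: C)
 show ?thesis
 proof (cases "x \<in> V \<and> x \<in> S")
  case False
  then have "cut_hessian psi b eps x = 0" using C1c_zero[OF psi(1), of x]
   by (auto simp: cut_hessian_def)
  then show ?thesis
   using False energy_density_outside[OF psi(1,2) eps, of x b] C_nonneg R(1) A_pos[OF R(1)] by simp
 next
  case True
  let ?t = "norm (D x)"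
  have eta: "D x \<noteq> 0" "?t <= R" using True R by (auto simp: V_def)
  then have t: "0 < ?t" by simp
  have "c / 2 * (A ?t * ((psi x)\<^sup>2 * cut_powr b eps ?t * (\<Sum>l\<in>UNIV. (norm (Hv l x))\<^sup>2)))
    - C * (A ?t * (?t\<^sup>2 * ?t powr (- b))) <= (\<Sum>i\<in>UNIV. energy_density psi b eps i x)"
   unfolding sum_energy_density[OF psi(1) conjunct1[OF True]] C
   by (rule hessian_pointwise[OF eta b cut_powr_nonneg cut_powr_le[OF norm_ge_zero eps]
      cut_powr_rest_bounds[OF t eps] psi(3,4) Pg refl c c'])
  moreover have "C * (A ?t * (?t\<^sup>2 * ?t powr (- b))) <= C * (R * A R * R powr (1 - b))"
  proof (rule mult_left_mono[OF _ C_nonneg])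
   have "A ?t * (?t\<^sup>2 * ?t powr (- b)) = (?t * A ?t) * ?t powr (1 - b)"
    using t powr_add[of ?t "- b" 1] by (simp add: power2_eq_square mult_ac)
   also have "... <= (R * A R) * R powr (1 - b)"
    by (rule mult_mono[OF tA_mono[OF t eta(2)] powr_mono2])
     (use A_pos[OF R(1)] R(1) eta(2) b in \<open>auto intro: mult_nonneg_nonneg\<close>)
   finally show "A ?t * (?t\<^sup>2 * ?t powr (- b)) <= R * A R * R powr (1 - b)" .
  qed
  ultimately show ?thesis using True by (simp add: cut_hessian_def HH_def mult.assoc)
 qed
qed

lemma cut_hessian_integral_bound:
 assumes psi: "C1c S psi" "S \<subseteq> U" "!!x. 0 <= psi x" "!!x. psi x <= 1" and b: "0 <= b" "b < 1"
 obtains K where "!!eps. 0 < eps ==> integrable lborel (cut_hessian psi b eps)"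
  "!!eps. 0 < eps ==> (LBINT x. cut_hessian psi b eps x) <= K"
proof -
 note S = C1c_compact[OF psi(1)] and [measurable] = C1c_measurable[OF psi(1)]
 obtain Pg where Pg: "!!x. norm (grad psi x) <= Pg" using C1c_bounded[OF psi(1)] by metis
 obtain K0 R where R: "R > 0" "!!x. x \<in> S ==> norm (D x) <= R" and
  lin: "!!F FF eps Fm i. (!!eta. GDERIV F eta :> FF eta) ==> continuous_on UNIV FF ==> eps > 0 ==>
   (!!eta. norm eta < eps ==> F eta = 0) ==> (!!eta. norm eta < eps ==> FF eta = 0) ==>
    (!!eta. norm eta <= R ==> \<bar>F eta\<bar> <= Fm) ==>
   integrable lborel (lin_integrand psi F FF i) \<and> \<bar>LBINT x. lin_integrand psi F FF i x\<bar> <= K0 * Fm"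
  by (rule linearized_equation[OF psi]) blast
 define c where "c = (1 - b) * ell_min"
 define c' where "c' = 2 * ell_max * Pg + CB * R * (real CARD('n) + 3)"
 define C where "C = (c'\<^sup>2 / (2 * c) + 2 * CB * R * Pg) * (R * A R * R powr (1 - b))"
 define K where "K = real CARD('n) * (K0 * R powr (1 - b)) + C * (LBINT x. indicator S x)"
 have c: "0 < c" using b ell_min_pos by (simp add: c_def)
 have bounds: "integrable lborel (cut_hessian psi b eps)" "c / 2 * (LBINT x. cut_hessian psi b eps x)
   <= K"
  if eps: "0 < eps" for eps
 proof -
  let ?T = "%x. \<Sum>i\<in>UNIV. energy_density psi b eps i x"
  note T = energy_density_integral[OF psi(1,2) eps, of b]
  have le: "c / 2 * cut_hessian psi b eps x <= ?T x + C * indicator S x" for x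
   unfolding C_def by (rule cut_hessian_le[OF psi b eps R Pg c_def c'_def refl])
  have bound: "integrable lborel (%x. ?T x + C * indicator S x)"
   by (intro Bochner_Integration.integrable_add Bochner_Integration.integrable_sum T(1)
     integrable_mult_right integrable_indicator_compact[OF S])
  have int: "integrable lborel (%x. c / 2 * cut_hessian psi b eps x)"
  proof (rule Bochner_Integration.integrable_bound[OF bound])
   show "(%x. c / 2 * cut_hessian psi b eps x) \<in> borel_measurable lborel"
    unfolding cut_hessian_def cut_powr_def by measurable
   have "0 <= c / 2 * cut_hessian psi b eps x" for x
    using c cut_hessian_nonneg by (intro mult_nonneg_nonneg) auto
   then show "AE x in lborel. norm (c / 2 * cut_hessian psi b eps x) <= norm (?T x + C * indicator S x)"
    by (intro AE_I2) (metis abs_of_nonneg le order_trans real_norm_def)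
  qed
  from int[unfolded integrable_mult_left_iff] show "integrable lborel (cut_hessian psi b eps)"
   using c by simp
  have lin_le: "(LBINT x. lin_integrand psi (cut_component b eps i) (cut_component_grad b eps i) i x)
    <= K0 * R powr (1 - b)" for i
   using lin[OF cut_component_GDERIV[OF eps, where b = b and i = i] eps cut_component_eq_0
     cut_component_le[OF eps b(2)], where i = i]
   by (simp add: abs_le_iff)
  have "(LBINT x. ?T x) = (\<Sum>i\<in>UNIV. LBINT x. energy_density psi b eps i x)"
   by (rule Bochner_Integration.integral_sum) (rule T(1))
  also have "... <= (\<Sum>i\<in>(UNIV::'n set). K0 * R powr (1 - b))"
   unfolding T(2) by (rule sum_mono) (rule lin_le)
  finally have "(LBINT x. ?T x) <= real CARD('n) * (K0 * R powr (1 - b))" by simp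
  moreover have "(LBINT x. c / 2 * cut_hessian psi b eps x) <= (LBINT x. ?T x + C * indicator S x)"
   by (rule integral_mono[OF int bound le])
  moreover have "(LBINT x. ?T x + C * indicator S x) = (LBINT x. ?T x) + C * (LBINT x. indicator S x)"
   using T(1) integrable_indicator_compact[OF S] by simp
  ultimately show "c / 2 * (LBINT x. cut_hessian psi b eps x) <= K" by (simp add: K_def)
 qed
 show ?thesis
  by (rule that[of "K / (c / 2)"]) (use bounds c in \<open>auto simp: pos_le_divide_eq mult.commute\<close>)
qed

theorem weighted_hessian_estimate:
 assumes psi: "C1c S psi" "S \<subseteq> U" "!!x. 0 <= psi x" "!!x. psi x <= 1" and b: "0 <= b" "b < 1"
 shows "integrable lborel (%x. indicator V x * A (norm (D x)) * ((psi x)\<^sup>2 * norm (D x) powr (- b)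
   * HH x))"
proof -
 obtain K where K: "!!eps. 0 < eps ==> integrable lborel (cut_hessian psi b eps)"
  "!!eps. 0 < eps ==> (LBINT x. cut_hessian psi b eps x) <= K"
  by (rule cut_hessian_integral_bound[OF psi b]) blast
 note [measurable] = C1c_measurable[OF psi(1)]
 show ?thesis
 proof (rule integrable_Fatou[of lborel "%n. cut_hessian psi b (step n)", OF K(1)[OF step_pos]
    cut_hessian_nonneg K(2)[OF step_pos]])
  have "(%n. cut_hessian psi b (step n) x)
    \<longlonglongrightarrow> indicator V x * A (norm (D x)) * ((psi x)\<^sup>2 * norm (D x) powr (- b) * HH x)" for x
   unfolding cut_hessian_def
   by (cases "x \<in> V") (auto intro!: tendsto_intros cut_powr_tendsto simp: V_def)
  then show "AE x in lborel. (%n. cut_hessian psi b (step n) x)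
    \<longlonglongrightarrow> indicator V x * A (norm (D x)) * ((psi x)\<^sup>2 * norm (D x) powr (- b) * HH x)" by simp
 qed measurable
qed

end

text \<open>A \<^term>\<open>C1\<close>-regularisation of the identity: for \<^term>\<open>t >= eps\<close> it equals \<^term>\<open>t + eps\<^sup>2 / t\<close>.\<close>
definition soft_max :: "real => real => real" where
 "soft_max eps t = 2 * eps + (max 0 (t - eps))\<^sup>2 / t"

definition soft_max_deriv :: "real => real => real" where
 "soft_max_deriv eps t = max 0 (t - eps) * (2 * t - max 0 (t - eps)) / t\<^sup>2"

lemma soft_max_DERIV:
 assumes t: "t > 0"
 shows "(soft_max eps has_real_derivative soft_max_deriv eps t) (at t)"
proof -
 have "((%t. t - eps) has_real_derivative 1) (at t)" by (auto intro!: derivative_eq_intros)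
 from DERIV_divide[OF DERIV_chain2[OF DERIV_pos_part_sq this] DERIV_ident] t
 have "((%t. (max 0 (t - eps))\<^sup>2 / t) has_real_derivative soft_max_deriv eps t) (at t)"
  by (simp add: soft_max_deriv_def algebra_simps power2_eq_square)
 from DERIV_add[OF DERIV_const[of "2 * eps"] this] show ?thesis
  by (simp add: soft_max_def[abs_def])
qed

lemma soft_max_deriv_cont: "continuous_on {0<..} (soft_max_deriv eps)"
 unfolding soft_max_deriv_def[abs_def] by (intro continuous_intros) auto

lemma soft_max_eq_const:
 assumes "t <= eps"
 shows "soft_max eps t = 2 * eps" "soft_max_deriv eps t = 0"
 using assms by (simp_all add: soft_max_def soft_max_deriv_def)

lemma soft_max_eq_add:
 assumes "0 < eps" "eps <= t"
 shows "soft_max eps t = t + eps\<^sup>2 / t"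
 using assms by (simp add: soft_max_def power2_eq_square field_simps)

lemma soft_max_bounds:
 assumes eps: "0 < eps" and t: "0 <= t"
 shows "t <= soft_max eps t" "soft_max eps t > 0" "soft_max eps t <= t + 2 * eps" "eps <= t ==> soft_max eps t
   <= 2 * t"
proof -
 have large: "eps\<^sup>2 / t <= eps" if "eps <= t"
  using that eps mult_left_mono[OF that, of eps] by (simp add: divide_le_eq power2_eq_square)
 have nonneg: "0 <= eps\<^sup>2 / t" using t by simp
 show "t <= soft_max eps t"
  using soft_max_eq_const(1)[of t eps] soft_max_eq_add[OF eps, of t] nonneg eps
   by (cases "t <= eps") auto
 show "soft_max eps t > 0" using eps t by (simp add: soft_max_def add_pos_nonneg)
 show "eps <= t ==> soft_max eps t <= 2 * t" using soft_max_eq_add[OF eps, of t] large by auto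
 show "soft_max eps t <= t + 2 * eps"
  using soft_max_eq_const(1)[of t eps] soft_max_eq_add[OF eps, of t] large eps t
   by (cases "t <= eps") auto
qed

lemma soft_max_deriv_le_1:
 assumes "0 < eps"
 shows "\<bar>soft_max_deriv eps t\<bar> <= 1"
proof (cases "t <= eps")
 case False
 then have "soft_max_deriv eps t = 1 - (eps / t)\<^sup>2"
  using assms by (simp add: soft_max_deriv_def power2_eq_square field_simps)
 moreover have "(eps / t)\<^sup>2 <= 1" using False assms by (intro power_le_one) auto
 ultimately show ?thesis by simp
qed (simp add: soft_max_eq_const)

lemma soft_max_tendsto: "t > 0 ==> (%n. soft_max (step n) t) \<longlonglongrightarrow> t"
 unfolding soft_max_def by (auto intro!: tendsto_eq_intros step_tendsto_0 simp: power2_eq_square)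

context local_solution
begin

definition inv_weight :: "real => real => real" where "inv_weight b t = t powr (- b) / A t"

definition inv_weight_deriv :: "real => real => real" where
 "inv_weight_deriv b t = - (b + t * deriv A t / A t) * inv_weight b t / t"

lemma inv_weight_pos: "t > 0 ==> inv_weight b t > 0" using A_pos by (simp add: inv_weight_def)

lemma inv_weight_DERIV:
 assumes t: "t > 0"
 shows "(inv_weight b has_real_derivative inv_weight_deriv b t) (at t)"
proof -
 have "((%t. t powr (- b)) has_real_derivative - b * t powr (- b) / t) (at t)"
  using t by (auto intro!: derivative_eq_intros simp: powr_diff)
 from DERIV_divide[OF this A_DERIV[OF t]] A_pos[OF t]
 have "(inv_weight b has_real_derivative
   (- b * t powr (- b) / t * A t - t powr (- b) * deriv A t) / (A t * A t)) (at t)"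
  by (simp add: inv_weight_def[abs_def])
 then show ?thesis
  by (rule DERIV_cong) (use t A_pos[OF t] in \<open>simp add: inv_weight_deriv_def inv_weight_def
    field_simps\<close>)
qed

lemma inv_weight_cont: "continuous_on {0<..} (inv_weight b)"
 by (rule DERIV_continuous_on[OF has_field_derivative_at_within[OF inv_weight_DERIV]]) simp

lemma inv_weight_deriv_cont: "continuous_on {0<..} (inv_weight_deriv b)"
 unfolding inv_weight_deriv_def[abs_def]
 by (intro continuous_intros inv_weight_cont A_cont A_contOn)
  (auto simp: less_imp_neq[symmetric] dest: A_pos)

lemma inv_weight_deriv_bound:
 assumes b: "0 <= b" and t: "t > 0"
 shows "\<bar>inv_weight_deriv b t\<bar> <= (b + ell_max) * inv_weight b t / t"
proof -
 have "\<bar>b + t * deriv A t / A t\<bar> <= b + ell_max"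
  using A_m[OF t] A_M[OF t] b by (auto simp: ell_max_def)
 then have "\<bar>b + t * deriv A t / A t\<bar> * inv_weight b t / t <= (b + ell_max) * inv_weight b t / t"
  using t inv_weight_pos[OF t, of b] by (intro divide_right_mono mult_right_mono) auto
 then show ?thesis
  using t inv_weight_pos[OF t, of b]
  by (simp only: inv_weight_deriv_def abs_divide abs_mult abs_minus_cancel abs_of_pos)
qed

definition cut_inv_weight :: "real => real => real^'n => real" where
 "cut_inv_weight b eps eta = inv_weight b (soft_max eps (norm eta))"

definition cut_inv_weight_grad :: "real => real => real^'n => real^'n" where
 "cut_inv_weight_grad b eps eta
  = (inv_weight_deriv b (soft_max eps (norm eta)) * soft_max_deriv eps (norm eta)) *\<^sub>R sgn eta"

lemma cut_inv_weight_pos: "0 < eps ==> 0 < cut_inv_weight b eps eta"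
 by (simp add: cut_inv_weight_def inv_weight_pos soft_max_bounds)

lemma cut_inv_weight_GDERIV:
 assumes eps: "0 < eps"
 shows "GDERIV (cut_inv_weight b eps) eta :> cut_inv_weight_grad b eps eta"
  "continuous_on UNIV (cut_inv_weight_grad b eps)"
proof -
 let ?K = "%t. inv_weight b (soft_max eps t)"
 let ?K' = "%t. inv_weight_deriv b (soft_max eps t) * soft_max_deriv eps t"
 have deriv: "(?K has_real_derivative ?K' t) (at t)" if "t > 0" for t
  using that eps by (intro DERIV_chain2[OF inv_weight_DERIV soft_max_DERIV] soft_max_bounds) auto
 have "continuous_on {0<..} (soft_max eps)"
  by (rule DERIV_continuous_on[OF has_field_derivative_at_within[OF soft_max_DERIV]]) simp
 then have cont: "continuous_on {0<..} ?K'"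
  using eps by (intro continuous_intros soft_max_deriv_cont continuous_on_compose2[OF
    inv_weight_deriv_cont])
   (auto intro: soft_max_bounds)
 have "?K t = inv_weight b (2 * eps)" "?K' t = 0" if "t < eps" for t
  using soft_max_eq_const[OF less_imp_le[OF that]] by simp_all
 note radial_GDERIV[of ?K ?K', OF deriv cont eps this, where 'n = 'n]
 then show "GDERIV (cut_inv_weight b eps) eta :> cut_inv_weight_grad b eps eta"
  "continuous_on UNIV (cut_inv_weight_grad b eps)"
  by (simp_all add: cut_inv_weight_def[abs_def] cut_inv_weight_grad_def[abs_def])
qed

lemma cut_inv_weight_grad_eq_0: "norm eta < eps ==> cut_inv_weight_grad b eps eta = 0"
 using soft_max_eq_const(2)[of "norm eta" eps] by (simp add: cut_inv_weight_grad_def)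

lemma norm_a_cut_inv_weight_le:
 assumes eps: "0 < eps" "eps <= 1" and b: "b < 1" and R: "norm eta <= R"
 shows "norm eta * A (norm eta) * cut_inv_weight b eps eta <= (R + 2) powr (1 - b)"
proof (cases "eta = 0")
 case False
 let ?s = "soft_max eps (norm eta)"
 have s: "norm eta <= ?s" "0 < ?s" "?s <= R + 2" using soft_max_bounds[OF eps(1), of "norm eta"] eps R
  by auto
 have "norm eta * A (norm eta) * cut_inv_weight b eps eta <= ?s * A ?s * inv_weight b ?s"
  unfolding cut_inv_weight_def
  using False s inv_weight_pos[OF s(2)] by (intro mult_right_mono tA_mono) (auto intro:
    less_imp_le)
 also have "... = ?s powr (1 - b)"
  using s(2) A_pos[OF s(2)] powr_add[of ?s "- b" 1] by (simp add: inv_weight_def)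
 also have "... <= (R + 2) powr (1 - b)" using s b by (intro powr_mono2) auto
 finally show ?thesis .
qed simp

lemma cut_inv_weight_tendsto:
 assumes "eta \<noteq> 0"
 shows "(%n. cut_inv_weight b (step n) eta) \<longlonglongrightarrow> norm eta powr (- b) / A (norm eta)"
proof -
 have "isCont (inv_weight b) (norm eta)"
  using assms by (intro DERIV_isCont[OF inv_weight_DERIV]) simp
 from isCont_tendsto_compose[OF this soft_max_tendsto[of "norm eta"]] assms
 show ?thesis by (simp add: cut_inv_weight_def inv_weight_def)
qed

lemma inv_weight_soft_max_mult_A_le:
 assumes "0 < eps" "eps <= t" "0 <= b"
 shows "inv_weight b (soft_max eps t) * A t <= 2 * t powr (- b)"
proof -
 let ?s = "soft_max eps t"
 have t: "0 < t" and s: "t <= ?s" "0 < ?s" "?s <= 2 * t" using soft_max_bounds[of eps t] assms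
  by auto
 have "t * A t <= ?s * A ?s" by (rule tA_mono[OF t s(1)])
 also have "... <= 2 * t * A ?s" using s A_pos[OF s(2)] by (intro mult_right_mono) auto
 finally have "A t <= 2 * A ?s" using t by simp
 then have "inv_weight b ?s * A t <= inv_weight b ?s * (2 * A ?s)"
  using inv_weight_pos[OF s(2), of b] by (intro mult_left_mono) auto
 also have "... = 2 * ?s powr (- b)" using A_pos[OF s(2)] by (simp add: inv_weight_def)
 also have "... <= 2 * t powr (- b)" using s t assms by (intro mult_left_mono powr_mono2') auto
 finally show ?thesis .
qed

lemma inv_weight_principal_bound:
 fixes h :: "'n => real^'n"
 assumes eta: "eta \<noteq> 0" and b: "0 <= b" and eps: "0 < eps" and c: "0 < c"
 shows "a eta \<bullet> (\<Sum>l\<in>UNIV. cut_inv_weight_grad b eps eta $ l *\<^sub>R h l) <= c / 2 * cut_inv_weight b eps eta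
  + (b + ell_max)\<^sup>2 / c * (A (norm eta) * (norm eta powr (- b) * (\<Sum>l\<in>UNIV. (norm (h l))\<^sup>2)))"
proof -
 let ?t = "norm eta" and ?S = "\<Sum>l\<in>UNIV. (norm (h l))\<^sup>2" and ?k = "cut_inv_weight b eps eta"
 define s where "s = soft_max eps ?t"
 define q where "q = inv_weight_deriv b s * soft_max_deriv eps ?t"
 have t: "0 < ?t" "0 < A ?t" using eta A_pos by auto
 have S: "0 <= ?S" by (intro sum_nonneg) simp
 have k: "0 < ?k" by (rule cut_inv_weight_pos[OF eps])
 have s: "?t <= s" "0 < s" using soft_max_bounds[OF eps, of ?t] by (auto simp: s_def)
 have grad: "(\<Sum>l\<in>UNIV. cut_inv_weight_grad b eps eta $ l *\<^sub>R h l) = q *\<^sub>R (\<Sum>l\<in>UNIV. sgn eta $ l *\<^sub>R h l)"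
  by (simp add: cut_inv_weight_grad_def q_def s_def scaleR_sum_right mult.assoc)
 show ?thesis
 proof (cases "?t <= eps")
  case True
  then have "q = 0" by (simp add: q_def soft_max_eq_const)
  then show ?thesis unfolding grad using c k t S by (simp add: add_nonneg_nonneg)
 next
  case False
  define v where "v = (b + ell_max) * A ?t * sqrt ?S"
  have v2: "v\<^sup>2 = (b + ell_max)\<^sup>2 * (A ?t * (A ?t * ?S))"
   using S by (simp add: v_def power_mult_distrib power2_eq_square[of "A ?t"])
  have "\<bar>q\<bar> <= (b + ell_max) * inv_weight b s / s * 1"
   unfolding q_def abs_mult using ell_max_pos b inv_weight_pos[OF s(2)] s(2) eps
   by (intro mult_mono inv_weight_deriv_bound soft_max_deriv_le_1) (auto intro: less_imp_le)
  also have "... <= (b + ell_max) * ?k / ?t"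
   using ell_max_pos b k s t by (simp add: cut_inv_weight_def s_def frac_le)
  finally have q: "\<bar>q\<bar> <= (b + ell_max) * ?k / ?t" .
  have "a eta \<bullet> (\<Sum>l\<in>UNIV. cut_inv_weight_grad b eps eta $ l *\<^sub>R h l)
    <= norm (a eta) * (\<bar>q\<bar> * norm (\<Sum>l\<in>UNIV. sgn eta $ l *\<^sub>R h l))"
   unfolding grad by (rule order_trans[OF norm_cauchy_schwarz]) simp
  also have "... <= (?t * A ?t) * ((b + ell_max) * ?k / ?t * sqrt ?S)"
   using t q by (intro mult_mono norm_sgn_sum_le eta) (auto simp: a_def mult.commute)
  also have "... = ?k * (v * 1)" using t by (simp add: v_def)
  also have "... <= ?k * (c / 2 * 1\<^sup>2 + v\<^sup>2 / (2 * c))"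
   using k c by (intro mult_left_mono young_quadratic) auto
  also have "... = c / 2 * ?k + (b + ell_max)\<^sup>2 / (2 * c) * ((?k * A ?t) * (A ?t * ?S))"
   by (simp add: v2 distrib_left mult_ac)
  also have "... <= c / 2 * ?k + (b + ell_max)\<^sup>2 / (2 * c) * ((2 * ?t powr (- b)) * (A ?t * ?S))"
   using False eps b c t S inv_weight_soft_max_mult_A_le[of eps ?t b]
   by (intro add_left_mono mult_left_mono mult_right_mono) (auto simp: cut_inv_weight_def)
  also have "... = c / 2 * ?k + (b + ell_max)\<^sup>2 / c * (A ?t * (?t powr (- b) * ?S))" by simp
  finally show ?thesis .
 qed
qed

lemma inverse_weight_pointwise:
 assumes psi: "C1c S psi" "S \<subseteq> U" "!!x. 0 <= psi x" "!!x. psi x <= 1" and b: "0 <= b" "b < 1"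
  and eps: "0 < eps" "eps <= 1" and c: "0 < c" and R: "0 < R" "!!x. x \<in> S ==> norm (D x) <= R"
  and Pg: "!!x. norm (grad psi x) <= Pg"
 defines "k \<equiv> cut_inv_weight b eps"
 shows "(psi x)\<^sup>2 * (a (D x) \<bullet> (\<Sum>l\<in>UNIV. cut_inv_weight_grad b eps (D x) $ l *\<^sub>R Hv l x))
   + 2 * psi x * k (D x) * (a (D x) \<bullet> grad psi x) + \<beta> (D x) * ((psi x)\<^sup>2 * k (D x))
  <= c / 2 * ((psi x)\<^sup>2 * k (D x)) + ((b + ell_max)\<^sup>2 / c *
    (indicator V x * A (norm (D x)) * ((psi x)\<^sup>2 * norm (D x) powr (- b) * HH x))
   + (2 * Pg + CB * R) * (R + 2) powr (1 - b) * indicator S x)"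
  (is "?principal + ?cutoff + ?gradient <= _ + (?C * ?Y + ?E * _)")
proof -
 let ?eta = "D x" and ?t = "norm (D x)" and ?r = "(R + 2) powr (1 - b)"
 have Pg0: "0 <= Pg" using Pg[of x] norm_ge_zero[of "grad psi x"] by linarith
 have k: "0 < k ?eta" unfolding k_def by (rule cut_inv_weight_pos[OF eps(1)])
 show ?thesis
 proof (cases "x \<in> V \<and> x \<in> S")
  case False
  have "?principal = 0 \<and> ?cutoff = 0 \<and> ?gradient = 0"
  proof (cases "x \<in> S")
   case True
   then have "?eta = 0" using False psi(2) by (auto simp: V_def)
   then show ?thesis by (simp add: a_def \<beta>_def B_0)
  qed (simp add: C1c_zero[OF psi(1)])
  moreover have "0 <= ?C * ?Y"
   using c HH_nonneg[of x] A_pos[of ?t] by (auto simp: V_def indicator_def)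
  moreover have "0 <= ?E * indicator S x" using Pg0 CB R(1) by simp
  moreover have "0 <= c / 2 * ((psi x)\<^sup>2 * k ?eta)" using c k by simp
  ultimately show ?thesis by linarith
 next
  case True
  then have eta: "?eta \<noteq> 0" and t: "?t <= R" using R by (auto simp: V_def)
  have A: "0 < A ?t" using eta A_pos by simp
  have weight: "?t * A ?t * k ?eta <= ?r" unfolding k_def
   by (rule norm_a_cut_inv_weight_le[OF eps b(2) t])
  have "?principal <= (psi x)\<^sup>2 * (c / 2 * k ?eta + ?C * (A ?t * (?t powr (- b) * HH x)))"
   unfolding k_def HH_def by (rule mult_left_mono[OF inv_weight_principal_bound[OF eta b(1) eps(1)
     c]]) simp
  then have principal: "?principal <= c / 2 * ((psi x)\<^sup>2 * k ?eta) + ?C * ?Y"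
   using True by (simp add: distrib_left mult_ac)
  have "a ?eta \<bullet> grad psi x <= ?t * A ?t * Pg"
   using A mult_left_mono[OF Pg[of x], of "?t * A ?t"]
   by (intro order_trans[OF norm_cauchy_schwarz]) (simp add: a_def mult.commute)
  then have "?cutoff <= 2 * psi x * k ?eta * (?t * A ?t * Pg)"
   using k psi(3)[of x] by (intro mult_left_mono) auto
  also have "... = (2 * Pg * psi x) * (?t * A ?t * k ?eta)" by simp
  also have "... <= (2 * Pg * 1) * ?r"
   using weight Pg0 A k psi(3,4)[of x] by (intro mult_mono) auto
  finally have cutoff: "?cutoff <= 2 * Pg * ?r" by simp
  have "\<beta> ?eta <= CB * (?t * (?t * A ?t))"
   using B_upper[of ?t] by (simp add: \<beta>_def power2_eq_square mult.assoc)
  also have "... <= CB * (R * (?t * A ?t))" using CB A t by (intro mult_left_mono mult_right_mono)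
    auto
  finally have "?gradient <= CB * (R * (?t * A ?t)) * (1 * k ?eta)"
   using CB R(1) A k psi(3,4)[of x] by (intro mult_mono mult_right_mono power_le_one) auto
  also have "... = CB * R * (?t * A ?t * k ?eta)" by simp
  also have "... <= CB * R * ?r" using weight CB R(1) by (intro mult_left_mono) auto
  finally have "?gradient <= CB * R * ?r" .
  moreover have "?E * indicator S x = 2 * Pg * ?r + CB * R * ?r" using True
   by (simp add: distrib_right)
  ultimately show ?thesis using principal cutoff by linarith
 qed
qed

lemma cut_inv_weight_equation:
 fixes b eps :: real
 assumes psi: "C1c S psi" "S \<subseteq> U" and eps: "0 < eps"
 defines "k \<equiv> cut_inv_weight b eps"
 defines "T \<equiv> %x. (psi x)\<^sup>2 * (a (D x) \<bullet> (\<Sum>l\<in>UNIV. cut_inv_weight_grad b eps (D x) $ l *\<^sub>R Hv l x))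
   + 2 * psi x * k (D x) * (a (D x) \<bullet> grad psi x) + \<beta> (D x) * ((psi x)\<^sup>2 * k (D x))"
 shows "integrable lborel T" "integrable lborel (%x. G x * ((psi x)\<^sup>2 * k (D x)))"
  "(LBINT x. T x) = (LBINT x. G x * ((psi x)\<^sup>2 * k (D x)))"
  "(%x. (psi x)\<^sup>2 * k (D x)) \<in> borel_measurable lborel"
proof -
 have GD: "GDERIV k eta :> cut_inv_weight_grad b eps eta" "continuous_on UNIV (cut_inv_weight_grad b
   eps)" for eta
  unfolding k_def by (rule cut_inv_weight_GDERIV[OF eps])+
 let ?principal = "%x. (psi x)\<^sup>2 * (a (D x) \<bullet> (\<Sum>l\<in>UNIV. cut_inv_weight_grad b eps (D x) $ l *\<^sub>R Hv l x))"
  and ?cutoff = "%x. 2 * psi x * k (D x) * (a (D x) \<bullet> grad psi x)"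
  and ?gradient = "%x. \<beta> (D x) * ((psi x)\<^sup>2 * k (D x))"
 have terms: "integrable lborel ?principal" "integrable lborel ?cutoff"
   "integrable lborel ?gradient"
  and source: "integrable lborel (%x. G x * ((psi x)\<^sup>2 * k (D x)))"
  and eq: "(LBINT x. ?principal x) + (LBINT x. ?cutoff x) + (LBINT x. ?gradient x)
   = (LBINT x. G x * ((psi x)\<^sup>2 * k (D x)))"
  by (rule weighted_equation[OF psi GD eps cut_inv_weight_grad_eq_0]; assumption)+
 show "integrable lborel T"
  unfolding T_def by (intro Bochner_Integration.integrable_add terms)
 show "integrable lborel (%x. G x * ((psi x)\<^sup>2 * k (D x)))" by (rule source)
 show "(LBINT x. T x) = (LBINT x. G x * ((psi x)\<^sup>2 * k (D x)))"
  unfolding T_def eq[symmetric]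
  by (simp only: Bochner_Integration.integral_add Bochner_Integration.integrable_add terms)
 have "continuous_on UNIV k" using GDERIV_isCont[OF GD(1)]
  by (simp add: continuous_at_imp_continuous_on)
 note [measurable] = C1c_measurable[OF psi(1)]
  measurable_compose[OF D_meas borel_measurable_continuous_onI[OF this]]
 show "(%x. (psi x)\<^sup>2 * k (D x)) \<in> borel_measurable lborel" by measurable
qed

lemma cut_inv_weight_integral_bound:
 assumes psi: "C1c S psi" "S \<subseteq> U" "!!x. 0 <= psi x" "!!x. psi x <= 1" and b: "0 <= b" "b < 1"
 obtains K where "!!eps. 0 < eps ==> eps <= 1 ==> integrable lborel (%x. (psi x)\<^sup>2 * cut_inv_weight b eps (D x))"
  "!!eps. 0 < eps ==> eps <= 1 ==> (LBINT x. (psi x)\<^sup>2 * cut_inv_weight b eps (D x)) <= K"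
proof -
 note S = C1c_compact[OF psi(1)]
 obtain Pg where Pg: "!!x. norm (grad psi x) <= Pg" using C1c_bounded[OF psi(1)] by metis
 obtain R where R: "R > 0" "!!x. x \<in> S ==> norm (D x) <= R" by (rule D_bound[OF S psi(2)]) blast
 obtain c where c: "c > 0" "AE x\<in>S in lborel. c <= G x" using G_pos[OF S psi(2)] by blast
 let ?Y = "%x. (b + ell_max)\<^sup>2 / c *
   (indicator V x * A (norm (D x)) * ((psi x)\<^sup>2 * norm (D x) powr (- b) * HH x))
  + (2 * Pg + CB * R) * (R + 2) powr (1 - b) * indicator S x"
 have Y: "integrable lborel ?Y"
  by (intro Bochner_Integration.integrable_add integrable_mult_right
    weighted_hessian_estimate[OF psi b] integrable_indicator_compact[OF S])
 have "integrable lborel (%x. (psi x)\<^sup>2 * cut_inv_weight b eps (D x))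
   \<and> c / 2 * (LBINT x. (psi x)\<^sup>2 * cut_inv_weight b eps (D x)) <= (LBINT x. ?Y x)"
  if eps: "0 < eps" "eps <= 1" for eps
 proof -
  let ?g = "%x. (psi x)\<^sup>2 * cut_inv_weight b eps (D x)"
  note eq = cut_inv_weight_equation[OF psi(1,2) eps(1), of b]
  have lower: "AE x in lborel. c * ?g x <= G x * ?g x"
   using c(2)
  proof eventually_elim
   case (elim x)
   then show ?case
    using cut_inv_weight_pos[OF eps(1), of b "D x"] C1c_zero[OF psi(1), of x]
    by (cases "x \<in> S") (auto intro!: mult_right_mono)
  qed
  have "integrable lborel (%x. c * ?g x)"
  proof (rule Bochner_Integration.integrable_bound[OF eq(2)])
   show "AE x in lborel. norm (c * ?g x) <= norm (G x * ?g x)"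
    using lower
   proof eventually_elim
    case (elim x)
    have "0 <= c * ?g x" using c cut_inv_weight_pos[OF eps(1), of b "D x"] by simp
    then show ?case using elim by simp
   qed
  qed (use eq(4) in measurable)
  then have g: "integrable lborel ?g" using c by (simp only: integrable_mult_left_iff) simp
  have "c * (LBINT x. ?g x) = (LBINT x. c * ?g x)" by simp
  also have "... <= (LBINT x. G x * ?g x)" by (rule integral_mono_AE[OF _ eq(2) lower]) (simp add:
    g)
  also have "... <= (LBINT x. c / 2 * ?g x + ?Y x)"
   unfolding eq(3)[symmetric]
   by (rule integral_mono[OF eq(1) _ inverse_weight_pointwise[OF psi b eps c(1) R Pg]])
    (intro Bochner_Integration.integrable_add integrable_mult_right g Y)
  also have "... = c / 2 * (LBINT x. ?g x) + (LBINT x. ?Y x)"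
   using g Bochner_Integration.integral_add[OF integrable_mult_right[OF g, of "c / 2"] Y]
    by simp
  finally show ?thesis using g by simp
 qed
 then show ?thesis
  using c(1) by (intro that[of "(LBINT x. ?Y x) / (c / 2)"]) (auto simp: pos_le_divide_eq
    mult.commute)
qed

theorem inverse_weight_estimate:
 assumes psi: "C1c S psi" "S \<subseteq> U" "!!x. 0 <= psi x" "!!x. psi x <= 1" and b: "0 <= b" "b < 1"
 shows "integrable lborel (%x. indicator V x * ((psi x)\<^sup>2 * (norm (D x) powr (- b) / A (norm (D x)))))"
  (is "integrable _ ?w")
proof -
 let ?k = "%n x. (psi x)\<^sup>2 * cut_inv_weight b (step n) (D x)"
 obtain K where "!!eps. 0 < eps ==> eps <= 1 ==> integrable lborel (%x. (psi x)\<^sup>2 * cut_inv_weight b eps (D x))"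
  "!!eps. 0 < eps ==> eps <= 1 ==> (LBINT x. (psi x)\<^sup>2 * cut_inv_weight b eps (D x)) <= K"
  by (rule cut_inv_weight_integral_bound[OF psi b]) blast
 note K = this[OF step_pos step_le_1]
 have nonneg: "0 <= ?k n x" for n x using cut_inv_weight_pos[OF step_pos, of b n "D x"] by simp
 have int: "integrable lborel (%x. indicator V x * ?k n x)" for n
  using integrable_mult_indicator[OF _ K(1)[of n], of V] by simp
 show ?thesis
 proof (rule integrable_Fatou[of lborel "%n x. indicator V x * ?k n x", OF int])
  show "(LBINT x. indicator V x * ?k n x) <= K" for n
   by (rule order_trans[OF integral_mono[OF int K(1)] K(2)[of n]])
    (use nonneg in \<open>simp add: indicator_def\<close>)
  have eq: "?w = (%x. indicator V x * ((psi x)\<^sup>2 * (norm (D x) powr (- b) / (indicator V x * A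
    (norm (D x))))))"
   by (auto simp: indicator_def)
  note [measurable] = C1c_measurable[OF psi(1)]
  show "?w \<in> borel_measurable lborel" unfolding eq by measurable
  have "(%n. indicator V x * ?k n x) \<longlonglongrightarrow> ?w x" for x
   using tendsto_mult_left[OF cut_inv_weight_tendsto[of "D x" b], of "(psi x)\<^sup>2"]
   by (cases "x \<in> V") (auto simp: V_def)
  then show "AE x in lborel. (%n. indicator V x * ?k n x) \<longlonglongrightarrow> ?w x" by simp
 qed (use nonneg in simp)
qed

end

section \<open>Integrability of the second derivatives\<close>

lemma powr_le_weighted_square:
 fixes y w s :: real
 assumes "y >= 0" "w > 0" "0 < s" "s < 2"
 shows "y powr s <= w * y\<^sup>2 + w powr (- (s / (2 - s)))"
proof (cases "y = 0")
 case False
 then have y: "y > 0" using assms by simp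
 show ?thesis
 proof (cases "1 <= w * y powr (2 - s)")
  case True
  have "y powr s <= (w * y powr (2 - s)) * y powr s"
   using mult_right_mono[OF True, of "y powr s"] by simp
  also have "... = w * y\<^sup>2" using y by (simp add: powr_add[symmetric] mult.assoc)
  finally show ?thesis by (simp add: add_increasing2)
 next
  case False
  then have "y powr (2 - s) <= w powr (- 1)" using assms by (simp add: powr_minus field_simps)
  then have "(y powr (2 - s)) powr (s / (2 - s)) <= (w powr (- 1)) powr (s / (2 - s))"
   using assms by (intro powr_mono2) auto
  moreover have "(w powr (- 1)) powr (s / (2 - s)) = w powr (- (s / (2 - s)))"
   unfolding powr_powr by simp
  moreover have "(y powr (2 - s)) powr (s / (2 - s)) = y powr s" using assms
   by (simp add: powr_powr)
  ultimately have "y powr s <= w powr (- (s / (2 - s)))" by (simp only:)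
  then show ?thesis using assms by (simp add: add_increasing)
 qed
qed (use assms in simp)

lemma locally_integrable_dominated_convergence:
 fixes g :: "nat => real^'n => real"
 assumes d: "locally_integrable U d" and g: "!!n. g n \<in> borel_measurable borel"
   "g' \<in> borel_measurable borel"
  and lim: "!!x. (%n. g n x) \<longlonglongrightarrow> g' x" and bound: "!!n x. \<bar>g n x\<bar> <= d x"
 shows "locally_integrable U g'"
  "compact S ==> S \<subseteq> U ==> k \<in> borel_measurable borel ==> (!!x. \<bar>k x\<bar> <= C) ==> (!!x. x \<notin> S ==> k x = 0) ==>
   (%n. LBINT x. g n x * k x) \<longlonglongrightarrow> (LBINT x. g' x * k x)"
proof -
 note [measurable] = g locally_integrable_measurable[OF d]
 have bound': "\<bar>g' x\<bar> <= d x" for x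
  by (rule LIMSEQ_le_const2[OF tendsto_rabs[OF lim]]) (simp add: bound)
 show "locally_integrable U g'"
  unfolding locally_integrable_def
 proof (intro conjI allI impI g)
  fix K assume K: "compact K \<and> K \<subseteq> U"
  then have [measurable]: "K \<in> sets borel" by (simp add: borel_compact)
  have "norm (indicator K x *\<^sub>R g' x) <= norm (indicator K x *\<^sub>R d x)" for x
   using bound'[of x] by (cases "x \<in> K") simp_all
  then show "set_integrable lborel K g'"
   using K unfolding set_integrable_def
   by (intro Bochner_Integration.integrable_bound[OF locally_integrableD[OF d, of K, unfolded
     set_integrable_def]])
    simp_all
 qed
 assume S: "compact S" "S \<subseteq> U" and [measurable]: "k \<in> borel_measurable borel"
  and k: "!!x. \<bar>k x\<bar> <= C" "!!x. x \<notin> S ==> k x = 0"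
 have "integrable lborel (%x. d x * \<bar>k x\<bar>)"
  by (rule integrable_mult_compact_support[OF locally_integrableD[OF d S] S(1), of _ C])
    (use k in auto)
 then show "(%n. LBINT x. g n x * k x) \<longlonglongrightarrow> (LBINT x. g' x * k x)"
  by (rule integral_dominated_convergence[rotated 2])
   (simp_all add: abs_mult tendsto_mult_right[OF lim] mult_right_mono[OF bound])
qed

lemma wderiv_dominated_convergence:
 fixes g h :: "nat => real^'n => real"
 assumes w: "!!n. wderiv U i (g n) (h n)"
  and g: "locally_integrable U d" "g' \<in> borel_measurable borel" "!!x. (%n. g n x) \<longlonglongrightarrow> g' x"
    "!!n x. \<bar>g n x\<bar> <= d x"
  and h: "locally_integrable U e" "h' \<in> borel_measurable borel" "!!x. (%n. h n x) \<longlonglongrightarrow> h' x"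
    "!!n x. \<bar>h n x\<bar> <= e x"
 shows "wderiv U i g' h'"
 unfolding wderiv_def
proof (intro conjI ballI)
 note limits = locally_integrable_dominated_convergence[OF g(1) wderivD(3)[OF w] g(2-4)]
  locally_integrable_dominated_convergence[OF h(1) wderivD(4)[OF w] h(2-4)]
 show "locally_integrable U g'" "locally_integrable U h'" by (rule limits)+
 fix phi assume phi: "phi \<in> test_fun U"
 obtain S where S: "C1c S phi" "S \<subseteq> U" by (rule test_funE[OF phi]) blast
 obtain C where C: "!!x. \<bar>phi x\<bar> <= C" "!!x. \<bar>pderiv_at i phi x\<bar> <= C" using C1c_bounded[OF S(1)]
  by metis
 have "(%n. LBINT x. g n x * pderiv_at i phi x) \<longlonglongrightarrow> (LBINT x. g' x * pderiv_at i phi x)"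
  by (rule limits(2)[OF C1c_compact[OF S(1)] S(2) C1c_measurable_pderiv[OF S(1)] C(2)
    C1c_pderiv_0[OF S(1)]])
 moreover have "(%n. - (LBINT x. h n x * phi x)) \<longlonglongrightarrow> - (LBINT x. h' x * phi x)"
  by (rule tendsto_minus[OF limits(4)[OF C1c_compact[OF S(1)] S(2) C1c_measurable[OF S(1)] C(1)
      C1c_zero[OF S(1)]]])
 ultimately show "(LBINT x. g' x * pderiv_at i phi x) = - (LBINT x. h' x * phi x)"
  unfolding wderivD(5)[OF w phi] by (rule LIMSEQ_unique)
qed

context local_solution
begin

lemma weighted_square_bound_subcubic:
 fixes R :: real
 assumes p: "p < 3" and R: "0 < R"
 obtains b C where "0 <= b" "b < 1" "0 <= C"
  "!!t y. 0 < t ==> t <= R ==> \<bar>y\<bar> powr 2 <= C * (A t * t powr (- b) * y\<^sup>2 + t powr (- b) / A t)"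
proof -
 define b where "b = max 0 (p - 2)"
 define c where "c = c2 * min 1 (R powr (p - 2))"
 have c: "c > 0" using c2 R by (simp add: c_def)
 have "\<bar>y\<bar> powr 2 <= 1 / c * (A t * t powr (- b) * y\<^sup>2 + t powr (- b) / A t)"
   if t: "0 < t" "t <= R" for t y
 proof -
  have "min 1 (R powr (p - 2)) <= t powr (p - 2) * t powr (- b)"
  proof (cases "p >= 2")
   case True
   then have "t powr (p - 2) * t powr (- b) = 1" using t
    by (simp add: b_def powr_add[symmetric])
   then show ?thesis by simp
  next
   case False
   then have "R powr (p - 2) <= t powr (p - 2)" using t by (intro powr_mono2') auto
   then show ?thesis using False t by (simp add: b_def)
  qed
  then have "c <= (c2 * t powr (p - 2)) * t powr (- b)" unfolding c_def using c2
   by (simp add: mult.assoc)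
  also have "... <= A t * t powr (- b)" by (intro mult_right_mono A_lower t) simp
  finally have "c * y\<^sup>2 <= A t * t powr (- b) * y\<^sup>2" by (intro mult_right_mono) auto
  also have "... <= A t * t powr (- b) * y\<^sup>2 + t powr (- b) / A t" using A_pos[OF t(1)] by simp
  finally show ?thesis using c by (simp add: field_simps)
 qed
 then show ?thesis using c p by (intro that[of b "1 / c"]) (auto simp: b_def)
qed

lemma weighted_square_bound_supercubic:
 assumes p: "3 <= p" and s: "1 <= s" "s < (p - 1) / (p - 2)"
 obtains b C where "0 <= b" "b < 1" "0 <= C"
  "!!t y. 0 < t ==> \<bar>y\<bar> powr s <= C * (A t * t powr (- b) * y\<^sup>2 + t powr (- b) / A t)"
proof -
 define b where "b = (p - 2) * (s - 1)"
 define e where "e = 2 * (s - 1) / (2 - s)"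
 define C where "C = max 1 (c2 powr (- e))"
 have "(p - 1) / (p - 2) <= 2" using p by (simp add: field_simps)
 then have s2: "s < 2" using s by linarith
 have "s * (p - 2) < p - 1" using p s by (simp add: pos_less_divide_eq)
 then have "b < 1" by (simp add: b_def algebra_simps)
 moreover have "0 <= b" unfolding b_def using p s by (intro mult_nonneg_nonneg) auto
 ultimately have b: "0 <= b" "b < 1" by auto
 have e: "e >= 0" using s s2 by (simp add: e_def)
 have eb: "(p - 2 - b) * e = 2 * b"
 proof -
  have "p - 2 - b = (p - 2) * (2 - s)" by (simp add: b_def algebra_simps)
  then show ?thesis using s2 by (simp add: e_def b_def)
 qed
 have "\<bar>y\<bar> powr s <= C * (A t * t powr (- b) * y\<^sup>2 + t powr (- b) / A t)" if t: "0 < t" for t y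
 proof -
  define W where "W = A t * t powr (- b)"
  have At: "A t > 0" and W: "W > 0" using A_pos t by (auto simp: W_def)
  have "c2 * t powr (p - 2 - b) = (c2 * t powr (p - 2)) * t powr (- b)"
   using t by (simp add: mult.assoc powr_add[symmetric])
  also have "... <= W" unfolding W_def by (intro mult_right_mono A_lower t) simp
  finally have "W powr (- e) <= (c2 * t powr (p - 2 - b)) powr (- e)" using e c2 t
   by (intro powr_mono2') auto
  also have "... = c2 powr (- e) * t powr (- (2 * b))" using c2 t eb
   by (simp add: powr_mult powr_powr)
  finally have "W powr (- e) <= C * t powr (- (2 * b))"
   by (rule order_trans) (simp add: C_def mult_right_mono)
  then have "W powr (- e) / W <= C * t powr (- (2 * b)) / W" using W
   by (intro divide_right_mono) auto
  also have "... = C * (t powr (- b) / A t)"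
  proof -
   have "t powr (- (2 * b)) = t powr (- b) * t powr (- b)" by (simp add: powr_add[symmetric])
   then show ?thesis using t by (simp add: W_def)
  qed
  also have "W powr (- e) / W = W powr (- (s / (2 - s)))"
  proof -
   have "s / (2 - s) = 1 + e" using s2 by (simp add: e_def field_simps)
   then have "- (s / (2 - s)) = - e - 1" by simp
   then show ?thesis using W powr_diff[of W "- e" 1] by simp
  qed
  finally have "W powr (- (s / (2 - s))) <= C * (t powr (- b) / A t)" .
  moreover have "W * y\<^sup>2 <= C * (W * y\<^sup>2)" using W mult_right_mono[of 1 C "W * y\<^sup>2"]
   by (simp add: C_def)
  moreover have "\<bar>y\<bar> powr s <= W * y\<^sup>2 + W powr (- (s / (2 - s)))"
   using powr_le_weighted_square[of "\<bar>y\<bar>" W s] W s s2 by simp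
  ultimately show ?thesis by (simp add: W_def distrib_left)
 qed
 then show ?thesis using b by (intro that[of b C]) (auto simp: C_def)
qed

definition admissible :: "real => bool" where
 "admissible s \<longleftrightarrow> p < 3 \<and> s = 2 \<or> 3 <= p \<and> 1 <= s \<and> s < (p - 1) / (p - 2)"

lemma admissible_ge_1: "admissible s ==> 1 <= s" by (auto simp: admissible_def)

lemma ex_admissible: "\<exists>s. admissible s"
proof (cases "p < 3")
 case True
 then have "admissible 2" by (simp add: admissible_def)
 then show ?thesis ..
next
 case False
 then have "admissible 1" by (simp add: admissible_def field_simps)
 then show ?thesis ..
qed

lemma H_powr_integrable:
 assumes K: "compact K" "K \<subseteq> U" and s: "admissible s"
 shows "integrable lborel (%x. indicator K x * \<bar>indicator V x * H i j x\<bar> powr s)"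
proof -
 obtain psi where psi: "psi \<in> test_fun U" "!!x. 0 <= psi x" "!!x. psi x <= 1" "!!x. x \<in> K ==> psi x = 1"
  by (rule smooth_cutoff[OF K(1) U K(2)]) blast
 obtain S where S: "C1c S psi" "S \<subseteq> U" by (rule test_funE[OF psi(1)]) blast
 have [measurable]: "K \<in> sets borel" using K by (simp add: borel_compact)
 obtain R where R: "R > 0" "!!x. x \<in> K ==> norm (D x) <= R" by (rule D_bound[OF K]) blast
 obtain b C where b: "0 <= b" "b < 1" and C: "0 <= C"
  and bound: "!!t y. 0 < t ==> t <= R ==> \<bar>y\<bar> powr s <= C * (A t * t powr (- b) * y\<^sup>2 + t powr (- b) /
    A t)"
  using s weighted_square_bound_subcubic[OF _ R(1)] weighted_square_bound_supercubic[of s]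
  unfolding admissible_def by metis
 let ?Y = "%x. indicator V x * A (norm (D x)) * ((psi x)\<^sup>2 * norm (D x) powr (- b) * HH x)"
  and ?W = "%x. indicator V x * ((psi x)\<^sup>2 * (norm (D x) powr (- b) / A (norm (D x))))"
 show ?thesis
 proof (rule Bochner_Integration.integrable_bound[of _ "%x. C * (?Y x + ?W x)"])
  show "integrable lborel (%x. C * (?Y x + ?W x))"
   by (intro integrable_mult_right Bochner_Integration.integrable_add
     weighted_hessian_estimate[OF S psi(2,3) b] inverse_weight_estimate[OF S psi(2,3) b])
  have le: "indicator K x * \<bar>indicator V x * H i j x\<bar> powr s <= C * (?Y x + ?W x)" for x
  proof (cases "x \<in> K \<and> x \<in> V")
   case True
   then have t: "0 < norm (D x)" "norm (D x) <= R" using R by (auto simp: V_def)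
   have "(H i j x)\<^sup>2 <= (norm (Hv j x))\<^sup>2"
    using power_mono[OF component_le_norm_cart[of "Hv j x" i], of 2] by (simp add: Hv_def)
   also have "... <= HH x" unfolding HH_def by (rule member_le_sum) auto
   finally have "C * (A (norm (D x)) * norm (D x) powr (- b) * (H i j x)\<^sup>2)
     <= C * (A (norm (D x)) * norm (D x) powr (- b) * HH x)"
    using A_pos[OF t(1)] C by (intro mult_left_mono) auto
   then have "\<bar>H i j x\<bar> powr s
     <= C * (A (norm (D x)) * norm (D x) powr (- b) * HH x + norm (D x) powr (- b) / A (norm (D x)))"
    using bound[OF t, of "H i j x"] unfolding distrib_left by linarith
   then show ?thesis using True psi(4) by (simp add: mult_ac)
  next
   case False
   have "0 <= ?Y x + ?W x"
    using A_pos[of "norm (D x)"] HH_nonneg[of x] by (auto simp: V_def indicator_def)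
   then show ?thesis using False C admissible_ge_1[OF s] by auto
  qed
  have norm_eq: "norm (indicator K x * \<bar>indicator V x * H i j x\<bar> powr s)
    = indicator K x * \<bar>indicator V x * H i j x\<bar> powr s" for x by (simp add: abs_mult)
  show "AE x in lborel. norm (indicator K x * \<bar>indicator V x * H i j x\<bar> powr s)
    <= norm (C * (?Y x + ?W x))"
   unfolding norm_eq by (intro AE_I2) (rule order_trans[OF le], simp only: real_norm_def
     abs_ge_self)
 qed simp
qed

lemma H_locally_integrable: "locally_integrable U (%x. indicator V x * H i j x)"
 unfolding locally_integrable_def
proof (intro conjI allI impI)
 fix K assume K: "compact K \<and> K \<subseteq> U"
 obtain s where s: "admissible s" using ex_admissible ..
 have [measurable]: "K \<in> sets borel" using K by (simp add: borel_compact)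
 have le: "\<bar>y\<bar> <= 1 + \<bar>y\<bar> powr s" for y :: real
 proof (cases "\<bar>y\<bar> <= 1")
  case False
  then have "\<bar>y\<bar> powr 1 <= \<bar>y\<bar> powr s" using admissible_ge_1[OF s] by (intro powr_mono) auto
  then show ?thesis by simp
 qed (simp add: add_increasing2)
 have "integrable lborel (%x. indicator K x + indicator K x * \<bar>indicator V x * H i j x\<bar> powr s)"
  using K by (intro Bochner_Integration.integrable_add integrable_indicator_compact
    H_powr_integrable s) auto
 then show "set_integrable lborel K (%x. indicator V x * H i j x)"
  unfolding set_integrable_def
 proof (rule Bochner_Integration.integrable_bound)
  have "norm (indicator K x *\<^sub>R (indicator V x * H i j x))
    <= norm (indicator K x + indicator K x * \<bar>indicator V x * H i j x\<bar> powr s)" for x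
   using le[of "indicator V x * H i j x"] by (cases "x \<in> K") auto
  then show "AE x in lborel. norm (indicator K x *\<^sub>R (indicator V x * H i j x))
    <= norm (indicator K x + indicator K x * \<bar>indicator V x * H i j x\<bar> powr s)" by simp
 qed simp
qed simp

end

lemma cut_powr_rest_tendsto_0: "t > 0 ==> (%n. cut_powr_rest b (step n) t) \<longlonglongrightarrow> 0"
 unfolding cut_powr_rest_def by (auto intro!: tendsto_eq_intros step_tendsto_0)

lemma cut_component_tendsto: "(%n. cut_component 0 (step n) i eta) \<longlonglongrightarrow> eta $ i"
proof (cases "eta = 0")
 case False
 then show ?thesis
  using tendsto_mult_right[OF cut_powr_tendsto[of "norm eta" 0], of "eta $ i"]
   by (simp add: cut_component_def)
qed (simp add: cut_component_def)

lemma cut_component_grad_inner: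
 assumes "eta \<noteq> 0"
 shows "cut_component_grad 0 eps i eta \<bullet> v
  = cut_powr 0 eps (norm eta) * v $ i + cut_powr_rest 0 eps (norm eta) * (sgn eta $ i * (sgn eta \<bullet> v))"
 using cut_powr_deriv_radial[OF assms, of i 0 eps]
 by (simp add: cut_component_grad_def inner_add_left inner_axis')

lemma cut_component_grad_tendsto:
 assumes "eta \<noteq> 0"
 shows "(%n. cut_component_grad 0 (step n) i eta \<bullet> v) \<longlonglongrightarrow> v $ i"
proof -
 have "(%n. cut_powr 0 (step n) (norm eta)) \<longlonglongrightarrow> 1" using cut_powr_tendsto[of "norm eta" 0] assms
  by simp
 from tendsto_add[OF tendsto_mult_right[OF this] tendsto_mult_right[OF cut_powr_rest_tendsto_0]]
 show ?thesis unfolding cut_component_grad_inner[OF assms] using assms by simp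
qed

lemma cut_component_grad_inner_le:
 assumes eps: "0 < eps"
 shows "\<bar>cut_component_grad 0 eps i eta \<bullet> v\<bar> <= 3 * norm v"
proof (cases "eta = 0")
 case True
 then show ?thesis using cut_component_eq_0(2)[of eta eps] eps by simp
next
 case False
 let ?K = "cut_powr 0 eps (norm eta)" and ?P = "cut_powr_rest 0 eps (norm eta)"
 have K: "0 <= ?K" "?K <= 1" using cut_powr_nonneg cut_powr_le[OF norm_ge_zero[of eta] eps, of 0] False
  by auto
 have "0 <= ?P" "?P <= 2 * sqrt ?K" using cut_powr_rest_bounds[of "norm eta" eps 0] False eps by simp_all
 then have P: "0 <= ?P" "?P <= 2" using K real_sqrt_le_1_iff[of ?K] by linarith+
 have "\<bar>?K * v $ i\<bar> <= 1 * norm v"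
  unfolding abs_mult using K by (intro mult_mono component_le_norm_cart) auto
 moreover have "\<bar>sgn eta $ i * (sgn eta \<bullet> v)\<bar> <= 1 * norm v"
  unfolding abs_mult
  using component_le_norm_cart[of "sgn eta" i] Cauchy_Schwarz_ineq2[of "sgn eta" v] False
  by (intro mult_mono) (auto simp: norm_sgn)
 then have "\<bar>?P * (sgn eta $ i * (sgn eta \<bullet> v))\<bar> <= 2 * (1 * norm v)"
  unfolding abs_mult[of ?P] using P by (intro mult_mono) auto
 ultimately show ?thesis unfolding cut_component_grad_inner[OF False] by linarith
qed

context local_solution
begin

theorem D_wderiv: "wderiv U j (%x. D x $ i) (%x. indicator V x * H i j x)"
proof (rule wderiv_dominated_convergence)
 let ?d = "%x. 3 * (\<Sum>k\<in>UNIV. \<bar>indicator V x * H k j x\<bar>)"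
 show "wderiv U j (%x. cut_component 0 (step n) i (D x)) (%x. cut_component_grad 0 (step n) i
   (D x) \<bullet> Hv j x)" for n
  by (rule chain_rule[OF cut_component_GDERIV[OF step_pos] step_pos cut_component_eq_0(2)])
 show "locally_integrable U (%x. norm (D x))"
  by (intro locally_integrable_continuous continuous_on_norm D_cont) measurable
 show "\<bar>cut_component 0 (step n) i (D x)\<bar> <= norm (D x)" for n x
  using cut_component_le[OF step_pos zero_less_one order_refl, where eta = "D x" and i = i]
   by simp
 show "locally_integrable U ?d"
  unfolding locally_integrable_def
 proof (intro conjI allI impI)
  fix K assume K: "compact K \<and> K \<subseteq> U"
  have "integrable lborel (%x. 3 * (\<Sum>k\<in>UNIV. \<bar>indicator K x *\<^sub>R (indicator V x * H k j x)\<bar>))"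
   using locally_integrableD[OF H_locally_integrable, of K] K unfolding set_integrable_def
   by (intro integrable_mult_right Bochner_Integration.integrable_sum integrable_abs) auto
  moreover have "indicator K x *\<^sub>R ?d x = 3 * (\<Sum>k\<in>UNIV. \<bar>indicator K x *\<^sub>R (indicator V x * H k
    j x)\<bar>)" for x
   by (simp add: abs_mult sum_distrib_left mult.left_commute)
  ultimately show "set_integrable lborel K ?d" by (simp only: set_integrable_def)
 qed measurable
 have "(%n. cut_component_grad 0 (step n) i (D x) \<bullet> Hv j x) \<longlonglongrightarrow> indicator V x * H i j x
   \<and> (\<forall>n. \<bar>cut_component_grad 0 (step n) i (D x) \<bullet> Hv j x\<bar> <= ?d x)" for x
 proof (cases "D x = 0")
  case True
  then have "cut_component_grad 0 (step n) i (D x) = 0" for n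
   using cut_component_eq_0(2)[of "D x" "step n" 0 i] step_pos[of n] by simp
  then show ?thesis using True by (simp add: V_def sum_nonneg)
 next
  case False
  then have "x \<in> V" by (auto simp: V_def D_def split: if_splits)
  have "norm (Hv j x) <= (\<Sum>k\<in>UNIV. \<bar>H k j x\<bar>)" using norm_le_l1_cart[of "Hv j x"]
   by (simp add: Hv_def)
  then have "\<bar>cut_component_grad 0 (step n) i (D x) \<bullet> Hv j x\<bar> <= 3 * (\<Sum>k\<in>UNIV. \<bar>H k j x\<bar>)" for n
   using cut_component_grad_inner_le[OF step_pos, of n i "D x" "Hv j x"] by linarith
  then show ?thesis
   using cut_component_grad_tendsto[OF False, of i "Hv j x"] \<open>x \<in> V\<close> by (simp add: Hv_def)
 qed
 then show "(%n. cut_component_grad 0 (step n) i (D x) \<bullet> Hv j x) \<longlonglongrightarrow> indicator V x * H i j x"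
  "\<bar>cut_component_grad 0 (step n) i (D x) \<bullet> Hv j x\<bar> <= ?d x" for n x by blast+
qed (measurable, rule cut_component_tendsto, measurable)

theorem pderiv_W1p_loc:
 assumes s: "admissible s"
 shows "pderiv_at i u \<in> W1p_loc s U"
 unfolding W1p_loc_def
proof (intro CollectI conjI allI)
 have eq: "pderiv_at i u x = D x $ i" if "x \<in> U" for x using that by (simp add: D_U)
 show "pderiv_at i u \<in> Lp_loc s U"
  unfolding Lp_loc_def
 proof (intro CollectI allI impI)
  fix K assume K: "compact K \<and> K \<subseteq> U"
  then have [measurable]: "K \<in> sets borel" by (simp add: borel_compact)
  obtain R where R: "!!x. x \<in> K ==> norm (D x) <= R" by (rule D_bound[of K]) (use K in blast)+
  have "norm (indicator K x * \<bar>D x $ i\<bar> powr s) <= R powr s" if "x \<in> K" for x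
   using that order_trans[OF component_le_norm_cart R[OF that]] admissible_ge_1[OF s]
   by (simp add: powr_mono2)
  then have "integrable lborel (%x. indicator K x * \<bar>D x $ i\<bar> powr s)"
   using K by (intro integrable_bounded_compact[of K _ "R powr s"]) auto
  then show "pderiv_at i u \<in> Lp_on s K"
   using K eq by (intro Lp_on_borelI[OF _ D_nth_meas[of i]]) auto
 qed
 fix j
 show "\<exists>h\<in>Lp_loc s U. weak_pderiv U j (pderiv_at i u) h"
 proof (rule bexI)
  show "weak_pderiv U j (pderiv_at i u) (%x. indicator V x * H i j x)"
   by (rule wderiv_imp_weak_pderiv[OF D_wderiv U eq]) auto
  show "(%x. indicator V x * H i j x) \<in> Lp_loc s U"
   unfolding Lp_loc_def
   by (intro CollectI allI impI Lp_on_borelI[OF _ _ refl H_powr_integrable[OF _ _ s]])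
    (auto simp: borel_compact)
 qed
qed

end

section \<open>Reduction to the local problem\<close>

lemma test_fun_weak_pderiv:
 assumes U: "open U" and phi: "phi \<in> test_fun U"
 shows "weak_pderiv U i phi (pderiv_at i phi)"
proof -
 obtain S where S: "C1c S phi" by (rule test_funE[OF phi]) blast
 show ?thesis
  by (rule wderiv_imp_weak_pderiv[OF wderiv_C1[OF U C1c_differentiable[OF S]
    C1c_continuous_grad[OF S]] U]) simp_all
qed

lemma weak_grad_eq_grad:
 fixes g :: "real^'n => real"
 assumes U: "open U" and V: "open V" "V \<subseteq> U"
  and g: "!!x. x \<in> V ==> g differentiable (at x)" "continuous_on V (grad g)"
  and ex: "!!i. \<exists>h. weak_pderiv U i g h"
 shows "AE x\<in>V in lborel. weak_grad U g x = grad g x"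
proof -
 obtain h where "!!i. weak_pderiv U i g (h i)" using ex by metis
 then have "\<exists>G. \<forall>i. weak_pderiv U i g (%x. G x $ i)" by (intro exI[of _ "%x. \<chi> i. h i x"]) simp
 from someI_ex[OF this] have weak: "weak_pderiv U i g (%x. weak_grad U g x $ i)" for i
  unfolding weak_grad_def by blast
 have "AE x\<in>V in lborel. weak_grad U g x $ i = grad g x $ i" for i
 proof -
  obtain g' h' where w: "wderiv U i g' h'"
   and eq: "AE x\<in>U in lborel. g x = g' x \<and> weak_grad U g x $ i = h' x"
   by (rule weak_pderiv_imp_wderiv[OF U weak])
  have "AE x\<in>V in lborel. g' x = indicator V x * g x"
   using eq by eventually_elim (use V in auto)
  moreover have "wderiv V i (%x. indicator V x * g x) (%x. indicator V x * pderiv_at i g x)"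
   by (rule wderiv_C1[OF V(1) g])
  ultimately have "AE x\<in>V in lborel. h' x = indicator V x * pderiv_at i g x"
   using wderiv_unique[OF V(1) wderiv_mono[OF w V(2)]] by blast
  from this eq
  show ?thesis by eventually_elim (use V in auto)
 qed
 then have "AE x in lborel. \<forall>i. x \<in> V --> weak_grad U g x $ i = grad g x $ i"
  unfolding AE_all_countable by blast
 then show ?thesis by eventually_elim (simp add: vec_eq_iff)
qed

lemma compact_support_Lp_on:
 fixes g :: "real^'n => real"
 assumes "open U" "compact S" "continuous_on UNIV g" "!!x. x \<notin> S ==> g x = 0" "0 < p"
 shows "g \<in> Lp_on p U"
proof -
 have [measurable]: "U \<in> sets borel" "g \<in> borel_measurable borel"
  using assms by (auto intro: borel_measurable_continuous_onI)
 obtain C where C: "!!x. norm (g x) <= C" using bounded_compact_support[OF assms(2-4)] by metis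
 then have "norm (indicator U x * \<bar>g x\<bar> powr p) <= C powr p" for x
  using C[of x] assms(5) by (auto simp: indicator_def intro!: powr_mono2)
 then have "integrable lborel (%x. indicator U x * \<bar>g x\<bar> powr p)"
  using assms by (intro integrable_bounded_compact[of S _ "C powr p"]) auto
 then show ?thesis by (intro Lp_on_borelI[of _ g]) simp_all
qed

lemma test_fun_W1p_0:
 assumes U: "open U" and phi: "phi \<in> test_fun U" and p: "p > 0"
 shows "phi \<in> W1p_0 p U \<inter> Linf_on U" "AE x\<in>U in lborel. weak_grad U phi x = grad phi x"
proof -
 obtain S where S: "C1c S phi" "S \<subseteq> U" by (rule test_funE[OF phi]) blast
 note weak = test_fun_weak_pderiv[OF U phi]
 show ae: "AE x\<in>U in lborel. weak_grad U phi x = grad phi x"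
  by (rule weak_grad_eq_grad[OF U U subset_refl C1c_differentiable[OF S(1)]
    C1c_continuous_grad[OF S(1)]])
   (use weak in blast)
 have Lp: "phi \<in> Lp_on p U" "pderiv_at i phi \<in> Lp_on p U" for i
  by (rule compact_support_Lp_on[OF U C1c_compact[OF S(1)] _ _ p];
    simp add: C1c_continuous[OF S(1)] C1c_continuous_pderiv[OF S(1)] C1c_zero[OF S(1)]
      C1c_pderiv_0[OF S(1)])+
 have "phi \<in> W1p_0 p U"
  unfolding W1p_0_def
 proof (intro CollectI conjI exI[of _ "%n. phi"] allI)
  show "phi \<in> W1p p U" using Lp weak by (auto simp: W1p_def)
  have "(LINT x:U|lebesgue. \<bar>pderiv_at i phi x - weak_grad U phi x $ i\<bar> powr p) = 0" for i
   unfolding set_lebesgue_integral_def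
  proof (rule integral_eq_zero_AE)
   show "AE x in lebesgue. indicator U x *\<^sub>R \<bar>pderiv_at i phi x - weak_grad U phi x $ i\<bar> powr p = 0"
    unfolding AE_completion_iff using ae
     by eventually_elim (use p in \<open>auto simp: indicator_def\<close>)
  qed
  then show "(%n. LINT x:U|lebesgue. \<bar>pderiv_at i phi x - weak_grad U phi x $ i\<bar> powr p) \<longlonglongrightarrow> 0" for i
   by simp
 qed (use phi p in auto)
 moreover have "phi \<in> Linf_on U"
 proof -
  obtain C where "!!x. \<bar>phi x\<bar> <= C" using C1c_bounded[OF S(1)] by metis
  moreover have [measurable]: "U \<in> sets borel" "phi \<in> borel_measurable borel"
   using U C1c_measurable[OF S(1)] by auto
  ultimately show ?thesis
   by (auto simp: Linf_on_def set_borel_measurable_def intro!: exI[of _ C]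
     measurable_completion)
 qed
 ultimately show "phi \<in> W1p_0 p U \<inter> Linf_on U" by simp
qed

lemma LINT_absolutely_integrable_transfer:
 fixes f g :: "real^'n => real"
 assumes f: "f absolutely_integrable_on U" and g: "g \<in> borel_measurable borel" and ae:
   "AE x\<in>U in lborel. f x = g x" and g0: "!!x. x \<notin> U ==> g x = 0"
 shows "integrable lborel g" "(LINT x:U|lebesgue. f x) = (LBINT x. g x)"
proof -
 have int: "integrable lebesgue (%x. indicator U x *\<^sub>R f x)" using f
  by (simp add: set_integrable_def)
 have eq: "AE x in lebesgue. indicator U x *\<^sub>R f x = g x"
  unfolding AE_completion_iff using ae by eventually_elim (use g0 in \<open>auto simp: indicator_def\<close>)
 have g_meas: "g \<in> borel_measurable lebesgue" using g by (auto intro: measurable_completion)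
 have "integrable lebesgue g" by (rule integrable_cong_AE_imp[OF int g_meas eq])
 then show "integrable lborel g" using g by (simp add: integrable_completion)
 have "(LINT x:U|lebesgue. f x) = (\<integral>x. g x \<partial>lebesgue)"
  unfolding set_lebesgue_integral_def
   by (rule integral_cong_AE[OF borel_measurable_integrable[OF int] g_meas eq])
 also have "... = (LBINT x. g x)" using g by (simp add: integral_completion)
 finally show "(LINT x:U|lebesgue. f x) = (LBINT x. g x)" .
qed

lemma structural_A_bounds:
 assumes "structural_A TYPE('n::finite) p A"
 obtains c2 m M where "c2 > 0" "- 1 < m"
  "!!eta eta' :: real^'n. eta \<noteq> 0 \<or> eta' \<noteq> 0 ==> (A (norm eta) *\<^sub>R eta - A (norm eta') *\<^sub>R eta') \<bullet> (eta - eta') >= c2 *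
    (norm eta + norm eta') powr (p - 2) * (norm (eta - eta'))\<^sup>2"
  "!!t. t > 0 ==> m <= t * deriv A t / A t" "!!t. t > 0 ==> t * deriv A t / A t <= M"
proof -
 obtain c2 where c2: "c2 > 0" "!!eta eta' :: real^'n. eta \<noteq> 0 \<or> eta' \<noteq> 0 ==>
  (A (norm eta) *\<^sub>R eta - A (norm eta')
   *\<^sub>R eta') \<bullet> (eta - eta') >= c2 * (norm eta + norm eta') powr (p - 2) * (norm (eta - eta'))\<^sup>2"
  using assms unfolding structural_A_def by blast
 have "- 1 < m_low A" "M_upp A < \<infinity>" using assms by (auto simp: structural_A_def)
 then obtain m M where m: "- 1 < ereal m" "ereal m < m_low A" and M: "M_upp A < ereal M"
  using ereal_dense2 by blast
 have "ereal m < ereal (t * deriv A t / A t)" "ereal (t * deriv A t / A t) < ereal M" if "t > 0"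
   for t
 proof -
  have "m_low A <= ereal (t * deriv A t / A t)" unfolding m_low_def using that
   by (intro INF_lower) auto
  then show "ereal m < ereal (t * deriv A t / A t)" using m(2) by (rule less_le_trans[rotated])
  have "ereal (t * deriv A t / A t) <= M_upp A" unfolding M_upp_def using that
   by (intro SUP_upper) auto
  then show "ereal (t * deriv A t / A t) < ereal M" using M by (rule le_less_trans)
 qed
 moreover have "- 1 < m" using m(1) by (simp add: one_ereal_def)
 ultimately show ?thesis using c2 by (intro that[of c2 m M]) (auto intro: less_imp_le)
qed

lemma W1inf_lipschitz:
 fixes f :: "real^'n => real"
 assumes U: "open U" and f: "f \<in> W1inf U"
 obtains f' L where "f' \<in> borel_measurable borel" "AE x\<in>U in lborel. f x = f' x"
  "L > 0" "AE x\<in>U in lborel. \<bar>f' x\<bar> <= L"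
  "!!i b. b > 0 ==> AE x in lborel. x \<in> segment_interior U (axis i 1) b -->
   \<bar>f' (x + b *\<^sub>R axis i 1) - f' x\<bar> <= L * b"
proof -
 obtain h where h: "!!i. h i \<in> Linf_on U" "!!i. weak_pderiv U i f (h i)"
  using f unfolding W1inf_def by (auto simp: Bex_def) metis
 have "f \<in> Lp_loc 1 U" using h(2) by (auto simp: weak_pderiv_def)
 then obtain f' where "locally_integrable U f'" "AE x\<in>U in lborel. f x = f' x"
  by (rule Lp_loc_1_borel[OF U])
 then have f': "f' \<in> borel_measurable borel" "AE x\<in>U in lborel. f x = f' x"
  by (auto dest: locally_integrable_measurable)
 have "\<exists>C. AE x\<in>U in lborel. \<bar>h i x\<bar> <= C" for i
  using h(1)[of i] by (simp add: Linf_on_def AE_completion_iff)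
 then obtain C where C: "!!i. AE x\<in>U in lborel. \<bar>h i x\<bar> <= C i" by metis
 obtain C0 where C0: "AE x\<in>U in lborel. \<bar>f x\<bar> <= C0"
  using f by (auto simp: W1inf_def Linf_on_def AE_completion_iff)
 define L where "L = \<bar>C0\<bar> + (\<Sum>i\<in>UNIV. \<bar>C i\<bar>) + 1"
 have CL: "C i <= L" for i using member_le_sum[of i UNIV "%i. \<bar>C i\<bar>"] by (simp add: L_def)
 have "0 <= (\<Sum>i\<in>UNIV. \<bar>C i\<bar>)" by (intro sum_nonneg) auto
 then have L: "C0 <= L" "L > 0" unfolding L_def by linarith+
 show ?thesis
 proof (rule that[OF f' L(2)])
  show "AE x\<in>U in lborel. \<bar>f' x\<bar> <= L" using f'(2) C0 by eventually_elim (use L in auto)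
  fix i :: 'n and b :: real
  assume b: "b > 0"
  obtain g h' where w: "wderiv U i g h'" and eq: "AE x\<in>U in lborel. f x = g x \<and> h i x = h' x"
   by (rule weak_pderiv_imp_wderiv[OF U h(2)])
  have "AE x\<in>U in lborel. g x = f' x" using eq f'(2) by eventually_elim auto
  then have "wderiv U i f' h'" by (rule wderiv_cong[OF w f'(1) wderivD(4)[OF w]]) simp
  moreover have "AE x\<in>U in lborel. \<bar>h' x\<bar> <= L"
   using eq C[of i] by eventually_elim (use CL[of i] in auto)
  ultimately show "AE x in lborel. x \<in> segment_interior U (axis i 1) b -->
    \<bar>f' (x + b *\<^sub>R axis i 1) - f' x\<bar> <= L * b"
   by (rule wderiv_bounded_lipschitz[OF U _ _ b refl])
 qed
qed

lemma singular_potential_C1: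
 fixes u :: "real^'n => real" and p q \<theta> :: real
 assumes u: "!!x. x \<in> U ==> u differentiable (at x)" "continuous_on U (grad u)"
   "!!x. x \<in> U ==> u x > 0"
  and origin: "0 \<notin> U"
 defines "k \<equiv> %x. \<theta> * (u x powr q / norm x powr p)"
 shows "x \<in> U ==> k differentiable (at x)" "continuous_on U (grad k)"
proof -
 define g where "g x = \<theta> *\<^sub>R (u x powr q *\<^sub>R ((- p * norm x powr (- p - 1)) *\<^sub>R sgn x)
  + norm x powr (- p) *\<^sub>R ((q * u x powr (q - 1)) *\<^sub>R grad u x))" for x
 have k: "k = (%x. \<theta> * (u x powr q * norm x powr (- p)))"
  by (simp add: k_def powr_minus divide_inverse)
 have deriv: "GDERIV k x :> g x" if x: "x \<in> U" for x
 proof -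
  have "x \<noteq> 0" using x origin by auto
  have "GDERIV (%x. u x powr q) x :> (q * u x powr (q - 1)) *\<^sub>R grad u x"
   by (rule GDERIV_DERIV_compose[OF GDERIV_grad[OF u(1)[OF x]] has_real_derivative_powr[OF
     u(3)[OF x]]])
  moreover have "GDERIV (%x. norm x powr (- p)) x :> (- p * norm x powr (- p - 1)) *\<^sub>R sgn x"
   by (rule GDERIV_DERIV_compose[OF GDERIV_norm[OF \<open>x \<noteq> 0\<close>] has_real_derivative_powr])
     (use \<open>x \<noteq> 0\<close> in simp)
  ultimately have "GDERIV (%x. u x powr q * norm x powr (- p)) x
    :> u x powr q *\<^sub>R ((- p * norm x powr (- p - 1)) *\<^sub>R sgn x)
     + norm x powr (- p) *\<^sub>R ((q * u x powr (q - 1)) *\<^sub>R grad u x)"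
   by (rule GDERIV_mult)
  from GDERIV_mult[OF GDERIV_const[of \<theta>] this] show ?thesis by (simp add: k g_def)
 qed
 then show "x \<in> U ==> k differentiable (at x)" by (simp add: GDERIV_iff_grad)
 have "x \<in> U ==> norm x \<noteq> 0" "x \<in> U ==> u x \<noteq> 0" for x using origin u(3)[of x] by auto
 then have "continuous_on U g"
  unfolding g_def sgn_div_norm
  by (intro continuous_intros differentiable_imp_continuous_on[OF u(1)] u(2)) auto
 then show "continuous_on U (grad k)"
  by (rule continuous_on_cong[THEN iffD1, rotated 2]) (use deriv in \<open>auto simp: GDERIV_iff_grad\<close>)
qed

lemma C1_locally_lipschitz:
 fixes k :: "real^'n => real"
 assumes U: "open U" and k: "!!x. x \<in> U ==> k differentiable (at x)" "continuous_on U (grad k)"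
  and K: "compact K" "K \<subseteq> U"
 obtains L \<delta> where "L > 0" "\<delta> > 0" "thicken \<delta> K \<subseteq> U"
  "!!i h x. 0 < h ==> h < \<delta> ==> x \<in> K ==> \<bar>k (x + h *\<^sub>R axis i 1) - k x\<bar> <= L * h"
proof -
 obtain \<delta> where \<delta>: "\<delta> > 0" "thicken \<delta> K \<subseteq> U" using thicken_subset_open[OF K(1) U K(2)] .
 have "bounded (grad k ` thicken \<delta> K)"
  by (intro compact_imp_bounded compact_continuous_image continuous_on_subset[OF k(2)]
    compact_thicken K \<delta>)
 then obtain L where L: "L > 0" "!!x. x \<in> thicken \<delta> K ==> norm (grad k x) <= L"
  by (auto simp: bounded_pos)
 show ?thesis
 proof (rule that[OF L(1) \<delta>])
  fix i :: 'n and h x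
  assume h: "0 < h" "h < \<delta>" "x \<in> K"
  have near: "x + t *\<^sub>R axis i 1 \<in> thicken \<delta> K" if "0 <= t" "t <= h" for t
   using h that by (intro thickenI[of x]) auto
  obtain z where z: "0 < z" "z < h"
   "k (x + h *\<^sub>R axis i 1) - k x = h * (axis i 1 \<bullet> grad k (x + z *\<^sub>R axis i 1))"
   by (rule mvt_direction[OF h(1), of k x "axis i 1"]) (use near \<delta>(2) k(1) in auto)
  have "\<bar>axis i 1 \<bullet> grad k (x + z *\<^sub>R axis i 1)\<bar> <= L"
   using L(2)[OF near[of z]] z component_le_norm_cart[of "grad k (x + z *\<^sub>R axis i 1)" i]
   by (simp add: inner_axis')
  then show "\<bar>k (x + h *\<^sub>R axis i 1) - k x\<bar> <= L * h"
   unfolding z(3) abs_mult using h by (simp add: mult.commute)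
 qed
qed

lemma source_measurable:
 fixes k f :: "real^'n => real"
 assumes "open U" "continuous_on U k" and [measurable]: "f \<in> borel_measurable borel"
 shows "(%x. indicator U x * (k x + f x)) \<in> borel_measurable borel"
proof -
 have [measurable]: "U \<in> sets borel" using assms(1) by simp
 have [measurable]: "(%x. indicator U x *\<^sub>R k x) \<in> borel_measurable borel"
  by (rule borel_measurable_continuous_on_indicator[OF _ assms(2)]) simp
 have "(%x. indicator U x * (k x + f x)) = (%x. indicator U x *\<^sub>R k x + indicator U x * f x)"
  by (simp add: distrib_left)
 then show ?thesis by (simp only:) measurable
qed

lemma source_locally_bounded:
 fixes k f :: "real^'n => real"
 assumes k: "continuous_on U k" and f: "AE x\<in>U in lborel. \<bar>f x\<bar> <= L" "0 < L"
  and K: "compact K" "K \<subseteq> U"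
 shows "\<exists>C>0. AE x\<in>K in lborel. \<bar>indicator U x * (k x + f x)\<bar> <= C"
proof -
 have "bounded (k ` K)" by (intro compact_imp_bounded compact_continuous_image
   continuous_on_subset[OF k] K)
 then obtain R where R: "R > 0" "!!x. x \<in> K ==> \<bar>k x\<bar> <= R" by (auto simp: bounded_pos)
 have "AE x\<in>K in lborel. \<bar>indicator U x * (k x + f x)\<bar> <= R + L"
  using f(1)
 proof eventually_elim
  case (elim x)
  then show ?case using R(2)[of x] K abs_triangle_ineq[of "k x" "f x"]
   by (auto simp: indicator_def)
 qed
 then show ?thesis using R(1) f(2) by (intro exI[of _ "R + L"]) simp
qed

lemma source_locally_lipschitz:
 fixes k f :: "real^'n => real"
 assumes U: "open U" "U \<subseteq> W" and k: "!!x. x \<in> U ==> k differentiable (at x)"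
   "continuous_on U (grad k)"
  and f: "!!i b. b > 0 ==> AE x in lborel. x \<in> segment_interior W (axis i 1) b -->
   \<bar>f (x + b *\<^sub>R axis i 1) - f x\<bar> <= L * b" "0 < L"
  and K: "compact K" "K \<subseteq> U"
 shows "\<exists>C>0. \<exists>\<delta>>0. \<forall>i h. 0 < h \<and> h < \<delta> --> (AE x\<in>K in lborel.
  \<bar>indicator U (x + h *\<^sub>R axis i 1) * (k (x + h *\<^sub>R axis i 1) + f (x + h *\<^sub>R axis i 1))
   - indicator U x * (k x + f x)\<bar> <= C * h)"
proof -
 obtain Lk \<delta> where Lk: "Lk > 0" "\<delta> > 0" "thicken \<delta> K \<subseteq> U"
  "!!i h x. 0 < h ==> h < \<delta> ==> x \<in> K ==> \<bar>k (x + h *\<^sub>R axis i 1) - k x\<bar> <= Lk * h"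
  using C1_locally_lipschitz[OF U(1) k K] by metis
 have "AE x\<in>K in lborel. \<bar>indicator U (x + h *\<^sub>R axis i 1) * (k (x + h *\<^sub>R axis i 1) + f (x + h *\<^sub>R axis i 1))
    - indicator U x * (k x + f x)\<bar> <= (Lk + L) * h" if h: "0 < h" "h < \<delta>" for i h
  using f(1)[OF h(1), of i]
 proof eventually_elim
  case (elim x)
  show ?case
  proof
   assume x: "x \<in> K"
   have segment: "x + t *\<^sub>R axis i 1 \<in> U" if "0 <= t" "t <= h" for t
    using that h x Lk(3) thickenI[of x K "x + t *\<^sub>R axis i 1" \<delta>] by auto
   then have "x \<in> segment_interior W (axis i 1) h" using U by (auto simp: segment_interior_def)
   then have "\<bar>f (x + h *\<^sub>R axis i 1) - f x\<bar> <= L * h" using elim by blast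
   moreover have "\<bar>k (x + h *\<^sub>R axis i 1) - k x\<bar> <= Lk * h" by (rule Lk(4)[OF h x])
   ultimately show "\<bar>indicator U (x + h *\<^sub>R axis i 1) * (k (x + h *\<^sub>R axis i 1) + f (x + h *\<^sub>R axis i 1))
     - indicator U x * (k x + f x)\<bar> <= (Lk + L) * h"
    using segment[of h] segment[of 0] h by (simp add: distrib_right)
  qed
 qed
 moreover have "0 < Lk + L" using Lk(1) f(2) by simp
 ultimately show ?thesis using Lk(2) by blast
qed

lemma source_locally_positive:
 fixes k f :: "real^'n => real"
 assumes k: "continuous_on U k" "!!x. x \<in> U ==> 0 < k x" and f: "AE x\<in>U in lborel. 0 <= f x"
  and K: "compact K" "K \<subseteq> U"
 shows "\<exists>c>0. AE x\<in>K in lborel. c <= indicator U x * (k x + f x)"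
proof -
 obtain c where c: "c > 0" "!!x. x \<in> K ==> c <= k x"
 proof (cases "K = {}")
  case False
  then obtain y where "y \<in> K" "\<forall>x\<in>K. k y <= k x"
   using continuous_attains_inf[OF K(1) False continuous_on_subset[OF k(1) K(2)]] by blast
  then show ?thesis using that[of "k y"] k(2) K by blast
 qed (use that[of 1] in auto)
 have "AE x\<in>K in lborel. c <= indicator U x * (k x + f x)"
  using f
 proof eventually_elim
  case (elim x)
  then show ?case using c(2)[of x] K by (auto simp: indicator_def)
 qed
 then show ?thesis using c(1) by blast
qed

lemma borel_measurable_radial:
 assumes "continuous_on {0<..} A"
 shows "(%eta::real^'n. A (norm eta) *\<^sub>R eta) \<in> borel_measurable borel"
proof -
 have [measurable]: "(%t. indicator {0<..} t *\<^sub>R A t :: real) \<in> borel_measurable borel"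
  by (rule borel_measurable_continuous_on_indicator[OF _ assms]) simp
 have "(%eta::real^'n. A (norm eta) *\<^sub>R eta) = (%eta. (indicator {0<..} (norm eta) *\<^sub>R A (norm eta)) *\<^sub>R eta)"
  by (auto simp: indicator_def)
 then show ?thesis by (simp only:) measurable
qed

lemma weak_solution_AE_gradients:
 fixes u phi :: "real^'n => real"
 assumes \<Omega>: "open \<Omega>" and ws: "weak_solution \<Omega> p q \<theta> A B f u" and p: "p > 0"
  and u: "!!x. x \<in> \<Omega> - {0} ==> u differentiable (at x)" "continuous_on (\<Omega> - {0}) (grad u)"
  and phi: "phi \<in> test_fun \<Omega>"
 shows "AE x in lborel. x \<in> \<Omega> -->
  x \<noteq> 0 \<and> weak_grad \<Omega> u x = grad u x \<and> weak_grad \<Omega> phi x = grad phi x"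
proof -
 have "u \<in> W1p p \<Omega>" using ws by (auto simp: weak_solution_def W1p_0_def)
 then have "AE x in lborel. x \<in> \<Omega> - {0} --> weak_grad \<Omega> u x = grad u x"
  using \<Omega> u by (intro weak_grad_eq_grad[OF \<Omega>]) (auto simp: W1p_def open_delete)
 with test_fun_W1p_0(2)[OF \<Omega> phi p] AE_lborel_singleton[of 0] show ?thesis
  by eventually_elim auto
qed

lemma weak_solution_local_equation:
 fixes u f f' :: "real^'n => real" and p q \<theta> :: real
 assumes \<Omega>: "open \<Omega>" and ws: "weak_solution \<Omega> p q \<theta> A B f u" and p: "p > 0"
  and u: "!!x. x \<in> \<Omega> - {0} ==> u differentiable (at x)" "continuous_on (\<Omega> - {0}) (grad u)"
  and A: "continuous_on {0<..} A" and B: "continuous_on {0..} B"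
  and f': "f' \<in> borel_measurable borel" "AE x in lborel. x \<in> \<Omega> --> f x = f' x"
  and phi: "phi \<in> test_fun (\<Omega> - {0})"
 shows "(LBINT x. A (norm (grad u x)) * (grad u x \<bullet> grad phi x)) + (LBINT x. B (norm (grad u x)) * phi x)
  = (LBINT x. indicator (\<Omega> - {0}) x * (\<theta> * (u x powr q / norm x powr p) + f' x) * phi x)"
proof -
 define U where "U = \<Omega> - {0}"
 have U: "open U" using \<Omega> by (simp add: U_def open_delete)
 have upos: "!!x. x \<in> U ==> u x > 0" using ws by (auto simp: weak_solution_def U_def)
 define D where "D x = indicator U x *\<^sub>R grad u x" for x
 define \<kappa> where "\<kappa> x = indicator U x *\<^sub>R (u x powr q / norm x powr p)" for x
 obtain S where S: "C1c S phi" "S \<subseteq> U" using phi unfolding U_def by (rule test_funE) blast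
 have outside: "phi x = 0" "grad phi x = 0" if "x \<notin> U" for x
  using that S C1c_zero[OF S(1)] C1c_grad_0[OF S(1)] by auto
 have D: "D \<in> borel_measurable borel"
  unfolding D_def[abs_def] using U u(2) by (intro borel_measurable_continuous_on_indicator)
    (auto simp: U_def)
 have "continuous_on U (%x. u x powr q / norm x powr p)"
  by (intro continuous_intros differentiable_imp_continuous_on u) (use upos in \<open>force simp:
    U_def\<close>)+
 then have \<kappa>: "\<kappa> \<in> borel_measurable borel"
  unfolding \<kappa>_def[abs_def] using U by (intro borel_measurable_continuous_on_indicator) auto
 have "continuous_on UNIV (%eta::real^'n. B (norm eta))"
  by (intro continuous_on_compose2[OF B] continuous_intros) auto
 note BD = measurable_compose[OF D borel_measurable_continuous_onI[OF this]]
 have "phi \<in> test_fun \<Omega>" using phi by (rule test_fun_mono) auto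
 note W = test_fun_W1p_0(1)[OF \<Omega> this p]
 have grads: "AE x in lborel. x \<in> \<Omega> --> x \<noteq> 0 \<and> weak_grad \<Omega> u x = grad u x
   \<and> weak_grad \<Omega> phi x = grad phi x"
  by (rule weak_solution_AE_gradients[OF \<Omega> ws p u \<open>phi \<in> test_fun \<Omega>\<close>])
 have ae: "AE x in lborel. x \<in> \<Omega> --> x \<in> U \<and> weak_grad \<Omega> u x = D x \<and> weak_grad \<Omega> phi x = grad phi x"
  using grads by eventually_elim (auto simp: U_def D_def)
 let ?a = "%x. A (norm (weak_grad \<Omega> u x)) * (weak_grad \<Omega> u x \<bullet> weak_grad \<Omega> phi x)"
  and ?b = "%x. B (norm (weak_grad \<Omega> u x)) * phi x" and ?h = "%x. u x powr q / norm x powr p * phi x"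
 have eq: "?a absolutely_integrable_on \<Omega>" "?b absolutely_integrable_on \<Omega>"
   "?h absolutely_integrable_on \<Omega>"
  "(%x. f x * phi x) absolutely_integrable_on \<Omega>"
  "(LINT x:\<Omega>|lebesgue. ?a x) + (LINT x:\<Omega>|lebesgue. ?b x)
   = \<theta> * (LINT x:\<Omega>|lebesgue. ?h x) + (LINT x:\<Omega>|lebesgue. f x * phi x)"
  using ws W unfolding weak_solution_def Let_def by blast+
 have ae_eq: "AE x in lborel. x \<in> \<Omega> --> ?a x = (A (norm (D x)) *\<^sub>R D x) \<bullet> grad phi x"
  "AE x in lborel. x \<in> \<Omega> --> ?b x = B (norm (D x)) * phi x" "AE x in lborel. x \<in> \<Omega> --> ?h x
    = \<kappa> x * phi x"
  "AE x in lborel. x \<in> \<Omega> --> f x * phi x = f' x * phi x"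
  by (use ae f'(2) in \<open>eventually_elim; auto simp: \<kappa>_def\<close>)+
 note a = LINT_absolutely_integrable_transfer(2)[OF eq(1) borel_measurable_inner[OF
    measurable_compose[OF D borel_measurable_radial[OF A]] C1c_measurable_grad[OF S(1)]]
      ae_eq(1)]
  and b = LINT_absolutely_integrable_transfer(2)[OF eq(2) borel_measurable_times[OF BD
    C1c_measurable[OF S(1)]] ae_eq(2)]
  and h = LINT_absolutely_integrable_transfer[OF eq(3) borel_measurable_times[OF \<kappa>
    C1c_measurable[OF S(1)]] ae_eq(3)]
  and f = LINT_absolutely_integrable_transfer[OF eq(4) borel_measurable_times[OF f'(1)
    C1c_measurable[OF S(1)]] ae_eq(4)]
 have "(LBINT x. indicator U x * (\<theta> * (u x powr q / norm x powr p) + f' x) * phi x)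
   = (LBINT x. \<theta> * (\<kappa> x * phi x) + f' x * phi x)"
  by (rule Bochner_Integration.integral_cong)
   (auto simp: \<kappa>_def outside indicator_def distrib_right)
 also have "... = \<theta> * (LBINT x. \<kappa> x * phi x) + (LBINT x. f' x * phi x)"
  using h(1) f(1) by (simp add: outside U_def)
 also have "... = (LBINT x. (A (norm (D x)) *\<^sub>R D x) \<bullet> grad phi x) + (LBINT x. B (norm (D x)) * phi x)"
  using eq(5) a b h(2) f(2) by (simp add: outside U_def)
 also have "(%x. (A (norm (D x)) *\<^sub>R D x) \<bullet> grad phi x) = (%x. A (norm (grad u x)) * (grad u x \<bullet>
   grad phi x))"
  using outside(2) by (auto simp: D_def indicator_def fun_eq_iff)
 also have "(%x. B (norm (D x)) * phi x) = (%x. B (norm (grad u x)) * phi x)"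
  using outside(1) by (auto simp: D_def indicator_def fun_eq_iff)
 finally show ?thesis by (simp add: U_def)
qed

theorem weak_solution_imp_local_solution:
 fixes u f :: "real^'n => real" and p q \<theta> :: real
 assumes \<Omega>: "open \<Omega>" and p: "1 < p" and \<theta>: "\<theta> > 0"
  and A: "structural_A TYPE('n) p A" and B: "structural_B p A B"
  and f: "f \<in> W1inf \<Omega>" "AE x in lebesgue. x \<in> \<Omega> --> f x >= 0"
  and u: "Ck_on 1 (\<Omega> - {0}) u" and ws: "weak_solution \<Omega> p q \<theta> A B f u"
 obtains B' G c2 m M CB where "local_solution (\<Omega> - {0}) u A B B' G p c2 m M CB"
proof -
 let ?U = "\<Omega> - {0}"
 have U: "open ?U" using \<Omega> by (simp add: open_delete)
 have u_C1: "!!x. x \<in> ?U ==> u differentiable (at x)" "continuous_on ?U (grad u)"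
  using u by (auto simp: continuous_on_grad_iff)
 have u_pos: "!!x. x \<in> ?U ==> u x > 0" using ws by (auto simp: weak_solution_def)
 obtain c2 m M where ell: "c2 > 0" "- 1 < m"
  "!!eta eta' :: real^'n. eta \<noteq> 0 \<or> eta' \<noteq> 0 ==> (A (norm eta) *\<^sub>R eta - A (norm eta') *\<^sub>R eta') \<bullet> (eta - eta')
   >= c2 * (norm eta + norm eta') powr (p - 2) * (norm (eta - eta'))\<^sup>2"
  "!!t. t > 0 ==> m <= t * deriv A t / A t" "!!t. t > 0 ==> t * deriv A t / A t <= M"
  by (rule structural_A_bounds[OF A]) blast
 have A_props: "!!t. t > 0 ==> A t > 0" "!!t. t > 0 ==> A differentiable (at t)"
  "continuous_on {0<..} (deriv A)" "mono_on {0<..} (%t. t * A t)"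
  using A by (auto simp: structural_A_def)
 obtain B' CB where B_props: "!!t. t >= 0 ==> B t >= 0" "B 0 = 0"
  "!!t. t >= 0 ==> (B has_real_derivative B' t) (at t within {0..})"
  "continuous_on {0..} B'" "CB > 0" "!!t. t > 0 ==> B' t <= CB * (t * A t)"
  using B unfolding structural_B_def by blast
 obtain f' L where f': "f' \<in> borel_measurable borel" "AE x in lborel. x \<in> \<Omega> --> f x = f' x"
  "L > 0" "AE x in lborel. x \<in> \<Omega> --> \<bar>f' x\<bar> <= L"
  and f'_lip: "!!i b. b > 0 ==> AE x in lborel. x \<in> segment_interior \<Omega> (axis i 1) b -->
   \<bar>f' (x + b *\<^sub>R axis i 1) - f' x\<bar> <= L * b"
  by (rule W1inf_lipschitz[OF \<Omega> f(1)]) blast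
 have f'_nonneg: "AE x\<in>?U in lborel. 0 <= f' x"
  using f'(2) f(2)[unfolded AE_completion_iff] by eventually_elim auto
 have f'_bd: "AE x\<in>?U in lborel. \<bar>f' x\<bar> <= L" using f'(4) by eventually_elim auto
 define k where "k x = \<theta> * (u x powr q / norm x powr p)" for x
 have k: "!!x. x \<in> ?U ==> k differentiable (at x)" "continuous_on ?U (grad k)"
  unfolding k_def[abs_def] using singular_potential_C1[of ?U u, OF u_C1 u_pos] by auto
 note k_cont = differentiable_imp_continuous_on[OF k(1)]
 have k_pos: "k x > 0" if "x \<in> ?U" for x using u_pos[OF that] that \<theta> by (simp add: k_def)
 define G where "G x = indicator ?U x * (k x + f' x)" for x
 have "local_solution ?U u A B B' G p c2 m M CB"
 proof
  show "G \<in> borel_measurable borel" unfolding G_def[abs_def]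
   by (rule source_measurable[OF U k_cont f'(1)])
 next
  fix K :: "(real^'n) set"
  assume K: "compact K" "K \<subseteq> ?U"
  show "\<exists>L>0. AE x\<in>K in lborel. \<bar>G x\<bar> <= L"
   unfolding G_def by (rule source_locally_bounded[OF k_cont f'_bd f'(3) K])
  show "\<exists>L>0. \<exists>\<delta>>0. \<forall>i h. 0 < h \<and> h < \<delta> -->
    (AE x\<in>K in lborel. \<bar>G (x + h *\<^sub>R axis i 1) - G x\<bar> <= L * h)"
   unfolding G_def by (rule source_locally_lipschitz[OF U Diff_subset k f'_lip f'(3) K])
  show "\<exists>c>0. AE x\<in>K in lborel. c <= G x"
   unfolding G_def by (rule source_locally_positive[OF k_cont k_pos f'_nonneg K])
 next
  fix phi
  assume phi: "phi \<in> test_fun ?U"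
  have "continuous_on {0<..} A"
   using A_props(2) by (auto intro!: continuous_at_imp_continuous_on
     differentiable_imp_continuous_within)
  moreover have "continuous_on {0..} B" using B_props(3)
   by (meson DERIV_continuous_on atLeast_iff)
  ultimately show "(LBINT x. A (norm (grad u x)) * (grad u x \<bullet> grad phi x))
    + (LBINT x. B (norm (grad u x)) * phi x) = (LBINT x. G x * phi x)"
   unfolding G_def k_def using p by (intro weak_solution_local_equation[OF \<Omega> ws _ u_C1 _ _
     f'(1,2) phi]) auto
 qed (fact U u_C1 A_props ell B_props)+
 then show ?thesis by (rule that)
qed

theorem weak_pderiv_has_classical_pderiv2:
 assumes \<Omega>: "open \<Omega>" and cont: "continuous_on (\<Omega> - {0}) (grad u)"
  and h: "weak_pderiv (\<Omega> - {0}) j (pderiv_at i u) h"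
 shows "AE x in lebesgue. x \<in> \<Omega> --> has_classical_pderiv2 \<Omega> u i j x (h x)"
proof -
 let ?U = "\<Omega> - {0}"
 define v where "v x = indicator ?U x *\<^sub>R pderiv_at i u x" for x
 have U: "open ?U" using \<Omega> by (simp add: open_delete)
 have c: "continuous_on ?U (pderiv_at i u)" using cont continuous_on_grad_iff by blast
 have v_meas: "v \<in> borel_measurable borel"
  unfolding v_def[abs_def] by (rule borel_measurable_continuous_on_indicator[OF _ c]) (use U in
    simp)
 have v_cont: "continuous_on ?U v" by (rule continuous_on_eq[OF c]) (simp add: v_def)
 obtain g' h' where w': "wderiv ?U j g' h'"
  and eq: "AE x\<in>?U in lborel. pderiv_at i u x = g' x \<and> h x = h' x"
  by (rule weak_pderiv_imp_wderiv[OF U h])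
 have "AE x\<in>?U in lborel. g' x = v x" using eq by eventually_elim (auto simp: v_def)
 then have w: "wderiv ?U j v h'" by (rule wderiv_cong[OF w' v_meas wderivD(4)[OF w']]) simp
 show ?thesis
  unfolding AE_completion_iff
  using AE_DERIV_of_wderiv[OF U w v_cont refl] wderiv_zero_on_zeros[OF U w v_cont] eq
   AE_lborel_singleton[of 0]
 proof eventually_elim
  case (elim x)
  show ?case
  proof
   assume "x \<in> \<Omega>"
   then have x: "x \<in> ?U" and hx: "h x = h' x" using elim by auto
   show "has_classical_pderiv2 \<Omega> u i j x (h x)"
   proof (cases "x \<in> crit_set \<Omega> u")
    case True
    then have "grad u x $ i = 0" by (simp add: crit_set_def)
    then have "v x = 0" by (simp add: v_def)
    then show ?thesis using True elim x hx by (auto simp: has_classical_pderiv2_def)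
   next
    case False
    have "((%t. v (x + t *\<^sub>R axis j 1)) has_real_derivative h x) (at 0)" using elim x hx
     by simp
    moreover have "open ((%t. x + t *\<^sub>R axis j 1) -` ?U)"
     by (rule open_vimage[OF U]) (intro continuous_intros)
    ultimately have "((%t. pderiv_at i u (x + t *\<^sub>R axis j 1)) has_real_derivative h x) (at 0)"
     by (rule has_field_derivative_transform_within_open) (use x in \<open>auto simp: v_def\<close>)
    then show ?thesis using False by (simp add: has_classical_pderiv2_def)
   qed
  qed
 qed
qed

theorem theorem1p5:
  fixes \<Omega> :: "(real^'n) set" and p q \<theta> :: real and A B :: "real \<Rightarrow> real"
    and f u :: "real^'n \<Rightarrow> real"
  assumes "smooth_bounded_domain \<Omega>" and "0 \<in> \<Omega>"
    and "1 < p" and "p < real CARD('n)"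
    and "p - 1 < q" and "q < p" and "\<theta> > 0"
    and "structural_A TYPE('n) p A" and "structural_B p A B"
    and "f \<in> W1inf \<Omega>" and "AE x in lebesgue. x \<in> \<Omega> \<longrightarrow> f x \<ge> 0"
    and "C1_upto (\<Omega> - {0}) (closure \<Omega> - {0}) u"
    and "weak_solution \<Omega> p q \<theta> A B f u"
    and "\<forall>x\<in>frontier \<Omega>. u x = 0"
  shows "(p < 3 \<longrightarrow> (\<forall>i. pderiv_at i u \<in> W1p_loc 2 (\<Omega> - {0}))) \<and>
         (p \<ge> 3 \<longrightarrow> (\<forall>i. \<forall>s. 1 \<le> s \<and> s < (p - 1) / (p - 2) \<longrightarrow>
                        pderiv_at i u \<in> W1p_loc s (\<Omega> - {0}))) \<and>
         (\<forall>i j. \<forall>h. weak_pderiv (\<Omega> - {0}) j (pderiv_at i u) h \<longrightarrow>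
            (AE x in lebesgue. x \<in> \<Omega> \<longrightarrow> has_classical_pderiv2 \<Omega> u i j x (h x)))"
proof -
 have \<Omega>: "open \<Omega>" using assms(1) by (simp add: smooth_bounded_domain_def)
 have u: "Ck_on 1 (\<Omega> - {0}) u" using assms(12) by (simp add: C1_upto_def)
 obtain B' G c2 m M CB where "local_solution (\<Omega> - {0}) u A B B' G p c2 m M CB"
  by (rule weak_solution_imp_local_solution[OF \<Omega> assms(3,7-11) u assms(13)])
 then interpret local_solution "\<Omega> - {0}" u A B B' G p c2 m M CB .
 have "pderiv_at i u \<in> W1p_loc s (\<Omega> - {0})" if "admissible s" for i s
  by (rule pderiv_W1p_loc[OF that])
 moreover have "AE x in lebesgue. x \<in> \<Omega> --> has_classical_pderiv2 \<Omega> u i j x (h x)"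
  if "weak_pderiv (\<Omega> - {0}) j (pderiv_at i u) h" for i j h
  by (rule weak_pderiv_has_classical_pderiv2[OF \<Omega> u_cont that])
 ultimately show ?thesis by (auto simp: admissible_def)
qed

end
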